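(* Let $\Omega$ be a compact Riemannian manifold of dimension $d\ge 3$, with or without boundary, let $\beta\in\mathbb{R}$ be such that $\int_\Omega(|\nabla u|^2+\beta|u|^2)\,\mathrm{d}x\gtrsim\int_\Omega|u|^2\,\mathrm{d}x$ for all $u\in H_0^1(\Omega)$, and let $\gamma\in L^\infty(\Omega,\mathbb{R}_+)$. Let $f\in\mathscr{C}^1(\mathbb{R},\mathbb{R})$ with $f(0)=0$, set $F(s)=\int_0^s f(\tau)\,\mathrm{d}\tau$, and assume that there exist $1<p<\frac{d+2}{d-2}$, $1<p_0<+\infty$, $C_f>0$ and $\varepsilon>0$ such that \[|f(s_1)-f(s_2)|\le C_f|s_1-s_2|\left(1+|s_1|^{p-1}+|s_2|^{p-1}\right),\quad s_1,s_2\in\mathbb{R},\tag{1}\] \[sf(s)\ge(2+\varepsilon)F(s),\quad s\in\mathbb{R},\tag{2}\] \[\|u\|_{L^2}^{p_0+1}\le C_f\int_\Omega F(u)\,\mathrm{d}x,\quad u\in H_0^1(\Omega).\tag{3}\] Assume that the Cauchy problem \[\square u+\gamma\partial_t u+\beta u=f(u)\ \text{in }\mathbb{R}\times\Omega,\qquad (u(0),\partial_t u(0))=(u^0,u^1)\ \text{in }\Omega,\qquad u=0\ \text{on }\mathbb{R}\times\partial\Omega\tag{$\ast$}\] is locally well-posed in $H_0^1(\Omega)\times L^2(\Omega)$ (in the sense made precise in the context). Then the following hold. (i) There exists $C=C(f,\gamma)>0$ such that for all real-valued $(u^0,u^1)\in H_0^1(\Omega)\times L^2(\Omega)$, if the solution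 $u$ of $(\ast)$ exists on $\mathbb{R}_+$, then \[E(u^0,u^1)\ge E(u(t),\partial_t u(t))\ge -C,\quad t\ge 0.\] (ii) There exist $c_0=c_0(f,\gamma)>0$, $c_1=c_1(f,\gamma)>0$ and $c_2=c_2(f)>0$ such that for all real-valued $(u^0,u^1)\in H_0^1(\Omega)\times L^2(\Omega)$, if the solution $u$ of $(\ast)$ exists on $\mathbb{R}_+$, then \[\|u(t)\|_{L^2}^2\le\|u^0\|_{L^2}^2e^{-c_2t}+\left(c_0+c_1|E(u^0,u^1)|\right)\left(1-e^{-c_2t}\right),\quad t\ge0.\] (iii) Assume, in addition, that $f$ satisfies (1) with $p\le\frac{d}{d-2}$. Then there exists $c=c(f,\gamma)>0$ such that the function $\alpha:s\mapsto c\exp(cs)$ satisfies the following property. For all real-valued $(u^0,u^1)\in H_0^1(\Omega)\times L^2(\Omega)$, if the solution $u$ of $(\ast)$ exists on $\mathbb{R}_+$, then \[\|(u(t),\partial_t u(t))\|_{H_0^1\times L^2}\le\alpha\left(\|u^0\|_{H_0^1}^2+\|u^1\|_{L^2}^2\right),\quad t\ge0.\] In addition, there exists $T\ge0$, which depends on $f$, $\gamma$ and $\|u^0\|_{H_0^1}^2+\|u^1\|_{L^2}^2$, such that \[\|(u(t),\partial_t u(t))\|_{H_0^1\times L^2}\le\alpha\left(|E(u^0,u^1)|\right),\quad t\ge T.\]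
   Context: Notation. $\square=\partial_t^2-\Delta$, with $\Delta$ the Laplace–Beltrami operator of $\Omega$; $\mathbb{R}_+=[0,+\infty)$. If $\partial\Omega=\emptyset$, then $H_0^1(\Omega)=H^1(\Omega)$ and there is no boundary condition. The notation $A\gtrsim B$ means $A\ge \kappa B$ for some constant $\kappa>0$ independent of $u$. The norm on $H_0^1(\Omega)$ is $\|u\|_{H_0^1}^2=\int_\Omega(|\nabla u|^2+\beta|u|^2)\,\mathrm{d}x$, and $\|(u,v)\|_{H_0^1\times L^2}^2=\|u\|_{H_0^1}^2+\|v\|_{L^2}^2$. The energy of $(u^0,u^1)\in H_0^1(\Omega)\times L^2(\Omega)$ is \[E(u^0,u^1)=\tfrac12\|u^0\|_{H_0^1}^2+\tfrac12\|u^1\|_{L^2}^2-\int_\Omega F(u^0)\,\mathrm{d}x.\] Local well-posedness (standing assumption on $\Omega$ and $f$). For any real-valued $(u^0,u^1)\in H_0^1(\Omega)\times L^2(\Omega)$ there exist a maximal time of existence $T_{\max}\in(0,+\infty]$ and a unique solution $u$ of $(\ast)$ in $\mathscr{C}^0([0,T_{\max}),H_0^1(\Omega))\cap\mathscr{C}^1([0,T_{\max}),L^2(\Omega))$; if $T_{\max}<+\infty$ then $\|(u(t),\partial_tu(t))\|_{H_0^1\times L^2}\to+\infty$ as $t\to T_{\max}^-$. "The solution exists on $\mathbb{R}_+$" means $T_{\max}=+\infty$. Solutions satisfy the energy equality: if $u$ exists on $[0,T]$, then for $0\le t_0\le t_1\le T$, \[E(u(t_1),\partial_tu(t_1))=E(u(t_0),\partial_tu(t_0))-\int_{t_0}^{t_1}\int_\Omega\gamma|\partial_tu|^2\,\mathrm{d}x\,\mathrm{d}t.\]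 Convention on constants. All constants may depend on $\Omega$ (and on the fixed $\beta$). Writing that a constant depends on $f$ means that it depends only on the constants $p,p_0,C_f,\varepsilon$ appearing in (1), (2), (3). Constants written as functions of $f$ only do not depend on $\gamma$. No constant depends on the initial data unless stated. *)

theory Defs
  imports "HOL-Analysis.Analysis"
begin

section \<open>Smooth functions\<close>

primrec Ck_on :: "nat \<Rightarrow> ('a::real_normed_vector \<Rightarrow> 'b::real_normed_vector) \<Rightarrow> 'a set \<Rightarrow> bool" where
  "Ck_on 0 f S \<longleftrightarrow> continuous_on S f"
| "Ck_on (Suc k) f S \<longleftrightarrow> (\<forall>x\<in>S. f differentiable (at x)) \<and>
     (\<forall>v. Ck_on k (\<lambda>x. frechet_derivative f (at x) v) S)"

text \<open>The set \<open>S\<close> need not be open: near each of its points \<open>f\<close> must agree on \<open>S\<close> with a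
  function that is smooth on an open set. This is the usual notion for relatively open subsets of
  a half-space.\<close>

definition smooth_on :: "('a::real_normed_vector \<Rightarrow> 'b::real_normed_vector) \<Rightarrow> 'a set \<Rightarrow> bool" where
  "smooth_on f S \<longleftrightarrow> (\<forall>x\<in>S. \<exists>W g. open W \<and> x \<in> W \<and> (\<forall>k. Ck_on k g W) \<and> (\<forall>y\<in>W \<inter> S. g y = f y))"

definition euclidean_test_functions :: "'a::euclidean_space set \<Rightarrow> ('a \<Rightarrow> real) set" where
  "euclidean_test_functions V =
     {\<psi>. smooth_on \<psi> UNIV \<and> (\<exists>K. compact K \<and> K \<subseteq> V \<and> (\<forall>x. x \<notin> K \<longrightarrow> \<psi> x = 0))}"


section \<open>Compact Riemannian manifolds with or without boundary\<close>

text \<open>A chart consists of its domain and a map that is relevant only on that domain. The points of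
  the manifold form the whole type \<open>'m\<close>, and its dimension is \<open>CARD('n)\<close>.\<close>

type_synonym ('m, 'n) chart = "'m set \<times> ('m \<Rightarrow> real ^ 'n)"

abbreviation chart_dom :: "('m, 'n) chart \<Rightarrow> 'm set" where "chart_dom c \<equiv> fst c"
abbreviation chart_map :: "('m, 'n) chart \<Rightarrow> 'm \<Rightarrow> real ^ 'n" where "chart_map c \<equiv> snd c"

definition chart_img :: "('m, 'n) chart \<Rightarrow> (real ^ 'n) set" where
  "chart_img c = chart_map c ` chart_dom c"

definition chart_inv :: "('m, 'n) chart \<Rightarrow> real ^ 'n \<Rightarrow> 'm" where
  "chart_inv c = inv_into (chart_dom c) (chart_map c)"

definition is_chart :: "('m::topological_space, 'n::finite) chart \<Rightarrow> bool" where
  "is_chart c \<longleftrightarrow> open (chart_dom c) \<and>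
     homeomorphism (chart_dom c) (chart_img c) (chart_map c) (chart_inv c) \<and>
     (\<exists>k. openin (top_of_set {x. 0 \<le> x $ k}) (chart_img c))"

definition overlap_img :: "('m, 'n) chart \<Rightarrow> ('m, 'n) chart \<Rightarrow> (real ^ 'n) set" where
  "overlap_img c c' = chart_map c ` (chart_dom c \<inter> chart_dom c')"

definition transition :: "('m, 'n) chart \<Rightarrow> ('m, 'n) chart \<Rightarrow> real ^ 'n \<Rightarrow> real ^ 'n" where
  "transition c c' = chart_map c' \<circ> chart_inv c"

text \<open>\<open>metric M c p\<close> is the Gram matrix of the metric at \<open>p\<close> in the coordinates of \<open>c\<close>. The
  Riemannian volume measure is carried as a field and is determined by the other two fields through
  \<open>compact_riemannian_manifold\<close> below.\<close>

record ('m, 'n) riemannian =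
  atlas :: "('m, 'n) chart set"
  metric :: "('m, 'n) chart \<Rightarrow> 'm \<Rightarrow> real ^ 'n ^ 'n"
  vol :: "'m measure"

definition smooth_atlas :: "('m::topological_space, 'n::finite) chart set \<Rightarrow> bool" where
  "smooth_atlas A \<longleftrightarrow> (\<forall>c\<in>A. is_chart c) \<and> (\<Union>c\<in>A. chart_dom c) = UNIV \<and>
     (\<forall>c\<in>A. \<forall>c'\<in>A. smooth_on (transition c c') (overlap_img c c'))"

definition riemannian_metric ::
    "('m, 'n::finite) chart set \<Rightarrow> (('m, 'n) chart \<Rightarrow> 'm \<Rightarrow> real ^ 'n ^ 'n) \<Rightarrow> bool" where
  "riemannian_metric A g \<longleftrightarrow>
     (\<forall>c\<in>A. \<forall>p\<in>chart_dom c.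
        transpose (g c p) = g c p \<and> (\<forall>v. v \<noteq> 0 \<longrightarrow> v \<bullet> (g c p *v v) > 0)) \<and>
     (\<forall>c\<in>A. \<forall>i j. smooth_on (\<lambda>x. g c (chart_inv c x) $ i $ j) (chart_img c)) \<and>
     (\<forall>c\<in>A. \<forall>c'\<in>A. \<forall>p\<in>chart_dom c \<inter> chart_dom c'. \<forall>D.
        (transition c c' has_derivative D) (at (chart_map c p) within overlap_img c c') \<longrightarrow>
        (\<forall>v w. v \<bullet> (g c p *v w) = D v \<bullet> (g c' p *v D w)))"

definition riemannian_volume ::
    "('m::topological_space, 'n::finite) chart set \<Rightarrow> (('m, 'n) chart \<Rightarrow> 'm \<Rightarrow> real ^ 'n ^ 'n) \<Rightarrow>
     'm measure \<Rightarrow> bool" where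
  "riemannian_volume A g \<mu> \<longleftrightarrow> sets \<mu> = sets borel \<and>
     (\<forall>c\<in>A. \<forall>B\<in>sets borel. B \<subseteq> chart_dom c \<longrightarrow>
        emeasure \<mu> B =
          (\<integral>\<^sup>+x\<in>chart_map c ` B. ennreal (sqrt (det (g c (chart_inv c x)))) \<partial>lborel))"

definition compact_riemannian_manifold ::
    "('m::{t2_space, second_countable_topology}, 'n::finite) riemannian \<Rightarrow> bool" where
  "compact_riemannian_manifold M \<longleftrightarrow> compact (UNIV :: 'm set) \<and> smooth_atlas (atlas M) \<and>
     riemannian_metric (atlas M) (metric M) \<and> riemannian_volume (atlas M) (metric M) (vol M)"

text \<open>By invariance of domain this does not depend on the chart used; the complement is the
  boundary of the manifold.\<close>

definition manifold_interior :: "('m, 'n::finite) riemannian \<Rightarrow> 'm set" where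
  "manifold_interior M =
     {p. \<exists>c\<in>atlas M. p \<in> chart_dom c \<and> chart_map c p \<in> interior (chart_img c)}"

definition test_functions :: "('m::topological_space, 'n::finite) riemannian \<Rightarrow> ('m \<Rightarrow> real) set" where
  "test_functions M =
     {\<psi>. (\<forall>c\<in>atlas M. smooth_on (\<psi> \<circ> chart_inv c) (chart_img c)) \<and>
         (\<exists>K. compact K \<and> K \<subseteq> manifold_interior M \<and> (\<forall>p. p \<notin> K \<longrightarrow> \<psi> p = 0))}"


section \<open>Covector fields and weak differentials\<close>

text \<open>\<open>\<omega> c p\<close> is the vector of coordinates at \<open>p\<close>, in the chart \<open>c\<close>, of the covector field \<open>\<omega>\<close>.
  The change-of-coordinates rule is required everywhere, which for measurable fields given up to
  null sets is only a choice of representative.\<close>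

type_synonym ('m, 'n) covector_field = "('m, 'n) chart \<Rightarrow> 'm \<Rightarrow> real ^ 'n"

definition measurable_covector_field ::
    "('m::topological_space, 'n::finite) riemannian \<Rightarrow> ('m, 'n) covector_field \<Rightarrow> bool" where
  "measurable_covector_field M \<omega> \<longleftrightarrow>
     (\<forall>c\<in>atlas M. \<omega> c \<in> borel_measurable (restrict_space borel (chart_dom c))) \<and>
     (\<forall>c\<in>atlas M. \<forall>c'\<in>atlas M. \<forall>p\<in>chart_dom c \<inter> chart_dom c'. \<forall>D.
        (transition c c' has_derivative D) (at (chart_map c p) within overlap_img c c') \<longrightarrow>
        (\<forall>v. \<omega> c p \<bullet> v = \<omega> c' p \<bullet> D v))"

text \<open>The pairing \<open>g\<^sup>i\<^sup>j \<omega>\<^sub>i \<eta>\<^sub>j\<close>, that is, the scalar product of the associated gradient vectors. Its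
  value is the same in every chart around \<open>p\<close>.\<close>

definition covector_inner ::
    "('m, 'n::finite) riemannian \<Rightarrow> ('m, 'n) covector_field \<Rightarrow> ('m, 'n) covector_field \<Rightarrow> 'm \<Rightarrow> real" where
  "covector_inner M \<omega> \<eta> p =
     (let c = SOME c. c \<in> atlas M \<and> p \<in> chart_dom c
      in \<omega> c p \<bullet> (matrix_inv (metric M c p) *v \<eta> c p))"

definition L2 :: "('m, 'n::finite) riemannian \<Rightarrow> ('m \<Rightarrow> real) set" where
  "L2 M = {u. u \<in> borel_measurable (vol M) \<and> integrable (vol M) (\<lambda>x. (u x)\<^sup>2)}"

definition L2_norm :: "('m, 'n::finite) riemannian \<Rightarrow> ('m \<Rightarrow> real) \<Rightarrow> real" where
  "L2_norm M u = sqrt (\<integral>x. (u x)\<^sup>2 \<partial>vol M)"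

definition weak_differential ::
    "('m::topological_space, 'n::finite) riemannian \<Rightarrow> ('m \<Rightarrow> real) \<Rightarrow> ('m, 'n) covector_field \<Rightarrow> bool" where
  "weak_differential M u \<omega> \<longleftrightarrow> measurable_covector_field M \<omega> \<and>
     integrable (vol M) (covector_inner M \<omega> \<omega>) \<and>
     (\<forall>c\<in>atlas M. \<forall>\<psi>\<in>euclidean_test_functions (interior (chart_img c)). \<forall>i.
        (LINT x:interior (chart_img c)|lborel.
            u (chart_inv c x) * frechet_derivative \<psi> (at x) (axis i 1)) =
        - (LINT x:interior (chart_img c)|lborel. \<omega> c (chart_inv c x) $ i * \<psi> x))"

definition H1 :: "('m::topological_space, 'n::finite) riemannian \<Rightarrow> ('m \<Rightarrow> real) set" where
  "H1 M = {u \<in> L2 M. \<exists>\<omega>. weak_differential M u \<omega>}"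

text \<open>Unique up to null sets for \<open>u\<close> in \<open>H1 M\<close>.\<close>

definition wdiff ::
    "('m::topological_space, 'n::finite) riemannian \<Rightarrow> ('m \<Rightarrow> real) \<Rightarrow> ('m, 'n) covector_field" where
  "wdiff M u = (SOME \<omega>. weak_differential M u \<omega>)"

text \<open>The integral of \<open>\<nabla>u \<cdot> \<nabla>w\<close>.\<close>

definition dirichlet_form ::
    "('m::topological_space, 'n::finite) riemannian \<Rightarrow> ('m \<Rightarrow> real) \<Rightarrow> ('m \<Rightarrow> real) \<Rightarrow> real" where
  "dirichlet_form M u w = (\<integral>x. covector_inner M (wdiff M u) (wdiff M w) x \<partial>vol M)"

text \<open>The integral of \<open>|\<nabla>u|\<^sup>2 + \<beta> |u|\<^sup>2\<close>; for \<open>\<beta> = 1\<close> it is the square of the standard norm of \<open>H1 M\<close>.\<close>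

definition H1_sq :: "('m::topological_space, 'n::finite) riemannian \<Rightarrow> real \<Rightarrow> ('m \<Rightarrow> real) \<Rightarrow> real" where
  "H1_sq M \<beta> u = (\<integral>x. covector_inner M (wdiff M u) (wdiff M u) x + \<beta> * (u x)\<^sup>2 \<partial>vol M)"

definition H10 :: "('m::topological_space, 'n::finite) riemannian \<Rightarrow> ('m \<Rightarrow> real) set" where
  "H10 M = {u \<in> H1 M. \<exists>\<psi>::nat \<Rightarrow> 'm \<Rightarrow> real. (\<forall>n. \<psi> n \<in> test_functions M) \<and>
     (\<lambda>n. H1_sq M 1 (\<lambda>x. \<psi> n x - u x)) \<longlonglongrightarrow> 0}"

definition H10_norm :: "('m::topological_space, 'n::finite) riemannian \<Rightarrow> real \<Rightarrow> ('m \<Rightarrow> real) \<Rightarrow> real" where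
  "H10_norm M \<beta> u = sqrt (H1_sq M \<beta> u)"

definition state_norm ::
    "('m::topological_space, 'n::finite) riemannian \<Rightarrow> real \<Rightarrow> ('m \<Rightarrow> real) \<Rightarrow> ('m \<Rightarrow> real) \<Rightarrow> real" where
  "state_norm M \<beta> u v = sqrt ((H10_norm M \<beta> u)\<^sup>2 + (L2_norm M v)\<^sup>2)"

definition coercive :: "('m::topological_space, 'n::finite) riemannian \<Rightarrow> real \<Rightarrow> bool" where
  "coercive M \<beta> \<longleftrightarrow> (\<exists>\<kappa>>0. \<forall>u\<in>H10 M. H1_sq M \<beta> u \<ge> \<kappa> * (\<integral>x. (u x)\<^sup>2 \<partial>vol M))"


section \<open>The damped nonlinear wave equation\<close>

definition damping :: "('m, 'n::finite) riemannian \<Rightarrow> ('m \<Rightarrow> real) \<Rightarrow> bool" where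
  "damping M \<gamma> \<longleftrightarrow> \<gamma> \<in> borel_measurable (vol M) \<and> (\<exists>K. AE x in vol M. 0 \<le> \<gamma> x \<and> \<gamma> x \<le> K)"

text \<open>The interval integral is oriented, hence \<open>primitive f s\<close> is also correct for negative \<open>s\<close>.\<close>

definition primitive :: "(real \<Rightarrow> real) \<Rightarrow> real \<Rightarrow> real" where
  "primitive f s = (LBINT \<tau>=ereal 0..ereal s. f \<tau>)"

definition nonlinearity ::
    "('m::topological_space, 'n::finite) riemannian \<Rightarrow> real \<Rightarrow> real \<Rightarrow> real \<Rightarrow> real \<Rightarrow> (real \<Rightarrow> real) \<Rightarrow> bool" where
  "nonlinearity M p p\<^sub>0 C\<^sub>f \<epsilon> f \<longleftrightarrow> f C1_differentiable_on UNIV \<and> f 0 = 0 \<and>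
     (\<forall>s\<^sub>1 s\<^sub>2. \<bar>f s\<^sub>1 - f s\<^sub>2\<bar> \<le>
        C\<^sub>f * \<bar>s\<^sub>1 - s\<^sub>2\<bar> * (1 + \<bar>s\<^sub>1\<bar> powr (p - 1) + \<bar>s\<^sub>2\<bar> powr (p - 1))) \<and>
     (\<forall>s. s * f s \<ge> (2 + \<epsilon>) * primitive f s) \<and>
     (\<forall>u\<in>H10 M. L2_norm M u powr (p\<^sub>0 + 1) \<le> C\<^sub>f * (\<integral>x. primitive f (u x) \<partial>vol M))"

definition energy ::
    "('m::topological_space, 'n::finite) riemannian \<Rightarrow> real \<Rightarrow> (real \<Rightarrow> real) \<Rightarrow>
     ('m \<Rightarrow> real) \<Rightarrow> ('m \<Rightarrow> real) \<Rightarrow> real" where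
  "energy M \<beta> f u v = (H10_norm M \<beta> u)\<^sup>2 / 2 + (L2_norm M v)\<^sup>2 / 2 - (\<integral>x. primitive f (u x) \<partial>vol M)"

text \<open>Solutions on \<open>[0, T)\<close>, with \<open>T = \<infinity>\<close> allowed: \<open>u\<close> is of class \<open>C\<^sup>0\<close> with values in \<open>H10 M\<close> and
  of class \<open>C\<^sup>1\<close> with values in \<open>L2 M\<close>, and \<open>v\<close> is its time derivative. The equation is understood
  in the dual of \<open>H10 M\<close>, where \<open>- \<Delta> u\<close> is the functional \<open>\<phi> \<mapsto> dirichlet_form M u \<phi>\<close>; the boundary
  condition is contained in \<open>u t \<in> H10 M\<close>. Functions on the manifold are representatives of their
  classes modulo null sets.\<close>

definition time_interval :: "ereal \<Rightarrow> real set" where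
  "time_interval T = {t. 0 \<le> t \<and> ereal t < T}"

definition wave_solution ::
    "('m::topological_space, 'n::finite) riemannian \<Rightarrow> real \<Rightarrow> ('m \<Rightarrow> real) \<Rightarrow> (real \<Rightarrow> real) \<Rightarrow> ereal \<Rightarrow>
     ('m \<Rightarrow> real) \<Rightarrow> ('m \<Rightarrow> real) \<Rightarrow> (real \<Rightarrow> 'm \<Rightarrow> real) \<Rightarrow> (real \<Rightarrow> 'm \<Rightarrow> real) \<Rightarrow> bool" where
  "wave_solution M \<beta> \<gamma> f T u0 u1 u v \<longleftrightarrow> 0 < T \<and>
     (AE x in vol M. u 0 x = u0 x) \<and> (AE x in vol M. v 0 x = u1 x) \<and>
     (\<forall>t\<in>time_interval T.
        u t \<in> H10 M \<and> v t \<in> L2 M \<and>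
        ((\<lambda>s. H10_norm M \<beta> (\<lambda>x. u s x - u t x)) \<longlongrightarrow> 0) (at t within time_interval T) \<and>
        ((\<lambda>s. L2_norm M (\<lambda>x. (u s x - u t x) / (s - t) - v t x)) \<longlongrightarrow> 0)
          (at t within time_interval T) \<and>
        ((\<lambda>s. L2_norm M (\<lambda>x. v s x - v t x)) \<longlongrightarrow> 0) (at t within time_interval T) \<and>
        (\<forall>\<phi>\<in>H10 M.
           ((\<lambda>s. \<integral>x. v s x * \<phi> x \<partial>vol M) has_real_derivative
              (- dirichlet_form M (u t) \<phi> - (\<integral>x. \<gamma> x * v t x * \<phi> x \<partial>vol M)
               - \<beta> * (\<integral>x. u t x * \<phi> x \<partial>vol M) + (\<integral>x. f (u t x) * \<phi> x \<partial>vol M)))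
           (at t within time_interval T)))"

definition locally_well_posed ::
    "('m::topological_space, 'n::finite) riemannian \<Rightarrow> real \<Rightarrow> ('m \<Rightarrow> real) \<Rightarrow> (real \<Rightarrow> real) \<Rightarrow> bool" where
  "locally_well_posed M \<beta> \<gamma> f \<longleftrightarrow>
     (\<forall>u0\<in>H10 M. \<forall>u1\<in>L2 M. \<exists>Tmax u v.
        wave_solution M \<beta> \<gamma> f Tmax u0 u1 u v \<and>
        (\<forall>T u' v'. wave_solution M \<beta> \<gamma> f T u0 u1 u' v' \<longrightarrow>
           T \<le> Tmax \<and> (\<forall>t\<in>time_interval T. AE x in vol M. u' t x = u t x)) \<and>
        (Tmax < \<infinity> \<longrightarrow>
           filterlim (\<lambda>t. state_norm M \<beta> (u t) (v t)) at_top (at_left (real_of_ereal Tmax))) \<and>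
        (\<forall>t\<^sub>0 t\<^sub>1. 0 \<le> t\<^sub>0 \<longrightarrow> t\<^sub>0 \<le> t\<^sub>1 \<longrightarrow> ereal t\<^sub>1 < Tmax \<longrightarrow>
           energy M \<beta> f (u t\<^sub>1) (v t\<^sub>1) = energy M \<beta> f (u t\<^sub>0) (v t\<^sub>0)
             - integral {t\<^sub>0..t\<^sub>1} (\<lambda>t. \<integral>x. \<gamma> x * (v t x)\<^sup>2 \<partial>vol M)))"

end

theory Submission
  imports Defs "HOL-Computational_Algebra.Polynomial"
begin

text \<open>Along a global solution put \<open>Y = \<parallel>u\<parallel>\<^sup>2\<close>, \<open>P = Y' / 2\<close> and \<open>Q = P'\<close>, with norms in \<open>L2\<close>. Testing the
  equation with \<open>u\<close> and eliminating the nonlinear term through the energy \<open>E\<close>, which is nonincreasing,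
  gives the virial inequality
  \<open>2 Q \<ge> (4 + \<epsilon> / 4) \<parallel>v\<parallel>\<^sup>2 + \<epsilon> / 2 \<parallel>u\<parallel>\<^sub>H\<^sup>2 - (4 + \<epsilon>) E - C1\<close>; the indefinite damping term is absorbed because
  (3) makes the integral of \<open>F u\<close> superlinear in \<open>Y\<close>. If \<open>E\<close> were below \<open>- C1 / (4 + \<epsilon>)\<close>, a negative
  power of \<open>Y\<close> would be concave and reach zero in finite time. The same inequality bounds \<open>Y' + l Y\<close>, as
  otherwise \<open>Y\<close> would tend to infinity and the concavity argument would apply again; this is the decay
  estimate for \<open>Y\<close>. Integrating the virial inequality over a unit window then bounds the integral of
  \<open>e = \<parallel>(u, v)\<parallel>\<^sup>2\<close> over that window. For \<open>p \<le> d / (d - 2)\<close> the Sobolev embedding into \<open>L^(2 d / (d - 2))\<close> gives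
  \<open>e' \<le> 2 L (1 + e) e\<close>, so that Gronwall's inequality, started at a time of the window at which \<open>e\<close> is at
  most its mean, turns this into a pointwise bound.

  The Sobolev inequality is proved for test functions on boxes in charts by Gagliardo's argument, in
  an averaged form valid without boundary conditions, so that no partition of unity is needed.\<close>

section \<open>Integral inequalities\<close>

text \<open>The constants may depend on f only through \<open>p\<close>, \<open>p0\<close>,
  \<open>Cf\<close> and \<epsilon>. Hence the locales carry \<kappa>, \<open>K\<close>,
  \<open>C1\<close> and \<open>S\<close> as parameters, fixed before a nonlinearity or a solution is
  given. The damping enters only through \<open>K\<close> and the additive constant
  \<open>C1\<close>; the decay rate, the square root of \<epsilon> \<kappa> / 2, is therefore free
  of it. Members of \<open>H10\<close> are known only as limits of test functions, and their
  differentials only as a choice among weak ones. Uniqueness of weak differentials, from the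
  fundamental lemma, makes the norms computable; Fatou's lemma carries the Sobolev inequality to the
  limit. The condition p <= d / (d - 2) means that 2 p is at most the Sobolev exponent 2 d / (d -
  2), so that f(u) is square integrable and can be paired with v in L2. The differential inequality
  for e is used only in integrated form: the energy merely gives e(t) - e(s) <= 2 (G(t) - G(s)),
  with G the integral of F(u), and the increments of G are bounded through one-sided difference
  quotients.\<close>

lemma weighted_geom_mean_le:
  fixes a :: "'k \<Rightarrow> real"
  assumes fin: "finite I" and pos: "0 < a0" "\<And>k. k \<in> I \<Longrightarrow> 0 < a k"
    and w: "0 \<le> \<theta>" "0 \<le> p" "\<theta> + real (card I) * p = 1"
  shows "a0 powr \<theta> * (\<Prod>k\<in>I. a k powr p) \<le> \<theta> * a0 + p * (\<Sum>k\<in>I. a k)"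
proof -
  define S where "S = \<theta> * a0 + p * (\<Sum>k\<in>I. a k)"
  have "0 < S"
  proof (cases "\<theta> = 0")
    case True
    with w have "p > 0" "I \<noteq> {}" by (auto simp: less_le)
    then have "0 < p * (\<Sum>k\<in>I. a k)" using pos fin by (intro mult_pos_pos sum_pos) auto
    then show ?thesis using True by (simp add: S_def)
  next
    case False
    then have "0 < \<theta> * a0" using w pos by simp
    moreover have "0 \<le> p * (\<Sum>k\<in>I. a k)"
      using pos w by (intro mult_nonneg_nonneg sum_nonneg) (auto simp: less_imp_le)
    ultimately show ?thesis by (simp add: S_def)
  qed
  \<comment> \<open>Tangent of the concave function \<open>ln\<close> at the weighted mean
    \<open>S\<close>. Summed with weights of total mass 1, the linear terms add up to S / S - 1 =
    0.\<close>
  have l: "ln x \<le> ln S + (x / S - 1)" if "0 < x" for x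
    using ln_le_minus_one[of "x / S"] that \<open>0 < S\<close> by (simp add: ln_div)
  have "\<theta> * ln a0 + (\<Sum>k\<in>I. p * ln (a k)) \<le> \<theta> * (ln S + (a0 / S - 1)) + (\<Sum>k\<in>I. p * (ln S + (a k / S - 1)))"
    by (intro add_mono mult_left_mono sum_mono l pos w)
  also have "\<dots> = (\<theta> + real (card I) * p) * (ln S - 1) + (\<theta> * a0 + p * (\<Sum>k\<in>I. a k)) / S"
    by (simp add: algebra_simps sum.distrib sum_subtractf sum_distrib_left sum_divide_distrib add_divide_distrib)
  also have "\<dots> = ln S" using \<open>0 < S\<close> w by (simp add: S_def[symmetric])
  finally have "exp (\<theta> * ln a0 + (\<Sum>k\<in>I. p * ln (a k))) \<le> S"
    using \<open>0 < S\<close> by (metis exp_le_cancel_iff exp_ln)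
  moreover have "a0 powr \<theta> * (\<Prod>k\<in>I. a k powr p) = exp (\<theta> * ln a0 + (\<Sum>k\<in>I. p * ln (a k)))"
  proof -
    have "(\<Prod>k\<in>I. a k powr p) = exp (\<Sum>k\<in>I. p * ln (a k))"
      unfolding exp_sum[OF fin] by (rule prod.cong) (use pos(2) in \<open>force simp: powr_def\<close>)+
    then show ?thesis using pos(1) by (simp add: exp_add powr_def)
  qed
  ultimately show ?thesis by (simp add: S_def)
qed

section \<open>Holder's inequality for products and the grid lines estimate\<close>

lemma integrable_bounded_prob:
  fixes f :: "'a \<Rightarrow> real"
  assumes "emeasure M (space M) = 1" "f \<in> borel_measurable M" "\<And>x. x \<in> space M \<Longrightarrow> \<bar>f x\<bar> \<le> B"
  shows "integrable M f"
proof -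
  interpret finite_measure M by standard (use assms in simp)
  show ?thesis by (rule integrable_const_bound[where B=B]) (use assms in auto)
qed

lemma integral_between_prob:
  fixes f :: "'a \<Rightarrow> real"
  assumes M: "emeasure M (space M) = 1" and f: "f \<in> borel_measurable M"
    and b: "\<And>x. x \<in> space M \<Longrightarrow> \<delta> \<le> f x" "\<And>x. x \<in> space M \<Longrightarrow> f x \<le> B"
  shows "\<delta> \<le> integral\<^sup>L M f" "integral\<^sup>L M f \<le> B"
proof -
  interpret finite_measure M by standard (use M in simp)
  have i: "integrable M f"
    by (rule integrable_bounded_prob[OF M f, of "max \<bar>\<delta>\<bar> \<bar>B\<bar>"]) (use b in \<open>fastforce simp: abs_le_iff\<close>)
  have m: "measure M (space M) = 1" using M by (simp add: measure_def)
  have "integral\<^sup>L M (\<lambda>_. \<delta>) \<le> integral\<^sup>L M f" by (rule integral_mono) (use i b in auto)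
  then show "\<delta> \<le> integral\<^sup>L M f" by (simp add: m)
  have "integral\<^sup>L M f \<le> integral\<^sup>L M (\<lambda>_. B)" by (rule integral_mono) (use i b in auto)
  then show "integral\<^sup>L M f \<le> B" by (simp add: m)
qed

lemma prod_powr_bound:
  fixes a :: "'k \<Rightarrow> real"
  assumes "\<And>k. k \<in> I \<Longrightarrow> 0 \<le> a k \<and> a k \<le> B" "0 \<le> p"
  shows "(\<Prod>k\<in>I. a k powr p) \<le> (\<Prod>k\<in>I. B powr p)" "0 \<le> (\<Prod>k\<in>I. a k powr p)"
  by (rule prod_mono) (use assms in \<open>auto intro: powr_mono2\<close>, simp add: prod_nonneg)

text \<open>After division of each factor by its integral, the weighted arithmetic-geometric mean
  inequality holds pointwise, and its right-hand side has integral 1. The bounds by \<delta> and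
  \<open>B\<close> on a probability space settle integrability and keep the integrals away from
  zero; \<delta> is removed again in \<open>Gagliardo_box\<close>.\<close>

lemma Holder_prod:
  fixes h :: "'k \<Rightarrow> 'a \<Rightarrow> real"
  assumes M: "emeasure M (space M) = 1" and fin: "finite I" and d: "0 < \<delta>"
    and h0: "h0 \<in> borel_measurable M" "\<And>x. x \<in> space M \<Longrightarrow> \<delta> \<le> h0 x" "\<And>x. x \<in> space M \<Longrightarrow> h0 x \<le> B"
    and h: "\<And>k. k \<in> I \<Longrightarrow> h k \<in> borel_measurable M" "\<And>k x. k \<in> I \<Longrightarrow> x \<in> space M \<Longrightarrow> \<delta> \<le> h k x"
       "\<And>k x. k \<in> I \<Longrightarrow> x \<in> space M \<Longrightarrow> h k x \<le> B"
    and w: "0 \<le> \<theta>" "0 \<le> p" "\<theta> + real (card I) * p = 1"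
  shows "(\<integral>x. h0 x powr \<theta> * (\<Prod>k\<in>I. h k x powr p) \<partial>M)
    \<le> integral\<^sup>L M h0 powr \<theta> * (\<Prod>k\<in>I. integral\<^sup>L M (h k) powr p)"
proof -
  define H0 where "H0 = integral\<^sup>L M h0"
  define H where "H k = integral\<^sup>L M (h k)" for k
  note [measurable] = h0(1) h(1)
  have H0: "0 < H0" using integral_between_prob(1)[OF M h0] d by (simp add: H0_def)
  have H: "0 < H k" if "k \<in> I" for k
    using integral_between_prob(1)[OF M h[OF that]] d by (simp add: H_def)
  have i0: "integrable M h0"
    by (rule integrable_bounded_prob[OF M, where B=B]) (use h0 d in fastforce)+
  have i: "integrable M (h k)" if "k \<in> I" for k
    by (rule integrable_bounded_prob[OF M h(1)[OF that], where B=B]) (use h(2,3)[OF that] d in fastforce)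
  have ptw: "h0 x powr \<theta> * (\<Prod>k\<in>I. h k x powr p)
      \<le> H0 powr \<theta> * (\<Prod>k\<in>I. H k powr p) * (\<theta> * (h0 x / H0) + p * (\<Sum>k\<in>I. h k x / H k))" (is "_ \<le> _ * ?r x")
    if x: "x \<in> space M" for x
  proof -
    have p0: "0 < h0 x" using h0(2)[OF x] d by linarith
    have pk: "0 < h k x" if "k \<in> I" for k using h(2)[OF that x] d by linarith
    have "(h0 x / H0) powr \<theta> * (\<Prod>k\<in>I. (h k x / H k) powr p) \<le> ?r x"
      by (rule weighted_geom_mean_le[OF fin _ _ w]) (use p0 pk H0 H in auto)
    then have "H0 powr \<theta> * (\<Prod>k\<in>I. H k powr p) * ((h0 x / H0) powr \<theta> * (\<Prod>k\<in>I. (h k x / H k) powr p))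
        \<le> H0 powr \<theta> * (\<Prod>k\<in>I. H k powr p) * ?r x"
      by (rule mult_left_mono) (auto intro!: mult_nonneg_nonneg prod_nonneg)
    also have "H0 powr \<theta> * (\<Prod>k\<in>I. H k powr p) * ((h0 x / H0) powr \<theta> * (\<Prod>k\<in>I. (h k x / H k) powr p))
       = (H0 * (h0 x / H0)) powr \<theta> * (\<Prod>k\<in>I. (H k * (h k x / H k)) powr p)"
    proof -
      have "(\<Prod>k\<in>I. (H k * (h k x / H k)) powr p) = (\<Prod>k\<in>I. H k powr p * (h k x / H k) powr p)"
        by (rule prod.cong[OF refl], subst powr_mult[symmetric]) (use H pk in \<open>force simp: less_imp_le\<close>)+
      moreover have "(H0 * (h0 x / H0)) powr \<theta> = H0 powr \<theta> * (h0 x / H0) powr \<theta>"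
        using H0 p0 by (subst powr_mult) auto
      ultimately show ?thesis by (simp add: prod.distrib)
    qed
    also have "(\<Prod>k\<in>I. (H k * (h k x / H k)) powr p) = (\<Prod>k\<in>I. h k x powr p)"
      by (rule prod.cong) (use H in force)+
    finally show ?thesis using H0 by simp
  qed
  have ir: "integrable M (\<lambda>x. H0 powr \<theta> * (\<Prod>k\<in>I. H k powr p) * ?r x)"
    using i0 i by (intro integrable_mult_right integrable_add integrable_sum) auto
  have "(\<integral>x. h0 x powr \<theta> * (\<Prod>k\<in>I. h k x powr p) \<partial>M)
     \<le> (\<integral>x. H0 powr \<theta> * (\<Prod>k\<in>I. H k powr p) * ?r x \<partial>M)"
  proof (rule integral_mono_AE'[OF ir])
    show "AE x in M. h0 x powr \<theta> * (\<Prod>k\<in>I. h k x powr p) \<le> H0 powr \<theta> * (\<Prod>k\<in>I. H k powr p) * ?r x"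
      using ptw by simp
    show "AE x in M. 0 \<le> H0 powr \<theta> * (\<Prod>k\<in>I. H k powr p) * ?r x"
      by (rule AE_I2, rule order_trans[OF _ ptw]) (auto intro!: mult_nonneg_nonneg prod_nonneg)
  qed
  also have "\<dots> = H0 powr \<theta> * (\<Prod>k\<in>I. H k powr p) * (\<integral>x. ?r x \<partial>M)" by simp
  also have "(\<integral>x. ?r x \<partial>M) = \<theta> * (H0 / H0) + p * (\<Sum>k\<in>I. H k / H k)"
    using i0 i by (simp add: Bochner_Integration.integral_add H0_def H_def)
  also have "(\<Sum>k\<in>I. H k / H k) = real (card I)"
    using H by (subst sum.cong[OF refl, of I _ "\<lambda>_. 1"]) force+
  also have "\<theta> * (H0 / H0) + p * real (card I) = 1" using H0 w by (simp add: mult.commute)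
  finally show ?thesis by (simp add: H0_def H_def)
qed

lemma (in product_sigma_finite) emeasure_PiM_space_1:
  assumes "finite I" "\<And>i. emeasure (M i) (space (M i)) = 1"
  shows "emeasure (PiM I M) (space (PiM I M)) = 1"
  using emeasure_PiM[OF assms(1), of "\<lambda>i. space (M i)"] assms(2) by (simp add: space_PiM)

lemma integral_product_fun_upd_measurable:
  fixes f :: "('i \<Rightarrow> 'a) \<Rightarrow> real"
  assumes M: "product_sigma_finite M" and f: "f \<in> borel_measurable (PiM I M)" and i: "i \<in> I"
  shows "(\<lambda>x. \<integral>t. f (x(i := t)) \<partial>M i) \<in> borel_measurable (PiM I M)"
proof -
  interpret product_sigma_finite M by fact
  have "(\<lambda>(x, t). f (x(i := t))) \<in> borel_measurable (PiM I M \<Otimes>\<^sub>M M i)"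
  proof -
    have "(\<lambda>p. (fst p)(i := snd p)) \<in> PiM I M \<Otimes>\<^sub>M M i \<rightarrow>\<^sub>M PiM (insert i I) M"
      by measurable
    with i f show ?thesis
      by (auto simp: insert_absorb split_beta' intro!: measurable_compose[OF _ f])
  qed
  then show ?thesis
    by (intro sigma_finite_measure.borel_measurable_lebesgue_integral sigma_finite_measures)
qed

text \<open>The induction behind the Gagliardo inequality (the ``grid lines lemma'' of van Doorn and
  Macbeth): integrating out one coordinate and applying Holder's inequality in it replaces \<open>f\<close> by
  its integral over that coordinate.\<close>

lemma grid_lines:
  fixes f :: "('i \<Rightarrow> 'a) \<Rightarrow> real"
  assumes M: "product_sigma_finite M" and one: "\<And>i. emeasure (M i) (space (M i)) = 1"
    and I: "finite I" and d: "0 < \<delta>" and p: "0 \<le> p" "(real (card I) - 1) * p \<le> 1"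
    and f: "f \<in> borel_measurable (PiM I M)" "\<And>x. x \<in> space (PiM I M) \<Longrightarrow> \<delta> \<le> f x"
      "\<And>x. x \<in> space (PiM I M) \<Longrightarrow> f x \<le> B"
  shows "(\<integral>x. f x powr (1 - (real (card I) - 1) * p) * (\<Prod>i\<in>I. (\<integral>t. f (x(i := t)) \<partial>M i) powr p) \<partial>PiM I M)
    \<le> (integral\<^sup>L (PiM I M) f) powr (1 + p)"
proof -
  interpret product_sigma_finite M by fact
  show ?thesis using I p(2) f
  proof (induction I arbitrary: f rule: finite_induct)
    \<comment> \<open>With no coordinates the product space is a single point and
      \<open>card I - 1\<close> is -1, so both sides are the same power with exponent 1 + p.\<close>
    case empty
    then show ?case by (simp add: PiM_empty lebesgue_integral_count_space_finite)
  next
    case (insert j I)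
    note [measurable] = insert.prems(2)
    let ?P = "PiM I M"
    have c: "real (card (insert j I)) - 1 = real (card I)" using insert by simp
    have cp: "real (card I) * p \<le> 1" using insert.prems(1) by (simp add: c)
    have fupd: "x(j := y) \<in> space (PiM (insert j I) M)" if "x \<in> space ?P" "y \<in> space (M j)" for x y
      using that insert(2) by (auto simp: space_PiM PiE_def extensional_def)
    define \<Phi> where "\<Phi> x = (\<integral>y. f (x(j := y)) \<partial>M j)" for x
    have m2: "(\<lambda>(x, y). f (x(j := y))) \<in> borel_measurable (?P \<Otimes>\<^sub>M M j)"
      using measurable_compose[OF measurable_add_dim insert.prems(2)] by (simp add: split_beta')
    have \<Phi>m[measurable]: "\<Phi> \<in> borel_measurable ?P"
      unfolding \<Phi>_def[abs_def] using m2
      by (intro sigma_finite_measure.borel_measurable_lebesgue_integral sigma_finite_measures)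
    have fy: "(\<lambda>y. f (x(j := y))) \<in> borel_measurable (M j)" if "x \<in> space ?P" for x
      using measurable_compose_Pair1[OF that m2] by simp
    have \<Phi>b: "\<delta> \<le> \<Phi> x" "\<Phi> x \<le> B" if "x \<in> space ?P" for x
      unfolding \<Phi>_def
      by (rule integral_between_prob[OF one fy[OF that] insert.prems(3,4)[OF fupd[OF that]]]; assumption)+
    define G where "G x = f x powr (1 - real (card I) * p) * (\<Prod>i\<in>insert j I. (\<integral>t. f (x(i := t)) \<partial>M i) powr p)" for x
    have Ai: "(\<lambda>x. \<integral>t. f (x(i := t)) \<partial>M i) \<in> borel_measurable (PiM (insert j I) M)" if "i \<in> insert j I" for i
      by (rule integral_product_fun_upd_measurable) (use M that insert.prems in auto)
    have Ab: "\<delta> \<le> (\<integral>t. f (x(i := t)) \<partial>M i)" "(\<integral>t. f (x(i := t)) \<partial>M i) \<le> B"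
      if "x \<in> space (PiM (insert j I) M)" "i \<in> insert j I" for x i
    proof -
      have u: "x(i := t) \<in> space (PiM (insert j I) M)" if "t \<in> space (M i)" for t
        using that \<open>x \<in> _\<close> \<open>i \<in> _\<close> by (auto simp: space_PiM PiE_def extensional_def)
      have mt: "(\<lambda>t. f (x(i := t))) \<in> borel_measurable (M i)"
      proof -
        have "(\<lambda>t. x(i := t)) \<in> M i \<rightarrow>\<^sub>M PiM (insert i (insert j I)) M"
          using that by (intro measurable_fun_upd[where J="insert j I"]) auto
        then show ?thesis
          using that(2) insert.prems(2) by (auto simp: insert_absorb intro: measurable_compose)
      qed
      show "\<delta> \<le> (\<integral>t. f (x(i := t)) \<partial>M i)" "(\<integral>t. f (x(i := t)) \<partial>M i) \<le> B"
        by (rule integral_between_prob[OF one mt insert.prems(3,4)[OF u]]; assumption)+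
    qed
    have Gm: "G \<in> borel_measurable (PiM (insert j I) M)"
      unfolding G_def[abs_def] 
      by (intro borel_measurable_times borel_measurable_prod powr_real_measurable borel_measurable_const Ai insert.prems(2))
    have Gb: "\<bar>G x\<bar> \<le> B powr (1 - real (card I) * p) * (\<Prod>i\<in>insert j I. B powr p)"
      if "x \<in> space (PiM (insert j I) M)" for x
    proof -
      have a: "(\<Prod>i\<in>insert j I. (\<integral>t. f (x(i := t)) \<partial>M i) powr p) \<le> (\<Prod>i\<in>insert j I. B powr p)"
        "0 \<le> (\<Prod>i\<in>insert j I. (\<integral>t. f (x(i := t)) \<partial>M i) powr p)"
        by (rule prod_powr_bound[OF conjI[OF order_trans[OF less_imp_le[OF d] Ab(1)[OF that]] Ab(2)[OF that]] p(1)];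
          assumption)+
      have b: "f x powr (1 - real (card I) * p) \<le> B powr (1 - real (card I) * p)"
        using insert.prems(3,4)[OF that] d cp by (intro powr_mono2) auto
      show ?thesis unfolding G_def using a b by (simp only: abs_mult) (intro mult_mono; simp)
    qed
    have G_int: "integrable (PiM (insert j I) M) G"
      by (rule integrable_bounded_prob[OF emeasure_PiM_space_1[OF _ one] Gm Gb]) (use insert in auto)
    have f_int: "integrable (PiM (insert j I) M) f"
      by (rule integrable_bounded_prob[OF emeasure_PiM_space_1[OF _ one] insert.prems(2), of "max \<bar>\<delta>\<bar> \<bar>B\<bar>"])
        (use insert in \<open>fastforce simp: abs_le_iff\<close>)+
    \<comment> \<open>In the variable \<open>j\<close> the factor of index \<open>j\<close> is the
      constant \<open>\<Phi> x powr p\<close>. Holder's inequality is applied to the remaining ones,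
      with weight \<open>1 - card I * p\<close> for f and weight \<open>p\<close> for each of the
      \<open>card I\<close> line integrals. The powers of \<open>\<Phi> x\<close> then combine to
      the exponent that the induction hypothesis expects.\<close>
    have inner: "(\<integral>y. G (x(j := y)) \<partial>M j)
        \<le> \<Phi> x powr (1 - (real (card I) - 1) * p) * (\<Prod>i\<in>I. (\<integral>t. \<Phi> (x(i := t)) \<partial>M i) powr p)"
      if x: "x \<in> space ?P" for x
    proof -
      have Gx: "G (x(j := y)) = \<Phi> x powr p * (f (x(j := y)) powr (1 - real (card I) * p)
          * (\<Prod>i\<in>I. (\<integral>t. f (x(j := y, i := t)) \<partial>M i) powr p))" for y
        using insert(1,2) by (simp add: G_def \<Phi>_def mult_ac)
      have swap: "(\<integral>y. \<integral>t. f (x(j := y, i := t)) \<partial>M i \<partial>M j) = (\<integral>t. \<Phi> (x(i := t)) \<partial>M i)" if i: "i \<in> I" for i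
      proof -
        interpret pj: pair_sigma_finite "M i" "M j"
          by (simp add: pair_sigma_finite.intro sigma_finite_measures)
        have ij: "i \<noteq> j" using i insert by auto
        have mm: "(\<lambda>(t, y). f (x(j := y, i := t))) \<in> borel_measurable (M i \<Otimes>\<^sub>M M j)"
        proof -
          have "(\<lambda>p. x(j := snd p)) \<in> M i \<Otimes>\<^sub>M M j \<rightarrow>\<^sub>M PiM (insert j I) M"
            by (rule measurable_fun_upd[where J=I]) (use x in auto)
          then have "(\<lambda>p. x(j := snd p, i := fst p)) \<in> M i \<Otimes>\<^sub>M M j \<rightarrow>\<^sub>M PiM (insert j I) M"
            by (rule measurable_fun_upd[where J="insert j I", rotated]) (use i in auto)
          from measurable_compose[OF this insert.prems(2)] show ?thesis
            by (simp add: split_beta' fun_upd_def)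
        qed
        have sp: "emeasure (M i \<Otimes>\<^sub>M M j) (space (M i \<Otimes>\<^sub>M M j)) = 1"
          by (simp add: space_pair_measure sigma_finite_measure.emeasure_pair_measure_Times[OF sigma_finite_measures] one)
        have u: "x(j := y, i := t) \<in> space (PiM (insert j I) M)" if "y \<in> space (M j)" "t \<in> space (M i)" for y t
          using that x i by (auto simp: space_PiM PiE_def extensional_def)
        have "integrable (M i \<Otimes>\<^sub>M M j) (\<lambda>(t, y). f (x(j := y, i := t)))"
          by (rule integrable_bounded_prob[OF sp mm, of "max \<bar>\<delta>\<bar> \<bar>B\<bar>"])
            (use insert.prems(3,4)[OF u] in \<open>fastforce simp: abs_le_iff space_pair_measure\<close>)
        from pj.Fubini_integral[OF this] show ?thesis
          using ij by (simp add: \<Phi>_def fun_upd_twist)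
      qed
      have "(\<integral>y. f (x(j := y)) powr (1 - real (card I) * p)
          * (\<Prod>i\<in>I. (\<integral>t. f (x(j := y, i := t)) \<partial>M i) powr p) \<partial>M j)
         \<le> (\<integral>y. f (x(j := y)) \<partial>M j) powr (1 - real (card I) * p)
          * (\<Prod>i\<in>I. (\<integral>y. \<integral>t. f (x(j := y, i := t)) \<partial>M i \<partial>M j) powr p)"
      proof (rule Holder_prod[OF one insert(1) d, where B=B])
        fix k assume k: "k \<in> I"
        show "(\<lambda>y. \<integral>t. f (x(j := y, k := t)) \<partial>M k) \<in> borel_measurable (M j)"
        proof -
          have "(\<lambda>y. x(j := y)) \<in> M j \<rightarrow>\<^sub>M PiM (insert j I) M"
            by (rule measurable_fun_upd[where J=I]) (use x in auto)
          from measurable_compose[OF this Ai[of k]] k show ?thesis by simp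
        qed
      qed (use x insert.prems fupd fy Ab cp p in auto)
      also have "\<dots> = \<Phi> x powr (1 - real (card I) * p) * (\<Prod>i\<in>I. (\<integral>t. \<Phi> (x(i := t)) \<partial>M i) powr p)"
        by (simp add: swap \<Phi>_def[of x, symmetric])
      finally have "(\<integral>y. G (x(j := y)) \<partial>M j)
        \<le> \<Phi> x powr p * (\<Phi> x powr (1 - real (card I) * p) * (\<Prod>i\<in>I. (\<integral>t. \<Phi> (x(i := t)) \<partial>M i) powr p))"
        unfolding Gx by (simp add: mult_left_mono)
      also have "\<dots> = \<Phi> x powr (1 - (real (card I) - 1) * p) * (\<Prod>i\<in>I. (\<integral>t. \<Phi> (x(i := t)) \<partial>M i) powr p)"
        by (simp add: mult.assoc[symmetric] powr_add[symmetric] algebra_simps)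
      finally show ?thesis .
    qed
    have \<Phi>A: "(\<lambda>x. \<integral>t. \<Phi> (x(i := t)) \<partial>M i) \<in> borel_measurable ?P" if "i \<in> I" for i
      by (rule integral_product_fun_upd_measurable[OF M \<Phi>m that])
    have \<Phi>Ab: "\<delta> \<le> (\<integral>t. \<Phi> (x(i := t)) \<partial>M i) \<and> (\<integral>t. \<Phi> (x(i := t)) \<partial>M i) \<le> B" if "x \<in> space ?P" "i \<in> I" for x i
    proof -
      have u: "x(i := t) \<in> space ?P" if "t \<in> space (M i)" for t
        using that \<open>x \<in> _\<close> \<open>i \<in> _\<close> by (auto simp: space_PiM PiE_def extensional_def)
      have mt: "(\<lambda>t. \<Phi> (x(i := t))) \<in> borel_measurable (M i)"
      proof -
        have "(\<lambda>t. x(i := t)) \<in> M i \<rightarrow>\<^sub>M PiM I M"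
          using that by (intro measurable_fun_upd[where J=I]) auto
        then show ?thesis using \<Phi>m by (auto intro: measurable_compose)
      qed
      show ?thesis
        by (rule conjI; rule integral_between_prob[OF one mt \<Phi>b[OF u]]; assumption)
    qed
    have ic: "(real (card I) - 1) * p \<le> 1" using cp p by (simp add: algebra_simps)
    have R_int: "integrable ?P (\<lambda>x. \<Phi> x powr (1 - (real (card I) - 1) * p) * (\<Prod>i\<in>I. (\<integral>t. \<Phi> (x(i := t)) \<partial>M i) powr p))"
    proof (rule integrable_bounded_prob[OF emeasure_PiM_space_1[OF insert(1) one]])
      show "(\<lambda>x. \<Phi> x powr (1 - (real (card I) - 1) * p) * (\<Prod>i\<in>I. (\<integral>t. \<Phi> (x(i := t)) \<partial>M i) powr p)) \<in> borel_measurable ?P"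
        by (intro borel_measurable_times borel_measurable_prod powr_real_measurable borel_measurable_const \<Phi>A \<Phi>m)
      fix x assume x: "x \<in> space ?P"
      have a: "(\<Prod>i\<in>I. (\<integral>t. \<Phi> (x(i := t)) \<partial>M i) powr p) \<le> (\<Prod>i\<in>I. B powr p)"
        "0 \<le> (\<Prod>i\<in>I. (\<integral>t. \<Phi> (x(i := t)) \<partial>M i) powr p)"
        by (rule prod_powr_bound[OF conjI[OF order_trans[OF less_imp_le[OF d] conjunct1[OF \<Phi>Ab[OF x]]]
          conjunct2[OF \<Phi>Ab[OF x]]] p(1)]; assumption)+
      have b: "\<Phi> x powr (1 - (real (card I) - 1) * p) \<le> B powr (1 - (real (card I) - 1) * p)"
        using \<Phi>b[OF x] d ic by (intro powr_mono2) auto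
      show "\<bar>\<Phi> x powr (1 - (real (card I) - 1) * p) * (\<Prod>i\<in>I. (\<integral>t. \<Phi> (x(i := t)) \<partial>M i) powr p)\<bar>
        \<le> B powr (1 - (real (card I) - 1) * p) * (\<Prod>i\<in>I. B powr p)"
        using a b by (simp only: abs_mult) (intro mult_mono; simp)
    qed
    have "integral\<^sup>L (PiM (insert j I) M) G = (\<integral>x. (\<integral>y. G (x(j := y)) \<partial>M j) \<partial>?P)"
      by (rule product_integral_insert[OF insert(1,2) G_int])
    also have "\<dots> \<le> (\<integral>x. \<Phi> x powr (1 - (real (card I) - 1) * p) * (\<Prod>i\<in>I. (\<integral>t. \<Phi> (x(i := t)) \<partial>M i) powr p) \<partial>?P)"
      by (rule integral_mono_AE'[OF R_int]) (use inner in \<open>auto intro!: mult_nonneg_nonneg prod_nonneg\<close>)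
    also have "\<dots> \<le> (integral\<^sup>L ?P \<Phi>) powr (1 + p)"
      by (rule insert.IH) (use \<Phi>b ic \<Phi>m in auto)
    also have "integral\<^sup>L ?P \<Phi> = integral\<^sup>L (PiM (insert j I) M) f"
      unfolding \<Phi>_def[abs_def] by (rule product_integral_insert[OF insert(1,2) f_int, symmetric])
    finally show ?case unfolding c G_def .
  qed
qed

section \<open>Square-integrable functions and averages along a line\<close>

lemma square_integrable_mult:
  fixes f g :: "'a \<Rightarrow> real"
  assumes [measurable]: "f \<in> borel_measurable M" "g \<in> borel_measurable M"
    and i: "integrable M (\<lambda>x. (f x)\<^sup>2)" "integrable M (\<lambda>x. (g x)\<^sup>2)"
  shows "integrable M (\<lambda>x. f x * g x)"
proof (rule Bochner_Integration.integrable_bound)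
  show "integrable M (\<lambda>x. (f x)\<^sup>2 + (g x)\<^sup>2)" using i by simp
  have "\<bar>f x * g x\<bar> \<le> (f x)\<^sup>2 + (g x)\<^sup>2" for x
  proof -
    have "2 * \<bar>f x\<bar> * \<bar>g x\<bar> \<le> (f x)\<^sup>2 + (g x)\<^sup>2" using sum_squares_bound[of "\<bar>f x\<bar>" "\<bar>g x\<bar>"] by simp
    moreover have "0 \<le> \<bar>f x\<bar> * \<bar>g x\<bar>" by simp
    ultimately show ?thesis unfolding abs_mult by linarith
  qed
  then show "AE x in M. norm (f x * g x) \<le> norm ((f x)\<^sup>2 + (g x)\<^sup>2)" by simp
qed simp

lemma integral_Cauchy_Schwarz_abs:
  fixes f g :: "'a \<Rightarrow> real"
  assumes [measurable]: "f \<in> borel_measurable M" "g \<in> borel_measurable M"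
    and i: "integrable M (\<lambda>x. (f x)\<^sup>2)" "integrable M (\<lambda>x. (g x)\<^sup>2)"
  shows "(\<integral>x. \<bar>f x * g x\<bar> \<partial>M) \<le> sqrt (\<integral>x. (f x)\<^sup>2 \<partial>M) * sqrt (\<integral>x. (g x)\<^sup>2 \<partial>M)"
proof -
  have fg: "integrable M (\<lambda>x. \<bar>f x * g x\<bar>)"
    using square_integrable_mult[OF assms] by simp
  have "(\<integral>\<^sup>+x. ennreal \<bar>f x\<bar> * ennreal \<bar>g x\<bar> \<partial>M)\<^sup>2
      \<le> (\<integral>\<^sup>+x. (ennreal \<bar>f x\<bar>)\<^sup>2 \<partial>M) * (\<integral>\<^sup>+x. (ennreal \<bar>g x\<bar>)\<^sup>2 \<partial>M)"
    by (rule Cauchy_Schwarz_nn_integral) auto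
  then have "(\<integral>\<^sup>+x. ennreal \<bar>f x * g x\<bar> \<partial>M)\<^sup>2
      \<le> (\<integral>\<^sup>+x. ennreal ((f x)\<^sup>2) \<partial>M) * (\<integral>\<^sup>+x. ennreal ((g x)\<^sup>2) \<partial>M)"
    by (simp add: ennreal_mult'[symmetric] abs_mult ennreal_power)
  then have "ennreal ((\<integral>x. \<bar>f x * g x\<bar> \<partial>M)\<^sup>2) \<le> ennreal ((\<integral>x. (f x)\<^sup>2 \<partial>M) * (\<integral>x. (g x)\<^sup>2 \<partial>M))"
    using fg i by (simp add: nn_integral_eq_integral ennreal_power ennreal_mult)
  then have "(\<integral>x. \<bar>f x * g x\<bar> \<partial>M)\<^sup>2 \<le> (\<integral>x. (f x)\<^sup>2 \<partial>M) * (\<integral>x. (g x)\<^sup>2 \<partial>M)"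
    by (subst (asm) ennreal_le_iff) simp_all
  then show ?thesis by (simp add: real_sqrt_mult[symmetric] real_le_rsqrt)
qed

lemma integral_Cauchy_Schwarz:
  fixes f g :: "'a \<Rightarrow> real"
  assumes "f \<in> borel_measurable M" "g \<in> borel_measurable M"
    and "integrable M (\<lambda>x. (f x)\<^sup>2)" "integrable M (\<lambda>x. (g x)\<^sup>2)"
  shows "\<bar>\<integral>x. f x * g x \<partial>M\<bar> \<le> sqrt (\<integral>x. (f x)\<^sup>2 \<partial>M) * sqrt (\<integral>x. (g x)\<^sup>2 \<partial>M)"
  using integral_abs_bound[of M "\<lambda>x. f x * g x"] integral_Cauchy_Schwarz_abs[OF assms] by linarith

text \<open>At the origin the difference quotient has size |h|^(s - 1), which tends to 0 because s >
  1. Elsewhere |y| is y or -y near the point, and \<open>powr\<close> is differentiated on that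
  half-line.\<close>

lemma has_real_derivative_abs_powr:
  assumes s: "1 < (s::real)"
  shows "((\<lambda>y. \<bar>y\<bar> powr s) has_real_derivative s * \<bar>y\<bar> powr (s - 1) * sgn y) (at y)"
proof -
  consider "0 < y" | "y < 0" | "y = 0" by linarith
  then show ?thesis
  proof cases
    case 1
    have "((\<lambda>y. y powr s) has_real_derivative s * y powr (s - 1)) (at y)"
      by (rule has_real_derivative_powr[OF 1])
    moreover have "eventually (\<lambda>z. z powr s = \<bar>z\<bar> powr s) (nhds y)"
      using eventually_nhds_in_open[of "{0<..}" y] 1 by (auto elim!: eventually_mono)
    ultimately show ?thesis using 1
      by (subst DERIV_cong_ev[OF refl _ refl, symmetric]) (auto elim!: DERIV_cong)
  next
    case 2
    have "((\<lambda>y. (- y) powr s) has_real_derivative (s * (- y) powr (s - 1)) * (- 1)) (at y)"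
      by (rule DERIV_chain2[where g=uminus and f="\<lambda>y. y powr s"], rule has_real_derivative_powr)
        (use 2 in \<open>auto intro!: derivative_eq_intros\<close>)
    moreover have "eventually (\<lambda>z. (- z) powr s = \<bar>z\<bar> powr s) (nhds y)"
      using eventually_nhds_in_open[of "{..<0}" y] 2 by (auto elim!: eventually_mono)
    ultimately show ?thesis using 2
      by (subst DERIV_cong_ev[OF refl _ refl, symmetric]) (auto elim!: DERIV_cong)
  next
    case 3
    have "((\<lambda>h. \<bar>h\<bar> powr s / h) \<longlongrightarrow> 0) (at 0)"
    proof (rule Lim_null_comparison)
      have "norm (\<bar>h\<bar> powr s / h) \<le> \<bar>h\<bar> powr (s - 1)" for h
        by (cases "h = 0") (simp_all add: powr_diff)
      then show "eventually (\<lambda>h. norm (\<bar>h\<bar> powr s / h) \<le> \<bar>h\<bar> powr (s - 1)) (at 0)" by simp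
      have "((\<lambda>h::real. \<bar>h\<bar> powr (s - 1)) \<longlongrightarrow> \<bar>0\<bar> powr (s - 1)) (at 0)"
        using s by (intro tendsto_powr' tendsto_rabs tendsto_ident_at tendsto_const) auto
      then show "((\<lambda>h::real. \<bar>h\<bar> powr (s - 1)) \<longlongrightarrow> 0) (at 0)" by simp
    qed
    with 3 show ?thesis by (simp add: DERIV_def)
  qed
qed

text \<open>Averaging \<open>h x \<le> h y + \<integral>|h'|\<close> over \<open>y\<close> needs no boundary condition, in contrast to the
  usual argument for compactly supported functions.\<close>

lemma line_average_bound:
  fixes h h' :: "real \<Rightarrow> real"
  assumes "a < b" and x: "x \<in> {a<..<b}"
    and d: "\<And>t. t \<in> {a<..<b} \<Longrightarrow> (h has_real_derivative h' t) (at t)"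
    and c: "continuous_on {a<..<b} h'"
    and hi: "integrable lborel (\<lambda>t. indicator {a<..<b} t * h t)"
    and gi: "integrable lborel (\<lambda>t. indicator {a<..<b} t * g t)"
    and g: "\<And>t. t \<in> {a<..<b} \<Longrightarrow> \<bar>h' t\<bar> \<le> g t"
  shows "h x \<le> (\<integral>t. indicator {a<..<b} t * (h t / (b - a) + g t) \<partial>lborel)"
proof -
  have m: "emeasure lborel {a<..<b} = ennreal (b - a)" using \<open>a < b\<close> by simp
  define J where "J = (\<integral>t. indicator {a<..<b} t * g t \<partial>lborel)"
  have g0: "0 \<le> indicator {a<..<b} t * g t" for t using g[of t] by (auto simp: indicator_def)
  \<comment> \<open>Both inequalities are recorded for s <= t, because the point over which the
    average is taken may lie on either side of x.\<close>
  have ord: "h t \<le> h s + J \<and> h s \<le> h t + J" if st: "s \<in> {a<..<b}" "t \<in> {a<..<b}" "s \<le> t" for s t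
  proof -
    have sub: "{s..t} \<subseteq> {a<..<b}" using st by auto
    have F: "has_bochner_integral lborel (\<lambda>u. indicator {s..t} u *\<^sub>R h' u) (h t - h s)"
    proof (rule has_bochner_integral_FTC_Icc[OF st(3)])
      fix u assume "s \<le> u" "u \<le> t"
      then have "u \<in> {a<..<b}" using sub by auto
      from d[OF this] show "(h has_vector_derivative h' u) (at u within {s..t})"
        by (simp add: has_real_derivative_iff_has_vector_derivative has_vector_derivative_at_within)
    qed (rule continuous_on_subset[OF c sub])
    then have "\<bar>h t - h s\<bar> \<le> (\<integral>u. \<bar>indicator {s..t} u * h' u\<bar> \<partial>lborel)"
      using integral_abs_bound[of lborel "\<lambda>u. indicator {s..t} u * h' u"]
      by (simp add: has_bochner_integral_iff)
    also have "\<dots> \<le> J" unfolding J_def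
    proof (rule integral_mono_AE'[OF gi])
      show "AE u in lborel. \<bar>indicator {s..t} u * h' u\<bar> \<le> indicator {a<..<b} u * g u"
      proof (rule AE_I2)
        fix u
        show "\<bar>indicator {s..t} u * h' u\<bar> \<le> indicator {a<..<b} u * g u"
          using g[of u] sub g0[of u] by (cases "u \<in> {s..t}") (auto simp: indicator_def)
      qed
    qed (use g0 in auto)
    finally show ?thesis by linarith
  qed
  have le: "h x \<le> h y + J" if "y \<in> {a<..<b}" for y
    using ord[OF x that] ord[OF that x] by linarith
  have "(\<integral>t. indicator {a<..<b} t * h x \<partial>lborel) \<le> (\<integral>t. indicator {a<..<b} t * (h t + J) \<partial>lborel)"
  proof (rule integral_mono)
    show "integrable lborel (\<lambda>t. indicator {a<..<b} t * h x)"
      using m by (intro integrable_mult_left) simp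
    have "integrable lborel (\<lambda>t. indicator {a<..<b} t * h t + indicator {a<..<b} t * J)"
      using m hi by (intro Bochner_Integration.integrable_add integrable_mult_left[where c=J]) auto
    then show "integrable lborel (\<lambda>t. indicator {a<..<b} t * (h t + J))"
      by (simp add: algebra_simps)
  qed (use le in \<open>auto simp: indicator_def\<close>)
  also have "(\<integral>t. indicator {a<..<b} t * (h t + J) \<partial>lborel) = (\<integral>t. indicator {a<..<b} t * h t + indicator {a<..<b} t * J \<partial>lborel)"
    by (simp add: algebra_simps)
  also have "\<dots> = (\<integral>t. indicator {a<..<b} t * h t \<partial>lborel) + (b - a) * J"
    using m hi \<open>a < b\<close> by (subst Bochner_Integration.integral_add) auto
  finally have "(b - a) * h x \<le> (\<integral>t. indicator {a<..<b} t * h t \<partial>lborel) + (b - a) * J"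
    using \<open>a < b\<close> by simp
  then have "h x \<le> (\<integral>t. indicator {a<..<b} t * h t \<partial>lborel) / (b - a) + J"
    using \<open>a < b\<close> by (simp add: field_simps)
  also have "\<dots> = (\<integral>t. indicator {a<..<b} t * h t / (b - a) + indicator {a<..<b} t * g t \<partial>lborel)"
    unfolding J_def using hi gi by (subst Bochner_Integration.integral_add) auto
  also have "\<dots> = (\<integral>t. indicator {a<..<b} t * (h t / (b - a) + g t) \<partial>lborel)"
    by (simp add: algebra_simps)
  finally show ?thesis .
qed

section \<open>The Sobolev inequality on a box\<close>

text \<open>The uniform probability on the interval. Products of such measures are Lebesgue measure
  on a box divided by its volume, so that \<open>grid_lines\<close> can be applied to a box.\<close>

definition unif :: "real \<Rightarrow> real \<Rightarrow> real measure" where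
  "unif l u = density lborel (\<lambda>t. ennreal (indicator {l<..<u} t / (u - l)))"

lemma unif_simps[simp]:
  shows "sets (unif l u) = sets borel" "space (unif l u) = UNIV"
  by (simp_all add: unif_def)

lemma emeasure_unif_space:
  assumes "l < u" shows "emeasure (unif l u) (space (unif l u)) = 1"
proof -
  have "emeasure (unif l u) UNIV = (\<integral>\<^sup>+t. ennreal (1 / (u - l)) * indicator {l<..<u} t \<partial>lborel)"
    unfolding unif_def
      by (subst emeasure_density) (auto intro!: nn_integral_cong split: split_indicator)
  also have "\<dots> = ennreal (1 / (u - l)) * ennreal (u - l)"
    using assms by (subst nn_integral_cmult_indicator) auto
  also have "\<dots> = 1" using assms by (simp add: ennreal_mult'[symmetric])
  finally show ?thesis by simp
qed

lemma integral_unif: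
  assumes "l < u" "f \<in> borel_measurable borel"
  shows "integral\<^sup>L (unif l u) f = (\<integral>t. indicator {l<..<u} t * (f t / (u - l)) \<partial>lborel)"
  unfolding unif_def using assms by (subst integral_real_density) auto

lemma product_sigma_finite_unif:
  assumes "\<And>i. l i < u i" shows "product_sigma_finite (\<lambda>i. unif (l i) (u i))"
proof
  fix i
  interpret finite_measure "unif (l i) (u i)"
    by standard (use emeasure_unif_space[OF assms] in simp)
  show "\<exists>A. countable A \<and> A \<subseteq> sets (unif (l i) (u i)) \<and> \<Union> A = space (unif (l i) (u i)) \<and>
      (\<forall>a\<in>A. emeasure (unif (l i) (u i)) a \<noteq> \<infinity>)"
    by (rule sigma_finite_countable)
qed

text \<open>Both measures give a rectangle the product of the measures of its sides, and a product
  measure is determined by its values on rectangles.\<close>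

lemma PiM_unif:
  assumes lu: "\<And>i. l i < u i" and I: "finite I"
  shows "PiM I (\<lambda>i. unif (l i) (u i))
    = density (PiM I (\<lambda>_. lborel)) (\<lambda>x. ennreal (\<Prod>i\<in>I. indicator {l i<..<u i} (x i) / (u i - l i)))" (is "?P = ?D")
proof -
  interpret U: product_sigma_finite "\<lambda>i. unif (l i) (u i)"
    by (rule product_sigma_finite_unif[OF lu])
  interpret L: product_sigma_finite "\<lambda>_. lborel :: real measure" by standard
  have m: "(\<lambda>x. \<Prod>i\<in>I. indicator {l i<..<u i} (x i) / (u i - l i) :: real) \<in> borel_measurable (PiM I (\<lambda>_. lborel))"
    by (intro borel_measurable_prod borel_measurable_divide borel_measurable_const
       measurable_compose[OF measurable_component_singleton]) auto
  have "?D = ?P"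
  proof (rule U.PiM_eqI[OF I])
    show "sets ?D = sets ?P" by (simp, rule sets_PiM_cong) auto
    fix A :: "'a \<Rightarrow> real set" assume A: "\<And>i. i \<in> I \<Longrightarrow> A i \<in> sets (unif (l i) (u i))"
    have As: "Pi\<^sub>E I A \<in> sets (PiM I (\<lambda>_. lborel :: real measure))"
      using A I by (intro sets_PiM_I_finite) auto
    have "emeasure ?D (Pi\<^sub>E I A) = (\<integral>\<^sup>+x. ennreal (\<Prod>i\<in>I. indicator {l i<..<u i} (x i) / (u i - l i)) * indicator (Pi\<^sub>E I A) x \<partial>PiM I (\<lambda>_. lborel))"
      using m As by (subst emeasure_density) auto
    also have "\<dots> = (\<integral>\<^sup>+x. (\<Prod>i\<in>I. ennreal (indicator {l i<..<u i} (x i) / (u i - l i)) * indicator (A i) (x i)) \<partial>PiM I (\<lambda>_. lborel))"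
    proof (rule nn_integral_cong)
      fix x assume "x \<in> space (PiM I (\<lambda>_. lborel :: real measure))"
      then have "indicator (Pi\<^sub>E I A) x = (\<Prod>i\<in>I. indicator (A i) (x i) :: ennreal)"
        using I by (auto simp: space_PiM PiE_def indicator_def Pi_def prod_eq_1_iff intro!: prod_zero[symmetric] prod.neutral[symmetric])
      moreover have "ennreal (\<Prod>i\<in>I. indicator {l i<..<u i} (x i) / (u i - l i)) = (\<Prod>i\<in>I. ennreal (indicator {l i<..<u i} (x i) / (u i - l i)))"
        using lu by (intro prod_ennreal[symmetric]) (auto simp: indicator_def less_imp_le)
      ultimately show "ennreal (\<Prod>i\<in>I. indicator {l i<..<u i} (x i) / (u i - l i)) * indicator (Pi\<^sub>E I A) x
        = (\<Prod>i\<in>I. ennreal (indicator {l i<..<u i} (x i) / (u i - l i)) * indicator (A i) (x i))"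
        by (simp add: prod.distrib)
    qed
    also have "\<dots> = (\<Prod>i\<in>I. \<integral>\<^sup>+t. ennreal (indicator {l i<..<u i} t / (u i - l i)) * indicator (A i) t \<partial>lborel)"
      using A by (intro L.product_nn_integral_prod[OF I]) auto
    also have "\<dots> = (\<Prod>i\<in>I. emeasure (unif (l i) (u i)) (A i))"
      using A by (intro prod.cong refl) (simp add: unif_def emeasure_density)
    finally show "emeasure ?D (Pi\<^sub>E I A) = (\<Prod>i\<in>I. emeasure (unif (l i) (u i)) (A i))" .
  qed
  then show ?thesis ..
qed

abbreviation coords :: "('a \<Rightarrow> real) \<Rightarrow> 'a::euclidean_space" where
  "coords x \<equiv> (\<Sum>b\<in>Basis. x b *\<^sub>R b)"

lemma coords_inner: "b \<in> Basis \<Longrightarrow> coords x \<bullet> b = x b"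
  by (simp add: inner_sum_left inner_Basis if_distrib cong: if_cong)

lemma coords_upd: "b \<in> Basis \<Longrightarrow> coords (x(b := t)) = coords x + (t - x b) *\<^sub>R b"
proof -
  assume b: "b \<in> Basis"
  have "(\<Sum>c\<in>Basis. (x(b := t)) c *\<^sub>R c) = t *\<^sub>R b + (\<Sum>c\<in>Basis - {b}. x c *\<^sub>R c)"
    using b by (subst sum.remove[of _ b]) (auto intro!: sum.cong)
  also have "(\<Sum>c\<in>Basis - {b}. x c *\<^sub>R c) = coords x - x b *\<^sub>R b"
    using b by (subst (2) sum.remove[of _ b]) auto
  finally show ?thesis by (simp add: algebra_simps)
qed

text \<open>Lebesgue measure on a Euclidean space is the image under \<open>coords\<close> of the
  product of one-dimensional ones, and the product of the interval indicators is the indicator of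
  the box. This is the bridge between functions of coordinate families and integrals over a
  box.\<close>

lemma integral_PiM_unif_box:
  fixes a b :: "'a::euclidean_space" and \<phi> :: "'a \<Rightarrow> real"
  assumes ab: "\<And>i. i \<in> Basis \<Longrightarrow> a \<bullet> i < b \<bullet> i" and lu: "\<And>i. l i < u i"
    and l: "\<And>i. i \<in> Basis \<Longrightarrow> l i = a \<bullet> i" "\<And>i. i \<in> Basis \<Longrightarrow> u i = b \<bullet> i"
    and \<phi>[measurable]: "\<phi> \<in> borel_measurable borel"
  shows "(\<integral>x. \<phi> (coords x) \<partial>PiM Basis (\<lambda>i. unif (l i) (u i)))
    = (\<integral>x. indicator (box a b) x * \<phi> x \<partial>lborel) / (\<Prod>i\<in>Basis. b \<bullet> i - a \<bullet> i)"
proof -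
  have mc: "coords \<in> PiM Basis (\<lambda>_. lborel) \<rightarrow>\<^sub>M (borel :: 'a measure)" by measurable
  have m: "(\<lambda>x. \<Prod>i\<in>Basis. indicator {l i<..<u i} (x i) / (u i - l i) :: real) \<in> borel_measurable (PiM (Basis :: 'a set) (\<lambda>_. lborel))"
    by (intro borel_measurable_prod borel_measurable_divide borel_measurable_const
       measurable_compose[OF measurable_component_singleton]) auto
  have "(\<integral>x. \<phi> (coords x) \<partial>PiM Basis (\<lambda>i. unif (l i) (u i)))
    = (\<integral>x. (\<Prod>i\<in>Basis. indicator {l i<..<u i} (x i) / (u i - l i)) * \<phi> (coords x) \<partial>PiM Basis (\<lambda>_. lborel))"
    unfolding PiM_unif[OF lu finite_Basis]
    using m mc lu
      by (subst integral_real_density) (auto intro!: prod_nonneg AE_I2 divide_nonneg_pos)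
  also have "\<dots> = (\<integral>x. indicator (box a b) (coords x) * \<phi> (coords x) / (\<Prod>i\<in>Basis. b \<bullet> i - a \<bullet> i) \<partial>PiM Basis (\<lambda>_. lborel))"
  proof (rule Bochner_Integration.integral_cong[OF refl])
    fix x :: "'a \<Rightarrow> real"
    have "(\<Prod>i\<in>Basis. indicator {l i<..<u i} (x i) / (u i - l i)) = (\<Prod>i\<in>Basis. indicator {l i<..<u i} (x i) / (b \<bullet> i - a \<bullet> i))"
      using l by (intro prod.cong) auto
    also have "\<dots> = (\<Prod>i\<in>Basis. indicator {l i<..<u i} (x i)) / (\<Prod>i\<in>Basis. b \<bullet> i - a \<bullet> i)"
      by (rule prod_dividef)
    also have "(\<Prod>i\<in>(Basis::'a set). indicator {l i<..<u i} (x i) :: real) = indicator (box a b) (coords x)"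
    proof (cases "coords x \<in> box a b")
      case True
      then have "x i \<in> {l i<..<u i}" if "i \<in> Basis" for i
        using that l by (auto simp: mem_box coords_inner)
      then show ?thesis using True by (simp add: indicator_def)
    next
      case False
      then obtain i where "i \<in> Basis" "x i \<notin> {l i<..<u i}"
        using l by (auto simp: mem_box coords_inner)
      then show ?thesis using False by (auto intro!: prod_zero bexI[of _ i])
    qed
    finally show "(\<Prod>i\<in>Basis. indicator {l i<..<u i} (x i) / (u i - l i)) * \<phi> (coords x)
      = indicator (box a b) (coords x) * \<phi> (coords x) / (\<Prod>i\<in>Basis. b \<bullet> i - a \<bullet> i)" by simp
  qed
  also have "\<dots> = (\<integral>x. indicator (box a b) x * \<phi> x / (\<Prod>i\<in>Basis. b \<bullet> i - a \<bullet> i) \<partial>lborel)"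
    by (subst lborel_eq, subst integral_distr[OF mc]) auto
  finally show ?thesis by simp
qed

section \<open>The Gagliardo and Sobolev inequalities on a box\<close>

lemma le_powr_limit:
  fixes X Y r :: real
  assumes "\<And>\<delta>. 0 < \<delta> \<Longrightarrow> X \<le> (\<delta> + Y) powr r" "0 < r" "0 \<le> Y"
  shows "X \<le> Y powr r"
proof (rule tendsto_lowerbound[of "\<lambda>\<delta>. (\<delta> + Y) powr r" _ "at_right 0"])
  have "((\<lambda>\<delta>. (\<delta> + Y) powr r) \<longlongrightarrow> (0 + Y) powr r) (at_right 0)"
  proof (rule tendsto_powr')
    show "0 + Y \<noteq> 0 \<or> 0 < r \<and> (\<forall>\<^sub>F x in at_right 0. 0 \<le> x + Y)"
      using assms by (auto simp: eventually_at_filter intro!: always_eventually)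
  qed (rule tendsto_add tendsto_ident_at tendsto_const)+
  then show "((\<lambda>\<delta>. (\<delta> + Y) powr r) \<longlongrightarrow> Y powr r) (at_right 0)" by simp
  show "\<forall>\<^sub>F \<delta> in at_right 0. X \<le> (\<delta> + Y) powr r"
    using assms(1) by (auto simp: eventually_at_filter intro!: always_eventually)
qed simp

text \<open>Along each of the d coordinate lines through x, \<open>w x\<close> is at most an average
  of \<open>w + \<Lambda> g\<close>. The product of these d bounds, each to the power p = 1 / (d -
  1), has w^(d / (d - 1)) on the left, and \<open>grid_lines\<close> integrates the right-hand side:
  for this p the function itself occurs there with exponent 0.\<close>

lemma Gagliardo_box:
  fixes a b :: "'a::euclidean_space" and w :: "'a \<Rightarrow> real"
  assumes D: "DIM('a) \<ge> 2" and ab: "\<And>i. i \<in> Basis \<Longrightarrow> a \<bullet> i < b \<bullet> i"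
    and d: "\<And>x. x \<in> box a b \<Longrightarrow> (w has_derivative W x) (at x)"
    and c: "\<And>v. continuous_on (box a b) (\<lambda>x. W x v)"
    and w0: "\<And>x. x \<in> box a b \<Longrightarrow> 0 \<le> w x \<and> w x \<le> K"
    and gm: "(\<lambda>x. indicator (box a b) x * g x) \<in> borel_measurable borel"
    and g: "\<And>x i. x \<in> box a b \<Longrightarrow> i \<in> Basis \<Longrightarrow> \<bar>W x i\<bar> \<le> g x" "\<And>x. x \<in> box a b \<Longrightarrow> g x \<le> K"
  shows "(\<integral>x. indicator (box a b) x * w x powr (real DIM('a) / (real DIM('a) - 1)) \<partial>lborel) / (\<Prod>i\<in>Basis. b \<bullet> i - a \<bullet> i)
    \<le> ((\<integral>x. indicator (box a b) x * (w x + (\<Sum>i\<in>Basis. b \<bullet> i - a \<bullet> i) * g x) \<partial>lborel) / (\<Prod>i\<in>Basis. b \<bullet> i - a \<bullet> i))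
        powr (real DIM('a) / (real DIM('a) - 1))"
proof -
  \<comment> \<open>\<open>product_sigma_finite\<close> speaks of every index, so indices outside
    \<open>Basis\<close> also need a nondegenerate interval; there it is (0, 1).\<close>
  define l where "l i = (if i \<in> Basis then a \<bullet> i else 0)" for i
  define u where "u i = (if i \<in> Basis then b \<bullet> i else 1)" for i
  have lu: "l i < u i" for i using ab by (simp add: l_def u_def)
  define M where "M i = unif (l i) (u i)" for i
  define D1 where "D1 = real DIM('a) - 1"
  have D1: "D1 \<ge> 1" using D by (simp add: D1_def)
  define p where "p = 1 / D1"
  define r where "r = real DIM('a) / D1"
  have r: "r = 1 + p" "0 < r" "0 \<le> p" "D1 * p = 1"
    using D1 by (simp_all add: r_def p_def D1_def field_simps)
  \<comment> \<open>The sum of all side lengths bounds each of them, so that one factor serves every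
    direction.\<close>
  define \<Lambda> where "\<Lambda> = (\<Sum>i\<in>Basis. b \<bullet> i - a \<bullet> i)"
  have \<Lambda>: "b \<bullet> i - a \<bullet> i \<le> \<Lambda>" if "i \<in> Basis" for i
    unfolding \<Lambda>_def using that ab by (intro member_le_sum) (auto simp: less_imp_le)
  have \<Lambda>0: "0 \<le> \<Lambda>" unfolding \<Lambda>_def using ab by (intro sum_nonneg) (auto simp: less_imp_le)
  have K0: "0 \<le> K" if "x \<in> box a b" for x using w0[OF that] by linarith
  define W0 where "W0 x = indicator (box a b) x * w x" for x
  define G0 where "G0 x = indicator (box a b) x * (\<Lambda> * g x)" for x
  have wc: "continuous_on (box a b) w"
    using d by (intro continuous_at_imp_continuous_on ballI has_derivative_continuous) auto
  have [measurable]: "W0 \<in> borel_measurable borel"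
    unfolding W0_def[abs_def] using borel_measurable_continuous_on_indicator[OF _ wc] by simp
  have [measurable]: "G0 \<in> borel_measurable borel"
    unfolding G0_def[abs_def]
      using borel_measurable_times[OF borel_measurable_const[of \<Lambda>] gm] by (simp add: mult_ac)
  have g0: "0 \<le> g x" if "x \<in> box a b" for x using g(1)[OF that SOME_Basis] by linarith
  have W0b: "0 \<le> W0 x" "W0 x \<le> \<bar>K\<bar>" for x using w0[of x] by (auto simp: W0_def indicator_def)
  have G0b: "0 \<le> G0 x" "G0 x \<le> \<Lambda> * \<bar>K\<bar>" for x
    using g0[of x] g(2)[of x] \<Lambda>0 K0[of x]
      by (auto simp: G0_def indicator_def intro!: mult_left_mono)
  interpret PS: product_sigma_finite M
    unfolding M_def[abs_def] by (rule product_sigma_finite_unif[OF lu])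
  have one: "emeasure (M i) (space (M i)) = 1" for i
    unfolding M_def by (rule emeasure_unif_space[OF lu])
  have sM: "sets (PiM Basis M) = sets (PiM (Basis :: 'a set) (\<lambda>_. borel))"
    by (rule sets_PiM_cong) (auto simp: M_def)
  have mc: "coords \<in> PiM Basis M \<rightarrow>\<^sub>M (borel :: 'a measure)"
    by (subst measurable_cong_sets[OF sM refl]) measurable
  have line: "W0 (coords x) \<le> (\<integral>t. f (coords (x(i := t))) \<partial>M i)"
    if i: "i \<in> Basis" and f[measurable]: "f \<in> borel_measurable borel"
      and fge: "\<And>y. W0 y + G0 y \<le> f y" and fb: "\<And>y. f y \<le> B" for x i f B
  proof (cases "coords x \<in> box a b")
    case False
    have "0 \<le> f y" for y using fge[of y] W0b[of y] G0b[of y] by linarith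
    then show ?thesis using False by (simp add: W0_def Bochner_Integration.integral_nonneg)
  next
    case True
    define \<xi> where "\<xi> t = coords x + (t - x i) *\<^sub>R i" for t
    have \<xi>: "coords (x(i := t)) = \<xi> t" for t unfolding \<xi>_def by (rule coords_upd[OF i])
    have \<xi>b: "\<xi> t \<in> box a b \<longleftrightarrow> t \<in> {a \<bullet> i<..<b \<bullet> i}" for t
    proof -
      have "\<xi> t \<bullet> j = (if j = i then t else x j)" if "j \<in> Basis" for j
        using that i by (simp add: \<xi>_def inner_add_left inner_Basis coords_inner)
      moreover have "a \<bullet> j < x j \<and> x j < b \<bullet> j" if "j \<in> Basis" for j
        using True that by (auto simp: mem_box coords_inner)
      ultimately show ?thesis using i by (auto simp: mem_box)
    qed
    have \<xi>m[measurable]: "\<xi> \<in> borel_measurable borel" unfolding \<xi>_def[abs_def] by measurable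
    have \<xi>c: "continuous_on S \<xi>" for S unfolding \<xi>_def[abs_def] by (intro continuous_intros)
    have xi: "x i \<in> {a \<bullet> i<..<b \<bullet> i}" and x\<xi>: "\<xi> (x i) = coords x"
      using True i by (auto simp: mem_box coords_inner \<xi>_def)
    have Li: "0 < b \<bullet> i - a \<bullet> i" using ab[OF i] by simp
    have bi: "integrable lborel (\<lambda>t. indicator {a \<bullet> i<..<b \<bullet> i} t * h t)"
      if "h \<in> borel_measurable borel" "\<And>t. \<bar>h t\<bar> \<le> C" for h :: "real \<Rightarrow> real" and C
    proof -
      have "integrable lborel (\<lambda>t. indicator {a \<bullet> i<..<b \<bullet> i} t *\<^sub>R h t)"
        using that Li
          by (intro integrableI_bounded_set_indicator[of _ _ _ C]) (auto simp: less_imp_le)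
      then show ?thesis by simp
    qed
    have "w (\<xi> (x i)) \<le> (\<integral>t. indicator {a \<bullet> i<..<b \<bullet> i} t * (w (\<xi> t) / (b \<bullet> i - a \<bullet> i) + G0 (\<xi> t) / (b \<bullet> i - a \<bullet> i)) \<partial>lborel)"
    proof (rule line_average_bound[OF _ xi])
      show "a \<bullet> i < b \<bullet> i" using ab i by auto
      fix t assume t: "t \<in> {a \<bullet> i<..<b \<bullet> i}"
      have "(\<xi> has_derivative (\<lambda>h. h *\<^sub>R i)) (at t)"
        unfolding \<xi>_def[abs_def] by (auto intro!: derivative_eq_intros)
      moreover have "(w has_derivative W (\<xi> t)) (at (\<xi> t))" using t by (intro d) (simp add: \<xi>b)
      ultimately have "((\<lambda>t. w (\<xi> t)) has_derivative (\<lambda>h. W (\<xi> t) (h *\<^sub>R i))) (at t)"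
        by (rule has_derivative_compose)
      moreover have "linear (W (\<xi> t))" using d[of "\<xi> t"] t by (simp add: \<xi>b has_derivative_linear)
      ultimately show "((\<lambda>t. w (\<xi> t)) has_real_derivative W (\<xi> t) i) (at t)"
        by (simp add: linear_cmul has_field_derivative_def mult_commute_abs)
      have "\<bar>W (\<xi> t) i\<bar> \<le> g (\<xi> t)" using t i by (intro g) (simp_all add: \<xi>b)
      also have "\<dots> \<le> \<Lambda> * g (\<xi> t) / (b \<bullet> i - a \<bullet> i)"
        using Li \<Lambda>[OF i] g0[of "\<xi> t"] t
          by (simp add: \<xi>b pos_le_divide_eq mult.commute[of "g (\<xi> t)"] mult_right_mono)
      finally show "\<bar>W (\<xi> t) i\<bar> \<le> G0 (\<xi> t) / (b \<bullet> i - a \<bullet> i)" using t by (simp add: G0_def \<xi>b)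
    next
      show "continuous_on {a \<bullet> i<..<b \<bullet> i} (\<lambda>t. W (\<xi> t) i)"
        by (rule continuous_on_compose2[OF c \<xi>c]) (auto simp: \<xi>b)
      have "integrable lborel (\<lambda>t. indicator {a \<bullet> i<..<b \<bullet> i} t * W0 (\<xi> t))"
        using W0b by (intro bi[of _ "\<bar>K\<bar>"]) auto
      then show "integrable lborel (\<lambda>t. indicator {a \<bullet> i<..<b \<bullet> i} t * w (\<xi> t))"
        by (rule Bochner_Integration.integrable_cong[THEN iffD1, rotated -1]) (auto simp: W0_def \<xi>b indicator_def)
      have "integrable lborel (\<lambda>t. indicator {a \<bullet> i<..<b \<bullet> i} t * G0 (\<xi> t) / (b \<bullet> i - a \<bullet> i))"
        using G0b by (intro integrable_divide bi[of _ "\<Lambda> * \<bar>K\<bar>"]) auto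
      then show "integrable lborel (\<lambda>t. indicator {a \<bullet> i<..<b \<bullet> i} t * (G0 (\<xi> t) / (b \<bullet> i - a \<bullet> i)))" by simp
    qed
    also have "\<dots> \<le> (\<integral>t. indicator {a \<bullet> i<..<b \<bullet> i} t * (f (\<xi> t) / (b \<bullet> i - a \<bullet> i)) \<partial>lborel)"
    proof (rule integral_mono_AE')
      have f0: "0 \<le> f y" for y using fge[of y] W0b[of y] G0b[of y] by linarith
      have "integrable lborel (\<lambda>t. indicator {a \<bullet> i<..<b \<bullet> i} t * f (\<xi> t) / (b \<bullet> i - a \<bullet> i))"
        using f0 fb by (intro integrable_divide bi[of _ B]) auto
      then show "integrable lborel (\<lambda>t. indicator {a \<bullet> i<..<b \<bullet> i} t * (f (\<xi> t) / (b \<bullet> i - a \<bullet> i)))"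
        by simp
      show "AE t in lborel. indicator {a \<bullet> i<..<b \<bullet> i} t * (w (\<xi> t) / (b \<bullet> i - a \<bullet> i) + G0 (\<xi> t) / (b \<bullet> i - a \<bullet> i))
         \<le> indicator {a \<bullet> i<..<b \<bullet> i} t * (f (\<xi> t) / (b \<bullet> i - a \<bullet> i))"
      proof (rule AE_I2)
        fix t
        show "indicator {a \<bullet> i<..<b \<bullet> i} t * (w (\<xi> t) / (b \<bullet> i - a \<bullet> i) + G0 (\<xi> t) / (b \<bullet> i - a \<bullet> i))
         \<le> indicator {a \<bullet> i<..<b \<bullet> i} t * (f (\<xi> t) / (b \<bullet> i - a \<bullet> i))"
          using fge[of "\<xi> t"] Li
          by (cases "t \<in> {a \<bullet> i<..<b \<bullet> i}")
             (simp_all add: W0_def \<xi>b add_divide_distrib[symmetric] divide_right_mono)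
      qed
      show "AE t in lborel. 0 \<le> indicator {a \<bullet> i<..<b \<bullet> i} t * (f (\<xi> t) / (b \<bullet> i - a \<bullet> i))"
        using f0 Li by (auto simp: indicator_def)
    qed
    also have "\<dots> = (\<integral>t. f (\<xi> t) \<partial>M i)"
      unfolding M_def using i by (subst integral_unif[OF lu]) (auto simp: l_def u_def)
    finally show ?thesis unfolding \<xi> using True by (simp add: W0_def x\<xi>)
  qed
  define V where "V = (\<Prod>i\<in>Basis. b \<bullet> i - a \<bullet> i)"
  define X where "X = (\<integral>x. W0 (coords x) powr r \<partial>PiM Basis M)"
  define Y where "Y = (\<integral>x. W0 (coords x) + G0 (coords x) \<partial>PiM Basis M)"
  have P1: "emeasure (PiM Basis M) (space (PiM Basis M)) = 1"
    by (rule PS.emeasure_PiM_space_1[OF finite_Basis one])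
  have Y0: "0 \<le> Y" unfolding Y_def using W0b G0b by (intro Bochner_Integration.integral_nonneg) auto
  have "X \<le> (\<delta> + Y) powr r" if \<delta>: "0 < \<delta>" for \<delta>
  proof -
    \<comment> \<open>Adding \<delta> keeps the function away from zero, as
      \<open>grid_lines\<close> demands; \<open>le_powr_limit\<close> removes \<delta>
      afterwards.\<close>
    define f where "f y = \<delta> + (W0 y + G0 y)" for y
    define B where "B = \<delta> + (\<bar>K\<bar> + \<Lambda> * \<bar>K\<bar>)"
    have fm[measurable]: "f \<in> borel_measurable borel" unfolding f_def[abs_def] by measurable
    have fb: "\<delta> \<le> f y" "f y \<le> B" "W0 y + G0 y \<le> f y" for y
      using W0b[of y] G0b[of y] \<delta> by (auto simp: f_def B_def)
    have fcm: "(\<lambda>x. f (coords x)) \<in> borel_measurable (PiM Basis M)"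
      by (rule measurable_compose[OF mc fm])
    have i1: "integrable (PiM Basis M) (\<lambda>x. W0 (coords x) + G0 (coords x))"
      by (rule integrable_bounded_prob[OF P1, of _ "\<bar>K\<bar> + \<Lambda> * \<bar>K\<bar>"])
        (use W0b G0b in \<open>auto intro!: borel_measurable_add measurable_compose[OF mc] add_mono simp: abs_of_nonneg\<close>)
    have Am: "(\<lambda>x. \<integral>t. f (coords (x(i := t))) \<partial>M i) \<in> borel_measurable (PiM Basis M)" if "i \<in> Basis" for i
      by (rule integral_product_fun_upd_measurable[OF PS.product_sigma_finite_axioms fcm that])
    have Ab: "\<delta> \<le> (\<integral>t. f (coords (x(i := t))) \<partial>M i)" "(\<integral>t. f (coords (x(i := t))) \<partial>M i) \<le> B"
      if i: "i \<in> Basis" for x i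
    proof -
      have "(\<lambda>t. coords (x(i := t))) \<in> borel_measurable (M i)"
        unfolding coords_upd[OF i] M_def by (simp add: measurable_cong_sets[OF unif_simps(1) refl])
      then have "(\<lambda>t. f (coords (x(i := t)))) \<in> borel_measurable (M i)"
        by (rule measurable_compose[OF _ fm])
      from integral_between_prob[OF one this, of \<delta> B] fb
      show "\<delta> \<le> (\<integral>t. f (coords (x(i := t))) \<partial>M i)" "(\<integral>t. f (coords (x(i := t))) \<partial>M i) \<le> B" by auto
    qed
    have "X \<le> (\<integral>x. (\<Prod>i\<in>Basis. (\<integral>t. f (coords (x(i := t))) \<partial>M i) powr p) \<partial>PiM Basis M)"
      unfolding X_def
    proof (rule integral_mono_AE')
      show "integrable (PiM Basis M) (\<lambda>x. \<Prod>i\<in>Basis. (\<integral>t. f (coords (x(i := t))) \<partial>M i) powr p)"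
      proof (rule integrable_bounded_prob[OF P1])
        show "(\<lambda>x. \<Prod>i\<in>Basis. (\<integral>t. f (coords (x(i := t))) \<partial>M i) powr p) \<in> borel_measurable (PiM Basis M)"
          by (intro borel_measurable_prod powr_real_measurable borel_measurable_const Am)
        show "\<bar>\<Prod>i\<in>Basis. (\<integral>t. f (coords (x(i := t))) \<partial>M i) powr p\<bar> \<le> (\<Prod>i\<in>(Basis::'a set). B powr p)" for x
        proof -
          have "0 \<le> (\<integral>t. f (coords (x(i := t))) \<partial>M i) \<and> (\<integral>t. f (coords (x(i := t))) \<partial>M i) \<le> B" if "i \<in> Basis" for i
            using Ab[OF that] \<delta> by (meson less_imp_le order_trans)
          from prod_powr_bound[of Basis "\<lambda>i. \<integral>t. f (coords (x(i := t))) \<partial>M i", OF this r(3)]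
          show ?thesis by (simp del: fun_upd_apply)
        qed
      qed
      have "W0 (coords x) powr r \<le> (\<Prod>i\<in>Basis. (\<integral>t. f (coords (x(i := t))) \<partial>M i) powr p)" for x
      proof -
        have "W0 (coords x) powr r = (\<Prod>i\<in>(Basis::'a set). W0 (coords x) powr p)"
          using W0b(1)[of "coords x"] by (cases "W0 (coords x) = 0")
            (simp_all add: powr_realpow[symmetric] powr_powr r_def p_def mult.commute)
        also have "\<dots> \<le> (\<Prod>i\<in>Basis. (\<integral>t. f (coords (x(i := t))) \<partial>M i) powr p)"
        proof (rule prod_mono, intro conjI)
          fix i :: 'a assume i: "i \<in> Basis"
          show "W0 (coords x) powr p \<le> (\<integral>t. f (coords (x(i := t))) \<partial>M i) powr p"
            by (rule powr_mono2[OF r(3) W0b(1) line[OF i fm fb(3) fb(2)]])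
        qed simp
        finally show ?thesis .
      qed
      then show "AE x in PiM Basis M. W0 (coords x) powr r \<le> (\<Prod>i\<in>Basis. (\<integral>t. f (coords (x(i := t))) \<partial>M i) powr p)"
        by simp
      show "AE x in PiM Basis M. 0 \<le> (\<Prod>i\<in>Basis. (\<integral>t. f (coords (x(i := t))) \<partial>M i) powr p)"
        by (auto intro!: prod_nonneg)
    qed
    also have "\<dots> = (\<integral>x. f (coords x) powr (1 - (real DIM('a) - 1) * p) * (\<Prod>i\<in>Basis. (\<integral>t. f (coords (x(i := t))) \<partial>M i) powr p) \<partial>PiM Basis M)"
    proof (rule Bochner_Integration.integral_cong[OF refl])
      fix x
      have "f (coords x) \<noteq> 0" using fb(1)[of "coords x"] \<delta> by linarith
      then show "(\<Prod>i\<in>Basis. (\<integral>t. f (coords (x(i := t))) \<partial>M i) powr p)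
        = f (coords x) powr (1 - (real DIM('a) - 1) * p) * (\<Prod>i\<in>Basis. (\<integral>t. f (coords (x(i := t))) \<partial>M i) powr p)"
        using r(4) by (simp add: D1_def)
    qed
    also have "\<dots> \<le> (\<integral>x. f (coords x) \<partial>PiM Basis M) powr (1 + p)"
      by (rule grid_lines[OF PS.product_sigma_finite_axioms one finite_Basis \<delta> r(3) _ fcm, where B=B])
        (use fb r in \<open>auto simp: D1_def\<close>)
    also have "(\<integral>x. f (coords x) \<partial>PiM Basis M) = \<delta> + Y"
    proof -
      interpret finite_measure "PiM Basis M" by standard (simp add: P1)
      have "measure (PiM Basis M) (space (PiM Basis M)) = 1" using P1 by (simp add: measure_def)
      then show ?thesis
        unfolding f_def Y_def using i1 by (subst Bochner_Integration.integral_add) auto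
    qed
    finally show ?thesis by (simp add: r(1))
  qed
  then have XY: "X \<le> Y powr r" by (rule le_powr_limit[OF _ r(2) Y0])
  have I: "(\<integral>x. \<phi> (coords x) \<partial>PiM Basis M) = (\<integral>x. indicator (box a b) x * \<phi> x \<partial>lborel) / V"
    if "\<phi> \<in> borel_measurable borel" for \<phi> :: "'a \<Rightarrow> real"
    unfolding M_def V_def
      by (rule integral_PiM_unif_box[OF ab lu _ _ that]) (auto simp: l_def u_def)
  have "X = (\<integral>x. indicator (box a b) x * W0 x powr r \<partial>lborel) / V"
    unfolding X_def using I[of "\<lambda>x. W0 x powr r"] by simp
  also have "(\<lambda>x. indicator (box a b) x * W0 x powr r) = (\<lambda>x. indicator (box a b) x * w x powr r)"
    by (auto simp: W0_def indicator_def)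
  finally have X: "X = (\<integral>x. indicator (box a b) x * w x powr r \<partial>lborel) / V" .
  have "Y = (\<integral>x. indicator (box a b) x * (W0 x + G0 x) \<partial>lborel) / V"
    unfolding Y_def using I[of "\<lambda>x. W0 x + G0 x"] by simp
  also have "(\<lambda>x. indicator (box a b) x * (W0 x + G0 x)) = (\<lambda>x. indicator (box a b) x * (w x + \<Lambda> * g x))"
    by (auto simp: W0_def G0_def indicator_def)
  finally show ?thesis using XY unfolding X by (simp add: r_def D1_def V_def \<Lambda>_def)
qed

text \<open>The hypotheses combine to X <= V^(1 - r) (X B)^(r / 2). Since r < 2, the factor X^(r /
  2) can be absorbed on the left, and raising to the power m = 1 / (1 - r / 2) isolates X.\<close>

lemma Sobolev_box_exponents:
  fixes X Z V r m B :: real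
  assumes "0 \<le> X" "0 < V" "0 < r" "r < 2" "0 \<le> B" "m * (1 - r / 2) = 1"
    and le: "X / V \<le> (Z / V) powr r" and Z: "0 \<le> Z" "Z \<le> sqrt X * sqrt B"
  shows "X \<le> (V powr (1 - r)) powr m * B powr (r * m / 2)"
proof (cases "X = 0")
  case True
  then show ?thesis by simp
next
  case False
  then have X: "0 < X" using assms by simp
  have m: "0 < m"
    using assms by (smt (verit, best) divide_strict_left_mono mult_less_0_iff mult_nonpos_nonneg field_sum_of_halves)
  have "X = V * (X / V)" using assms by simp
  also have "\<dots> \<le> V * (Z / V) powr r" using le assms by (intro mult_left_mono) auto
  also have "\<dots> \<le> V * ((sqrt X * sqrt B) / V) powr r"
    using Z assms by (intro mult_left_mono powr_mono2 divide_right_mono) auto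
  also have "\<dots> = V powr (1 - r) * (X powr (r / 2) * B powr (r / 2))"
    using assms X by (simp add: powr_divide powr_mult powr_half_sqrt[symmetric] powr_powr powr_diff)
  finally have "X powr (- r / 2) * X \<le> X powr (- r / 2) * (V powr (1 - r) * (X powr (r / 2) * B powr (r / 2)))"
    by (rule mult_left_mono) simp
  also have "\<dots> = (X powr (- r / 2) * X powr (r / 2)) * (V powr (1 - r) * B powr (r / 2))" by simp
  also have "X powr (- r / 2) * X powr (r / 2) = 1" using X by (simp add: powr_add[symmetric])
  also have "X powr (- r / 2) * X = X powr (1 - r / 2)"
    using X powr_add[of X "- r / 2" 1] by simp
  finally have "(X powr (1 - r / 2)) powr m \<le> (V powr (1 - r) * B powr (r / 2)) powr m"
    using m by (intro powr_mono2) auto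
  then show ?thesis using assms X by (simp add: powr_powr powr_mult mult.commute)
qed

text \<open>Gagliardo's inequality is applied to |w|^s, whose gradient is s |w|^(s - 1) times that
  of w up to sign, and Cauchy-Schwarz splits off the factor |w|^(s - 1). The bound \<open>K\<close>
  guarantees integrability; the constant \<open>C\<close> is chosen before it.\<close>

lemma Sobolev_box:
  fixes a b :: "'a::euclidean_space"
  assumes D: "DIM('a) \<ge> 3" and ab: "\<And>i. i \<in> Basis \<Longrightarrow> a \<bullet> i < b \<bullet> i"
  obtains C where "0 < C"
    "\<And>(w :: 'a \<Rightarrow> real) W K. (\<And>x. x \<in> box a b \<Longrightarrow> (w has_derivative W x) (at x)) \<Longrightarrow>
      (\<And>v. continuous_on (box a b) (\<lambda>x. W x v)) \<Longrightarrow>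
      (\<And>x. x \<in> box a b \<Longrightarrow> \<bar>w x\<bar> \<le> K) \<Longrightarrow>
      (\<And>x i. x \<in> box a b \<Longrightarrow> i \<in> Basis \<Longrightarrow> \<bar>W x i\<bar> \<le> K) \<Longrightarrow>
      (\<integral>x. indicator (box a b) x * \<bar>w x\<bar> powr (2 * real DIM('a) / (real DIM('a) - 2)) \<partial>lborel)
      \<le> C * (\<integral>x. indicator (box a b) x * ((w x)\<^sup>2 + (\<Sum>i\<in>Basis. (W x i)\<^sup>2)) \<partial>lborel) powr (real DIM('a) / (real DIM('a) - 2))"
proof -
  define d where "d = real DIM('a)"
  have d: "3 \<le> d" using D by (simp add: d_def)
  \<comment> \<open>The exponent for which \<open>s * r\<close> and \<open>2 * (s - 1)\<close> both
    equal \<open>q\<close>: the left-hand side and the square of the split-off factor are then the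
    same integral, which \<open>Sobolev_box_exponents\<close> can absorb.\<close>
  define s where "s = 2 * (d - 1) / (d - 2)"
  define q where "q = 2 * d / (d - 2)"
  define r where "r = d / (d - 1)"
  have ex: "s * r = q" "2 * (s - 1) = q" "2 < s" "0 < r" "r < 2" "r * s / 2 = d / (d - 2)" "s * (1 - r / 2) = 1"
  proof -
    have nz: "d - 1 \<noteq> 0" "d - 2 \<noteq> 0" using d by auto
    show sr: "s * r = q" 
    proof -
      have "2 * (d - 1) / (d - 2) * (d / (d - 1)) = (2 * d * (d - 1)) / ((d - 2) * (d - 1))"
        by (simp only: times_divide_times_eq mult_ac)
      then show ?thesis
        unfolding s_def r_def q_def using nz(1) by (simp only: mult_divide_mult_cancel_right not_False_eq_True)
    qed
    show "2 * (s - 1) = q" "2 < s" "0 < r" "r < 2"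
      unfolding s_def r_def q_def using d by (simp_all add: field_simps)
    have q2: "q / 2 = d / (d - 2)" unfolding q_def using nz by (simp add: divide_simps)
    show "r * s / 2 = d / (d - 2)" unfolding mult.commute[of r s] sr q2 ..
    have "s * (1 - r / 2) = s - (s * r) / 2" by (simp add: algebra_simps)
    also have "\<dots> = (2 * (d - 1) - d) / (d - 2)"
      unfolding sr q2 unfolding s_def by (rule diff_divide_distrib[symmetric])
    also have "\<dots> = 1" using nz by simp
    finally show "s * (1 - r / 2) = 1" .
  qed
  define V where "V = (\<Prod>i\<in>Basis. b \<bullet> i - a \<bullet> i)"
  have V: "0 < V" unfolding V_def using ab by (intro prod_pos) auto
  define \<Lambda> where "\<Lambda> = (\<Sum>i\<in>Basis. b \<bullet> i - a \<bullet> i)"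
  have \<Lambda>0: "0 \<le> \<Lambda>" unfolding \<Lambda>_def using ab by (intro sum_nonneg) (auto simp: less_imp_le)
  \<comment> \<open>From (a + b)^2 <= 2 a^2 + 2 b^2 and the bound of the square of a sum of d terms
    by d times the sum of their squares.\<close>
  define C1 where "C1 = 2 + 2 * (\<Lambda> * s)\<^sup>2 * d"
  have C1: "0 < C1" unfolding C1_def using d by (intro add_pos_nonneg) auto
  define C where "C = (V powr (1 - r)) powr s * C1 powr (d / (d - 2))"
  show ?thesis
  proof
    show "0 < C" unfolding C_def using V C1 by simp
    fix w :: "'a \<Rightarrow> real" and W K
    assume dw: "\<And>x. x \<in> box a b \<Longrightarrow> (w has_derivative W x) (at x)"
      and c: "\<And>v. continuous_on (box a b) (\<lambda>x. W x v)"
      and wb: "\<And>x. x \<in> box a b \<Longrightarrow> \<bar>w x\<bar> \<le> K"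
      and Wb: "\<And>x i. x \<in> box a b \<Longrightarrow> i \<in> Basis \<Longrightarrow> \<bar>W x i\<bar> \<le> K"
    have wc: "continuous_on (box a b) w"
      using dw by (intro continuous_at_imp_continuous_on ballI has_derivative_continuous) auto
    have Sc: "continuous_on (box a b) (\<lambda>x. \<Sum>i\<in>Basis. \<bar>W x i\<bar>)"
      by (intro continuous_intros c)
    have pc: "continuous_on (box a b) (\<lambda>x. \<bar>w x\<bar> powr e)" if "0 < e" for e
      using that by (intro continuous_on_powr' continuous_intros wc) auto
    define w' where "w' x = \<bar>w x\<bar> powr s" for x
    define W' where "W' x v = s * (\<bar>w x\<bar> powr (s - 2) * w x) * W x v" for x v
    define g where "g x = s * \<bar>w x\<bar> powr (s - 1) * (\<Sum>i\<in>Basis. \<bar>W x i\<bar>)" for x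
    define K' where "K' = \<bar>K\<bar> powr s + s * \<bar>K\<bar> powr (s - 1) * (d * \<bar>K\<bar>)"
    have Sb: "(\<Sum>i\<in>Basis. \<bar>W x i\<bar>) \<le> d * \<bar>K\<bar>" if "x \<in> box a b" for x
      using sum_bounded_above[of Basis "\<lambda>i. \<bar>W x i\<bar>" "\<bar>K\<bar>"] Wb[OF that] by (fastforce simp: d_def)
    have wb': "\<bar>w x\<bar> \<le> \<bar>K\<bar>" if "x \<in> box a b" for x using wb[OF that] by linarith
    have gb: "0 \<le> g x" "g x \<le> s * \<bar>K\<bar> powr (s - 1) * (d * \<bar>K\<bar>)" if "x \<in> box a b" for x
      unfolding g_def using Sb[OF that] wb'[OF that] ex d
      by (intro mult_nonneg_nonneg mult_mono powr_mono2 sum_nonneg; simp)+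
    have "(\<integral>x. indicator (box a b) x * w' x powr r \<partial>lborel) / V
       \<le> ((\<integral>x. indicator (box a b) x * (w' x + \<Lambda> * g x) \<partial>lborel) / V) powr r"
      unfolding V_def \<Lambda>_def r_def d_def
    proof (rule Gagliardo_box[OF _ ab, where K=K'])
      show "2 \<le> DIM('a)" using D by simp
      fix x assume x: "x \<in> box a b"
      have "((\<lambda>x. \<bar>w x\<bar> powr s) has_derivative (\<lambda>h. W x h * (s * \<bar>w x\<bar> powr (s - 1) * sgn (w x)))) (at x)"
        using has_derivative_compose[OF dw[OF x] has_real_derivative_abs_powr[of s "w x", unfolded has_field_derivative_def]] ex
        by (simp add: mult.commute)
      moreover have sg: "\<bar>w x\<bar> powr (s - 1) * sgn (w x) = \<bar>w x\<bar> powr (s - 2) * w x"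
      proof (cases "w x = 0")
        case False
        have "\<bar>w x\<bar> powr (s - 1) = \<bar>w x\<bar> powr (s - 2) * \<bar>w x\<bar>"
          using False powr_add[of "\<bar>w x\<bar>" "s - 2" 1] by simp
        then show ?thesis by (simp add: mult.assoc abs_mult_sgn)
      qed simp
      ultimately show "(w' has_derivative W' x) (at x)"
        unfolding w'_def[abs_def] W'_def[abs_def] sg[symmetric] by (simp only: mult_ac)
      show "0 \<le> w' x \<and> w' x \<le> K'"
        unfolding w'_def K'_def using wb'[OF x] ex d
        by (auto intro!: add_increasing2 powr_mono2 mult_nonneg_nonneg)
      show "g x \<le> K'" using gb[OF x] unfolding K'_def by (simp add: add_increasing)
      fix i :: 'a assume i: "i \<in> Basis"
      have "\<bar>W' x i\<bar> = s * (\<bar>w x\<bar> powr (s - 2) * \<bar>w x\<bar>) * \<bar>W x i\<bar>"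
        using ex by (simp add: W'_def abs_mult)
      also have "\<bar>w x\<bar> powr (s - 2) * \<bar>w x\<bar> = \<bar>w x\<bar> powr (s - 1)"
        using powr_add[of "\<bar>w x\<bar>" "s - 2" 1] by (cases "w x = 0") simp_all
      also have "s * \<bar>w x\<bar> powr (s - 1) * \<bar>W x i\<bar> \<le> g x"
        unfolding g_def using i ex by (intro mult_left_mono member_le_sum) auto
      finally show "\<bar>W' x i\<bar> \<le> g x" .
    next
      fix v
      show "continuous_on (box a b) (\<lambda>x. W' x v)"
        unfolding W'_def using ex by (intro continuous_intros c pc wc) auto
    next
      have "continuous_on (box a b) g"
        unfolding g_def[abs_def] using ex by (intro continuous_intros pc Sc) auto
      then show "(\<lambda>x. indicator (box a b) x * g x) \<in> borel_measurable borel"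
        using borel_measurable_continuous_on_indicator[of "box a b" g] by simp
    qed
    moreover have "w' x powr r = \<bar>w x\<bar> powr q" for x by (simp add: w'_def powr_powr ex)
    ultimately have main: "(\<integral>x. indicator (box a b) x * \<bar>w x\<bar> powr q \<partial>lborel) / V
       \<le> ((\<integral>x. indicator (box a b) x * (w' x + \<Lambda> * g x) \<partial>lborel) / V) powr r" (is "?X / V \<le> (?Z / V) powr r")
      by simp
    define B where "B = (\<integral>x. indicator (box a b) x * ((w x)\<^sup>2 + (\<Sum>i\<in>Basis. (W x i)\<^sup>2)) \<partial>lborel)"
    have B0: "0 \<le> B"
      unfolding B_def by (intro Bochner_Integration.integral_nonneg) (auto intro!: mult_nonneg_nonneg add_nonneg_nonneg sum_nonneg)
    define k where "k x = \<bar>w x\<bar> + \<Lambda> * s * (\<Sum>i\<in>Basis. \<bar>W x i\<bar>)" for x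
    define F where "F x = indicator (box a b) x * \<bar>w x\<bar> powr (s - 1)" for x
    define H where "H x = indicator (box a b) x * k x" for x
    have kc: "continuous_on (box a b) k" unfolding k_def[abs_def] by (intro continuous_intros Sc wc)
    have bd: "emeasure lborel (box a b) < \<infinity>"
      using emeasure_lborel_box_finite by (simp add: top.not_eq_extremum)
    have intb: "integrable lborel (\<lambda>x. indicator (box a b) x * h x)"
      if "continuous_on (box a b) h" "\<And>x. x \<in> box a b \<Longrightarrow> \<bar>h x\<bar> \<le> B" for h :: "'a \<Rightarrow> real" and B
    proof -
      have "(\<lambda>x. indicator (box a b) x *\<^sub>R h x) \<in> borel_measurable lborel"
        using borel_measurable_continuous_on_indicator[OF _ that(1)] by simp
      then have "integrable lborel (\<lambda>x. indicator (box a b) x *\<^sub>R (indicator (box a b) x *\<^sub>R h x))"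
        using that(2) bd
          by (intro integrableI_bounded_set_indicator[of _ _ _ "\<bar>B\<bar>"]) (fastforce simp: indicator_def)+
      moreover have "(\<lambda>x. indicator (box a b) x *\<^sub>R (indicator (box a b) x *\<^sub>R h x)) = (\<lambda>x. indicator (box a b) x * h x)"
        by (auto simp: indicator_def)
      ultimately show ?thesis by simp
    qed
    have FH[measurable]: "F \<in> borel_measurable lborel" "H \<in> borel_measurable lborel"
      unfolding F_def[abs_def] H_def[abs_def]
      using borel_measurable_continuous_on_indicator[OF _ kc] borel_measurable_continuous_on_indicator[OF _ pc[of "s - 1"]] ex by auto
    have k0: "0 \<le> k x" for x
      unfolding k_def using \<Lambda>0 ex by (intro add_nonneg_nonneg mult_nonneg_nonneg sum_nonneg) auto
    have kb: "k x \<le> \<bar>K\<bar> + \<Lambda> * s * (d * \<bar>K\<bar>)" if "x \<in> box a b" for x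
      unfolding k_def using Sb[OF that] wb'[OF that] \<Lambda>0 ex by (intro add_mono mult_left_mono) auto
    have F2: "(\<lambda>x. (F x)\<^sup>2) = (\<lambda>x. indicator (box a b) x * \<bar>w x\<bar> powr q)"
    proof
      fix x
      have "(\<bar>w x\<bar> powr (s - 1))\<^sup>2 = \<bar>w x\<bar> powr (2 * (s - 1))"
        by (cases "w x = 0") (simp_all add: powr_realpow[symmetric] powr_powr mult.commute)
      then show "(F x)\<^sup>2 = indicator (box a b) x * \<bar>w x\<bar> powr q"
        using ex by (simp add: F_def indicator_def)
    qed
    have H2: "(\<lambda>x. (H x)\<^sup>2) = (\<lambda>x. indicator (box a b) x * (k x)\<^sup>2)"
      by (auto simp: H_def indicator_def)
    have "q > 0" using ex(2,3) by simp
    have iF: "integrable lborel (\<lambda>x. (F x)\<^sup>2)"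
      unfolding F2 using wb' \<open>q > 0\<close> by (intro intb[of _ "\<bar>K\<bar> powr q"] pc) (auto intro: powr_mono2)
    have iH: "integrable lborel (\<lambda>x. (H x)\<^sup>2)"
      unfolding H2
        using k0 kb by (intro intb[of _ "(\<bar>K\<bar> + \<Lambda> * s * (d * \<bar>K\<bar>))\<^sup>2"] continuous_intros kc) (auto intro: power_mono)
    have "?Z = (\<integral>x. \<bar>F x * H x\<bar> \<partial>lborel)"
    proof (rule Bochner_Integration.integral_cong[OF refl])
      fix x
      have "w' x = \<bar>w x\<bar> powr (s - 1) * \<bar>w x\<bar>"
        unfolding w'_def using powr_add[of "\<bar>w x\<bar>" "s - 1" 1] by (cases "w x = 0") simp_all
      then show "indicator (box a b) x * (w' x + \<Lambda> * g x) = \<bar>F x * H x\<bar>"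
        using k0[of x]
          by (simp add: F_def H_def g_def abs_mult indicator_def) (simp add: k_def algebra_simps)
    qed
    then have Z: "?Z \<le> sqrt ?X * sqrt (\<integral>x. (H x)\<^sup>2 \<partial>lborel)" "0 \<le> ?Z"
      using integral_Cauchy_Schwarz_abs[OF FH iF iH] by (simp_all add: F2)
    have B1: "integrable lborel (\<lambda>x. indicator (box a b) x * ((w x)\<^sup>2 + (\<Sum>i\<in>Basis. (W x i)\<^sup>2)))"
    proof (rule intb)
      show "continuous_on (box a b) (\<lambda>x. (w x)\<^sup>2 + (\<Sum>i\<in>Basis. (W x i)\<^sup>2))"
        by (intro continuous_intros wc c)
      fix x assume x: "x \<in> box a b"
      have "(\<Sum>i\<in>Basis. (W x i)\<^sup>2) \<le> (\<Sum>i\<in>(Basis::'a set). K\<^sup>2)"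
        using Wb[OF x] by (intro sum_mono) (metis abs_ge_self abs_le_square_iff order_trans)
      moreover have "(w x)\<^sup>2 \<le> K\<^sup>2"
        using wb[OF x] by (metis abs_ge_self abs_le_square_iff order_trans)
      moreover have "0 \<le> (\<Sum>i\<in>Basis. (W x i)\<^sup>2)" by (intro sum_nonneg) auto
      ultimately show "\<bar>(w x)\<^sup>2 + (\<Sum>i\<in>Basis. (W x i)\<^sup>2)\<bar> \<le> K\<^sup>2 + (\<Sum>i\<in>(Basis::'a set). K\<^sup>2)" by simp
    qed
    have "(\<integral>x. (H x)\<^sup>2 \<partial>lborel) \<le> (\<integral>x. C1 * (indicator (box a b) x * ((w x)\<^sup>2 + (\<Sum>i\<in>Basis. (W x i)\<^sup>2))) \<partial>lborel)"
    proof (rule integral_mono[OF iH])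
      show "integrable lborel (\<lambda>x. C1 * (indicator (box a b) x * ((w x)\<^sup>2 + (\<Sum>i\<in>Basis. (W x i)\<^sup>2))))"
        using B1 by simp
      fix x
      have "(\<Sum>i\<in>Basis. \<bar>W x i\<bar>)\<^sup>2 \<le> d * (\<Sum>i\<in>Basis. (W x i)\<^sup>2)"
        using Cauchy_Schwarz_ineq_sum[of "\<lambda>_. 1" "\<lambda>i. \<bar>W x i\<bar>" Basis] by (simp add: d_def)
      then have "(\<Lambda> * s)\<^sup>2 * (\<Sum>i\<in>Basis. \<bar>W x i\<bar>)\<^sup>2 \<le> (\<Lambda> * s)\<^sup>2 * (d * (\<Sum>i\<in>Basis. (W x i)\<^sup>2))"
        by (rule mult_left_mono) simp
      moreover have "(k x)\<^sup>2 \<le> 2 * (w x)\<^sup>2 + 2 * ((\<Lambda> * s)\<^sup>2 * (\<Sum>i\<in>Basis. \<bar>W x i\<bar>)\<^sup>2)"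
        unfolding k_def using sum_squares_bound[of "\<bar>w x\<bar>" "\<Lambda> * s * (\<Sum>i\<in>Basis. \<bar>W x i\<bar>)"]
        by (simp add: power2_sum power_mult_distrib)
      moreover have "0 \<le> (\<Lambda> * s)\<^sup>2 * d * (w x)\<^sup>2" "0 \<le> (\<Sum>i\<in>Basis. (W x i)\<^sup>2)"
        using d by (auto intro: sum_nonneg)
      ultimately have "(k x)\<^sup>2 \<le> C1 * ((w x)\<^sup>2 + (\<Sum>i\<in>Basis. (W x i)\<^sup>2))"
        unfolding C1_def by (simp add: algebra_simps)
      then show "(H x)\<^sup>2 \<le> C1 * (indicator (box a b) x * ((w x)\<^sup>2 + (\<Sum>i\<in>Basis. (W x i)\<^sup>2)))"
        by (simp add: H_def indicator_def)
    qed
    also have "\<dots> = C1 * B" unfolding B_def by simp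
    finally have "sqrt ?X * sqrt (\<integral>x. (H x)\<^sup>2 \<partial>lborel) \<le> sqrt ?X * sqrt (C1 * B)"
      by (intro mult_left_mono) (auto intro!: Bochner_Integration.integral_nonneg mult_nonneg_nonneg)
    with Z(1) have Z': "?Z \<le> sqrt ?X * sqrt (C1 * B)" by simp
    have "?X \<le> (V powr (1 - r)) powr s * (C1 * B) powr (r * s / 2)"
      by (rule Sobolev_box_exponents[OF _ V ex(4,5) _ ex(7) main Z(2) Z'])
        (use C1 B0 in \<open>auto intro!: Bochner_Integration.integral_nonneg mult_nonneg_nonneg\<close>)
    also have "\<dots> = C * B powr (d / (d - 2))"
      using C1 B0 by (simp add: ex C_def powr_mult)
    finally show "(\<integral>x. indicator (box a b) x * \<bar>w x\<bar> powr (2 * real DIM('a) / (real DIM('a) - 2)) \<partial>lborel)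
      \<le> C * (\<integral>x. indicator (box a b) x * ((w x)\<^sup>2 + (\<Sum>i\<in>Basis. (W x i)\<^sup>2)) \<partial>lborel) powr (real DIM('a) / (real DIM('a) - 2))"
      by (simp add: q_def d_def B_def)
  qed
qed

section \<open>Smoothness on subsets\<close>

lemma smooth_on_local:
  assumes "smooth_on f S" "x \<in> S"
  obtains W g where "open W" "x \<in> W" "\<And>y. y \<in> W \<Longrightarrow> g differentiable (at y)"
    "\<And>v. continuous_on W (\<lambda>y. frechet_derivative g (at y) v)" "continuous_on W g"
    "\<And>y. y \<in> W \<inter> S \<Longrightarrow> g y = f y"
proof -
  from assms obtain W g where W: "open W" "x \<in> W" "\<And>k. Ck_on k g W" "\<And>y. y \<in> W \<inter> S \<Longrightarrow> g y = f y"
    unfolding smooth_on_def by meson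
  from W(3)[of 0] W(3)[of "Suc 0"] show ?thesis by (intro that[OF W(1,2) _ _ _ W(4)]) auto
qed

lemma smooth_on_imp_continuous_on:
  assumes "smooth_on f S" shows "continuous_on S f"
  unfolding continuous_on_eq_continuous_within
proof
  fix x assume x: "x \<in> S"
  from smooth_on_local[OF assms this] obtain W g
    where W: "open W" "x \<in> W" "continuous_on W g" "\<And>y. y \<in> W \<inter> S \<Longrightarrow> g y = f y" by metis
  have "continuous (at x within S) g"
    using W(1-3)
      by (simp add: continuous_on_eq_continuous_at continuous_at_imp_continuous_at_within)
  moreover obtain e where "0 < e" "ball x e \<subseteq> W" using W(1,2) open_contains_ball by blast
  ultimately show "continuous (at x within S) f"
    by (intro continuous_transform_within[of x S g e f] x)
      (use W(4) \<open>ball x e \<subseteq> W\<close> in \<open>auto simp: dist_commute subset_iff\<close>)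
qed

text \<open>On an open set \<open>frechet_derivative\<close> is unaffected by changes of the
  function elsewhere. The derivative of a difference is identified only on \<open>W\<close>, and the
  induction for \<open>Ck_on_diff\<close> needs to exchange it there.\<close>

lemma Ck_on_cong:
  assumes "open W" "\<And>x. x \<in> W \<Longrightarrow> f x = g x" "Ck_on k f W"
  shows "Ck_on k g W"
  using assms(2,3)
proof (induction k arbitrary: f g)
  case 0
  then show ?case by (auto cong: continuous_on_cong)
next
  case (Suc k)
  have d: "(g has_derivative frechet_derivative f (at x)) (at x)" if "x \<in> W" for x
    using Suc.prems that assms(1)
    by (intro has_derivative_transform_within_open[of f _ x UNIV W g]) (auto simp: frechet_derivative_works)
  then have e: "frechet_derivative g (at x) = frechet_derivative f (at x)" if "x \<in> W" for x
    using that frechet_derivative_at by metis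
  have "Ck_on k (\<lambda>x. frechet_derivative g (at x) v) W" for v
    by (rule Suc.IH[of "\<lambda>x. frechet_derivative f (at x) v"]) (use Suc.prems e in auto)
  then show ?case using d by (auto simp: differentiable_def)
qed

lemma Ck_on_subset: "W' \<subseteq> W \<Longrightarrow> Ck_on k f W \<Longrightarrow> Ck_on k f W'"
  by (induction k arbitrary: f) (auto intro: continuous_on_subset)

lemma Ck_on_diff:
  assumes "open W" "Ck_on k f W" "Ck_on k g W"
  shows "Ck_on k (\<lambda>x. f x - g x) W"
  using assms(2,3)
proof (induction k arbitrary: f g)
  case 0
  then show ?case by (auto intro: continuous_on_diff)
next
  case (Suc k)
  have d: "((\<lambda>x. f x - g x) has_derivative (\<lambda>v. frechet_derivative f (at x) v - frechet_derivative g (at x) v)) (at x)"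
    if "x \<in> W" for x
    using Suc.prems that by (intro has_derivative_diff) (auto simp: frechet_derivative_works)
  then have e: "frechet_derivative (\<lambda>x. f x - g x) (at x) = (\<lambda>v. frechet_derivative f (at x) v - frechet_derivative g (at x) v)"
    if "x \<in> W" for x using that frechet_derivative_at by metis
  have "Ck_on k (\<lambda>x. frechet_derivative (\<lambda>x. f x - g x) (at x) v) W" for v
    by (rule Ck_on_cong[OF assms(1) _ Suc.IH[of "\<lambda>x. frechet_derivative f (at x) v" "\<lambda>x. frechet_derivative g (at x) v"]])
      (use Suc.prems e in auto)
  then show ?case using d by (auto simp: differentiable_def)
qed

lemma smooth_on_diff:
  assumes "smooth_on f S" "smooth_on g S"
  shows "smooth_on (\<lambda>x. f x - g x) S"
  unfolding smooth_on_def
proof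
  fix x assume x: "x \<in> S"
  from assms x obtain W f' W' g' where
    W: "open W" "x \<in> W" "\<And>k. Ck_on k f' W" "\<And>y. y \<in> W \<inter> S \<Longrightarrow> f' y = f y" and
    W': "open W'" "x \<in> W'" "\<And>k. Ck_on k g' W'" "\<And>y. y \<in> W' \<inter> S \<Longrightarrow> g' y = g y"
    unfolding smooth_on_def by meson
  show "\<exists>W h. open W \<and> x \<in> W \<and> (\<forall>k. Ck_on k h W) \<and> (\<forall>y\<in>W \<inter> S. h y = f y - g y)"
  proof (intro exI conjI allI ballI)
    show "open (W \<inter> W')" "x \<in> W \<inter> W'" using W W' by auto
    show "Ck_on k (\<lambda>y. f' y - g' y) (W \<inter> W')" for k
      by (rule Ck_on_diff) (use W W' in \<open>auto intro: Ck_on_subset[of _ W] Ck_on_subset[of _ W']\<close>)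
  qed (use W W' in auto)
qed

lemma borel_measurable_vec_nth:
  "f \<in> borel_measurable M \<Longrightarrow> (\<lambda>x. (f x :: real ^ 'n) $ i) \<in> borel_measurable M"
  by (rule measurable_compose[where g="\<lambda>v. v $ i"])
    (auto intro!: borel_measurable_continuous_onI continuous_intros)

section \<open>Positive definite matrices\<close>

definition pos_def :: "real ^ 'n ^ 'n \<Rightarrow> bool" where
  "pos_def A \<longleftrightarrow> transpose A = A \<and> (\<forall>v. v \<noteq> 0 \<longrightarrow> v \<bullet> (A *v v) > 0)"

lemma symmetric_inner:
  fixes A :: "real ^ 'n ^ 'n"
  assumes "transpose A = A" shows "v \<bullet> (A *v w) = w \<bullet> (A *v v)"
  by (metis assms dot_lmul_matrix inner_commute transpose_matrix_vector)

lemma pos_def_invertible: "pos_def A \<Longrightarrow> invertible A"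
  unfolding invertible_left_inverse matrix_left_invertible_ker pos_def_def
  by (metis inner_zero_right less_irrefl)

lemma matrix_inv_mult:
  fixes A :: "real ^ 'n ^ 'n"
  assumes "invertible A" shows "A ** matrix_inv A = mat 1" "matrix_inv A ** A = mat 1"
  using someI_ex[OF assms[unfolded invertible_def]] by (simp_all add: matrix_inv_def)

lemma matrix_inv_apply:
  fixes A :: "real ^ 'n ^ 'n"
  assumes "invertible A"
  shows "A *v (matrix_inv A *v x) = x" "matrix_inv A *v (A *v x) = x"
  by (simp_all add: matrix_vector_mul_assoc matrix_inv_mult[OF assms])

lemma pos_def_inverse_symmetric:
  assumes "pos_def A" shows "\<xi> \<bullet> (matrix_inv A *v \<eta>) = \<eta> \<bullet> (matrix_inv A *v \<xi>)"
  using symmetric_inner[of A "matrix_inv A *v \<xi>" "matrix_inv A *v \<eta>"] assms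
    matrix_inv_apply(1)[OF pos_def_invertible[OF assms]]
  by (simp add: pos_def_def inner_commute)

lemma pos_def_inverse_nonneg:
  assumes "pos_def A" shows "0 \<le> \<xi> \<bullet> (matrix_inv A *v \<xi>)"
proof -
  have "\<xi> \<bullet> (matrix_inv A *v \<xi>) = (matrix_inv A *v \<xi>) \<bullet> (A *v (matrix_inv A *v \<xi>))"
    by (simp add: matrix_inv_apply[OF pos_def_invertible[OF assms]] inner_commute)
  also have "0 \<le> \<dots>"
    using assms by (cases "matrix_inv A *v \<xi> = 0") (auto simp: pos_def_def less_imp_le)
  finally show ?thesis .
qed

text \<open>The substitution \<xi> = A v turns the inverse form into the product of v with A v, to
  which the two bounds on \<open>A\<close> apply.\<close>

lemma pos_def_inverse_bounds:
  assumes A: "pos_def A" and m: "0 < m" "\<And>v. m * (norm v)\<^sup>2 \<le> v \<bullet> (A *v v)"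
    and B: "\<And>v. norm (A *v v) \<le> B * norm v" "0 < B"
  shows "m / B\<^sup>2 * (norm \<xi>)\<^sup>2 \<le> \<xi> \<bullet> (matrix_inv A *v \<xi>)" "\<xi> \<bullet> (matrix_inv A *v \<xi>) \<le> (norm \<xi>)\<^sup>2 / m"
proof -
  define v where "v = matrix_inv A *v \<xi>"
  have Av: "A *v v = \<xi>" by (simp add: v_def matrix_inv_apply[OF pos_def_invertible[OF A]])
  have "(norm \<xi>)\<^sup>2 \<le> (B * norm v)\<^sup>2" using B(1)[of v] by (intro power_mono) (simp_all add: Av)
  then have "m / B\<^sup>2 * (norm \<xi>)\<^sup>2 \<le> m / B\<^sup>2 * (B * norm v)\<^sup>2" using m by (intro mult_left_mono) auto
  also have "\<dots> = m * (norm v)\<^sup>2" using B(2) by (simp add: power_mult_distrib)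
  also have "\<dots> \<le> v \<bullet> \<xi>" using m(2)[of v] by (simp add: Av)
  finally show "m / B\<^sup>2 * (norm \<xi>)\<^sup>2 \<le> \<xi> \<bullet> (matrix_inv A *v \<xi>)" by (simp add: v_def inner_commute)
  have c: "v \<bullet> \<xi> \<le> norm v * norm \<xi>" by (rule norm_cauchy_schwarz)
  have "m * (norm v)\<^sup>2 \<le> norm v * norm \<xi>" using m(2)[of v] c by (simp add: Av)
  then have "m * norm v \<le> norm \<xi>"
    by (cases "norm v = 0") (auto simp: power2_eq_square mult_le_cancel_left mult.left_commute)
  then have "norm v * norm \<xi> \<le> (norm \<xi> / m) * norm \<xi>"
    using m by (intro mult_right_mono) (auto simp: field_simps)
  with c show "\<xi> \<bullet> (matrix_inv A *v \<xi>) \<le> (norm \<xi>)\<^sup>2 / m"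
    by (simp add: v_def[symmetric] inner_commute power2_eq_square)
qed

text \<open>Young's inequality for the inverse form, from its nonnegativity at \<delta> \<xi> -
  \<eta>. The parameter \<delta> is kept in all norms built from this form, because optimising it at
  the end gives back the triangle inequality.\<close>

lemma pos_def_inverse_add:
  assumes A: "pos_def A" and d: "0 < \<delta>"
  shows "(\<xi> + \<eta>) \<bullet> (matrix_inv A *v (\<xi> + \<eta>))
    \<le> (1 + \<delta>) * (\<xi> \<bullet> (matrix_inv A *v \<xi>)) + (1 + 1 / \<delta>) * (\<eta> \<bullet> (matrix_inv A *v \<eta>))"
proof -
  have "0 \<le> (\<delta> *\<^sub>R \<xi> - \<eta>) \<bullet> (matrix_inv A *v (\<delta> *\<^sub>R \<xi> - \<eta>))" by (rule pos_def_inverse_nonneg[OF A])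
  also have "\<dots> = \<delta> * (\<delta> * (\<xi> \<bullet> (matrix_inv A *v \<xi>)) + (\<eta> \<bullet> (matrix_inv A *v \<eta>)) / \<delta> - 2 * (\<xi> \<bullet> (matrix_inv A *v \<eta>)))"
    using d pos_def_inverse_symmetric[OF A, of \<eta> \<xi>]
    by (simp add: matrix_vector_mult_diff_distrib matrix_vector_mult_scaleR inner_diff_left inner_diff_right algebra_simps)
  finally have "2 * (\<xi> \<bullet> (matrix_inv A *v \<eta>)) \<le> \<delta> * (\<xi> \<bullet> (matrix_inv A *v \<xi>)) + (\<eta> \<bullet> (matrix_inv A *v \<eta>)) / \<delta>"
    using d by (simp add: zero_le_mult_iff)
  then show ?thesis
    using pos_def_inverse_symmetric[OF A, of \<eta> \<xi>]
    by (simp add: matrix_vector_right_distrib inner_add_left inner_add_right algebra_simps)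
qed

section \<open>Determinants and families of matrices\<close>

lemma continuous_on_matrix_vector_mult:
  fixes A :: "'a::topological_space \<Rightarrow> real ^ 'n ^ 'm"
  assumes "continuous_on S A" "continuous_on S v"
  shows "continuous_on S (\<lambda>x. A x *v v x)"
  unfolding matrix_vector_mult_def by (intro continuous_intros assms)

lemma continuous_on_det:
  fixes A :: "'a::topological_space \<Rightarrow> real ^ 'n ^ 'n"
  assumes "continuous_on S A" shows "continuous_on S (\<lambda>x. det (A x))"
  unfolding det_def by (intro continuous_intros assms)

text \<open>The segment from the identity to \<open>A\<close> consists of positive definite, hence
  invertible matrices, so the determinant cannot vanish on it and keeps the sign it has at the
  identity.\<close>

lemma pos_def_det_pos:
  fixes A :: "real ^ 'n ^ 'n"
  assumes A: "pos_def A" shows "0 < det A"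
proof (rule ccontr)
  assume neg: "\<not> 0 < det A"
  define B where "B t = (1 - t) *\<^sub>R mat 1 + t *\<^sub>R A" for t :: real
  have c: "continuous_on {0..1} (\<lambda>t. det (B t))"
    unfolding B_def by (intro continuous_on_det continuous_intros)
  have "\<exists>t\<ge>0. t \<le> 1 \<and> det (B t) = 0"
    by (rule IVT2') (use neg c in \<open>auto simp: B_def\<close>)
  then obtain t where t: "0 \<le> t" "t \<le> 1" "det (B t) = 0" by blast
  have "pos_def (B t)" unfolding pos_def_def
  proof (intro conjI allI impI)
    show "transpose (B t) = B t"
      using A by (simp add: B_def pos_def_def transpose_def vec_eq_iff mat_def)
    fix v :: "real ^ 'n" assume v: "v \<noteq> 0"
    have "B t *v v = (1 - t) *\<^sub>R v + t *\<^sub>R (A *v v)"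
      by (simp add: B_def matrix_vector_mult_add_rdistrib scaleR_matrix_vector_assoc[symmetric])
    then have "v \<bullet> (B t *v v) = (1 - t) * (v \<bullet> v) + t * (v \<bullet> (A *v v))"
      by (simp add: inner_add_right)
    moreover have "0 < v \<bullet> (A *v v)" "0 < v \<bullet> v" using A v by (auto simp: pos_def_def)
    ultimately show "0 < v \<bullet> (B t *v v)" using t(1,2)
      by (cases "t = 0") (auto intro!: add_nonneg_pos)
  qed
  then have "det (B t) \<noteq> 0" using pos_def_invertible invertible_det_nz by blast
  with t show False by simp
qed

lemma borel_measurable_det:
  fixes A :: "'a \<Rightarrow> real ^ 'n ^ 'n"
  assumes "\<And>i j. (\<lambda>x. A x $ i $ j) \<in> borel_measurable M"
  shows "(\<lambda>x. det (A x)) \<in> borel_measurable M"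
  unfolding det_def
    by (intro borel_measurable_sum borel_measurable_times borel_measurable_prod borel_measurable_const assms)

text \<open>By Cramer's rule the components of the inverse applied to a vector are quotients of
  determinants, which are polynomials in the measurable entries.\<close>

lemma borel_measurable_inverse_form:
  fixes A :: "'a \<Rightarrow> real ^ 'n ^ 'n"
  assumes "\<And>i j. (\<lambda>x. A x $ i $ j) \<in> borel_measurable M"
    and "\<And>i. (\<lambda>x. \<xi> x $ i) \<in> borel_measurable M" "\<And>i. (\<lambda>x. \<eta> x $ i) \<in> borel_measurable M"
    and inv: "\<And>x. x \<in> space M \<Longrightarrow> invertible (A x)"
  shows "(\<lambda>x. \<xi> x \<bullet> (matrix_inv (A x) *v \<eta> x)) \<in> borel_measurable M"
proof -
  have "(\<lambda>x. \<Sum>k\<in>UNIV. \<xi> x $ k * (det (\<chi> i j. if j = k then \<eta> x $ i else A x $ i $ j) / det (A x))) \<in> borel_measurable M"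
  proof (intro borel_measurable_sum borel_measurable_times borel_measurable_divide borel_measurable_det assms)
    fix k i j :: 'n
    show "(\<lambda>x. (\<chi> i j. if j = k then \<eta> x $ i else A x $ i $ j) $ i $ j) \<in> borel_measurable M"
      using assms by (cases "j = k") simp_all
  qed
  then show ?thesis
  proof (rule measurable_cong[THEN iffD1, rotated])
    fix x assume "x \<in> space M"
    then have i: "invertible (A x)" by (rule inv)
    then have "det (A x) \<noteq> 0" by (simp add: invertible_det_nz)
    from cramer[OF this, of "matrix_inv (A x) *v \<eta> x" "\<eta> x"] matrix_inv_apply(1)[OF i]
    have "matrix_inv (A x) *v \<eta> x = (\<chi> k. det (\<chi> i j. if j = k then \<eta> x $ i else A x $ i $ j) / det (A x))" by simp
    then show "(\<Sum>k\<in>UNIV. \<xi> x $ k * (det (\<chi> i j. if j = k then \<eta> x $ i else A x $ i $ j) / det (A x)))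
      = \<xi> x \<bullet> (matrix_inv (A x) *v \<eta> x)" by (simp add: inner_vec_def)
  qed
qed

text \<open>The quadratic form and the norm of the image vector attain their extrema on the compact
  product of \<open>K\<close> with the unit sphere, and homogeneity extends the bounds to all
  vectors. They compare Riemannian with Euclidean quantities on compact parts of a chart.\<close>

lemma pos_def_family_bounds:
  fixes G :: "'a::topological_space \<Rightarrow> real ^ 'n ^ 'n"
  assumes K: "compact K" and G: "continuous_on K G" and pd: "\<And>x. x \<in> K \<Longrightarrow> pos_def (G x)"
  obtains m B where "0 < m" "0 < B"
    "\<And>x. x \<in> K \<Longrightarrow> m \<le> sqrt (det (G x)) \<and> sqrt (det (G x)) \<le> B"
    "\<And>x \<xi>. x \<in> K \<Longrightarrow> m * (norm \<xi>)\<^sup>2 \<le> \<xi> \<bullet> (matrix_inv (G x) *v \<xi>)"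
    "\<And>x \<xi>. x \<in> K \<Longrightarrow> \<xi> \<bullet> (matrix_inv (G x) *v \<xi>) \<le> B * (norm \<xi>)\<^sup>2"
proof (cases "K = {}")
  case True
  then show ?thesis using that[of 1 1] by auto
next
  case False
  let ?S = "sphere 0 1 :: (real ^ 'n) set"
  have "axis undefined 1 \<in> ?S" by simp
  then have KS: "compact (K \<times> ?S)" "K \<times> ?S \<noteq> {}" using K False by (auto intro: compact_Times)
  have cf: "continuous_on (K \<times> ?S) (\<lambda>p. G (fst p))"
    by (rule continuous_on_compose2[OF G]) (auto intro: continuous_intros)
  have c1: "continuous_on (K \<times> ?S) (\<lambda>p. snd p \<bullet> (G (fst p) *v snd p))"
    by (intro continuous_intros continuous_on_matrix_vector_mult cf)
  have c2: "continuous_on (K \<times> ?S) (\<lambda>p. norm (G (fst p) *v snd p))"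
    by (intro continuous_intros continuous_on_matrix_vector_mult cf)
  have c3: "continuous_on K (\<lambda>x. sqrt (det (G x)))"
    by (intro continuous_intros continuous_on_det G)
  obtain p1 where p1: "p1 \<in> K \<times> ?S" "\<And>p. p \<in> K \<times> ?S \<Longrightarrow> fst p1 \<in> K \<and> snd p1 \<bullet> (G (fst p1) *v snd p1) \<le> snd p \<bullet> (G (fst p) *v snd p)"
    using continuous_attains_inf[OF KS c1] by force
  obtain p2 where p2: "\<And>p. p \<in> K \<times> ?S \<Longrightarrow> norm (G (fst p) *v snd p) \<le> norm (G (fst p2) *v snd p2)"
    using continuous_attains_sup[OF KS c2] by blast
  obtain x1 where x1: "x1 \<in> K" "\<And>x. x \<in> K \<Longrightarrow> sqrt (det (G x1)) \<le> sqrt (det (G x))"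
    using continuous_attains_inf[OF K False c3] by blast
  obtain x2 where x2: "x2 \<in> K" "\<And>x. x \<in> K \<Longrightarrow> sqrt (det (G x)) \<le> sqrt (det (G x2))"
    using continuous_attains_sup[OF K False c3] by blast
  define a where "a = snd p1 \<bullet> (G (fst p1) *v snd p1)"
  \<comment> \<open>The summand 1 ensures that \<open>b\<close> is positive.\<close>
  define b where "b = norm (G (fst p2) *v snd p2) + 1"
  have "snd p1 \<noteq> 0" using p1(1) by auto
  then have a: "0 < a" using pd[of "fst p1"] p1 unfolding a_def pos_def_def by blast
  have b: "0 < b" by (simp add: b_def add_nonneg_pos)
  have s1: "0 < sqrt (det (G x1))" "0 < sqrt (det (G x2))"
    using pos_def_det_pos[OF pd] x1 x2 by auto
  have ga: "a * (norm v)\<^sup>2 \<le> v \<bullet> (G x *v v)" and gb: "norm (G x *v v) \<le> b * norm v" if x: "x \<in> K" for x v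
  proof -
    have "a * (norm v)\<^sup>2 \<le> v \<bullet> (G x *v v) \<and> norm (G x *v v) \<le> b * norm v"
    proof (cases "v = 0")
      case False
      define w where "w = v /\<^sub>R norm v"
      have w: "(x, w) \<in> K \<times> ?S" "v = norm v *\<^sub>R w" using False x by (auto simp: w_def)
      have "a * (norm v)\<^sup>2 \<le> (w \<bullet> (G x *v w)) * (norm v)\<^sup>2"
        using p1(2)[OF w(1)] by (intro mult_right_mono) (auto simp: a_def)
      also have "\<dots> = (norm v *\<^sub>R w) \<bullet> (G x *v (norm v *\<^sub>R w))"
        by (simp add: matrix_vector_mult_scaleR power2_eq_square)
      finally have 1: "a * (norm v)\<^sup>2 \<le> v \<bullet> (G x *v v)" using w(2) by simp
      have "norm (G x *v (norm v *\<^sub>R w)) = norm (G x *v w) * norm v"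
        by (simp add: matrix_vector_mult_scaleR)
      also have "\<dots> \<le> b * norm v" using p2[OF w(1)] by (intro mult_right_mono) (auto simp: b_def)
      finally show ?thesis using 1 w(2) by simp
    qed (simp add: matrix_vector_mult_0_right)
    then show "a * (norm v)\<^sup>2 \<le> v \<bullet> (G x *v v)" "norm (G x *v v) \<le> b * norm v" by auto
  qed
  define m where "m = min (sqrt (det (G x1))) (a / b\<^sup>2)"
  define B where "B = max (sqrt (det (G x2))) (1 / a)"
  show ?thesis
  proof (rule that)
    show "0 < m" "0 < B" using s1 a b by (auto simp: m_def B_def less_max_iff_disj)
    fix x and \<xi> :: "real ^ 'n" assume x: "x \<in> K"
    show "m \<le> sqrt (det (G x)) \<and> sqrt (det (G x)) \<le> B"
      using x1(2)[OF x] x2(2)[OF x] unfolding m_def B_def by (metis min.coboundedI1 max.coboundedI1)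
    note bd = pos_def_inverse_bounds[OF pd[OF x] a ga[OF x] gb[OF x] b, of \<xi>]
    have "m * (norm \<xi>)\<^sup>2 \<le> a / b\<^sup>2 * (norm \<xi>)\<^sup>2" by (rule mult_right_mono) (auto simp: m_def)
    with bd(1) show "m * (norm \<xi>)\<^sup>2 \<le> \<xi> \<bullet> (matrix_inv (G x) *v \<xi>)" by simp
    have "1 / a * (norm \<xi>)\<^sup>2 \<le> B * (norm \<xi>)\<^sup>2" by (rule mult_right_mono) (auto simp: B_def)
    with bd(2) show "\<xi> \<bullet> (matrix_inv (G x) *v \<xi>) \<le> B * (norm \<xi>)\<^sup>2" by simp
  qed
qed

section \<open>Charts\<close>

locale riem =
  fixes M :: "('m::{t2_space, second_countable_topology}, 'n::finite) riemannian"
  assumes M: "compact_riemannian_manifold M"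
begin

abbreviation gram :: "('m, 'n) chart \<Rightarrow> real ^ 'n \<Rightarrow> real ^ 'n ^ 'n" where
  "gram c x \<equiv> metric M c (chart_inv c x)"

abbreviation vol_density :: "('m, 'n) chart \<Rightarrow> real ^ 'n \<Rightarrow> real" where
  "vol_density c x \<equiv> sqrt (det (gram c x))"

lemma sets_vol[simp, measurable_cong]: "sets (vol M) = sets borel"
  using M by (simp add: compact_riemannian_manifold_def riemannian_volume_def)

lemma space_vol[simp]: "space (vol M) = UNIV"
  using sets_eq_imp_space_eq[OF sets_vol] by simp

lemma borel_measurable_vol[simp]: "borel_measurable (vol M) = borel_measurable borel"
  by (rule measurable_cong_sets) simp_all

lemma chart: "c \<in> atlas M \<Longrightarrow> is_chart c"
  using M by (simp add: compact_riemannian_manifold_def smooth_atlas_def)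

lemma dom_open: "c \<in> atlas M \<Longrightarrow> open (chart_dom c)"
  using chart by (simp add: is_chart_def)

lemma atlas_cover: "\<exists>c\<in>atlas M. p \<in> chart_dom c"
  using M by (auto simp: compact_riemannian_manifold_def smooth_atlas_def)

lemma chart_homeo:
  "c \<in> atlas M \<Longrightarrow> homeomorphism (chart_dom c) (chart_img c) (chart_map c) (chart_inv c)"
  using chart by (simp add: is_chart_def)

lemma chart_inv_map: "c \<in> atlas M \<Longrightarrow> p \<in> chart_dom c \<Longrightarrow> chart_inv c (chart_map c p) = p"
  using chart_homeo by (auto simp: homeomorphism_def)

lemma chart_map_inv: "c \<in> atlas M \<Longrightarrow> x \<in> chart_img c \<Longrightarrow> chart_map c (chart_inv c x) = x"
  using chart_homeo by (auto simp: homeomorphism_def)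

lemma chart_inv_dom: "c \<in> atlas M \<Longrightarrow> x \<in> chart_img c \<Longrightarrow> chart_inv c x \<in> chart_dom c"
  using chart_homeo by (fastforce simp: homeomorphism_def)

lemma chart_map_img: "p \<in> chart_dom c \<Longrightarrow> chart_map c p \<in> chart_img c"
  by (simp add: chart_img_def)

lemma chart_cont: "c \<in> atlas M \<Longrightarrow> continuous_on (chart_dom c) (chart_map c)"
  "c \<in> atlas M \<Longrightarrow> continuous_on (chart_img c) (chart_inv c)"
  using chart_homeo by (auto simp: homeomorphism_def)

lemma img_half_space:
  assumes "c \<in> atlas M"
  obtains k T where "open T" "chart_img c = T \<inter> {x. 0 \<le> x $ k}"
proof -
  from chart[OF assms] obtain k where "openin (top_of_set {x. 0 \<le> x $ k}) (chart_img c)"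
    unfolding is_chart_def by blast
  then show ?thesis using that by (auto simp: openin_open Int_commute)
qed

lemma img_borel: assumes "c \<in> atlas M" shows "chart_img c \<in> sets borel"
proof -
  obtain k T where T: "open T" "chart_img c = T \<inter> {x. 0 \<le> x $ k}" by (rule img_half_space[OF assms])
  have "closed {x :: real ^ 'n. 0 \<le> x $ k}" by (intro closed_Collect_le continuous_intros)
  then show ?thesis using T by auto
qed

text \<open>A chart image is relatively open in a half-space, so its non-interior points lie in the
  bounding hyperplane, which is Lebesgue null.\<close>

lemma img_boundary_null: assumes "c \<in> atlas M"
  shows "AE x in lborel. x \<in> chart_img c \<longrightarrow> x \<in> interior (chart_img c)"
proof -
  obtain k T where T: "open T" "chart_img c = T \<inter> {x. 0 \<le> x $ k}" by (rule img_half_space[OF assms])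
  have "negligible {x :: real ^ 'n. x $ k = 0}" by (rule negligible_standard_hyperplane_cart)
  moreover have "closed {x :: real ^ 'n. x $ k = 0}" by (intro closed_Collect_eq continuous_intros)
  ultimately have "{x :: real ^ 'n. x $ k = 0} \<in> null_sets lborel"
    by (simp add: negligible_iff_null_sets null_sets_completion_iff)
  moreover have "open (T \<inter> {x. 0 < x $ k})"
    using T by (intro open_Int open_Collect_less continuous_intros)
  moreover have "T \<inter> {x. 0 < x $ k} \<subseteq> chart_img c" unfolding T(2) by auto
  ultimately have N: "{x :: real ^ 'n. x $ k = 0} \<in> null_sets lborel" and I: "T \<inter> {x. 0 < x $ k} \<subseteq> interior (chart_img c)"
    by (auto intro: interior_maximal[THEN subsetD])
  have "x \<in> chart_img c \<longrightarrow> x \<in> interior (chart_img c)" if "x $ k \<noteq> 0" for x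
    using that I unfolding T(2) by (auto simp: less_le)
  then show ?thesis by (intro AE_I'[OF N]) blast
qed

lemma gram_pos_def:
  assumes "c \<in> atlas M" "p \<in> chart_dom c" shows "pos_def (metric M c p)"
  using M assms unfolding compact_riemannian_manifold_def riemannian_metric_def pos_def_def by auto

lemma gram_continuous:
  assumes "c \<in> atlas M" shows "continuous_on (chart_img c) (gram c)"
proof -
  have "continuous_on (chart_img c) (\<lambda>x. gram c x $ i $ j)" for i j
    using M assms by (intro smooth_on_imp_continuous_on)
      (auto simp: compact_riemannian_manifold_def riemannian_metric_def)
  then have "continuous_on (chart_img c) (\<lambda>x. \<chi> i j. gram c x $ i $ j)"
    by (rule continuous_on_vec_lambda[OF continuous_on_vec_lambda])
  then show ?thesis by (simp add: vec_lambda_eta)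
qed

lemma vol_density_pos:
  assumes "c \<in> atlas M" "x \<in> chart_img c" shows "0 < vol_density c x"
  using pos_def_det_pos[OF gram_pos_def[OF assms(1) chart_inv_dom[OF assms]]] by simp

lemma gram_bounds:
  assumes c: "c \<in> atlas M" and K: "compact K" "K \<subseteq> chart_img c"
  obtains m B where "0 < m" "0 < B"
    "\<And>x. x \<in> K \<Longrightarrow> m \<le> vol_density c x \<and> vol_density c x \<le> B"
    "\<And>x \<xi>. x \<in> K \<Longrightarrow> m * (norm \<xi>)\<^sup>2 \<le> \<xi> \<bullet> (matrix_inv (gram c x) *v \<xi>)"
    "\<And>x \<xi>. x \<in> K \<Longrightarrow> \<xi> \<bullet> (matrix_inv (gram c x) *v \<xi>) \<le> B * (norm \<xi>)\<^sup>2"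
  by (rule pos_def_family_bounds[OF K(1) continuous_on_subset[OF gram_continuous[OF c] K(2)]])
    (use K c in \<open>auto intro!: gram_pos_def chart_inv_dom\<close>)

text \<open>Outside the chart image \<open>chart_inv\<close> has arbitrary values; a constant there
  makes the map Borel on the whole space.\<close>

lemma chart_inv_measurable:
  fixes h :: "'m \<Rightarrow> 'b::{second_countable_topology, topological_space}"
  assumes c: "c \<in> atlas M"
  shows "(\<lambda>x. if x \<in> chart_img c then chart_inv c x else p0) \<in> borel_measurable borel"
  by (rule borel_measurable_continuous_on_if) (use c img_borel chart_cont in auto)

text \<open>\<open>riemannian_volume\<close> prescribes the volume only of Borel sets within a
  chart. This amounts to an equality of measures: the volume restricted to the chart domain is the
  image of Lebesgue measure with density \<open>vol_density\<close>. The formula for nonnegative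
  integrands follows from that equality.\<close>

lemma nn_integral_chart:
  assumes c: "c \<in> atlas M" and h[measurable]: "h \<in> borel_measurable borel"
  shows "(\<integral>\<^sup>+p. h p * indicator (chart_dom c) p \<partial>vol M)
    = (\<integral>\<^sup>+x. h (chart_inv c x) * ennreal (vol_density c x) * indicator (chart_img c) x \<partial>lborel)"
proof -
  define I where "I x = (if x \<in> chart_img c then chart_inv c x else undefined)" for x
  have I[measurable]: "I \<in> borel_measurable borel"
    unfolding I_def[abs_def] by (rule chart_inv_measurable[OF c])
  have [measurable]: "chart_dom c \<in> sets borel" using dom_open[OF c] by auto
  have [measurable]: "chart_img c \<in> sets borel" by (rule img_borel[OF c])
  define w where "w x = ennreal (indicator (chart_img c) x *\<^sub>R vol_density c x)" for x
  have [measurable]: "w \<in> borel_measurable borel" unfolding w_def[abs_def]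
    by (intro measurable_compose[OF _ measurable_ennreal] borel_measurable_continuous_on_indicator img_borel[OF c]
      continuous_intros continuous_on_det gram_continuous[OF c])
  have w: "w x = ennreal (vol_density c x) * indicator (chart_img c) x" for x
    by (simp add: w_def indicator_def)
  have eq: "density (vol M) (indicator (chart_dom c)) = distr (density lborel w) (vol M) I"
  proof (rule measure_eqI)
    fix A assume "A \<in> sets (density (vol M) (indicator (chart_dom c)))"
    then have A[measurable]: "A \<in> sets borel" by simp
    have vM: "\<forall>B\<in>sets borel. B \<subseteq> chart_dom c \<longrightarrow> emeasure (vol M) B = (\<integral>\<^sup>+x\<in>chart_map c ` B. ennreal (vol_density c x) \<partial>lborel)"
      using M c by (simp add: compact_riemannian_manifold_def riemannian_volume_def)
    have "emeasure (density (vol M) (indicator (chart_dom c))) A = (\<integral>\<^sup>+p. indicator (A \<inter> chart_dom c) p \<partial>vol M)"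
      by (subst emeasure_density) (auto intro!: nn_integral_cong simp del: nn_integral_indicator split: split_indicator)
    also have "\<dots> = emeasure (vol M) (A \<inter> chart_dom c)" by (subst nn_integral_indicator) auto
    also have "\<dots> = (\<integral>\<^sup>+x\<in>chart_map c ` (A \<inter> chart_dom c). ennreal (vol_density c x) \<partial>lborel)"
      by (rule vM[rule_format]) auto
    also have "\<dots> = (\<integral>\<^sup>+x. w x * indicator (I -` A) x \<partial>lborel)"
    proof (rule nn_integral_cong)
      fix x
      have "x \<in> chart_map c ` (A \<inter> chart_dom c) \<longleftrightarrow> x \<in> chart_img c \<and> chart_inv c x \<in> A"
        
      proof
        assume "x \<in> chart_map c ` (A \<inter> chart_dom c)"
        then obtain p where "p \<in> A" "p \<in> chart_dom c" "x = chart_map c p" by auto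
        then show "x \<in> chart_img c \<and> chart_inv c x \<in> A"
          by (simp add: chart_map_img chart_inv_map[OF c])
      next
        assume x: "x \<in> chart_img c \<and> chart_inv c x \<in> A"
        show "x \<in> chart_map c ` (A \<inter> chart_dom c)"
          by (rule image_eqI[of _ _ "chart_inv c x"]) (use x chart_map_inv[OF c] chart_inv_dom[OF c] in auto)
      qed
      then show "ennreal (vol_density c x) * indicator (chart_map c ` (A \<inter> chart_dom c)) x = w x * indicator (I -` A) x"
        by (auto simp: w I_def indicator_def)
    qed
    also have "\<dots> = emeasure (distr (density lborel w) (vol M) I) A"
      using measurable_sets[OF I A] by (subst emeasure_distr) (auto simp: emeasure_density)
    finally show "emeasure (density (vol M) (indicator (chart_dom c))) A = emeasure (distr (density lborel w) (vol M) I) A" .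
  qed simp
  have "(\<integral>\<^sup>+p. h p * indicator (chart_dom c) p \<partial>vol M) = (\<integral>\<^sup>+p. h p \<partial>density (vol M) (indicator (chart_dom c)))"
    by (subst nn_integral_density) (auto simp: mult.commute)
  also have "\<dots> = (\<integral>\<^sup>+x. w x * h (I x) \<partial>lborel)"
    unfolding eq by (simp add: nn_integral_distr nn_integral_density)
  also have "\<dots> = (\<integral>\<^sup>+x. h (chart_inv c x) * ennreal (vol_density c x) * indicator (chart_img c) x \<partial>lborel)"
    by (rule nn_integral_cong) (auto simp: w I_def indicator_def mult.commute)
  finally show ?thesis .
qed

end

section \<open>Smooth bump functions\<close>

text \<open>The polynomial factor makes this class closed under differentiation, which exp(-1/t)
  alone is not; smoothness at 0 then follows by induction.\<close>

definition flat :: "real poly \<Rightarrow> real \<Rightarrow> real" where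
  "flat P t = (if 0 < t then poly P (1 / t) * exp (- (1 / t)) else 0)"

lemma poly_div_exp_tendsto_0: "((\<lambda>x. poly P x * exp (- x)) \<longlongrightarrow> (0::real)) at_top"
proof -
  have "((\<lambda>x. \<Sum>i\<le>degree P. coeff P i * (x ^ i / exp x)) \<longlongrightarrow> (\<Sum>i\<le>degree P. coeff P i * 0)) at_top"
    by (intro tendsto_sum tendsto_mult tendsto_const tendsto_power_div_exp_0)
  then show ?thesis
    by (simp add: poly_altdef exp_minus divide_inverse sum_distrib_right mult.assoc)
qed

text \<open>For t > 0 the derivative is (P - P')(1/t) t^(-2) exp(-1/t), and
  \<open>[:0, 0, 1:]\<close> is the factor X^2 that stands for t^(-2).\<close>

lemma flat_has_derivative:
  "(flat P has_real_derivative flat ([:0, 0, 1:] * (P - pderiv P)) t) (at t)"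
proof -
  consider "0 < t" | "t < 0" | "t = 0" by linarith
  then show ?thesis
  proof cases
    case 1
    have "((\<lambda>t. poly P (1 / t) * exp (- (1 / t))) has_real_derivative
        flat ([:0, 0, 1:] * (P - pderiv P)) t) (at t)"
      using 1 by (auto intro!: derivative_eq_intros DERIV_chain2[OF poly_DERIV] simp: flat_def power2_eq_square field_simps)
    moreover have "eventually (\<lambda>s. poly P (1 / s) * exp (- (1 / s)) = flat P s) (nhds t)"
      using eventually_nhds_in_open[of "{0<..}" t] 1 by (auto elim!: eventually_mono simp: flat_def)
    ultimately show ?thesis by (subst DERIV_cong_ev[OF refl _ refl, symmetric])
  next
    case 2
    have "((\<lambda>t. 0) has_real_derivative flat ([:0, 0, 1:] * (P - pderiv P)) t) (at t)"
      using 2 by (simp add: flat_def)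
    moreover have "eventually (\<lambda>s. 0 = flat P s) (nhds t)"
      using eventually_nhds_in_open[of "{..<0}" t] 2 by (auto elim!: eventually_mono simp: flat_def)
    ultimately show ?thesis by (subst DERIV_cong_ev[OF refl _ refl, symmetric])
  next
    case 3
    have "((\<lambda>h. flat P h / h) \<longlongrightarrow> 0) (at_right 0)"
    proof (rule Lim_transform_eventually)
      \<comment> \<open>With x = 1 / h, dividing by h multiplies the polynomial by X, which is
        \<open>pCons 0 P\<close>.\<close>
      have "((\<lambda>h. poly (pCons 0 P) (inverse h) * exp (- inverse h)) \<longlongrightarrow> 0) (at_right 0)"
        by (rule filterlim_compose[OF poly_div_exp_tendsto_0 filterlim_inverse_at_top_right])
      then show "((\<lambda>h. poly (pCons 0 P) (inverse h) * exp (- inverse h)) \<longlongrightarrow> 0) (at_right 0)" .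
      show "\<forall>\<^sub>F h in at_right 0. poly (pCons 0 P) (inverse h) * exp (- inverse h) = flat P h / h"
        by (auto simp: eventually_at_filter flat_def divide_inverse intro!: always_eventually)
    qed
    moreover have "((\<lambda>h. flat P h / h) \<longlongrightarrow> 0) (at_left 0)"
      by (rule Lim_transform_eventually[OF tendsto_const])
        (auto simp: eventually_at_filter flat_def intro!: always_eventually)
    ultimately have "((\<lambda>h. flat P h / h) \<longlongrightarrow> 0) (at 0)" by (simp add: filterlim_split_at)
    moreover have "flat P 0 = 0" "flat ([:0, 0, 1:] * (P - pderiv P)) 0 = 0"
      by (simp_all add: flat_def)
    ultimately show ?thesis using 3 by (simp add: DERIV_def)
  qed
qed

lemma continuous_on_flat: "continuous_on S g \<Longrightarrow> continuous_on S (\<lambda>x. flat P (g x))"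
  by (rule continuous_on_compose2[of UNIV "flat P"])
    (auto intro!: continuous_at_imp_continuous_on DERIV_isCont[OF flat_has_derivative])

text \<open>The class contains the factors of \<open>box_bump\<close>, is closed under products, and
  contains all directional derivatives of its members. Such functions are differentiable to every
  order, by induction on the order.\<close>

inductive_set flat_algebra :: "('a::euclidean_space \<Rightarrow> real) set" where
  const: "(\<lambda>_. r) \<in> flat_algebra"
| flat: "(\<lambda>x. flat P (x \<bullet> e + r)) \<in> flat_algebra"
| add: "f \<in> flat_algebra \<Longrightarrow> g \<in> flat_algebra \<Longrightarrow> (\<lambda>x. f x + g x) \<in> flat_algebra"
| mult: "f \<in> flat_algebra \<Longrightarrow> g \<in> flat_algebra \<Longrightarrow> (\<lambda>x. f x * g x) \<in> flat_algebra"

lemma flat_algebra_derivative: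
  "f \<in> flat_algebra \<Longrightarrow> \<exists>f'. (\<forall>x. (f has_derivative f' x) (at x)) \<and> (\<forall>v. (\<lambda>x. f' x v) \<in> flat_algebra)"
proof (induction rule: flat_algebra.induct)
  case (const r)
  show ?case by (rule exI[of _ "\<lambda>_ _. 0"]) (auto intro: flat_algebra.const)
next
  case (flat P e r)
  let ?Q = "[:0, 0, 1:] * (P - pderiv P)"
  show ?case
  proof (intro exI[of _ "\<lambda>x v. (v \<bullet> e) * flat ?Q (x \<bullet> e + r)"] conjI allI)
    fix x
    have "((\<lambda>x. x \<bullet> e + r) has_derivative (\<lambda>v. v \<bullet> e)) (at x)"
      by (auto intro!: derivative_eq_intros)
    from has_derivative_compose[OF this flat_has_derivative[unfolded has_field_derivative_def]]
    show "((\<lambda>x. flat P (x \<bullet> e + r)) has_derivative (\<lambda>v. (v \<bullet> e) * flat ?Q (x \<bullet> e + r))) (at x)"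
      by (simp add: mult.commute)
    show "(\<lambda>x. (v \<bullet> e) * flat ?Q (x \<bullet> e + r)) \<in> flat_algebra" for v
      by (intro flat_algebra.mult flat_algebra.const flat_algebra.flat)
  qed
next
  case (add f g)
  then obtain f' g' where "\<forall>x. (f has_derivative f' x) (at x)" "\<forall>v. (\<lambda>x. f' x v) \<in> flat_algebra"
    "\<forall>x. (g has_derivative g' x) (at x)" "\<forall>v. (\<lambda>x. g' x v) \<in> flat_algebra" by blast
  then show ?case
    by (intro exI[of _ "\<lambda>x v. f' x v + g' x v"]) (auto intro: has_derivative_add flat_algebra.add)
next
  case (mult f g)
  then obtain f' g' where "\<forall>x. (f has_derivative f' x) (at x)" "\<forall>v. (\<lambda>x. f' x v) \<in> flat_algebra"
    "\<forall>x. (g has_derivative g' x) (at x)" "\<forall>v. (\<lambda>x. g' x v) \<in> flat_algebra" by blast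
  with mult(1,2) show ?case
    by (intro exI[of _ "\<lambda>x v. f x * g' x v + f' x v * g x"] conjI allI has_derivative_mult
        flat_algebra.add flat_algebra.mult) auto
qed

lemma flat_algebra_Ck: "f \<in> flat_algebra \<Longrightarrow> Ck_on k f UNIV"
proof (induction k arbitrary: f)
  case 0
  from flat_algebra_derivative[OF 0] obtain f' where "\<And>x. (f has_derivative f' x) (at x)" by blast
  then show ?case by (auto intro!: continuous_at_imp_continuous_on has_derivative_continuous)
next
  case (Suc k)
  from flat_algebra_derivative[OF Suc.prems] obtain f' where
    f': "\<And>x. (f has_derivative f' x) (at x)" "\<And>v. (\<lambda>x. f' x v) \<in> flat_algebra" by blast
  have "frechet_derivative f (at x) = f' x" for x using frechet_derivative_at[OF f'(1)] by simp
  with f' Suc.IH show ?case by (auto simp: differentiable_def)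
qed

text \<open>For n > 0 this is the product over i of exp(-1 / (n (x_i - a_i))) exp(-1 / (n (b_i -
  x_i))) inside the box and 0 outside; it tends to the indicator of the open box. The arguments are
  written in the affine form that \<open>flat_algebra\<close> generates.\<close>

definition box_bump :: "'a::euclidean_space \<Rightarrow> 'a \<Rightarrow> nat \<Rightarrow> 'a \<Rightarrow> real" where
  "box_bump a b n x = (\<Prod>i\<in>Basis. flat 1 (x \<bullet> (real n *\<^sub>R i) + - real n * (a \<bullet> i)) * flat 1 (x \<bullet> (- real n *\<^sub>R i) + real n * (b \<bullet> i)))"

lemma flat_1_bounds: "0 \<le> flat 1 t" "flat 1 t \<le> 1"
  by (auto simp: flat_def)

lemma box_bump_bounds: "0 \<le> box_bump a b n x" "box_bump a b n x \<le> 1"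
  unfolding box_bump_def
  by (auto intro!: prod_nonneg prod_le_1 mult_nonneg_nonneg mult_le_one flat_1_bounds)

lemma box_bump_zero: "x \<notin> box a b \<Longrightarrow> box_bump a b n x = 0"
proof -
  assume "x \<notin> box a b"
  then obtain i where i: "i \<in> Basis" "x \<bullet> i \<le> a \<bullet> i \<or> b \<bullet> i \<le> x \<bullet> i"
    by (auto simp: mem_box not_less)
  then have "real n * (x \<bullet> i) \<le> real n * (a \<bullet> i) \<or> real n * (b \<bullet> i) \<le> real n * (x \<bullet> i)"
    by (auto intro: mult_left_mono)
  then have "flat 1 (x \<bullet> (real n *\<^sub>R i) + - real n * (a \<bullet> i)) * flat 1 (x \<bullet> (- real n *\<^sub>R i) + real n * (b \<bullet> i)) = 0"
    by (auto simp: flat_def)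
  then show ?thesis unfolding box_bump_def using i(1) by (intro prod_zero) auto
qed

lemma box_bump_tendsto: "(\<lambda>n. box_bump a b n x) \<longlonglongrightarrow> indicator (box a b) x"
proof (cases "x \<in> box a b")
  case True
  have fl: "(\<lambda>n. flat 1 (real n * c)) \<longlonglongrightarrow> 1" if "0 < c" for c
  proof (rule Lim_transform_eventually)
    have "(\<lambda>n. 1 / c * (1 / real n)) \<longlonglongrightarrow> 1 / c * 0" by (intro tendsto_intros lim_1_over_n)
    then have "(\<lambda>n. exp (- (1 / c * (1 / real n)))) \<longlonglongrightarrow> exp (- 0)"
      by (intro tendsto_exp tendsto_minus) simp
    then show "(\<lambda>n. exp (- (1 / c * (1 / real n)))) \<longlonglongrightarrow> 1" by simp
    show "\<forall>\<^sub>F n in sequentially. exp (- (1 / c * (1 / real n))) = flat 1 (real n * c)"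
      by (rule eventually_mono[OF eventually_gt_at_top[of 0]]) (use that in \<open>simp add: flat_def mult.commute\<close>)
  qed
  have "(\<lambda>n. \<Prod>i\<in>Basis. flat 1 (real n * (x \<bullet> i - a \<bullet> i)) * flat 1 (real n * (b \<bullet> i - x \<bullet> i))) \<longlonglongrightarrow> (\<Prod>i\<in>(Basis::'a set). 1 * 1)"
    by (intro tendsto_prod tendsto_mult fl) (use True in \<open>auto simp: mem_box\<close>)
  then show ?thesis using True by (simp add: box_bump_def[abs_def] algebra_simps)
next
  case False
  then show ?thesis by (simp add: box_bump_zero)
qed

lemma box_bump_test:
  assumes "cbox a b \<subseteq> V" shows "box_bump a b n \<in> euclidean_test_functions V"
proof -
  have pr: "(\<lambda>x. \<Prod>i\<in>I. f i x) \<in> flat_algebra" if "finite I" "\<And>i. i \<in> I \<Longrightarrow> f i \<in> flat_algebra"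
    for I :: "'a set" and f :: "'a \<Rightarrow> 'a \<Rightarrow> real"
    using that by (induction I) (auto intro: flat_algebra.const flat_algebra.mult)
  have "box_bump a b n \<in> flat_algebra"
    unfolding box_bump_def[abs_def] by (intro pr flat_algebra.mult flat_algebra.flat finite_Basis)
  then have "smooth_on (box_bump a b n) UNIV"
    unfolding smooth_on_def
      using flat_algebra_Ck by (intro ballI exI[of _ UNIV] exI[of _ "box_bump a b n"]) auto
  then show ?thesis
    unfolding euclidean_test_functions_def
      using assms box_bump_zero[of _ a b n] box_subset_cbox[of a b]
    by (auto intro!: exI[of _ "cbox a b"])
qed

section \<open>The fundamental lemma of the calculus of variations\<close>

lemma AE_lborel_box_cbox: "AE x in lborel. x \<in> cbox a b \<longleftrightarrow> x \<in> box a (b :: 'a::euclidean_space)"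
proof (rule AE_I')
  have "negligible (cbox a b - box a b)" by (rule negligible_frontier_interval)
  then show "cbox a b - box a b \<in> null_sets lborel"
    by (simp add: negligible_iff_null_sets null_sets_completion_iff)
qed (use box_subset_cbox[of a b] in auto)

text \<open>\<open>ennreal\<close> truncates negative values, so \<open>P\<close> and
  \<open>N\<close> have the positive and the negative part of h as densities. They agree on boxes,
  an intersection-stable generator of the Borel sets; hence the measures are equal, and so are the
  densities almost everywhere.\<close>

lemma AE_zero_if_integral_boxes_zero:
  fixes h :: "'a::euclidean_space \<Rightarrow> real"
  assumes h: "integrable lborel h" and z: "\<And>a b. (\<integral>x. indicator (box a b) x * h x \<partial>lborel) = 0"
  shows "AE x in lborel. h x = 0"
proof -
  note [measurable] = borel_measurable_integrable[OF h]
  define P where "P = density lborel (\<lambda>x. ennreal (h x))"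
  define N where "N = density lborel (\<lambda>x. ennreal (- h x))"
  have fin: "(\<integral>\<^sup>+x. ennreal (g x) \<partial>lborel) < \<infinity>" if "integrable lborel g" for g :: "'a \<Rightarrow> real"
  proof -
    have "(\<integral>\<^sup>+x. ennreal (g x) \<partial>lborel) \<le> (\<integral>\<^sup>+x. ennreal (norm (g x)) \<partial>lborel)"
      by (intro nn_integral_mono) (simp add: ennreal_leI)
    also have "\<dots> < \<infinity>" using that by (simp add: integrable_iff_bounded)
    finally show ?thesis .
  qed
  have eq: "emeasure P (box a b) = emeasure N (box a b)" and fb: "emeasure P (box a b) < \<infinity>" for a b
  proof -
    have i: "integrable lborel (\<lambda>x. indicator (box a b) x * h x)"
      using integrable_mult_indicator[OF _ h, of "box a b"] by simp
    have 1: "emeasure P (box a b) = (\<integral>\<^sup>+x. ennreal (indicator (box a b) x * h x) \<partial>lborel)"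
      unfolding P_def
        by (subst emeasure_density) (auto intro!: nn_integral_cong split: split_indicator)
    have 2: "emeasure N (box a b) = (\<integral>\<^sup>+x. ennreal (- (indicator (box a b) x * h x)) \<partial>lborel)"
      unfolding N_def
        by (subst emeasure_density) (auto intro!: nn_integral_cong split: split_indicator)
    have f1: "emeasure P (box a b) < \<infinity>" "emeasure N (box a b) < \<infinity>"
      unfolding 1 2 using fin[OF i] fin[OF integrable_minus[OF i]] by auto
    have "enn2real (emeasure P (box a b)) = enn2real (emeasure N (box a b))"
      using z[of a b] unfolding real_lebesgue_integral_def[OF i] 1 2 by simp
    then show "emeasure P (box a b) = emeasure N (box a b)" "emeasure P (box a b) < \<infinity>"
      using f1 by (metis ennreal_enn2real infinity_ennreal_def)+
  qed
  have "P = N"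
  proof (rule measure_eqI_generator_eq)
    show "Int_stable (range (\<lambda>(a, b). box a b :: 'a set))"
      by (auto simp: Int_stable_def box_Int_box)
    show "sets P = sigma_sets UNIV (range (\<lambda>(a, b). box a b))" "sets N = sigma_sets UNIV (range (\<lambda>(a, b). box a b))"
      by (simp_all add: P_def N_def borel_eq_box sets_measure_of)
    show "range (\<lambda>n::nat. box (- (real n *\<^sub>R One)) (real n *\<^sub>R One) :: 'a set) \<subseteq> range (\<lambda>(a, b). box a b)" by auto
    show "(\<Union>n::nat. box (- (real n *\<^sub>R One)) (real n *\<^sub>R One) :: 'a set) = UNIV"
      by (rule UN_box_eq_UNIV)
  qed (use eq fb in \<open>auto simp: less_top[symmetric]\<close>)
  moreover have "(\<integral>\<^sup>+x. ennreal (h x) \<partial>lborel) \<noteq> \<infinity>" using fin[OF h] by auto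
  ultimately have "AE x in lborel. ennreal (h x) = ennreal (- h x)"
    unfolding P_def N_def by (subst finite_density_unique[symmetric]) auto
  then show ?thesis
  proof (eventually_elim)
    case (elim x)
    then show ?case by (cases "0 \<le> h x") (auto simp: ennreal_neg ennreal_eq_0_iff dest: sym)
  qed
qed

text \<open>On a closed box inside V the bump functions tend boundedly to the indicator of the open
  box, so the integral of h over every such box is zero and h vanishes almost everywhere there.
  Countably many closed boxes exhaust V. Local integrability is what a chart provides for the
  coordinates of a weak differential.\<close>

lemma fundamental_lemma:
  fixes h :: "'a::euclidean_space \<Rightarrow> real"
  assumes V: "open V"
    and loc: "\<And>K. compact K \<Longrightarrow> K \<subseteq> V \<Longrightarrow> integrable lborel (\<lambda>x. indicator K x * h x)"
    and z: "\<And>\<psi>. \<psi> \<in> euclidean_test_functions V \<Longrightarrow> (LINT x:V|lborel. h x * \<psi> x) = 0"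
  shows "AE x in lborel. x \<in> V \<longrightarrow> h x = 0"
proof -
  have box0: "(\<integral>x. indicator (box a b) x * h x \<partial>lborel) = 0" if ab: "cbox a b \<subseteq> V" for a b
  proof -
    have i: "integrable lborel (\<lambda>x. indicator (cbox a b) x * h x)" using ab by (intro loc) auto
    have s: "indicator V x * (h x * box_bump a b n x) = box_bump a b n x * (indicator (cbox a b) x * h x)" for n x
      using ab box_subset_cbox[of a b] box_bump_zero[of x a b n] by (auto simp: indicator_def)
    have bm: "box_bump a b n \<in> borel_measurable lborel" for n
      unfolding box_bump_def[abs_def]
      by (intro borel_measurable_prod borel_measurable_times)
        (simp_all, (intro borel_measurable_continuous_onI continuous_on_flat continuous_intros)+)
    have "(\<lambda>n. \<integral>x. box_bump a b n x * (indicator (cbox a b) x * h x) \<partial>lborel)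
        \<longlonglongrightarrow> (\<integral>x. indicator (box a b) x * (indicator (cbox a b) x * h x) \<partial>lborel)"
    proof (rule integral_dominated_convergence[where w="\<lambda>x. \<bar>indicator (cbox a b) x * h x\<bar>"])
      show "AE x in lborel. (\<lambda>n. box_bump a b n x * (indicator (cbox a b) x * h x)) \<longlonglongrightarrow> indicator (box a b) x * (indicator (cbox a b) x * h x)"
        by (intro AE_I2 tendsto_intros box_bump_tendsto)
      show "AE x in lborel. norm (box_bump a b n x * (indicator (cbox a b) x * h x)) \<le> \<bar>indicator (cbox a b) x * h x\<bar>" for n
        using box_bump_bounds[of a b n] by (intro AE_I2) (simp add: abs_mult mult_left_le_one_le)
      show "(\<lambda>x. indicator (box a b) x * (indicator (cbox a b) x * h x)) \<in> borel_measurable lborel"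
        using i by (intro borel_measurable_times borel_measurable_integrable[OF i]) auto
      show "(\<lambda>x. box_bump a b n x * (indicator (cbox a b) x * h x)) \<in> borel_measurable lborel" for n
        by (intro borel_measurable_times bm borel_measurable_integrable[OF i])
    qed (use i in auto)
    moreover have "(\<integral>x. box_bump a b n x * (indicator (cbox a b) x * h x) \<partial>lborel) = 0" for n
      using z[OF box_bump_test[OF ab, of n]] by (simp add: set_lebesgue_integral_def s)
    ultimately have "(\<integral>x. indicator (box a b) x * (indicator (cbox a b) x * h x) \<partial>lborel) = 0"
      by (simp add: LIMSEQ_const_iff)
    moreover have "indicator (box a b) x * (indicator (cbox a b) x * h x) = indicator (box a b) x * h x" for x
      using box_subset_cbox[of a b] by (auto simp: indicator_def)
    ultimately show ?thesis by simp
  qed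
  have cb: "AE x in lborel. x \<in> cbox c d \<longrightarrow> h x = 0" if cd: "cbox c d \<subseteq> V" for c d
  proof -
    have "AE x in lborel. indicator (cbox c d) x * h x = 0"
    proof (rule AE_zero_if_integral_boxes_zero)
      show i: "integrable lborel (\<lambda>x. indicator (cbox c d) x * h x)" using cd by (intro loc) auto
      fix a b
      \<comment> \<open>An arbitrary test box is cut down to \<open>box c d\<close>. The
        intersection is again an open box, and if it is not empty its closure stays inside V, as
        \<open>box0\<close> requires.\<close>
      define a' where "a' = (\<Sum>i\<in>Basis. max (a \<bullet> i) (c \<bullet> i) *\<^sub>R i)"
      define b' where "b' = (\<Sum>i\<in>Basis. min (b \<bullet> i) (d \<bullet> i) *\<^sub>R i)"
      have I: "box a b \<inter> box c d = box a' b'" unfolding a'_def b'_def by (rule box_Int_box)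
      have "(\<integral>x. indicator (box a b) x * (indicator (cbox c d) x * h x) \<partial>lborel) = (\<integral>x. indicator (box a' b') x * h x \<partial>lborel)"
      proof (rule integral_cong_AE)
        show ae: "AE x in lborel. indicator (box a b) x * (indicator (cbox c d) x * h x) = indicator (box a' b') x * h x"
          using AE_lborel_box_cbox[of c d]
            by eventually_elim (auto simp: I[symmetric] indicator_def)
        show m: "(\<lambda>x. indicator (box a b) x * (indicator (cbox c d) x * h x)) \<in> borel_measurable lborel"
          by (intro borel_measurable_times borel_measurable_integrable[OF i]) auto
        have "(\<lambda>x. indicator (box a' b') x * h x) = (\<lambda>x. indicator (box a' b') x * (indicator (cbox c d) x * h x))"
          using box_subset_cbox[of c d] by (auto simp: I[symmetric] indicator_def fun_eq_iff)
        also have "\<dots> \<in> borel_measurable lborel"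
          by (intro borel_measurable_times borel_measurable_integrable[OF i]) auto
        finally show "(\<lambda>x. indicator (box a' b') x * h x) \<in> borel_measurable lborel" .
      qed
      also have "\<dots> = 0"
      proof (cases "box a' b' = {}")
        case False
        then have "closure (box a' b') = cbox a' b'" by (rule closure_box)
        moreover have "closure (box a' b') \<subseteq> cbox c d"
          by (rule closure_minimal) (use I box_subset_cbox[of c d] in auto)
        ultimately show ?thesis using cd by (intro box0) auto
      qed simp
      finally show "(\<integral>x. indicator (box a b) x * (indicator (cbox c d) x * h x) \<partial>lborel) = 0" .
    qed
    then show ?thesis by eventually_elim (auto simp: indicator_def split: if_splits)
  qed
  obtain \<D> where \<D>: "countable \<D>" "\<D> \<subseteq> Pow V" "\<And>X. X \<in> \<D> \<Longrightarrow> \<exists>a b. X = cbox a b" "\<Union>\<D> = V"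
    using open_countable_Union_open_cbox[OF V] by metis
  have "AE x in lborel. \<forall>X\<in>\<D>. x \<in> X \<longrightarrow> h x = 0"
    unfolding AE_ball_countable[OF \<D>(1)] using \<D>(2,3) cb by (metis PowD subsetD)
  then show ?thesis by eventually_elim (use \<D>(4) in auto)
qed

section \<open>Integration by parts\<close>

lemma integral_lborel_translate:
  fixes h :: "'a::euclidean_space \<Rightarrow> real"
  assumes [measurable]: "h \<in> borel_measurable borel"
  shows "(\<integral>x. h (x + c) \<partial>lborel) = (\<integral>x. h x \<partial>lborel)"
proof -
  have "(\<integral>x. h x \<partial>lborel) = (\<integral>x. h x \<partial>distr lborel borel ((+) c))" by (simp add: lborel_distr_plus)
  also have "\<dots> = (\<integral>x. h (c + x) \<partial>lborel)" by (subst integral_distr) auto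
  finally show ?thesis by (simp add: add.commute)
qed

lemma integrable_compact_support:
  fixes h :: "'a::euclidean_space \<Rightarrow> real"
  assumes "continuous_on UNIV h" "compact K" "\<And>x. x \<notin> K \<Longrightarrow> h x = 0"
  shows "integrable lborel h" "\<exists>B. \<forall>x. \<bar>h x\<bar> \<le> B"
proof -
  have "compact (h ` K)"
    by (rule compact_continuous_image[OF continuous_on_subset[OF assms(1)]]) (use assms in auto)
  then obtain B where "\<And>x. x \<in> K \<Longrightarrow> \<bar>h x\<bar> \<le> B"
    using compact_imp_bounded[of "h ` K"] by (auto simp: bounded_iff)
  then have B: "\<bar>h x\<bar> \<le> \<bar>B\<bar>" for x using assms(3)[of x] by (cases "x \<in> K") force+
  then show "\<exists>B. \<forall>x. \<bar>h x\<bar> \<le> B" by blast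
  have "integrable lborel (\<lambda>x. indicator K x *\<^sub>R h x)"
    using assms B emeasure_compact_finite[OF assms(2)]
      by (intro integrableI_bounded_set_indicator[of _ _ _ "\<bar>B\<bar>"])
      (auto intro!: borel_measurable_continuous_onI borel_compact)
  moreover have "(\<lambda>x. indicator K x *\<^sub>R h x) = h"
    using assms(3) by (auto simp: indicator_def fun_eq_iff)
  ultimately show "integrable lborel h" by simp
qed

text \<open>Difference quotients of h in the direction e have integral zero by translation
  invariance. With steps at most 1 they vanish outside a ball enlarged by the norm of e, and the
  mean value theorem bounds them there, so dominated convergence applies.\<close>

lemma integral_directional_derivative_zero:
  fixes h :: "'a::euclidean_space \<Rightarrow> real"
  assumes d: "\<And>x. (h has_derivative H x) (at x)" and c: "continuous_on UNIV (\<lambda>x. H x e)"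
    and K: "compact K" "\<And>x. x \<notin> K \<Longrightarrow> h x = 0"
  shows "(\<integral>x. H x e \<partial>lborel) = 0"
proof -
  have hc: "continuous_on UNIV h"
    using d by (intro continuous_at_imp_continuous_on ballI has_derivative_continuous) auto
  have hm[measurable]: "h \<in> borel_measurable borel"
    using hc by (rule borel_measurable_continuous_onI)
  have H0: "H x e = 0" if "x \<notin> K" for x
  proof -
    have "((\<lambda>_. 0) has_derivative H x) (at x)"
      by (rule has_derivative_transform_within_open[OF d, of "- K"]) (use K that in \<open>auto simp: compact_imp_closed open_Compl\<close>)
    then have "H x = (\<lambda>_. 0)" using has_derivative_unique has_derivative_const by blast
    then show ?thesis by simp
  qed
  obtain B where B: "\<And>x. \<bar>H x e\<bar> \<le> B" using integrable_compact_support(2)[OF c K(1) H0] by blast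
  obtain R where R: "K \<subseteq> cball 0 R"
    using compact_imp_bounded[OF K(1)] by (auto simp: bounded_iff subset_iff)
  define t where "t n = inverse (real (Suc n))" for n
  have t: "0 < t n" "t n \<le> 1" for n by (auto simp: t_def divide_simps)
  define f where "f n x = (h (x + t n *\<^sub>R e) - h x) / t n" for n x
  have hi: "integrable lborel h" by (rule integrable_compact_support(1)[OF hc K])
  have hti: "integrable lborel (\<lambda>x. h (x + c))" for c
    by (rule integrable_compact_support(1)[where K="(\<lambda>x. x - c) ` K"])
      (use K in \<open>auto intro!: continuous_on_compose2[OF hc] continuous_intros compact_continuous_image simp: image_iff\<close>, metis add_diff_cancel_right')
  have line: "((\<lambda>s. h (x + s *\<^sub>R e)) has_real_derivative H (x + s *\<^sub>R e) e) (at s)" for x s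
  proof -
    have "((\<lambda>s. x + s *\<^sub>R e) has_derivative (\<lambda>r. r *\<^sub>R e)) (at s)"
      by (auto intro!: derivative_eq_intros)
    from has_derivative_compose[OF this d]
    have "((\<lambda>s. h (x + s *\<^sub>R e)) has_derivative (\<lambda>r. H (x + s *\<^sub>R e) (r *\<^sub>R e))) (at s)" .
    moreover have "linear (H (x + s *\<^sub>R e))" using d by (rule has_derivative_linear)
    ultimately show ?thesis by (simp add: linear_cmul has_field_derivative_def mult_commute_abs)
  qed
  have fb: "\<bar>f n x\<bar> \<le> indicator (cball 0 (R + norm e)) x * B" for n x
  proof (cases "x \<in> cball 0 (R + norm e)")
    case True
    obtain \<theta> where \<theta>: "0 < \<theta>" "\<theta> < t n" "h (x + t n *\<^sub>R e) - h (x + 0 *\<^sub>R e) = (t n - 0) * H (x + \<theta> *\<^sub>R e) e"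
      using MVT2[OF t(1)[of n], of "\<lambda>s. h (x + s *\<^sub>R e)" "\<lambda>s. H (x + s *\<^sub>R e) e"] line by blast
    then have "f n x = H (x + \<theta> *\<^sub>R e) e" using t(1)[of n] by (simp add: f_def)
    then show ?thesis using True B by simp
  next
    case False
    have "norm x \<le> norm (x + t n *\<^sub>R e) + norm (t n *\<^sub>R e)"
      using norm_triangle_ineq4[of "x + t n *\<^sub>R e" "t n *\<^sub>R e"] by simp
    moreover have "norm (t n *\<^sub>R e) \<le> norm e" using t[of n] by (simp add: mult_left_le_one_le)
    ultimately have "x + t n *\<^sub>R e \<notin> cball 0 R" "x \<notin> cball 0 R"
      using False norm_ge_zero[of e] by (auto simp del: norm_ge_zero)
    then have "x + t n *\<^sub>R e \<notin> K" "x \<notin> K" using R by auto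
    then show ?thesis using False K by (simp add: f_def)
  qed
  have "(\<lambda>n. \<integral>x. f n x \<partial>lborel) \<longlonglongrightarrow> (\<integral>x. H x e \<partial>lborel)"
  proof (rule integral_dominated_convergence[where w="\<lambda>x. indicator (cball 0 (R + norm e)) x * B"])
    show "AE x in lborel. (\<lambda>n. f n x) \<longlonglongrightarrow> H x e"
    proof (rule AE_I2)
      fix x
      have "((\<lambda>r. (h (x + (0 + r) *\<^sub>R e) - h (x + 0 *\<^sub>R e)) / r) \<longlongrightarrow> H (x + 0 *\<^sub>R e) e) (at 0)"
        using line[of x 0] unfolding DERIV_def .
      moreover have "filterlim t (at 0) sequentially"
        unfolding filterlim_at t_def[abs_def] using LIMSEQ_inverse_real_of_nat by auto
      ultimately show "(\<lambda>n. f n x) \<longlonglongrightarrow> H x e"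
        unfolding f_def by (auto dest: filterlim_compose)
    qed
    show "integrable lborel (\<lambda>x. indicator (cball 0 (R + norm e)) x * B)"
      by (intro integrable_mult_left integrable_real_indicator emeasure_compact_finite compact_cball) simp
    show "f n \<in> borel_measurable lborel" for n unfolding f_def[abs_def] by measurable
    show "(\<lambda>x. H x e) \<in> borel_measurable lborel" using borel_measurable_continuous_onI[OF c] by simp
  qed (use fb in auto)
  moreover have "(\<integral>x. f n x \<partial>lborel) = 0" for n
    unfolding f_def using hi hti by (simp add: integral_lborel_translate)
  ultimately show ?thesis by (simp add: LIMSEQ_const_iff)
qed

lemma euclidean_test_functionsD:
  assumes "\<psi> \<in> euclidean_test_functions V"
  obtains K where "compact K" "K \<subseteq> V" "\<And>x. x \<notin> K \<Longrightarrow> \<psi> x = 0"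
    "\<And>x. (\<psi> has_derivative frechet_derivative \<psi> (at x)) (at x)"
    "\<And>v. continuous_on UNIV (\<lambda>x. frechet_derivative \<psi> (at x) v)" "continuous_on UNIV \<psi>"
    "\<And>x v. x \<notin> K \<Longrightarrow> frechet_derivative \<psi> (at x) v = 0"
proof -
  from assms obtain K where K: "compact K" "K \<subseteq> V" "\<And>x. x \<notin> K \<Longrightarrow> \<psi> x = 0" and s: "smooth_on \<psi> UNIV"
    unfolding euclidean_test_functions_def by auto
  have loc: "\<psi> differentiable (at x) \<and> isCont (\<lambda>x. frechet_derivative \<psi> (at x) v) x" for x v
  proof -
    from s[unfolded smooth_on_def, rule_format, OF UNIV_I, of x]
    obtain W g where W: "open W" "x \<in> W" "\<forall>k. Ck_on k g W" "\<forall>y\<in>W. g y = \<psi> y" by auto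
    from W(3)[rule_format, of "Suc 0"] have g: "\<And>y. y \<in> W \<Longrightarrow> g differentiable (at y)"
      "continuous_on W (\<lambda>y. frechet_derivative g (at y) v)" by auto
    have fd: "(\<psi> has_derivative frechet_derivative g (at y)) (at y)" if "y \<in> W" for y
      by (rule has_derivative_transform_within_open[of g _ y UNIV W]) (use W g that in \<open>auto simp: frechet_derivative_works\<close>)
    then have "frechet_derivative \<psi> (at y) = frechet_derivative g (at y)" if "y \<in> W" for y
      using frechet_derivative_at that by metis
    then have "continuous_on W (\<lambda>y. frechet_derivative \<psi> (at y) v)"
      using g(2) by (auto cong: continuous_on_cong)
    then show ?thesis
      using fd[OF W(2)] W by (auto simp: continuous_on_eq_continuous_at differentiable_def)
  qed
  have d: "(\<psi> has_derivative frechet_derivative \<psi> (at x)) (at x)" for x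
    using loc frechet_derivative_works by blast
  show ?thesis
  proof (rule that[OF K d])
    show "continuous_on UNIV (\<lambda>x. frechet_derivative \<psi> (at x) v)" for v
      using loc by (simp add: continuous_at_imp_continuous_on)
    show "continuous_on UNIV \<psi>"
      using d by (intro continuous_at_imp_continuous_on ballI has_derivative_continuous) auto
    fix x v assume "x \<notin> K"
    then have "((\<lambda>_. 0) has_derivative frechet_derivative \<psi> (at x)) (at x)"
      by (intro has_derivative_transform_within_open[OF d, of "- K"]) (use K in \<open>auto simp: compact_imp_closed open_Compl\<close>)
    then have "frechet_derivative \<psi> (at x) = (\<lambda>_. 0)"
      using has_derivative_unique has_derivative_const by blast
    then show "frechet_derivative \<psi> (at x) v = 0" by simp
  qed
qed

text \<open>The product of w with the test function, extended by zero, is continuously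
  differentiable on the whole space, since V and the complement of \<open>K\<close> form an open
  cover; its derivative therefore integrates to zero.\<close>

lemma integration_by_parts_test:
  fixes w :: "'a::euclidean_space \<Rightarrow> real"
  assumes V: "open V" and d: "\<And>x. x \<in> V \<Longrightarrow> (w has_derivative W x) (at x)"
    and c: "continuous_on V (\<lambda>x. W x e)" and \<psi>: "\<psi> \<in> euclidean_test_functions V"
  shows "(LINT x:V|lborel. w x * frechet_derivative \<psi> (at x) e) = - (LINT x:V|lborel. W x e * \<psi> x)"
proof -
  from \<psi> obtain K where K: "compact K" "K \<subseteq> V" "\<And>x. x \<notin> K \<Longrightarrow> \<psi> x = 0"
    and pd: "\<And>x. (\<psi> has_derivative frechet_derivative \<psi> (at x)) (at x)"
    and pc: "\<And>v. continuous_on UNIV (\<lambda>x. frechet_derivative \<psi> (at x) v)" "continuous_on UNIV \<psi>"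
    and p0: "\<And>x v. x \<notin> K \<Longrightarrow> frechet_derivative \<psi> (at x) v = 0"
      by (rule euclidean_test_functionsD) metis
  have oK: "open (- K)" using K(1) by (simp add: compact_imp_closed open_Compl)
  have U: "V \<union> - K = UNIV" using K(2) by auto
  have wc: "continuous_on V w"
    using d by (intro continuous_at_imp_continuous_on ballI has_derivative_continuous) auto
  have ext: "continuous_on UNIV (\<lambda>x. indicator V x * (g x * \<phi> x))"
    if "continuous_on V g" "continuous_on UNIV \<phi>" "\<And>x. x \<notin> K \<Longrightarrow> \<phi> x = 0" for g \<phi> :: "'a \<Rightarrow> real"
  proof -
    have "continuous_on (V \<union> - K) (\<lambda>x. indicator V x * (g x * \<phi> x))"
    proof (rule continuous_on_open_Un[OF V oK])
      have "continuous_on V (\<lambda>x. g x * \<phi> x)"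
        using that continuous_on_subset by (blast intro: continuous_on_mult)
      then show "continuous_on V (\<lambda>x. indicator V x * (g x * \<phi> x))"
        by (auto cong: continuous_on_cong)
      show "continuous_on (- K) (\<lambda>x. indicator V x * (g x * \<phi> x))"
        by (rule continuous_on_eq[OF continuous_on_const[of _ 0]]) (simp add: that(3))
    qed
    then show ?thesis by (simp add: U)
  qed
  define h where "h x = indicator V x * (w x * \<psi> x)" for x
  define H where "H x v = indicator V x * (w x * frechet_derivative \<psi> (at x) v) + indicator V x * (W x v * \<psi> x)" for x v
  have c1: "continuous_on UNIV (\<lambda>x. indicator V x * (w x * frechet_derivative \<psi> (at x) e))"
    by (rule ext[OF wc pc(1) p0])
  have c2: "continuous_on UNIV (\<lambda>x. indicator V x * (W x e * \<psi> x))" by (rule ext[OF c pc(2) K(3)])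
  have "(h has_derivative H x) (at x)" for x
  proof (cases "x \<in> V")
    case True
    have "((\<lambda>x. w x * \<psi> x) has_derivative (\<lambda>v. w x * frechet_derivative \<psi> (at x) v + W x v * \<psi> x)) (at x)"
      by (rule has_derivative_mult[OF d[OF True] pd])
    then have "(h has_derivative (\<lambda>v. w x * frechet_derivative \<psi> (at x) v + W x v * \<psi> x)) (at x)"
      by (rule has_derivative_transform_within_open[OF _ V True]) (simp add: h_def)
    then show ?thesis using True by (simp add: H_def[abs_def])
  next
    case False
    then have "x \<in> - K" using K by auto
    have "(h has_derivative (\<lambda>_. 0)) (at x)"
      by (rule has_derivative_transform_within_open[OF has_derivative_const oK \<open>x \<in> - K\<close>]) (simp add: h_def K)
    then show ?thesis using False by (simp add: H_def[abs_def])
  qed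
  then have "(\<integral>x. H x e \<partial>lborel) = 0"
    by (rule integral_directional_derivative_zero[OF _ _ K(1)]) (use c1 c2 K in \<open>auto simp: H_def h_def intro!: continuous_on_add\<close>)
  moreover have "integrable lborel (\<lambda>x. indicator V x * (w x * frechet_derivative \<psi> (at x) e))"
    by (rule integrable_compact_support(1)[OF c1 K(1)]) (simp add: p0)
  moreover have "integrable lborel (\<lambda>x. indicator V x * (W x e * \<psi> x))"
    by (rule integrable_compact_support(1)[OF c2 K(1)]) (simp add: K)
  ultimately show ?thesis
    unfolding H_def set_lebesgue_integral_def by (simp add: Bochner_Integration.integral_add)
qed

section \<open>Weak differentials\<close>

text \<open>Before an integral is split its parts must be shown to exist, because a Bochner integral
  without integrability has the default value 0.\<close>

lemma test_pairing_integrable: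
  fixes h :: "'a::euclidean_space \<Rightarrow> real"
  assumes loc: "\<And>K. compact K \<Longrightarrow> K \<subseteq> V \<Longrightarrow> integrable lborel (\<lambda>x. indicator K x * h x)"
    and K: "compact K" "K \<subseteq> V" and \<phi>: "continuous_on UNIV \<phi>" "\<And>x. x \<notin> K \<Longrightarrow> \<phi> x = 0"
  shows "set_integrable lborel V (\<lambda>x. h x * \<phi> x)"
proof -
  obtain B where B: "\<And>x. \<bar>\<phi> x\<bar> \<le> B" using integrable_compact_support(2)[OF \<phi>(1) K(1) \<phi>(2)] by blast
  note i = loc[OF K]
  have "integrable lborel (\<lambda>x. \<phi> x * (indicator K x * h x))"
  proof (rule Bochner_Integration.integrable_bound[where f="\<lambda>x. B * \<bar>indicator K x * h x\<bar>"])
    show "integrable lborel (\<lambda>x. B * \<bar>indicator K x * h x\<bar>)" using i by simp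
    show "(\<lambda>x. \<phi> x * (indicator K x * h x)) \<in> borel_measurable lborel"
      using borel_measurable_continuous_onI[OF \<phi>(1)] borel_measurable_integrable[OF i] by simp
    have "0 \<le> B" using B[of undefined] by linarith
    then show "AE x in lborel. norm (\<phi> x * (indicator K x * h x)) \<le> norm (B * \<bar>indicator K x * h x\<bar>)"
      using B by (intro AE_I2) (simp add: abs_mult mult_right_mono)
  qed
  moreover have "(\<lambda>x. \<phi> x * (indicator K x * h x)) = (\<lambda>x. indicator V x *\<^sub>R (h x * \<phi> x))"
    using K(2) \<phi>(2) by (auto simp: indicator_def fun_eq_iff)
  ultimately show ?thesis by (simp add: set_integrable_def)
qed

context riem
begin

text \<open>The volume density is positive on the chart image, so a null set of the manifold
  corresponds to a Lebesgue null set there.\<close>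

lemma AE_chart:
  assumes c: "c \<in> atlas M" and P: "AE p in vol M. P p"
  shows "AE x in lborel. x \<in> chart_img c \<longrightarrow> P (chart_inv c x)"
proof -
  from AE_E[OF P] obtain N where N: "{p \<in> space (vol M). \<not> P p} \<subseteq> N" "emeasure (vol M) N = 0" "N \<in> sets (vol M)" .
  have [measurable]: "N \<in> sets borel" using N(3) by simp
  have [measurable]: "chart_img c \<in> sets borel" by (rule img_borel[OF c])
  have "(\<integral>\<^sup>+p. indicator N p * indicator (chart_dom c) p \<partial>vol M) \<le> (\<integral>\<^sup>+p. indicator N p \<partial>vol M)"
    by (intro nn_integral_mono) (auto simp: indicator_def)
  also have "\<dots> = 0" using N by simp
  finally have "(\<integral>\<^sup>+x. indicator N (chart_inv c x) * ennreal (vol_density c x) * indicator (chart_img c) x \<partial>lborel) = 0"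
    using nn_integral_chart[OF c, of "indicator N"] by simp
  moreover have "(\<lambda>x. indicator N (chart_inv c x) * ennreal (vol_density c x) * indicator (chart_img c) x) \<in> borel_measurable lborel"
  proof -
    have [measurable]: "(\<lambda>x. if x \<in> chart_img c then chart_inv c x else undefined) \<in> borel_measurable borel"
      by (rule chart_inv_measurable[OF c])
    have [measurable]: "(\<lambda>x. indicator (chart_img c) x *\<^sub>R vol_density c x) \<in> borel_measurable borel"
      by (intro borel_measurable_continuous_on_indicator img_borel[OF c] continuous_intros continuous_on_det gram_continuous[OF c])
    have "(\<lambda>x. indicator N (if x \<in> chart_img c then chart_inv c x else undefined) * ennreal (indicator (chart_img c) x *\<^sub>R vol_density c x)) \<in> borel_measurable borel"
      by measurable
    moreover have "(\<lambda>x. indicator N (if x \<in> chart_img c then chart_inv c x else undefined) * ennreal (indicator (chart_img c) x *\<^sub>R vol_density c x))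
      = (\<lambda>x. indicator N (chart_inv c x) * ennreal (vol_density c x) * indicator (chart_img c) x)"
      by (auto simp: indicator_def fun_eq_iff)
    ultimately show ?thesis by simp
  qed
  ultimately have "AE x in lborel. indicator N (chart_inv c x) * ennreal (vol_density c x) * indicator (chart_img c) x = 0"
    by (simp add: nn_integral_0_iff_AE)
  then show ?thesis
  proof eventually_elim
    case (elim x)
    show ?case
    proof
      assume x: "x \<in> chart_img c"
      then have "chart_inv c x \<notin> N"
        using elim vol_density_pos[OF c x] by (auto simp: indicator_def ennreal_eq_0_iff split: if_splits)
      then show "P (chart_inv c x)" using N(1) by auto
    qed
  qed
qed

lemma AE_from_chart:
  assumes c: "c \<in> atlas M" and N: "N \<in> sets borel" "N \<subseteq> chart_dom c"
    and P: "AE x in lborel. x \<in> chart_img c \<longrightarrow> chart_inv c x \<notin> N"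
  shows "AE p in vol M. p \<notin> N"
proof -
  have "emeasure (vol M) N = (\<integral>\<^sup>+p. indicator N p \<partial>vol M)" using N by simp
  also have "\<dots> = (\<integral>\<^sup>+p. indicator N p * indicator (chart_dom c) p \<partial>vol M)"
    using N by (intro nn_integral_cong) (auto simp: indicator_def)
  also have "\<dots> = (\<integral>\<^sup>+x. indicator N (chart_inv c x) * ennreal (vol_density c x) * indicator (chart_img c) x \<partial>lborel)"
    by (rule nn_integral_chart[OF c]) (use N in auto)
  also have "\<dots> = (\<integral>\<^sup>+x. 0 \<partial>(lborel :: (real^'n) measure))"
    by (rule nn_integral_cong_AE) (use P in \<open>auto simp: indicator_def elim!: eventually_mono\<close>)
  finally have "N \<in> null_sets (vol M)" using N by (auto intro!: null_setsI)
  then show ?thesis by (rule AE_not_in)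
qed

section \<open>Covector fields in charts\<close>

lemma finite_atlas:
  obtains C where "finite C" "C \<subseteq> atlas M" "\<And>p. \<exists>c\<in>C. p \<in> chart_dom c"
proof -
  have "compact (UNIV :: 'm set)" using M by (simp add: compact_riemannian_manifold_def)
  then obtain D where "D \<subseteq> atlas M" "finite D" "UNIV \<subseteq> (\<Union>c\<in>D. chart_dom c)"
    by (rule compactE_image[of UNIV "atlas M" chart_dom]) (use dom_open atlas_cover in auto)
  then show ?thesis by (intro that[of D]) auto
qed

text \<open>The transformation rules for metrics and covector fields are conditional on a derivative
  of the transition map. This provides one, also at boundary points, from the smooth local
  extension.\<close>

lemma transition_derivative:
  assumes "c \<in> atlas M" "c' \<in> atlas M" "p \<in> chart_dom c \<inter> chart_dom c'"
  obtains D where "(transition c c' has_derivative D) (at (chart_map c p) within overlap_img c c')"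
proof -
  have s: "smooth_on (transition c c') (overlap_img c c')"
    using M assms by (auto simp: compact_riemannian_manifold_def smooth_atlas_def)
  have x: "chart_map c p \<in> overlap_img c c'" using assms by (auto simp: overlap_img_def)
  from smooth_on_local[OF s x] obtain W g where W: "open W" "chart_map c p \<in> W" "g differentiable (at (chart_map c p))"
    "\<And>y. y \<in> W \<inter> overlap_img c c' \<Longrightarrow> g y = transition c c' y" by metis
  then obtain D where D: "(g has_derivative D) (at (chart_map c p) within overlap_img c c')"
    by (auto simp: differentiable_def intro: has_derivative_at_withinI)
  obtain e where "0 < e" "ball (chart_map c p) e \<subseteq> W" using W(1,2) open_contains_ball by blast
  then have "(transition c c' has_derivative D) (at (chart_map c p) within overlap_img c c')"
    by (intro has_derivative_transform_within[OF D _ x]) (use W(4) in \<open>auto simp: dist_commute subset_iff\<close>)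
  then show ?thesis by (rule that)
qed

text \<open>The derivative D of the transition map is an isometry between the two Gram forms, hence
  injective, hence onto. If v solves A v = \<eta> in one chart, surjectivity shows that D v solves
  the corresponding equation in the other.\<close>

lemma covector_form_invariant:
  assumes \<omega>: "measurable_covector_field M \<omega>" and \<eta>: "measurable_covector_field M \<eta>"
    and c: "c \<in> atlas M" "c' \<in> atlas M" and p: "p \<in> chart_dom c" "p \<in> chart_dom c'"
  shows "\<omega> c p \<bullet> (matrix_inv (metric M c p) *v \<eta> c p) = \<omega> c' p \<bullet> (matrix_inv (metric M c' p) *v \<eta> c' p)"
proof -
  let ?A = "metric M c p" and ?A' = "metric M c' p"
  obtain D where D: "(transition c c' has_derivative D) (at (chart_map c p) within overlap_img c c')"
    by (rule transition_derivative[OF c, of p]) (use p in auto)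
  have w: "\<omega> c p \<bullet> v = \<omega> c' p \<bullet> D v" and e: "\<eta> c p \<bullet> v = \<eta> c' p \<bullet> D v" for v
    using \<omega> \<eta> c p D unfolding measurable_covector_field_def by blast+
  have g: "v \<bullet> (?A *v w) = D v \<bullet> (?A' *v D w)" for v w
    using M c p D unfolding compact_riemannian_manifold_def riemannian_metric_def by blast
  have pd: "pos_def ?A" "pos_def ?A'" using c p gram_pos_def by auto
  have lin: "linear D" using D by (rule has_derivative_linear)
  have "inj D"
    unfolding linear_injective_0[OF lin]
  proof (intro allI impI)
    fix v assume "D v = 0"
    then have "v \<bullet> (?A *v v) = 0" by (simp add: g)
    then show "v = 0" using pd(1) unfolding pos_def_def by force
  qed
  then have surj: "surj D" using lin linear_injective_imp_surjective by blast
  define v where "v = matrix_inv ?A *v \<eta> c p"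
  have Av: "?A *v v = \<eta> c p" by (simp add: v_def matrix_inv_apply[OF pos_def_invertible[OF pd(1)]])
  have "z \<bullet> (?A' *v D v) = z \<bullet> \<eta> c' p" for z
  proof -
    obtain y where y: "z = D y" using surj by blast
    have "D y \<bullet> (?A' *v D v) = y \<bullet> \<eta> c p" using g[of y v] by (simp add: Av)
    also have "\<dots> = D y \<bullet> \<eta> c' p" using e[of y] by (simp add: inner_commute)
    finally show ?thesis by (simp add: y)
  qed
  then have "?A' *v D v = \<eta> c' p" using vector_eq_ldot by blast
  then have "matrix_inv ?A' *v \<eta> c' p = D v"
    using matrix_inv_apply(2)[OF pos_def_invertible[OF pd(2)]] by metis
  then show ?thesis using w[of v] by (simp add: v_def)
qed

text \<open>Replaces the chart picked by \<open>SOME\<close> in \<open>covector_inner\<close> by any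
  chart at hand.\<close>

lemma covector_inner_chart:
  assumes "measurable_covector_field M \<omega>" "measurable_covector_field M \<eta>" "c \<in> atlas M" "p \<in> chart_dom c"
  shows "covector_inner M \<omega> \<eta> p = \<omega> c p \<bullet> (matrix_inv (metric M c p) *v \<eta> c p)"
proof -
  define c' where "c' = (SOME c. c \<in> atlas M \<and> p \<in> chart_dom c)"
  have "c' \<in> atlas M \<and> p \<in> chart_dom c'"
    unfolding c'_def by (rule someI[of _ c]) (use assms in auto)
  then show ?thesis
    using covector_form_invariant[OF assms(1,2) assms(3) _ assms(4), of c']
      by (simp add: covector_inner_def c'_def Let_def)
qed

text \<open>The chart chosen in the definition varies with the point in an uncontrolled way; on each
  domain of a finite atlas the value is nevertheless given by one measurable formula.\<close>

lemma covector_inner_measurable: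
  assumes \<omega>: "measurable_covector_field M \<omega>" and \<eta>: "measurable_covector_field M \<eta>"
  shows "covector_inner M \<omega> \<eta> \<in> borel_measurable borel"
proof -
  obtain C where C: "finite C" "C \<subseteq> atlas M" "\<And>p. \<exists>c\<in>C. p \<in> chart_dom c"
    by (rule finite_atlas) blast
  show ?thesis
  proof (rule measurable_piecewise_restrict[of "chart_dom ` C"])
    show "countable (chart_dom ` C)" using C by (simp add: countable_finite)
    show "space borel \<subseteq> \<Union> (chart_dom ` C)" using C(3) by auto
    show "S \<inter> space borel \<in> sets borel" if "S \<in> chart_dom ` C" for S
      using that C(2) dom_open by auto
    fix S assume "S \<in> chart_dom ` C"
    then obtain c where c: "c \<in> atlas M" "S = chart_dom c" using C(2) by auto
    have "(\<lambda>p. \<omega> c p \<bullet> (matrix_inv (metric M c p) *v \<eta> c p)) \<in> borel_measurable (restrict_space borel (chart_dom c))"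
    proof (rule borel_measurable_inverse_form)
      fix i j
      have "continuous_on (chart_dom c) (\<lambda>p. gram c (chart_map c p) $ i $ j)"
        by (rule continuous_on_component[OF continuous_on_component], rule continuous_on_compose2[OF gram_continuous[OF c(1)] chart_cont(1)[OF c(1)]])
          (simp add: chart_img_def)
      then have "continuous_on (chart_dom c) (\<lambda>p. metric M c p $ i $ j)"
        by (rule continuous_on_eq) (simp add: chart_inv_map[OF c(1)])
      then show "(\<lambda>p. metric M c p $ i $ j) \<in> borel_measurable (restrict_space borel (chart_dom c))"
        by (rule borel_measurable_continuous_on_restrict)
      show "(\<lambda>p. \<omega> c p $ i) \<in> borel_measurable (restrict_space borel (chart_dom c))"
        "(\<lambda>p. \<eta> c p $ i) \<in> borel_measurable (restrict_space borel (chart_dom c))"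
        using \<omega> \<eta> c by (auto intro!: borel_measurable_vec_nth simp: measurable_covector_field_def)
    next
      show "invertible (metric M c p)" if "p \<in> space (restrict_space borel (chart_dom c))" for p
        using that c(2) pos_def_invertible[OF gram_pos_def[OF c(1)]]
          by (simp add: space_restrict_space)
    qed
    then show "covector_inner M \<omega> \<eta> \<in> borel_measurable (restrict_space borel S)"
      unfolding c(2)
        by (rule measurable_cong[THEN iffD1, rotated]) (use c covector_inner_chart[OF \<omega> \<eta> c(1)] in \<open>auto simp: space_restrict_space\<close>)
  qed
qed

lemma covector_inner_nonneg:
  assumes \<omega>: "measurable_covector_field M \<omega>" shows "0 \<le> covector_inner M \<omega> \<omega> p"
proof -
  obtain c where c: "c \<in> atlas M" "p \<in> chart_dom c" using atlas_cover by blast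
  show ?thesis
    using pos_def_inverse_nonneg[OF gram_pos_def[OF c]] by (simp add: covector_inner_chart[OF \<omega> \<omega> c])
qed

lemma measurable_covector_field_add:
  assumes \<omega>: "measurable_covector_field M \<omega>" and \<eta>: "measurable_covector_field M \<eta>"
  shows "measurable_covector_field M (\<lambda>c p. \<omega> c p + s *\<^sub>R \<eta> c p)"
  unfolding measurable_covector_field_def
proof (intro conjI ballI allI impI)
  fix c assume "c \<in> atlas M"
  then show "(\<lambda>p. \<omega> c p + s *\<^sub>R \<eta> c p) \<in> borel_measurable (restrict_space borel (chart_dom c))"
    using \<omega> \<eta>
      by (auto intro!: borel_measurable_add borel_measurable_scaleR simp: measurable_covector_field_def)
next
  fix c c' p D v
  assume "c \<in> atlas M" "c' \<in> atlas M" "p \<in> chart_dom c \<inter> chart_dom c'"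
    "(transition c c' has_derivative D) (at (chart_map c p) within overlap_img c c')"
  then have "\<omega> c p \<bullet> v = \<omega> c' p \<bullet> D v" "\<eta> c p \<bullet> v = \<eta> c' p \<bullet> D v"
    using \<omega> \<eta> unfolding measurable_covector_field_def by blast+
  then show "(\<omega> c p + s *\<^sub>R \<eta> c p) \<bullet> v = (\<omega> c' p + s *\<^sub>R \<eta> c' p) \<bullet> D v"
    by (simp add: inner_add_left)
qed

lemma covector_inner_add_le:
  assumes \<omega>: "measurable_covector_field M \<omega>" and \<eta>: "measurable_covector_field M \<eta>" and d: "0 < \<delta>"
  shows "covector_inner M (\<lambda>c p. \<omega> c p + s *\<^sub>R \<eta> c p) (\<lambda>c p. \<omega> c p + s *\<^sub>R \<eta> c p) p
    \<le> (1 + \<delta>) * covector_inner M \<omega> \<omega> p + (1 + 1 / \<delta>) * (s\<^sup>2 * covector_inner M \<eta> \<eta> p)"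
proof -
  obtain c where c: "c \<in> atlas M" "p \<in> chart_dom c" using atlas_cover by blast
  note a = measurable_covector_field_add[OF \<omega> \<eta>, of s]
  show ?thesis
    using pos_def_inverse_add[OF gram_pos_def[OF c] d, of "\<omega> c p" "s *\<^sub>R \<eta> c p"]
    by (simp add: covector_inner_chart[OF \<omega> \<omega> c] covector_inner_chart[OF \<eta> \<eta> c] covector_inner_chart[OF a a c]
        matrix_vector_mult_scaleR power2_eq_square mult.assoc)
qed

lemma chart_pullback_measurable:
  fixes F :: "'m \<Rightarrow> real"
  assumes c: "c \<in> atlas M" and F: "F \<in> borel_measurable (restrict_space borel (chart_dom c))"
  shows "(\<lambda>x. indicator (chart_img c) x * F (chart_inv c x)) \<in> borel_measurable borel"
proof -
  have "chart_inv c \<in> restrict_space borel (chart_img c) \<rightarrow>\<^sub>M restrict_space borel (chart_dom c)"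
  proof (rule measurable_restrict_space2)
    show "chart_inv c \<in> space (restrict_space borel (chart_img c)) \<rightarrow> chart_dom c"
      using chart_inv_dom[OF c] by (simp add: space_restrict_space)
    show "chart_inv c \<in> borel_measurable (restrict_space borel (chart_img c))"
      by (rule borel_measurable_continuous_on_restrict[OF chart_cont(2)[OF c]])
  qed
  then have "(\<lambda>x. F (chart_inv c x)) \<in> borel_measurable (restrict_space borel (chart_img c))"
    by (rule measurable_compose[OF _ F])
  then show ?thesis
    using borel_measurable_restrict_space_iff[of "chart_img c" borel "\<lambda>x. F (chart_inv c x)"] img_borel[OF c] by simp
qed

lemma restrict_dom_measurable:
  "f \<in> borel_measurable borel \<Longrightarrow> f \<in> borel_measurable (restrict_space borel (chart_dom c))"
  by (rule measurable_restrict_space1)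

text \<open>On a compact part of the chart image the volume density is bounded below; the constant
  is the reciprocal of that bound.\<close>

lemma nn_integral_pullback_le:
  assumes c: "c \<in> atlas M" and K: "compact K" "K \<subseteq> chart_img c"
  obtains m where "0 < m" "\<And>h. h \<in> borel_measurable borel \<Longrightarrow>
    (\<integral>\<^sup>+x. indicator K x * h (chart_inv c x) \<partial>lborel) \<le> ennreal m * (\<integral>\<^sup>+p. h p \<partial>vol M)"
proof -
  obtain m where m: "0 < m" "\<And>x. x \<in> K \<Longrightarrow> m \<le> vol_density c x" by (rule gram_bounds[OF c K]) metis
  show ?thesis
  proof (rule that)
    show "0 < 1 / m" using m by simp
    fix h :: "'m \<Rightarrow> ennreal" assume h: "h \<in> borel_measurable borel"
    have "(\<integral>\<^sup>+x. indicator K x * h (chart_inv c x) \<partial>lborel)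
        \<le> (\<integral>\<^sup>+x. ennreal (1 / m) * h (chart_inv c x) * ennreal (vol_density c x) * indicator (chart_img c) x \<partial>lborel)"
    proof (rule nn_integral_mono)
      fix x
      show "indicator K x * h (chart_inv c x) \<le> ennreal (1 / m) * h (chart_inv c x) * ennreal (vol_density c x) * indicator (chart_img c) x"
      proof (cases "x \<in> K")
        case True
        have "1 \<le> ennreal (1 / m) * ennreal (vol_density c x)"
          using m(1) m(2)[OF True] by (subst ennreal_mult'[symmetric]) (auto simp: le_divide_eq)
        then have "1 * h (chart_inv c x) \<le> (ennreal (1 / m) * ennreal (vol_density c x)) * h (chart_inv c x)"
          by (rule mult_right_mono) simp
        then show ?thesis using True K by (auto simp: mult_ac)
      qed simp
    qed
    also have "\<dots> = (\<integral>\<^sup>+p. (ennreal (1 / m) * h p) * indicator (chart_dom c) p \<partial>vol M)"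
      by (rule nn_integral_chart[OF c, symmetric]) (use h in simp)
    also have "\<dots> \<le> (\<integral>\<^sup>+p. ennreal (1 / m) * h p \<partial>vol M)"
      by (intro nn_integral_mono) (auto simp: indicator_def)
    also have "\<dots> = ennreal (1 / m) * (\<integral>\<^sup>+p. h p \<partial>vol M)" by (rule nn_integral_cmult) (use h in simp)
    finally show "(\<integral>\<^sup>+x. indicator K x * h (chart_inv c x) \<partial>lborel) \<le> ennreal (1 / m) * (\<integral>\<^sup>+p. h p \<partial>vol M)" .
  qed
qed

text \<open>On the compact set |F| <= 1 + F^2 <= 1 + |H|. The constant is integrable because the set
  has finite measure, and H because the volume density is bounded below.\<close>

lemma chart_pullback_integrable:
  fixes F :: "'m \<Rightarrow> real"
  assumes c: "c \<in> atlas M" and F: "F \<in> borel_measurable (restrict_space borel (chart_dom c))"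
    and K: "compact K" "K \<subseteq> chart_img c"
    and H: "integrable (vol M) H" "\<And>x. x \<in> K \<Longrightarrow> (F (chart_inv c x))\<^sup>2 \<le> H (chart_inv c x)"
  shows "integrable lborel (\<lambda>x. indicator K x * F (chart_inv c x))"
proof -
  have Km: "K \<in> sets borel" using K by (simp add: borel_compact)
  have m: "(\<lambda>x. indicator K x * F (chart_inv c x)) \<in> borel_measurable borel"
  proof -
    have "(\<lambda>x. indicator K x * (indicator (chart_img c) x * F (chart_inv c x))) \<in> borel_measurable borel"
      by (rule borel_measurable_times[OF borel_measurable_indicator[OF Km] chart_pullback_measurable[OF c F]])
    moreover have "(\<lambda>x. indicator K x * (indicator (chart_img c) x * F (chart_inv c x))) = (\<lambda>x. indicator K x * F (chart_inv c x))"
      using K by (auto simp: indicator_def fun_eq_iff)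
    ultimately show ?thesis by simp
  qed
  have Hm: "(\<lambda>p. ennreal \<bar>H p\<bar>) \<in> borel_measurable borel"
    using borel_measurable_integrable[OF H(1)] by simp
  obtain k where k: "0 < k" "\<And>h. h \<in> borel_measurable borel \<Longrightarrow>
    (\<integral>\<^sup>+x. indicator K x * h (chart_inv c x) \<partial>lborel) \<le> ennreal k * (\<integral>\<^sup>+p. h p \<partial>vol M)"
    by (rule nn_integral_pullback_le[OF c K]) blast
  have "(\<integral>\<^sup>+x. ennreal (norm (indicator K x * F (chart_inv c x))) \<partial>lborel)
     \<le> (\<integral>\<^sup>+x. indicator K x + indicator K x * ennreal \<bar>H (chart_inv c x)\<bar> \<partial>lborel)"
  proof (rule nn_integral_mono)
    fix x
    show "ennreal (norm (indicator K x * F (chart_inv c x))) \<le> indicator K x + indicator K x * ennreal \<bar>H (chart_inv c x)\<bar>"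
    proof (cases "x \<in> K")
      case True
      have "\<bar>F (chart_inv c x)\<bar> \<le> 1 + (F (chart_inv c x))\<^sup>2"
        using sum_squares_bound[of "1" "\<bar>F (chart_inv c x)\<bar>"] by (simp add: field_simps)
      also have "\<dots> \<le> 1 + \<bar>H (chart_inv c x)\<bar>" using H(2)[OF True] by linarith
      finally have "ennreal \<bar>F (chart_inv c x)\<bar> \<le> ennreal (1 + \<bar>H (chart_inv c x)\<bar>)"
        by (rule ennreal_leI)
      then show ?thesis using True by simp
    qed simp
  qed
  also have "\<dots> = emeasure lborel K + (\<integral>\<^sup>+x. indicator K x * ennreal \<bar>H (chart_inv c x)\<bar> \<partial>lborel)"
  proof (subst nn_integral_add)
    note [measurable] = Km
    have [measurable]: "(\<lambda>x. indicator (chart_img c) x * \<bar>H (chart_inv c x)\<bar>) \<in> borel_measurable borel"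
      using borel_measurable_integrable[OF H(1)]
        by (intro chart_pullback_measurable[OF c restrict_dom_measurable]) simp
    have "(\<lambda>x. indicator K x * ennreal (indicator (chart_img c) x * \<bar>H (chart_inv c x)\<bar>)) \<in> borel_measurable borel"
      by measurable
    also have "(\<lambda>x. indicator K x * ennreal (indicator (chart_img c) x * \<bar>H (chart_inv c x)\<bar>)) = (\<lambda>x. indicator K x * ennreal \<bar>H (chart_inv c x)\<bar>)"
      using K by (auto simp: indicator_def fun_eq_iff)
    finally show "(\<lambda>x. indicator K x * ennreal \<bar>H (chart_inv c x)\<bar>) \<in> borel_measurable lborel"
      by simp
  qed (use Km in auto)
  also have "\<dots> \<le> emeasure lborel K + ennreal k * (\<integral>\<^sup>+p. ennreal \<bar>H p\<bar> \<partial>vol M)"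
    by (intro add_left_mono k(2)[OF Hm])
  also have "\<dots> < \<infinity>"
    using emeasure_compact_finite[OF K(1)] H(1)
      by (simp add: integrable_iff_bounded ennreal_mult_less_top)
  finally show ?thesis using m by (simp add: integrable_iff_bounded)
qed

section \<open>Linearity and uniqueness of weak differentials\<close>

lemma L2_pullback_integrable:
  assumes c: "c \<in> atlas M" and u: "u \<in> L2 M" and K: "compact K" "K \<subseteq> chart_img c"
  shows "integrable lborel (\<lambda>x. indicator K x * u (chart_inv c x))"
  by (rule chart_pullback_integrable[OF c restrict_dom_measurable K, of _ "\<lambda>p. (u p)\<^sup>2"]) (use u in \<open>auto simp: L2_def\<close>)

lemma covector_pullback_integrable:
  assumes c: "c \<in> atlas M" and \<omega>: "measurable_covector_field M \<omega>" "integrable (vol M) (covector_inner M \<omega> \<omega>)"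
    and K: "compact K" "K \<subseteq> chart_img c"
  shows "integrable lborel (\<lambda>x. indicator K x * \<omega> c (chart_inv c x) $ i)"
proof -
  obtain m where m: "0 < m" "\<And>x \<xi>. x \<in> K \<Longrightarrow> m * (norm \<xi>)\<^sup>2 \<le> \<xi> \<bullet> (matrix_inv (gram c x) *v \<xi>)"
    by (rule gram_bounds[OF c K]) metis
  show ?thesis
  proof (rule chart_pullback_integrable[OF c _ K, of _ "\<lambda>p. covector_inner M \<omega> \<omega> p / m"])
    show "(\<lambda>p. \<omega> c p $ i) \<in> borel_measurable (restrict_space borel (chart_dom c))"
      using \<omega> c by (auto intro!: borel_measurable_vec_nth simp: measurable_covector_field_def)
    show "integrable (vol M) (\<lambda>p. covector_inner M \<omega> \<omega> p / m)" using \<omega> by simp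
    fix x assume x: "x \<in> K"
    then have d: "chart_inv c x \<in> chart_dom c" using K chart_inv_dom[OF c] by auto
    let ?\<xi> = "\<omega> c (chart_inv c x)"
    have "(?\<xi> $ i)\<^sup>2 \<le> (norm ?\<xi>)\<^sup>2"
      using component_le_norm_cart[of ?\<xi> i] by (metis abs_le_square_iff abs_norm_cancel)
    also have "\<dots> \<le> covector_inner M \<omega> \<omega> (chart_inv c x) / m"
      using m(1) m(2)[OF x, of ?\<xi>] by (simp add: covector_inner_chart[OF \<omega>(1) \<omega>(1) c d] field_simps)
    finally show "(?\<xi> $ i)\<^sup>2 \<le> covector_inner M \<omega> \<omega> (chart_inv c x) / m" .
  qed
qed

lemma weak_differential_add:
  assumes u: "u \<in> L2 M" "weak_differential M u \<omega>" and w: "w \<in> L2 M" "weak_differential M w \<eta>"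
  shows "weak_differential M (\<lambda>x. u x + s * w x) (\<lambda>c p. \<omega> c p + s *\<^sub>R \<eta> c p)"
proof -
  have \<omega>: "measurable_covector_field M \<omega>" "integrable (vol M) (covector_inner M \<omega> \<omega>)"
    and \<eta>: "measurable_covector_field M \<eta>" "integrable (vol M) (covector_inner M \<eta> \<eta>)"
    using u w by (auto simp: weak_differential_def)
  note a = measurable_covector_field_add[OF \<omega>(1) \<eta>(1), of s]
  show ?thesis
    unfolding weak_differential_def
  proof (intro conjI ballI allI)
    show "measurable_covector_field M (\<lambda>c p. \<omega> c p + s *\<^sub>R \<eta> c p)" by (rule a)
    show "integrable (vol M) (covector_inner M (\<lambda>c p. \<omega> c p + s *\<^sub>R \<eta> c p) (\<lambda>c p. \<omega> c p + s *\<^sub>R \<eta> c p))"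
    proof (rule Bochner_Integration.integrable_bound)
      show "integrable (vol M) (\<lambda>p. (1 + 1) * covector_inner M \<omega> \<omega> p + (1 + 1 / 1) * (s\<^sup>2 * covector_inner M \<eta> \<eta> p))"
        using \<omega> \<eta> by simp
      show "AE p in vol M. norm (covector_inner M (\<lambda>c p. \<omega> c p + s *\<^sub>R \<eta> c p) (\<lambda>c p. \<omega> c p + s *\<^sub>R \<eta> c p) p)
         \<le> norm ((1 + 1) * covector_inner M \<omega> \<omega> p + (1 + 1 / 1) * (s\<^sup>2 * covector_inner M \<eta> \<eta> p))"
        using covector_inner_add_le[OF \<omega>(1) \<eta>(1), of 1 s] covector_inner_nonneg[OF a]
        by (intro AE_I2) (smt (verit) real_norm_def)
    qed (use covector_inner_measurable[OF a a] in simp)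
  next
    fix c \<psi> i assume c: "c \<in> atlas M" and \<psi>: "\<psi> \<in> euclidean_test_functions (interior (chart_img c))"
    let ?V = "interior (chart_img c)"
    from \<psi> obtain K where K: "compact K" "K \<subseteq> ?V" "\<And>x. x \<notin> K \<Longrightarrow> \<psi> x = 0"
      and pc: "\<And>v. continuous_on UNIV (\<lambda>x. frechet_derivative \<psi> (at x) v)" "continuous_on UNIV \<psi>"
      and p0: "\<And>x v. x \<notin> K \<Longrightarrow> frechet_derivative \<psi> (at x) v = 0"
        by (rule euclidean_test_functionsD) metis
    have sub: "K' \<subseteq> chart_img c" if "K' \<subseteq> ?V" for K' using that interior_subset by blast
    have i1: "set_integrable lborel ?V (\<lambda>x. u (chart_inv c x) * frechet_derivative \<psi> (at x) (axis i 1))"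
      by (rule test_pairing_integrable[OF L2_pullback_integrable[OF c u(1)] K(1,2) pc(1) p0]) (use sub in auto)
    have i2: "set_integrable lborel ?V (\<lambda>x. w (chart_inv c x) * frechet_derivative \<psi> (at x) (axis i 1))"
      by (rule test_pairing_integrable[OF L2_pullback_integrable[OF c w(1)] K(1,2) pc(1) p0]) (use sub in auto)
    have i3: "set_integrable lborel ?V (\<lambda>x. \<omega> c (chart_inv c x) $ i * \<psi> x)"
      by (rule test_pairing_integrable[OF covector_pullback_integrable[OF c \<omega>] K(1,2) pc(2) K(3)]) (use sub in auto)
    have i4: "set_integrable lborel ?V (\<lambda>x. \<eta> c (chart_inv c x) $ i * \<psi> x)"
      by (rule test_pairing_integrable[OF covector_pullback_integrable[OF c \<eta>] K(1,2) pc(2) K(3)]) (use sub in auto)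
    have "(LINT x:?V|lborel. (u (chart_inv c x) + s * w (chart_inv c x)) * frechet_derivative \<psi> (at x) (axis i 1))
      = (LINT x:?V|lborel. u (chart_inv c x) * frechet_derivative \<psi> (at x) (axis i 1) + s * (w (chart_inv c x) * frechet_derivative \<psi> (at x) (axis i 1)))"
      by (simp add: algebra_simps)
    also have "\<dots> = (LINT x:?V|lborel. u (chart_inv c x) * frechet_derivative \<psi> (at x) (axis i 1))
        + s * (LINT x:?V|lborel. w (chart_inv c x) * frechet_derivative \<psi> (at x) (axis i 1))"
      using i1 i2 by (subst set_integral_add) (auto intro: set_integrable_mult_right)
    also have "\<dots> = - ((LINT x:?V|lborel. \<omega> c (chart_inv c x) $ i * \<psi> x) + s * (LINT x:?V|lborel. \<eta> c (chart_inv c x) $ i * \<psi> x))"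
      using u(2) w(2) c \<psi> by (simp add: weak_differential_def)
    also have "(LINT x:?V|lborel. \<omega> c (chart_inv c x) $ i * \<psi> x) + s * (LINT x:?V|lborel. \<eta> c (chart_inv c x) $ i * \<psi> x)
      = (LINT x:?V|lborel. \<omega> c (chart_inv c x) $ i * \<psi> x + s * (\<eta> c (chart_inv c x) $ i * \<psi> x))"
      using i3 i4 by (subst set_integral_add) (auto intro: set_integrable_mult_right)
    also have "\<dots> = (LINT x:?V|lborel. (\<omega> c (chart_inv c x) + s *\<^sub>R \<eta> c (chart_inv c x)) $ i * \<psi> x)"
      by (simp add: algebra_simps)
    finally show "(LINT x:?V|lborel. (u (chart_inv c x) + s * w (chart_inv c x)) * frechet_derivative \<psi> (at x) (axis i 1))
      = - (LINT x:?V|lborel. (\<omega> c (chart_inv c x) + s *\<^sub>R \<eta> c (chart_inv c x)) $ i * \<psi> x)" .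
  qed
qed

lemma weak_differential_eq:
  assumes "weak_differential M u \<omega>" "c \<in> atlas M" "\<psi> \<in> euclidean_test_functions (interior (chart_img c))"
  shows "(LINT x:interior (chart_img c)|lborel. u (chart_inv c x) * frechet_derivative \<psi> (at x) (axis i 1))
    = - (LINT x:interior (chart_img c)|lborel. \<omega> c (chart_inv c x) $ i * \<psi> x)"
  using assms unfolding weak_differential_def by blast

text \<open>The difference of corresponding coordinates integrates to zero against every test
  function in the interior of the chart image, so the fundamental lemma applies; the rest of the
  image is null.\<close>

lemma weak_differential_unique:
  assumes \<omega>': "weak_differential M u \<omega>" and \<eta>': "weak_differential M u \<eta>" and c: "c \<in> atlas M"
  shows "AE p in vol M. p \<in> chart_dom c \<longrightarrow> \<omega> c p = \<eta> c p"
proof -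
  have \<omega>: "measurable_covector_field M \<omega>" "integrable (vol M) (covector_inner M \<omega> \<omega>)"
    and \<eta>: "measurable_covector_field M \<eta>" "integrable (vol M) (covector_inner M \<eta> \<eta>)"
    using \<omega>' \<eta>' by (auto simp: weak_differential_def)
  let ?V = "interior (chart_img c)"
  have sub: "K' \<subseteq> chart_img c" if "K' \<subseteq> ?V" for K' using that interior_subset by blast
  have "AE x in lborel. x \<in> ?V \<longrightarrow> \<omega> c (chart_inv c x) $ i - \<eta> c (chart_inv c x) $ i = 0" for i
  proof (rule fundamental_lemma)
    fix K assume K: "compact K" "K \<subseteq> ?V"
    show "integrable lborel (\<lambda>x. indicator K x * (\<omega> c (chart_inv c x) $ i - \<eta> c (chart_inv c x) $ i))"
      using covector_pullback_integrable[OF c \<omega> K(1) sub[OF K(2)], of i] covector_pullback_integrable[OF c \<eta> K(1) sub[OF K(2)], of i]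
      by (simp add: right_diff_distrib)
  next
    fix \<psi> assume \<psi>: "\<psi> \<in> euclidean_test_functions ?V"
    from \<psi> obtain K where K: "compact K" "K \<subseteq> ?V" "\<And>x. x \<notin> K \<Longrightarrow> \<psi> x = 0" and pc: "continuous_on UNIV \<psi>"
      by (rule euclidean_test_functionsD) metis
    have i3: "set_integrable lborel ?V (\<lambda>x. \<omega> c (chart_inv c x) $ i * \<psi> x)"
      by (rule test_pairing_integrable[OF covector_pullback_integrable[OF c \<omega>] K(1,2) pc K(3)]) (use sub in auto)
    have i4: "set_integrable lborel ?V (\<lambda>x. \<eta> c (chart_inv c x) $ i * \<psi> x)"
      by (rule test_pairing_integrable[OF covector_pullback_integrable[OF c \<eta>] K(1,2) pc K(3)]) (use sub in auto)
    have "- (LINT x:?V|lborel. \<omega> c (chart_inv c x) $ i * \<psi> x) = - (LINT x:?V|lborel. \<eta> c (chart_inv c x) $ i * \<psi> x)"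
      using weak_differential_eq[OF \<omega>' c \<psi>, of i] weak_differential_eq[OF \<eta>' c \<psi>, of i] by simp
    then show "(LINT x:?V|lborel. (\<omega> c (chart_inv c x) $ i - \<eta> c (chart_inv c x) $ i) * \<psi> x) = 0"
      using i3 i4 by (simp add: left_diff_distrib set_integral_diff(2))
  qed simp
  then have "AE x in lborel. \<forall>i\<in>UNIV. x \<in> ?V \<longrightarrow> \<omega> c (chart_inv c x) $ i - \<eta> c (chart_inv c x) $ i = 0"
    by (subst AE_ball_countable) (auto simp: countable_finite)
  then have ae: "AE x in lborel. x \<in> chart_img c \<longrightarrow> \<omega> c (chart_inv c x) = \<eta> c (chart_inv c x)"
    using img_boundary_null[OF c] by eventually_elim (auto simp: vec_eq_iff)
  define N where "N = {p \<in> chart_dom c. \<omega> c p \<noteq> \<eta> c p}"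
  have "(\<lambda>p. \<omega> c p - \<eta> c p) \<in> borel_measurable (restrict_space borel (chart_dom c))"
    using \<omega>(1) \<eta>(1) c by (intro borel_measurable_diff) (auto simp: measurable_covector_field_def)
  from measurable_sets[OF this, of "- {0}"]
  have "(\<lambda>p. \<omega> c p - \<eta> c p) -` (- {0}) \<inter> chart_dom c \<in> sets (restrict_space borel (chart_dom c))"
    by (simp add: space_restrict_space)
  moreover have "(\<lambda>p. \<omega> c p - \<eta> c p) -` (- {0}) \<inter> chart_dom c = N" by (auto simp: N_def)
  ultimately have "N \<in> sets borel"
    using dom_open[OF c] by (auto simp: sets_restrict_space)
  then have "AE p in vol M. p \<notin> N"
    by (rule AE_from_chart[OF c]) (use ae in \<open>auto simp: N_def elim!: eventually_mono\<close>)
  then show ?thesis by eventually_elim (auto simp: N_def)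
qed

lemma weak_differential_unique_inner:
  assumes \<omega>': "weak_differential M u \<omega>" and \<eta>': "weak_differential M u \<eta>"
  shows "AE p in vol M. covector_inner M \<omega> \<omega> p = covector_inner M \<eta> \<eta> p"
proof -
  have \<omega>: "measurable_covector_field M \<omega>" and \<eta>: "measurable_covector_field M \<eta>"
    using \<omega>' \<eta>' by (auto simp: weak_differential_def)
  obtain C where C: "finite C" "C \<subseteq> atlas M" "\<And>p. \<exists>c\<in>C. p \<in> chart_dom c"
    by (rule finite_atlas) blast
  have "AE p in vol M. \<forall>c\<in>C. p \<in> chart_dom c \<longrightarrow> \<omega> c p = \<eta> c p"
    using C weak_differential_unique[OF assms]
      by (subst AE_ball_countable) (auto simp: countable_finite)
  then show ?thesis
  proof eventually_elim
    case (elim p)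
    obtain c where "c \<in> C" "p \<in> chart_dom c" using C(3) by blast
    then show ?case
      using elim C(2) covector_inner_chart[OF \<omega> \<omega>, of c p] covector_inner_chart[OF \<eta> \<eta>, of c p] by auto
  qed
qed

text \<open>An equality of predicates in the second argument: \<open>wdiff\<close> applies
  \<open>SOME\<close> to this predicate, so functions that are equal almost everywhere receive the
  very same differential.\<close>

lemma weak_differential_cong:
  assumes u: "u \<in> borel_measurable borel" "w \<in> borel_measurable borel" "AE p in vol M. u p = w p"
  shows "weak_differential M u = weak_differential M w"
proof -
  have "(LINT x:interior (chart_img c)|lborel. u (chart_inv c x) * frechet_derivative \<psi> (at x) (axis i 1))
      = (LINT x:interior (chart_img c)|lborel. w (chart_inv c x) * frechet_derivative \<psi> (at x) (axis i 1))"
    if c: "c \<in> atlas M" and \<psi>: "\<psi> \<in> euclidean_test_functions (interior (chart_img c))" for c \<psi> i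
  proof -
    have pc: "continuous_on UNIV (\<lambda>x. frechet_derivative \<psi> (at x) (axis i 1))"
      by (rule euclidean_test_functionsD[OF \<psi>]) metis
    have m: "(\<lambda>x. indicator (interior (chart_img c)) x *\<^sub>R (g (chart_inv c x) * frechet_derivative \<psi> (at x) (axis i 1))) \<in> borel_measurable lborel"
      if "g \<in> borel_measurable borel" for g
    proof -
      have "(\<lambda>x. indicator (interior (chart_img c)) x * ((indicator (chart_img c) x * g (chart_inv c x)) * frechet_derivative \<psi> (at x) (axis i 1))) \<in> borel_measurable borel"
        by (intro borel_measurable_times chart_pullback_measurable[OF c restrict_dom_measurable[OF that]] borel_measurable_continuous_onI[OF pc]) auto
      moreover have "(\<lambda>x. indicator (interior (chart_img c)) x * ((indicator (chart_img c) x * g (chart_inv c x)) * frechet_derivative \<psi> (at x) (axis i 1)))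
        = (\<lambda>x. indicator (interior (chart_img c)) x *\<^sub>R (g (chart_inv c x) * frechet_derivative \<psi> (at x) (axis i 1)))"
        using interior_subset[of "chart_img c"] by (auto simp: indicator_def fun_eq_iff)
      ultimately show ?thesis by simp
    qed
    show ?thesis unfolding set_lebesgue_integral_def
    proof (rule integral_cong_AE[OF m[OF u(1)] m[OF u(2)]])
      show "AE x in lborel. indicator (interior (chart_img c)) x *\<^sub>R (u (chart_inv c x) * frechet_derivative \<psi> (at x) (axis i 1))
        = indicator (interior (chart_img c)) x *\<^sub>R (w (chart_inv c x) * frechet_derivative \<psi> (at x) (axis i 1))"
        using AE_chart[OF c u(3)]
          by eventually_elim (use interior_subset[of "chart_img c"] in \<open>auto simp: indicator_def\<close>)
    qed
  qed
  then show ?thesis by (auto simp: fun_eq_iff weak_differential_def)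
qed

end

section \<open>Test functions on a manifold\<close>

text \<open>The bound concerns \<open>S\<close> only. In the application \<open>S\<close> is the
  interior of a chart image, where two-sided derivatives make sense, while \<open>K\<close> may
  reach the boundary.\<close>

lemma locally_bounded_compact:
  fixes h :: "'a::topological_space \<Rightarrow> real"
  assumes K: "compact K" and loc: "\<And>x. x \<in> K \<Longrightarrow> \<exists>T B. open T \<and> x \<in> T \<and> (\<forall>y\<in>T \<inter> S. \<bar>h y\<bar> \<le> B)"
  shows "\<exists>B. \<forall>y\<in>K \<inter> S. \<bar>h y\<bar> \<le> B"
proof -
  from loc obtain T B where T: "\<And>x. x \<in> K \<Longrightarrow> open (T x) \<and> x \<in> T x \<and> (\<forall>y\<in>T x \<inter> S. \<bar>h y\<bar> \<le> B x)"
    by metis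
  obtain D where D: "D \<subseteq> K" "finite D" "K \<subseteq> (\<Union>x\<in>D. T x)"
    by (rule compactE_image[OF K, of K T]) (use T in auto)
  have "\<bar>h y\<bar> \<le> (\<Sum>x\<in>D. \<bar>B x\<bar>)" if y: "y \<in> K \<inter> S" for y
  proof -
    obtain x where x: "x \<in> D" "y \<in> T x" using D(3) y by auto
    then have "x \<in> K" using D(1) by auto
    then have "\<bar>h y\<bar> \<le> B x" using T[of x] x y by blast
    then have "\<bar>h y\<bar> \<le> \<bar>B x\<bar>" by linarith
    also have "\<dots> \<le> (\<Sum>x\<in>D. \<bar>B x\<bar>)" using x D(2) by (intro member_le_sum) auto
    finally show ?thesis .
  qed
  then show ?thesis by blast
qed

context riem
begin

lemma test_functions_smooth:
  "\<psi> \<in> test_functions M \<Longrightarrow> c \<in> atlas M \<Longrightarrow> smooth_on (\<psi> \<circ> chart_inv c) (chart_img c)"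
  by (simp add: test_functions_def)

lemma test_functions_diff:
  assumes "\<psi> \<in> test_functions M" "\<phi> \<in> test_functions M"
  shows "(\<lambda>p. \<psi> p - \<phi> p) \<in> test_functions M"
proof -
  from assms obtain K L where K: "compact K" "K \<subseteq> manifold_interior M" "\<And>p. p \<notin> K \<Longrightarrow> \<psi> p = 0"
    and L: "compact L" "L \<subseteq> manifold_interior M" "\<And>p. p \<notin> L \<Longrightarrow> \<phi> p = 0"
    unfolding test_functions_def by blast
  have "smooth_on ((\<lambda>p. \<psi> p - \<phi> p) \<circ> chart_inv c) (chart_img c)" if "c \<in> atlas M" for c
    using smooth_on_diff[OF test_functions_smooth[OF assms(1) that] test_functions_smooth[OF assms(2) that]] by (simp add: o_def)
  moreover have "compact (K \<union> L)" "K \<union> L \<subseteq> manifold_interior M" using K L by auto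
  moreover have "\<psi> p - \<phi> p = 0" if "p \<notin> K \<union> L" for p using that K(3)[of p] L(3)[of p] by simp
  ultimately show ?thesis unfolding test_functions_def by blast
qed

text \<open>By invariance of domain.\<close>

lemma interior_chart:
  assumes c: "c \<in> atlas M" "c' \<in> atlas M" and p: "p \<in> chart_dom c \<inter> chart_dom c'"
    and i: "chart_map c p \<in> interior (chart_img c)"
  shows "chart_map c p \<in> interior (overlap_img c c')" "chart_map c' p \<in> interior (chart_img c')"
proof -
  let ?V = "interior (chart_img c)"
  have ci: "continuous_on ?V (chart_inv c)"
    by (rule continuous_on_subset[OF chart_cont(2)[OF c(1)] interior_subset])
  define U where "U = ?V \<inter> chart_inv c -` chart_dom c'"
  have oU: "open U"
    unfolding U_def by (rule continuous_open_preimage[OF ci open_interior dom_open[OF c(2)]])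
  have Ui: "x \<in> chart_img c" "chart_inv c x \<in> chart_dom c" "chart_inv c x \<in> chart_dom c'" if "x \<in> U" for x
    using that interior_subset[of "chart_img c"] chart_inv_dom[OF c(1)] by (auto simp: U_def)
  have pU: "chart_map c p \<in> U" using i p chart_inv_map[OF c(1)] by (simp add: U_def)
  have "U \<subseteq> overlap_img c c'"
  proof
    fix x assume x: "x \<in> U"
    show "x \<in> overlap_img c c'" unfolding overlap_img_def
      by (rule image_eqI[of _ _ "chart_inv c x"]) (use Ui[OF x] chart_map_inv[OF c(1)] in auto)
  qed
  then show "chart_map c p \<in> interior (overlap_img c c')" using oU pU by (rule interiorI[rotated 2])
  define \<tau> where "\<tau> = (\<lambda>x. chart_map c' (chart_inv c x))"
  have "continuous_on U \<tau>" unfolding \<tau>_def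
    by (rule continuous_on_compose2[OF chart_cont(1)[OF c(2)] continuous_on_subset[OF ci]]) (use Ui in \<open>auto simp: U_def\<close>)
  moreover have "inj_on \<tau> U"
  proof (rule inj_onI)
    fix x y assume xy: "x \<in> U" "y \<in> U" "\<tau> x = \<tau> y"
    then have "chart_inv c x = chart_inv c y" unfolding \<tau>_def
      using chart_inv_map[OF c(2)] Ui by metis
    then show "x = y" using chart_map_inv[OF c(1)] Ui xy by metis
  qed
  ultimately have "open (\<tau> ` U)" using oU by (intro invariance_of_domain)
  moreover have "\<tau> ` U \<subseteq> chart_img c'" using Ui by (auto simp: \<tau>_def chart_map_img)
  moreover have "chart_map c' p \<in> \<tau> ` U"
    by (rule image_eqI[OF _ pU]) (use p chart_inv_map[OF c(1)] in \<open>auto simp: \<tau>_def\<close>)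
  ultimately show "chart_map c' p \<in> interior (chart_img c')" by (meson interiorI)
qed

text \<open>The value 0 at points that are not interior in the chart avoids two-sided derivatives at
  the boundary. Interior points are the same in every chart, so the cutoff respects the change of
  coordinates, and it affects only a null set.\<close>

definition classical_differential :: "('m \<Rightarrow> real) \<Rightarrow> ('m, 'n) covector_field" where
  "classical_differential \<psi> c p =
    indicator (interior (chart_img c)) (chart_map c p) *\<^sub>R
      (\<chi> i. frechet_derivative (\<psi> \<circ> chart_inv c) (at (chart_map c p)) (axis i 1))"

text \<open>Near a point of the chart image w agrees on the interior with a function g that is
  smooth across the boundary, so the derivatives agree as well. Boundedness on compact sets that
  touch the boundary is inherited from g.\<close>

lemma smooth_chart_derivative:
  fixes w :: "real ^ 'n \<Rightarrow> real" and c :: "('m, 'n) chart"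
  assumes w: "smooth_on w (chart_img c)"
  shows "\<And>x. x \<in> interior (chart_img c) \<Longrightarrow> (w has_derivative frechet_derivative w (at x)) (at x)"
    and "continuous_on (interior (chart_img c)) (\<lambda>x. frechet_derivative w (at x) v)"
    and "compact K \<Longrightarrow> K \<subseteq> chart_img c \<Longrightarrow> \<exists>B. \<forall>x\<in>K \<inter> interior (chart_img c). \<bar>frechet_derivative w (at x) v\<bar> \<le> B"
proof -
  let ?V = "interior (chart_img c)"
  have loc: "\<exists>W g. open W \<and> x \<in> W \<and> continuous_on W (\<lambda>y. frechet_derivative g (at y) v) \<and>
      (\<forall>y\<in>W \<inter> ?V. (w has_derivative frechet_derivative g (at y)) (at y) \<and> frechet_derivative w (at y) = frechet_derivative g (at y))"
    if x: "x \<in> chart_img c" for x v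
  proof -
    from smooth_on_local[OF w x] obtain W g where W: "open W" "x \<in> W" "\<And>y. y \<in> W \<Longrightarrow> g differentiable (at y)"
      "\<And>v. continuous_on W (\<lambda>y. frechet_derivative g (at y) v)" "\<And>y. y \<in> W \<inter> chart_img c \<Longrightarrow> g y = w y" by metis
    have d: "(w has_derivative frechet_derivative g (at y)) (at y)" if y: "y \<in> W \<inter> ?V" for y
    proof (rule has_derivative_transform_within_open[of g _ y UNIV "W \<inter> ?V"])
      show "(g has_derivative frechet_derivative g (at y)) (at y)"
        using W(3) y by (simp add: frechet_derivative_works)
      show "g z = w z" if "z \<in> W \<inter> ?V" for z
        using W(5)[of z] that interior_subset[of "chart_img c"] by auto
    qed (use W y in auto)
    then have "frechet_derivative w (at y) = frechet_derivative g (at y)" if "y \<in> W \<inter> ?V" for y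
      using frechet_derivative_at[OF d[OF that]] by simp
    with d W show ?thesis by (intro exI[of _ W] exI[of _ g]) blast
  qed
  have sub: "?V \<subseteq> chart_img c" by (rule interior_subset)
  show "(w has_derivative frechet_derivative w (at x)) (at x)" if x: "x \<in> ?V" for x
    using loc[of x undefined] x sub by force
  show "continuous_on ?V (\<lambda>x. frechet_derivative w (at x) v)"
  proof (rule continuous_at_imp_continuous_on, rule ballI)
    fix x assume x: "x \<in> ?V"
    then obtain W g where W: "open W" "x \<in> W" "continuous_on W (\<lambda>y. frechet_derivative g (at y) v)"
      "\<forall>y\<in>W \<inter> ?V. frechet_derivative w (at y) = frechet_derivative g (at y)"
      using loc[of x v] sub by blast
    have "continuous_on (W \<inter> ?V) (\<lambda>y. frechet_derivative w (at y) v)"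
      by (rule continuous_on_eq[OF continuous_on_subset[OF W(3)]]) (use W(4) in auto)
    then show "isCont (\<lambda>y. frechet_derivative w (at y) v) x"
      using W(1,2) x by (simp add: continuous_on_eq_continuous_at open_Int)
  qed
  show "\<exists>B. \<forall>x\<in>K \<inter> ?V. \<bar>frechet_derivative w (at x) v\<bar> \<le> B" if K: "compact K" "K \<subseteq> chart_img c"
  proof (rule locally_bounded_compact[where h="\<lambda>x. frechet_derivative w (at x) v", OF K(1)])
    fix x assume "x \<in> K"
    then obtain W g where W: "open W" "x \<in> W" "continuous_on W (\<lambda>y. frechet_derivative g (at y) v)"
      "\<forall>y\<in>W \<inter> ?V. frechet_derivative w (at y) = frechet_derivative g (at y)"
      using loc[of x v] K(2) by blast
    have "continuous_on W (\<lambda>y. \<bar>frechet_derivative g (at y) v\<bar>)" by (intro continuous_on_rabs W(3))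
    then have "open (W \<inter> (\<lambda>y. \<bar>frechet_derivative g (at y) v\<bar>) -` {..<\<bar>frechet_derivative g (at x) v\<bar> + 1})"
      by (intro continuous_open_preimage W(1)) auto
    then show "\<exists>T B. open T \<and> x \<in> T \<and> (\<forall>y\<in>T \<inter> ?V. \<bar>frechet_derivative w (at y) v\<bar> \<le> B)"
      using W(2,4)
        by (intro exI[of _ "W \<inter> (\<lambda>y. \<bar>frechet_derivative g (at y) v\<bar>) -` {..<\<bar>frechet_derivative g (at x) v\<bar> + 1}"]
          exI[of _ "\<bar>frechet_derivative g (at x) v\<bar> + 1"]) (auto intro: less_imp_le)
  qed
qed

lemma classical_differential_inner:
  assumes \<psi>: "\<psi> \<in> test_functions M" and c: "c \<in> atlas M" and x: "chart_map c p \<in> interior (chart_img c)"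
  shows "classical_differential \<psi> c p \<bullet> v = frechet_derivative (\<psi> \<circ> chart_inv c) (at (chart_map c p)) v"
proof -
  have lin: "linear (frechet_derivative (\<psi> \<circ> chart_inv c) (at (chart_map c p)))"
    by (rule has_derivative_linear[OF smooth_chart_derivative(1)[OF test_functions_smooth[OF \<psi> c] x]])
  have "frechet_derivative (\<psi> \<circ> chart_inv c) (at (chart_map c p)) (\<Sum>i\<in>UNIV. v $ i *\<^sub>R axis i 1)
     = (\<Sum>i\<in>UNIV. v $ i * frechet_derivative (\<psi> \<circ> chart_inv c) (at (chart_map c p)) (axis i 1))"
    by (simp add: linear_sum[OF lin] linear_cmul[OF lin])
  moreover have "(\<Sum>i\<in>UNIV. v $ i *\<^sub>R axis i 1) = v"
    using basis_expansion[of v] by (simp add: scalar_mult_eq_scaleR)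
  ultimately show ?thesis
    using x by (simp add: classical_differential_def inner_vec_def mult.commute)
qed

lemma classical_differential_field:
  assumes \<psi>: "\<psi> \<in> test_functions M"
  shows "measurable_covector_field M (classical_differential \<psi>)"
  unfolding measurable_covector_field_def
proof (intro conjI ballI allI impI)
  fix c assume c: "c \<in> atlas M"
  note s = test_functions_smooth[OF \<psi> c]
  have "continuous_on (interior (chart_img c)) (\<lambda>x. \<chi> i. frechet_derivative (\<psi> \<circ> chart_inv c) (at x) (axis i 1))"
    by (intro continuous_on_vec_lambda smooth_chart_derivative(2)[OF s])
  then have "(\<lambda>x. indicator (interior (chart_img c)) x *\<^sub>R (\<chi> i. frechet_derivative (\<psi> \<circ> chart_inv c) (at x) (axis i 1))) \<in> borel_measurable borel"
    by (intro borel_measurable_continuous_on_indicator) auto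
  from measurable_compose[OF borel_measurable_continuous_on_restrict[OF chart_cont(1)[OF c]] this]
  show "classical_differential \<psi> c \<in> borel_measurable (restrict_space borel (chart_dom c))"
    by (simp add: classical_differential_def[abs_def])
next
  fix c c' p D v
  assume c: "c \<in> atlas M" "c' \<in> atlas M" and p: "p \<in> chart_dom c \<inter> chart_dom c'"
    and D: "(transition c c' has_derivative D) (at (chart_map c p) within overlap_img c c')"
  show "classical_differential \<psi> c p \<bullet> v = classical_differential \<psi> c' p \<bullet> D v"
  proof (cases "chart_map c p \<in> interior (chart_img c)")
    case True
    note int = interior_chart[OF c p True]
    have D': "(transition c c' has_derivative D) (at (chart_map c p))"
      using D by (simp add: at_within_interior[OF int(1)])
    have tp: "transition c c' (chart_map c p) = chart_map c' p"
      using p chart_inv_map[OF c(1)] by (simp add: transition_def)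
    let ?w = "\<psi> \<circ> chart_inv c" and ?w' = "\<psi> \<circ> chart_inv c'"
    have "(?w' has_derivative frechet_derivative ?w' (at (chart_map c' p))) (at (transition c c' (chart_map c p)))"
      unfolding tp by (rule smooth_chart_derivative(1)[OF test_functions_smooth[OF \<psi> c(2)] int(2)])
    from has_derivative_compose[OF D' this]
    have "((\<lambda>x. ?w' (transition c c' x)) has_derivative (\<lambda>v. frechet_derivative ?w' (at (chart_map c' p)) (D v))) (at (chart_map c p))" .
    then have "(?w has_derivative (\<lambda>v. frechet_derivative ?w' (at (chart_map c' p)) (D v))) (at (chart_map c p))"
    proof (rule has_derivative_transform_within_open[OF _ open_interior int(1)])
      fix x assume "x \<in> interior (overlap_img c c')"
      then have "x \<in> overlap_img c c'" using interior_subset by blast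
      then obtain r where "r \<in> chart_dom c" "r \<in> chart_dom c'" "x = chart_map c r"
        by (auto simp: overlap_img_def)
      then show "?w' (transition c c' x) = ?w x"
        using chart_inv_map[OF c(1)] chart_inv_map[OF c(2)] by (simp add: transition_def)
    qed
    from frechet_derivative_at[OF this]
    show ?thesis
      unfolding classical_differential_inner[OF \<psi> c(1) True] classical_differential_inner[OF \<psi> c(2) int(2)] by metis
  next
    \<comment> \<open>By \<open>interior_chart\<close> with the charts exchanged, the point is not
      interior in the other chart either, and both differentials are 0.\<close>
    case False
    moreover have "chart_map c' p \<notin> interior (chart_img c')"
      using interior_chart(2)[OF c(2,1), of p] p False by auto
    ultimately show ?thesis by (simp add: classical_differential_def)
  qed
qed

section \<open>Finite covers by boxes in charts\<close>

lemma box_neighbourhood: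
  "\<exists>c a b U. c \<in> atlas M \<and> (\<forall>i\<in>Basis. a \<bullet> i < b \<bullet> (i :: real ^ 'n)) \<and> cbox a b \<subseteq> chart_img c \<and>
    open U \<and> p \<in> U \<and> U \<subseteq> chart_inv c ` cbox a b"
proof -
  obtain c where c: "c \<in> atlas M" "p \<in> chart_dom c" using atlas_cover by blast
  obtain k T where T: "open T" "chart_img c = T \<inter> {x. 0 \<le> x $ k}" by (rule img_half_space[OF c(1)])
  define x0 where "x0 = chart_map c p"
  have x0: "x0 \<in> T" "0 \<le> x0 $ k" using chart_map_img[OF c(2)] by (auto simp: x0_def T(2))
  obtain a0 b0 where ab0: "x0 \<in> box a0 b0" "cbox a0 b0 \<subseteq> T"
    using open_contains_cbox[OF T(1) x0(1)] by (metis)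
  \<comment> \<open>The lower face is raised to the hyperplane x_k = 0 if it lies below. Thus the
    closed box stays in the chart image even around a boundary point, where it rests on the
    boundary.\<close>
  define a where "a = (\<chi> i. if i = k then max 0 (a0 $ k) else a0 $ i)"
  have a0b: "a0 $ i < x0 $ i" "x0 $ i < b0 $ i" for i using ab0(1) by (auto simp: mem_box_cart)
  have ab: "a $ i < b0 $ i" for i using a0b[of i] x0(2) by (auto simp: a_def)
  have sub: "cbox a b0 \<subseteq> chart_img c"
  proof
    fix x assume "x \<in> cbox a b0"
    then have x: "a $ i \<le> x $ i" "x $ i \<le> b0 $ i" for i by (auto simp: mem_box_cart)
    have "a0 $ i \<le> x $ i" for i using x(1)[of i] by (auto simp: a_def split: if_splits)
    then have "x \<in> T" using x(2) ab0(2) by (auto simp: mem_box_cart)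
    moreover have "0 \<le> x $ k" using x(1)[of k] by (simp add: a_def)
    ultimately show "x \<in> chart_img c" by (simp add: T(2))
  qed
  define U where "U = chart_dom c \<inter> chart_map c -` box a0 b0"
  have oU: "open U"
    unfolding U_def by (rule continuous_open_preimage[OF chart_cont(1)[OF c(1)] dom_open[OF c(1)] open_box])
  have "U \<subseteq> chart_inv c ` cbox a b0"
  proof
    fix r assume r: "r \<in> U"
    have "chart_map c r \<in> cbox a b0"
    proof -
      have "0 \<le> chart_map c r $ k" using chart_map_img[of r c] r by (simp add: T(2) U_def)
      moreover have "a0 $ i < chart_map c r $ i \<and> chart_map c r $ i < b0 $ i" for i
        using r by (auto simp: U_def mem_box_cart)
      ultimately show ?thesis by (auto simp: mem_box_cart a_def less_imp_le)
    qed
    then show "r \<in> chart_inv c ` cbox a b0"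
      by (rule image_eqI[rotated]) (use r chart_inv_map[OF c(1)] in \<open>auto simp: U_def\<close>)
  qed
  moreover have "p \<in> U" using c ab0(1) by (simp add: U_def x0_def)
  moreover have "a \<bullet> i < b0 \<bullet> i" if "i \<in> Basis" for i
    using that ab by (auto simp: Basis_vec_def inner_axis)
  ultimately show ?thesis using c(1) sub oU by blast
qed

text \<open>Compactness selects finitely many boxes. They may overlap, since only upper estimates of
  integrals are drawn from the cover.\<close>

lemma box_cover:
  obtains \<B> where "finite \<B>"
    "\<And>c a b. (c, a, b) \<in> \<B> \<Longrightarrow> c \<in> atlas M \<and> (\<forall>i\<in>Basis. a \<bullet> i < b \<bullet> (i :: real ^ 'n)) \<and> cbox a b \<subseteq> chart_img c"
    "\<And>p. \<exists>(c, a, b)\<in>\<B>. p \<in> chart_inv c ` cbox a b"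
proof -
  define good where "good t U \<longleftrightarrow> (case t of (c, a, b) \<Rightarrow> c \<in> atlas M \<and> (\<forall>i\<in>Basis. a \<bullet> i < b \<bullet> (i :: real ^ 'n)) \<and>
      cbox a b \<subseteq> chart_img c \<and> U \<subseteq> chart_inv c ` cbox a b)" for t U
  have "\<exists>t U. good t U \<and> open U \<and> p \<in> U" for p
  proof -
    obtain c a b U where "c \<in> atlas M" "\<forall>i\<in>Basis. a \<bullet> i < b \<bullet> (i :: real ^ 'n)" "cbox a b \<subseteq> chart_img c"
      "open U" "p \<in> U" "U \<subseteq> chart_inv c ` cbox a b" using box_neighbourhood[of p] by blast
    then show ?thesis
      by (intro exI[of _ "(c, a, b)"] exI[of _ U]) (simp add: good_def)
  qed
  then obtain t U where tU: "\<And>p. good (t p) (U p)" "\<And>p. open (U p)" "\<And>p. p \<in> U p" by metis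
  have "compact (UNIV :: 'm set)" using M by (simp add: compact_riemannian_manifold_def)
  then obtain D where D: "finite D" "UNIV \<subseteq> (\<Union>p\<in>D. U p)"
    by (rule compactE_image[of UNIV UNIV U]) (use tU in auto)
  show ?thesis
  proof (rule that[of "t ` D"])
    show "finite (t ` D)" using D by simp
    show "c \<in> atlas M \<and> (\<forall>i\<in>Basis. a \<bullet> i < b \<bullet> i) \<and> cbox a b \<subseteq> chart_img c" if "(c, a, b) \<in> t ` D" for c a b
    proof -
      from that obtain p where p: "(c, a, b) = t p" by (rule imageE)
      show ?thesis using tU(1)[of p] unfolding good_def p[symmetric] prod.case by blast
    qed
    fix p
    obtain r where r: "r \<in> D" "p \<in> U r" using D(2) by auto
    then show "\<exists>(c, a, b)\<in>t ` D. p \<in> chart_inv c ` cbox a b"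
      using tU(1)[of r] by (intro bexI[of _ "t r"]) (auto simp: good_def split: prod.splits)
  qed
qed

lemma inv_box_borel:
  assumes "c \<in> atlas M" "cbox a b \<subseteq> chart_img c" shows "chart_inv c ` cbox a b \<in> sets borel"
  by (intro borel_compact compact_continuous_image continuous_on_subset[OF chart_cont(2)[OF assms(1)] assms(2)] compact_cbox)

text \<open>The volume density is bounded on the closed box. The closed box covers the manifold
  while the Sobolev inequality lives on the open one; the two differ by a null set.\<close>

lemma nn_integral_inv_box_le:
  assumes c: "c \<in> atlas M" and ab: "cbox a b \<subseteq> chart_img c"
  obtains B where "0 < B" "\<And>h. h \<in> borel_measurable borel \<Longrightarrow>
    (\<integral>\<^sup>+p. h p * indicator (chart_inv c ` cbox a b) p \<partial>vol M) \<le> ennreal B * (\<integral>\<^sup>+x. indicator (box a b) x * h (chart_inv c x) \<partial>lborel)"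
proof -
  obtain B where B: "0 < B" "\<And>x. x \<in> cbox a b \<Longrightarrow> vol_density c x \<le> B"
    by (rule gram_bounds[OF c compact_cbox ab]) metis
  let ?P = "chart_inv c ` cbox a b"
  have Pm[measurable]: "?P \<in> sets borel" by (rule inv_box_borel[OF c ab])
  have Px: "chart_inv c x \<in> ?P \<longleftrightarrow> x \<in> cbox a b" if "x \<in> chart_img c" for x
  proof
    assume "chart_inv c x \<in> ?P"
    then obtain y where y: "y \<in> cbox a b" "chart_inv c x = chart_inv c y" by blast
    then have "x = y" using chart_map_inv[OF c that] chart_map_inv[OF c, of y] ab by auto
    with y show "x \<in> cbox a b" by simp
  qed simp
  have Pd: "?P \<subseteq> chart_dom c" using ab chart_inv_dom[OF c] by auto
  show ?thesis
  proof (rule that[OF B(1)])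
    fix h :: "'m \<Rightarrow> ennreal" assume h[measurable]: "h \<in> borel_measurable borel"
    have "(\<integral>\<^sup>+p. h p * indicator ?P p \<partial>vol M) = (\<integral>\<^sup>+p. (h p * indicator ?P p) * indicator (chart_dom c) p \<partial>vol M)"
      using Pd by (intro nn_integral_cong) (auto simp: indicator_def)
    also have "\<dots> = (\<integral>\<^sup>+x. h (chart_inv c x) * indicator ?P (chart_inv c x) * ennreal (vol_density c x) * indicator (chart_img c) x \<partial>lborel)"
      by (rule nn_integral_chart[OF c]) measurable
    also have "\<dots> \<le> (\<integral>\<^sup>+x. ennreal B * (indicator (box a b) x * h (chart_inv c x)) \<partial>lborel)"
    proof (rule nn_integral_mono_AE)
      show "AE x in lborel. h (chart_inv c x) * indicator ?P (chart_inv c x) * ennreal (vol_density c x) * indicator (chart_img c) x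
         \<le> ennreal B * (indicator (box a b) x * h (chart_inv c x))"
        using AE_lborel_box_cbox[of a b]
      proof eventually_elim
        case (elim x)
        show ?case
        proof (cases "x \<in> cbox a b")
          case True
          have "ennreal (vol_density c x) * h (chart_inv c x) \<le> ennreal B * h (chart_inv c x)"
            by (intro mult_right_mono ennreal_leI B(2) True) simp
          then show ?thesis using True elim ab Px[of x] by (auto simp: mult.commute)
        next
          case False
          then show ?thesis using Px[of x] by (auto simp: indicator_def)
        qed
      qed
    qed
    also have "\<dots> = ennreal B * (\<integral>\<^sup>+x. indicator (box a b) x * h (chart_inv c x) \<partial>lborel)"
    proof (rule nn_integral_cmult)
      have [measurable]: "(\<lambda>x. if x \<in> chart_img c then chart_inv c x else undefined) \<in> borel_measurable borel"
        by (rule chart_inv_measurable[OF c])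
      have "(\<lambda>x. indicator (box a b) x * h (if x \<in> chart_img c then chart_inv c x else undefined)) \<in> borel_measurable borel"
        by measurable
      moreover have "(\<lambda>x. indicator (box a b) x * h (if x \<in> chart_img c then chart_inv c x else undefined)) = (\<lambda>x. indicator (box a b) x * h (chart_inv c x))"
        using ab box_subset_cbox[of a b] by (auto simp: indicator_def fun_eq_iff)
      ultimately show "(\<lambda>x. indicator (box a b) x * h (chart_inv c x)) \<in> borel_measurable lborel"
        by simp
    qed
    finally show "(\<integral>\<^sup>+p. h p * indicator ?P p \<partial>vol M) \<le> ennreal B * (\<integral>\<^sup>+x. indicator (box a b) x * h (chart_inv c x) \<partial>lborel)" .
  qed
qed

lemma nn_integral_cover_le:
  assumes \<B>: "finite \<B>"
    "\<And>c a b. (c, a, b) \<in> \<B> \<Longrightarrow> c \<in> atlas M \<and> (\<forall>i\<in>Basis. a \<bullet> i < b \<bullet> (i :: real ^ 'n)) \<and> cbox a b \<subseteq> chart_img c"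
    "\<And>p. \<exists>(c, a, b)\<in>\<B>. p \<in> chart_inv c ` cbox a b"
    and h: "h \<in> borel_measurable borel"
  shows "(\<integral>\<^sup>+p. h p \<partial>vol M) \<le> (\<Sum>(c, a, b)\<in>\<B>. \<integral>\<^sup>+p. h p * indicator (chart_inv c ` cbox a b) p \<partial>vol M)"
proof -
  have "(\<integral>\<^sup>+p. h p \<partial>vol M) \<le> (\<integral>\<^sup>+p. (\<Sum>t\<in>\<B>. h p * indicator (chart_inv (fst t) ` cbox (fst (snd t)) (snd (snd t))) p) \<partial>vol M)"
  proof (rule nn_integral_mono)
    fix p
    obtain t where t: "t \<in> \<B>" "p \<in> chart_inv (fst t) ` cbox (fst (snd t)) (snd (snd t))"
      using \<B>(3)[of p] by auto
    have "h p = h p * indicator (chart_inv (fst t) ` cbox (fst (snd t)) (snd (snd t))) p"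
      using t(2) by simp
    also have "\<dots> \<le> (\<Sum>t\<in>\<B>. h p * indicator (chart_inv (fst t) ` cbox (fst (snd t)) (snd (snd t))) p)"
      by (rule member_le_sum[OF t(1)]) (use \<B>(1) in auto)
    finally show "h p \<le> (\<Sum>t\<in>\<B>. h p * indicator (chart_inv (fst t) ` cbox (fst (snd t)) (snd (snd t))) p)" .
  qed
  also have "\<dots> = (\<Sum>t\<in>\<B>. \<integral>\<^sup>+p. h p * indicator (chart_inv (fst t) ` cbox (fst (snd t)) (snd (snd t))) p \<partial>vol M)"
  proof (rule nn_integral_sum)
    fix t assume "t \<in> \<B>"
    then have "chart_inv (fst t) ` cbox (fst (snd t)) (snd (snd t)) \<in> sets borel"
      using \<B>(2)[of "fst t" "fst (snd t)" "snd (snd t)"] by (intro inv_box_borel) auto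
    then show "(\<lambda>p. h p * indicator (chart_inv (fst t) ` cbox (fst (snd t)) (snd (snd t))) p) \<in> borel_measurable (vol M)"
      using h by simp
  qed
  finally show ?thesis by (simp add: split_beta')
qed

text \<open>The volume density is bounded on each box of a finite cover, and boxes have finite
  Lebesgue measure.\<close>

lemma finite_measure_vol: "finite_measure (vol M)"
proof
  obtain \<B> where \<B>: "finite \<B>"
    "\<And>c a b. (c, a, b) \<in> \<B> \<Longrightarrow> c \<in> atlas M \<and> (\<forall>i\<in>Basis. a \<bullet> i < b \<bullet> (i :: real ^ 'n)) \<and> cbox a b \<subseteq> chart_img c"
    "\<And>p. \<exists>(c, a, b)\<in>\<B>. p \<in> chart_inv c ` cbox a b" by (rule box_cover) blast
  have "emeasure (vol M) (space (vol M)) = (\<integral>\<^sup>+p. 1 \<partial>vol M)" by simp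
  also have "\<dots> \<le> (\<Sum>(c, a, b)\<in>\<B>. \<integral>\<^sup>+p. 1 * indicator (chart_inv c ` cbox a b) p \<partial>vol M)"
    by (rule nn_integral_cover_le[OF \<B>]) auto
  also have "\<dots> < \<infinity>"
  proof -
    have "(\<integral>\<^sup>+p. 1 * indicator (chart_inv c ` cbox a b) p \<partial>vol M) < \<infinity>" if t: "(c, a, b) \<in> \<B>" for c a b
    proof -
      have c: "c \<in> atlas M" and ab: "cbox a b \<subseteq> chart_img c" using \<B>(2)[OF t] by auto
      obtain B where "0 < B" "\<And>h. h \<in> borel_measurable borel \<Longrightarrow>
        (\<integral>\<^sup>+p. h p * indicator (chart_inv c ` cbox a b) p \<partial>vol M) \<le> ennreal B * (\<integral>\<^sup>+x. indicator (box a b) x * h (chart_inv c x) \<partial>lborel)"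
        by (rule nn_integral_inv_box_le[OF c ab]) blast
      from this(2)[of "\<lambda>_. 1"] have "(\<integral>\<^sup>+p. 1 * indicator (chart_inv c ` cbox a b) p \<partial>vol M) \<le> ennreal B * emeasure lborel (box a b)"
        by simp
      also have "\<dots> < \<infinity>" by (simp add: ennreal_mult_less_top emeasure_lborel_box_eq)
      finally show ?thesis .
    qed
    then show ?thesis
      using \<B>(1) by (auto simp: split_beta' intro!: ennreal_sum_less_top[unfolded infinity_ennreal_def[symmetric]])
  qed
  finally show "emeasure (vol M) (space (vol M)) \<noteq> \<infinity>" by simp
qed

lemma test_function_continuous:
  assumes \<psi>: "\<psi> \<in> test_functions M" shows "continuous_on UNIV \<psi>" "\<exists>B. \<forall>p. \<bar>\<psi> p\<bar> \<le> B"
proof -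
  have "isCont \<psi> p" for p
  proof -
    obtain c where c: "c \<in> atlas M" "p \<in> chart_dom c" using atlas_cover by blast
    have "continuous_on (chart_dom c) (\<lambda>r. (\<psi> \<circ> chart_inv c) (chart_map c r))"
      by (rule continuous_on_compose2[OF smooth_on_imp_continuous_on[OF test_functions_smooth[OF \<psi> c(1)]] chart_cont(1)[OF c(1)]])
        (auto simp: chart_map_img)
    then have "continuous_on (chart_dom c) \<psi>"
      by (rule continuous_on_eq) (simp add: chart_inv_map[OF c(1)])
    then show ?thesis using c dom_open[OF c(1)] by (simp add: continuous_on_eq_continuous_at)
  qed
  then show ct: "continuous_on UNIV \<psi>" by (simp add: continuous_at_imp_continuous_on)
  have "compact (UNIV :: 'm set)" using M by (simp add: compact_riemannian_manifold_def)
  then have "bounded (range \<psi>)" using compact_continuous_image[OF ct] compact_imp_bounded by blast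
  then show "\<exists>B. \<forall>p. \<bar>\<psi> p\<bar> \<le> B" by (auto simp: bounded_iff)
qed

lemma integrable_bounded_vol:
  fixes h :: "'m \<Rightarrow> real"
  assumes "h \<in> borel_measurable borel" "\<And>p. \<bar>h p\<bar> \<le> B" shows "integrable (vol M) h"
proof -
  interpret finite_measure "vol M" by (rule finite_measure_vol)
  show ?thesis by (rule integrable_const_bound[of _ B]) (use assms in auto)
qed

lemma test_function_L2: assumes \<psi>: "\<psi> \<in> test_functions M" shows "\<psi> \<in> L2 M"
proof -
  have m: "\<psi> \<in> borel_measurable borel"
    by (rule borel_measurable_continuous_onI[OF test_function_continuous(1)[OF \<psi>]])
  obtain B where B: "\<And>p. \<bar>\<psi> p\<bar> \<le> B" using test_function_continuous(2)[OF \<psi>] by blast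
  have "\<bar>(\<psi> p)\<^sup>2\<bar> \<le> B\<^sup>2" for p using B[of p] by (simp add: abs_le_square_iff[symmetric])
  then show ?thesis using m by (auto simp: L2_def intro!: integrable_bounded_vol)
qed

lemma test_derivative_bounds:
  assumes \<psi>: "\<psi> \<in> test_functions M" and c: "c \<in> atlas M" and ab: "cbox a b \<subseteq> chart_img c"
  obtains B where "\<And>x. x \<in> cbox a b \<Longrightarrow> \<bar>\<psi> (chart_inv c x)\<bar> \<le> B"
    "\<And>x v. x \<in> cbox a b \<inter> interior (chart_img c) \<Longrightarrow> v \<in> Basis \<Longrightarrow> \<bar>frechet_derivative (\<psi> \<circ> chart_inv c) (at x) v\<bar> \<le> B"
proof -
  obtain B0 where B0: "\<And>p. \<bar>\<psi> p\<bar> \<le> B0" using test_function_continuous(2)[OF \<psi>] by blast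
  have "\<exists>B. \<forall>x\<in>cbox a b \<inter> interior (chart_img c). \<bar>frechet_derivative (\<psi> \<circ> chart_inv c) (at x) v\<bar> \<le> B" for v
    by (rule smooth_chart_derivative(3)[OF test_functions_smooth[OF \<psi> c] compact_cbox ab])
  then obtain B where B: "\<And>v x. x \<in> cbox a b \<inter> interior (chart_img c) \<Longrightarrow> \<bar>frechet_derivative (\<psi> \<circ> chart_inv c) (at x) v\<bar> \<le> B v" by metis
  show ?thesis
  proof (rule that[of "\<bar>B0\<bar> + (\<Sum>v\<in>Basis. \<bar>B v\<bar>)"])
    have s0: "0 \<le> (\<Sum>v\<in>(Basis :: (real ^ 'n) set). \<bar>B v\<bar>)" by (intro sum_nonneg) auto
    show "\<bar>\<psi> (chart_inv c x)\<bar> \<le> \<bar>B0\<bar> + (\<Sum>v\<in>Basis. \<bar>B v\<bar>)" for x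
      using B0[of "chart_inv c x"] s0 by linarith
    fix x v assume x: "x \<in> cbox a b \<inter> interior (chart_img c)" and v: "v \<in> (Basis :: (real ^ 'n) set)"
    have "\<bar>B v\<bar> \<le> (\<Sum>v\<in>Basis. \<bar>B v\<bar>)" by (rule member_le_sum[OF v]) auto
    then show "\<bar>frechet_derivative (\<psi> \<circ> chart_inv c) (at x) v\<bar> \<le> \<bar>B0\<bar> + (\<Sum>v\<in>Basis. \<bar>B v\<bar>)"
      using B[OF x, of v] by linarith
  qed
qed

lemma norm_classical_differential:
  assumes \<psi>: "\<psi> \<in> test_functions M" and c: "c \<in> atlas M" and x: "x \<in> interior (chart_img c)"
  shows "(norm (classical_differential \<psi> c (chart_inv c x)))\<^sup>2 = (\<Sum>i\<in>Basis. (frechet_derivative (\<psi> \<circ> chart_inv c) (at x) i)\<^sup>2)"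
proof -
  have m: "chart_map c (chart_inv c x) = x"
    using x interior_subset[of "chart_img c"] chart_map_inv[OF c] by auto
  have "(norm (classical_differential \<psi> c (chart_inv c x)))\<^sup>2 = (\<Sum>i\<in>Basis. (classical_differential \<psi> c (chart_inv c x) \<bullet> i)\<^sup>2)"
    by (subst power2_norm_eq_inner, subst euclidean_inner) (simp add: power2_eq_square)
  also have "\<dots> = (\<Sum>i\<in>Basis. (frechet_derivative (\<psi> \<circ> chart_inv c) (at x) i)\<^sup>2)"
    using x by (subst classical_differential_inner[OF \<psi> c]) (simp_all add: m)
  finally show ?thesis .
qed

lemma classical_differential_integrable:
  assumes \<psi>: "\<psi> \<in> test_functions M"
  shows "integrable (vol M) (covector_inner M (classical_differential \<psi>) (classical_differential \<psi>))" (is "integrable _ ?h")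
proof -
  note f = classical_differential_field[OF \<psi>]
  obtain \<B> where \<B>: "finite \<B>"
    "\<And>c a b. (c, a, b) \<in> \<B> \<Longrightarrow> c \<in> atlas M \<and> (\<forall>i\<in>Basis. a \<bullet> i < b \<bullet> (i :: real ^ 'n)) \<and> cbox a b \<subseteq> chart_img c"
    "\<And>p. \<exists>(c, a, b)\<in>\<B>. p \<in> chart_inv c ` cbox a b" by (rule box_cover) blast
  have "\<exists>B. \<forall>p\<in>chart_inv c ` cbox a b. ?h p \<le> B" if t: "(c, a, b) \<in> \<B>" for c a b
  proof -
    have c: "c \<in> atlas M" and ab: "cbox a b \<subseteq> chart_img c" using \<B>(2)[OF t] by auto
    obtain m where m: "0 < m" "\<And>x \<xi>. x \<in> cbox a b \<Longrightarrow> \<xi> \<bullet> (matrix_inv (gram c x) *v \<xi>) \<le> m * (norm \<xi>)\<^sup>2"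
      by (rule gram_bounds[OF c compact_cbox ab]) metis
    obtain B where B: "\<And>x v. x \<in> cbox a b \<inter> interior (chart_img c) \<Longrightarrow> v \<in> Basis \<Longrightarrow> \<bar>frechet_derivative (\<psi> \<circ> chart_inv c) (at x) v\<bar> \<le> B"
      by (rule test_derivative_bounds[OF \<psi> c ab]) metis
    have "?h (chart_inv c x) \<le> m * (\<Sum>i\<in>(Basis :: (real ^ 'n) set). B\<^sup>2)" if x: "x \<in> cbox a b" for x
    proof -
      have d: "chart_inv c x \<in> chart_dom c" and mi: "chart_map c (chart_inv c x) = x"
        using x ab chart_inv_dom[OF c] chart_map_inv[OF c] by auto
      have n: "(norm (classical_differential \<psi> c (chart_inv c x)))\<^sup>2 \<le> (\<Sum>i\<in>(Basis :: (real ^ 'n) set). B\<^sup>2)"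
      proof (cases "x \<in> interior (chart_img c)")
        case True
        have "(frechet_derivative (\<psi> \<circ> chart_inv c) (at x) i)\<^sup>2 \<le> B\<^sup>2" if "i \<in> Basis" for i
          using B[of x i] True x that by (metis IntI abs_ge_self abs_le_square_iff order_trans)
        then show ?thesis unfolding norm_classical_differential[OF \<psi> c True] by (rule sum_mono)
      next
        case False
        then show ?thesis by (simp add: classical_differential_def mi)
      qed
      have "?h (chart_inv c x) \<le> m * (norm (classical_differential \<psi> c (chart_inv c x)))\<^sup>2"
        using m(2)[OF x] by (simp add: covector_inner_chart[OF f f c d])
      also have "\<dots> \<le> m * (\<Sum>i\<in>(Basis :: (real ^ 'n) set). B\<^sup>2)"
        using n m(1) by (intro mult_left_mono) auto
      finally show ?thesis .
    qed
    then show ?thesis by blast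
  qed
  then have "\<forall>t\<in>\<B>. \<exists>B. \<forall>p\<in>chart_inv (fst t) ` cbox (fst (snd t)) (snd (snd t)). ?h p \<le> B" by auto
  then obtain B where B: "\<And>t p. t \<in> \<B> \<Longrightarrow> p \<in> chart_inv (fst t) ` cbox (fst (snd t)) (snd (snd t)) \<Longrightarrow> ?h p \<le> B t" by metis
  have "\<bar>?h p\<bar> \<le> (\<Sum>t\<in>\<B>. \<bar>B t\<bar>)" for p
  proof -
    obtain t where t: "t \<in> \<B>" "p \<in> chart_inv (fst t) ` cbox (fst (snd t)) (snd (snd t))"
      using \<B>(3)[of p] by auto
    have "?h p \<le> \<bar>B t\<bar>" using B[OF t] by simp
    also have "\<dots> \<le> (\<Sum>t\<in>\<B>. \<bar>B t\<bar>)" by (rule member_le_sum[OF t(1)]) (use \<B>(1) in auto)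
    finally show ?thesis using covector_inner_nonneg[OF f] by simp
  qed
  then show ?thesis by (intro integrable_bounded_vol covector_inner_measurable[OF f f])
qed

lemma classical_weak_differential:
  assumes \<psi>: "\<psi> \<in> test_functions M"
  shows "weak_differential M \<psi> (classical_differential \<psi>)"
  unfolding weak_differential_def
proof (intro conjI ballI allI classical_differential_field[OF \<psi>] classical_differential_integrable[OF \<psi>])
  fix c \<phi> i assume c: "c \<in> atlas M" and \<phi>: "\<phi> \<in> euclidean_test_functions (interior (chart_img c))"
  let ?V = "interior (chart_img c)"
  note s = test_functions_smooth[OF \<psi> c]
  have e: "classical_differential \<psi> c (chart_inv c x) $ i = frechet_derivative (\<psi> \<circ> chart_inv c) (at x) (axis i 1)" if "x \<in> ?V" for x
    using that interior_subset[of "chart_img c"] chart_map_inv[OF c]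
      by (auto simp: classical_differential_def subset_iff)
  have "(LINT x:?V|lborel. (\<psi> \<circ> chart_inv c) x * frechet_derivative \<phi> (at x) (axis i 1))
      = - (LINT x:?V|lborel. frechet_derivative (\<psi> \<circ> chart_inv c) (at x) (axis i 1) * \<phi> x)"
    by (rule integration_by_parts_test[OF open_interior smooth_chart_derivative(1,2)[OF s] \<phi>])
  also have "(LINT x:?V|lborel. frechet_derivative (\<psi> \<circ> chart_inv c) (at x) (axis i 1) * \<phi> x)
      = (LINT x:?V|lborel. classical_differential \<psi> c (chart_inv c x) $ i * \<phi> x)"
    by (intro set_lebesgue_integral_cong) (auto simp: e)
  finally show "(LINT x:?V|lborel. \<psi> (chart_inv c x) * frechet_derivative \<phi> (at x) (axis i 1))
      = - (LINT x:?V|lborel. classical_differential \<psi> c (chart_inv c x) $ i * \<phi> x)" by simp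
qed

lemma test_function_H1: "\<psi> \<in> test_functions M \<Longrightarrow> \<psi> \<in> H1 M"
  unfolding H1_def using test_function_L2 classical_weak_differential by blast

end

lemma integrable_on_box:
  fixes h :: "'a::euclidean_space \<Rightarrow> real"
  assumes "continuous_on (box a b) h" "\<And>x. x \<in> box a b \<Longrightarrow> \<bar>h x\<bar> \<le> B"
  shows "integrable lborel (\<lambda>x. indicator (box a b) x * h x)"
proof -
  have bd: "emeasure lborel (box a b) < \<infinity>"
    using emeasure_lborel_box_finite by (simp add: top.not_eq_extremum)
  have "(\<lambda>x. indicator (box a b) x *\<^sub>R h x) \<in> borel_measurable lborel"
    using borel_measurable_continuous_on_indicator[OF _ assms(1)] by simp
  then have "integrable lborel (\<lambda>x. indicator (box a b) x *\<^sub>R (indicator (box a b) x *\<^sub>R h x))"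
    using assms(2) bd
      by (intro integrableI_bounded_set_indicator[of _ _ _ "\<bar>B\<bar>"]) (fastforce simp: indicator_def)+
  moreover have "(\<lambda>x. indicator (box a b) x *\<^sub>R (indicator (box a b) x *\<^sub>R h x)) = (\<lambda>x. indicator (box a b) x * h x)"
    by (auto simp: indicator_def)
  ultimately show ?thesis by simp
qed

section \<open>The spaces \<open>L2\<close>, \<open>H1\<close> and \<open>H10\<close> and their
  norms\<close>

context riem
begin

lemma wdiff_weak: "u \<in> H1 M \<Longrightarrow> weak_differential M u (wdiff M u)"
  unfolding wdiff_def H1_def by (auto intro: someI[of "weak_differential M u"])

lemma wdiff_field: "u \<in> H1 M \<Longrightarrow> measurable_covector_field M (wdiff M u)"
  using wdiff_weak by (simp add: weak_differential_def)

lemma wdiff_integrable: "u \<in> H1 M \<Longrightarrow> integrable (vol M) (covector_inner M (wdiff M u) (wdiff M u))"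
  using wdiff_weak by (simp add: weak_differential_def)

lemma L2_measurable: "u \<in> L2 M \<Longrightarrow> u \<in> borel_measurable borel"
  by (simp add: L2_def)

lemma L2_integrable: "u \<in> L2 M \<Longrightarrow> integrable (vol M) (\<lambda>x. (u x)\<^sup>2)"
  by (simp add: L2_def)

lemma H1_L2: "u \<in> H1 M \<Longrightarrow> u \<in> L2 M"
  by (simp add: H1_def)

lemma H10_H1: "u \<in> H10 M \<Longrightarrow> u \<in> H1 M"
  by (simp add: H10_def)

lemma H1_sq_eq:
  assumes u: "u \<in> H1 M"
  shows "H1_sq M \<beta> u = dirichlet_form M u u + \<beta> * (\<integral>x. (u x)\<^sup>2 \<partial>vol M)"
  unfolding H1_sq_def dirichlet_form_def
  using wdiff_integrable[OF u] L2_integrable[OF H1_L2[OF u]] by simp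

lemma dirichlet_form_nonneg: "u \<in> H1 M \<Longrightarrow> 0 \<le> dirichlet_form M u u"
  unfolding dirichlet_form_def by (simp add: covector_inner_nonneg wdiff_field)

text \<open>\<open>dirichlet_form\<close> uses the differential picked by \<open>wdiff\<close>; by
  uniqueness any other weak differential gives the same integral. This admits explicit differentials
  for sums and for test functions.\<close>

lemma dirichlet_form_eq:
  assumes u: "u \<in> L2 M" and \<omega>: "weak_differential M u \<omega>"
  shows "dirichlet_form M u u = (\<integral>x. covector_inner M \<omega> \<omega> x \<partial>vol M)"
proof -
  have "u \<in> H1 M" using assms by (auto simp: H1_def)
  then show ?thesis unfolding dirichlet_form_def
    by (intro integral_cong_AE) (use weak_differential_unique_inner[OF wdiff_weak \<omega>] \<omega> wdiff_field
        covector_inner_measurable in \<open>auto simp: weak_differential_def\<close>)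
qed

lemma square_add_le:
  fixes x y :: real
  assumes "0 < \<delta>" shows "(x + y)\<^sup>2 \<le> (1 + \<delta>) * x\<^sup>2 + (1 + 1 / \<delta>) * y\<^sup>2"
proof -
  have "0 \<le> (\<delta> * x - y)\<^sup>2 / \<delta>" using assms by simp
  also have "\<dots> = \<delta> * x\<^sup>2 + y\<^sup>2 / \<delta> - 2 * x * y"
    using assms by (simp add: power2_eq_square field_simps)
  finally show ?thesis by (simp add: power2_eq_square algebra_simps)
qed

lemma L2_add:
  assumes u: "u \<in> L2 M" and w: "w \<in> L2 M"
  shows "(\<lambda>x. u x + s * w x) \<in> L2 M"
proof -
  have "integrable (vol M) (\<lambda>x. u x * w x)"
    by (rule square_integrable_mult) (use assms in \<open>auto simp: L2_def\<close>)
  then have "integrable (vol M) (\<lambda>x. (u x)\<^sup>2 + (2 * s * (u x * w x) + s\<^sup>2 * (w x)\<^sup>2))"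
    using assms by (auto simp: L2_def)
  moreover have "(\<lambda>x. u x + s * w x) \<in> borel_measurable borel"
    using assms by (intro borel_measurable_add borel_measurable_times) (auto simp: L2_def)
  ultimately show ?thesis by (simp add: L2_def power2_sum power_mult_distrib algebra_simps)
qed

lemma L2_diff: "u \<in> L2 M \<Longrightarrow> w \<in> L2 M \<Longrightarrow> (\<lambda>x. u x - w x) \<in> L2 M"
  using L2_add[of u w "-1"] by simp

lemma H1_add:
  assumes u: "u \<in> H1 M" and w: "w \<in> H1 M"
  shows "(\<lambda>x. u x + s * w x) \<in> H1 M"
  unfolding H1_def
  using L2_add[OF H1_L2[OF u] H1_L2[OF w], of s]
    weak_differential_add[OF H1_L2[OF u] wdiff_weak[OF u] H1_L2[OF w] wdiff_weak[OF w], of s]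
      by blast

lemma H1_diff: "u \<in> H1 M \<Longrightarrow> w \<in> H1 M \<Longrightarrow> (\<lambda>x. u x - w x) \<in> H1 M"
  using H1_add[of u w "-1"] by simp

lemma dirichlet_form_add_le:
  assumes u: "u \<in> H1 M" and w: "w \<in> H1 M" and d: "0 < \<delta>"
  shows "dirichlet_form M (\<lambda>x. u x + s * w x) (\<lambda>x. u x + s * w x)
    \<le> (1 + \<delta>) * dirichlet_form M u u + (1 + 1 / \<delta>) * (s\<^sup>2 * dirichlet_form M w w)"
proof -
  let ?\<omega> = "\<lambda>c p. wdiff M u c p + s *\<^sub>R wdiff M w c p"
  note a = weak_differential_add[OF H1_L2[OF u] wdiff_weak[OF u] H1_L2[OF w] wdiff_weak[OF w], of s]
  have "dirichlet_form M (\<lambda>x. u x + s * w x) (\<lambda>x. u x + s * w x) = (\<integral>x. covector_inner M ?\<omega> ?\<omega> x \<partial>vol M)"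
    by (rule dirichlet_form_eq[OF L2_add[OF H1_L2[OF u] H1_L2[OF w]] a])
  also have "\<dots> \<le> (\<integral>x. (1 + \<delta>) * covector_inner M (wdiff M u) (wdiff M u) x + (1 + 1 / \<delta>) * (s\<^sup>2 * covector_inner M (wdiff M w) (wdiff M w) x) \<partial>vol M)"
    using a wdiff_integrable[OF u] wdiff_integrable[OF w]
    by (intro integral_mono covector_inner_add_le[OF wdiff_field[OF u] wdiff_field[OF w] d])
      (auto simp: weak_differential_def)
  also have "\<dots> = (1 + \<delta>) * dirichlet_form M u u + (1 + 1 / \<delta>) * (s\<^sup>2 * dirichlet_form M w w)"
    unfolding dirichlet_form_def using wdiff_integrable[OF u] wdiff_integrable[OF w] by simp
  finally show ?thesis .
qed

lemma L2_sq_add_le: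
  assumes u: "u \<in> L2 M" and w: "w \<in> L2 M" and d: "0 < \<delta>"
  shows "(\<integral>x. (u x + s * w x)\<^sup>2 \<partial>vol M) \<le> (1 + \<delta>) * (\<integral>x. (u x)\<^sup>2 \<partial>vol M) + (1 + 1 / \<delta>) * (s\<^sup>2 * (\<integral>x. (w x)\<^sup>2 \<partial>vol M))"
proof -
  have "(\<integral>x. (u x + s * w x)\<^sup>2 \<partial>vol M) \<le> (\<integral>x. (1 + \<delta>) * (u x)\<^sup>2 + (1 + 1 / \<delta>) * (s\<^sup>2 * (w x)\<^sup>2) \<partial>vol M)"
    using L2_integrable[OF L2_add[OF u w, of s]] L2_integrable[OF u] L2_integrable[OF w]
      square_add_le[OF d, of "u _" "s * w _"]
        by (intro integral_mono) (auto simp: power_mult_distrib)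
  then show ?thesis using L2_integrable[OF u] L2_integrable[OF w] by simp
qed

lemma H1_sq_add_le:
  assumes u: "u \<in> H1 M" and w: "w \<in> H1 M" and d: "0 < \<delta>"
  shows "H1_sq M 1 (\<lambda>x. u x + s * w x) \<le> (1 + \<delta>) * H1_sq M 1 u + (1 + 1 / \<delta>) * (s\<^sup>2 * H1_sq M 1 w)"
  using dirichlet_form_add_le[OF assms, of s] L2_sq_add_le[OF H1_L2[OF u] H1_L2[OF w] d, of s]
  unfolding H1_sq_eq[OF u] H1_sq_eq[OF w] H1_sq_eq[OF H1_add[OF u w]]
  by (simp add: algebra_simps)

lemma H1_sq_nonneg: "u \<in> H1 M \<Longrightarrow> 0 \<le> H1_sq M 1 u"
  by (simp add: H1_sq_eq dirichlet_form_nonneg)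

lemma L2_le_H1_sq: "u \<in> H1 M \<Longrightarrow> (\<integral>x. (u x)\<^sup>2 \<partial>vol M) \<le> H1_sq M 1 u"
  by (simp add: H1_sq_eq dirichlet_form_nonneg)

lemma wdiff_cong:
  assumes "u \<in> L2 M" "w \<in> L2 M" "AE x in vol M. u x = w x"
  shows "wdiff M u = wdiff M w"
  unfolding wdiff_def using weak_differential_cong[OF L2_measurable L2_measurable] assms by metis

lemma H1_sq_cong:
  assumes "u \<in> L2 M" "w \<in> L2 M" "AE x in vol M. u x = w x"
  shows "H1_sq M \<beta> u = H1_sq M \<beta> w"
proof -
  have e: "wdiff M u = wdiff M w" by (rule wdiff_cong[OF assms])
  show ?thesis
  proof (cases "covector_inner M (wdiff M w) (wdiff M w) \<in> borel_measurable borel")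
    case True
    note [measurable] = True L2_measurable[OF assms(1)] L2_measurable[OF assms(2)]
    show ?thesis unfolding H1_sq_def e
    proof (rule integral_cong_AE)
      show "AE x in vol M. covector_inner M (wdiff M w) (wdiff M w) x + \<beta> * (u x)\<^sup>2
          = covector_inner M (wdiff M w) (wdiff M w) x + \<beta> * (w x)\<^sup>2"
        using assms(3) by eventually_elim simp
    qed (simp_all, measurable)
  next
    \<comment> \<open>Without measurability neither integrand is integrable, and both integrals have
      the default value 0.\<close>
    case False
    have "\<not> integrable (vol M) (\<lambda>x. covector_inner M (wdiff M w) (wdiff M w) x + \<beta> * (f x)\<^sup>2)" if "f \<in> L2 M" for f
    proof
      assume "integrable (vol M) (\<lambda>x. covector_inner M (wdiff M w) (wdiff M w) x + \<beta> * (f x)\<^sup>2)"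
      then have "(\<lambda>x. covector_inner M (wdiff M w) (wdiff M w) x + \<beta> * (f x)\<^sup>2) \<in> borel_measurable borel"
        by (drule_tac borel_measurable_integrable) simp
      moreover have "(\<lambda>x. \<beta> * (f x)\<^sup>2) \<in> borel_measurable borel"
        using L2_measurable[OF that] by simp
      ultimately have "(\<lambda>x. (covector_inner M (wdiff M w) (wdiff M w) x + \<beta> * (f x)\<^sup>2) - \<beta> * (f x)\<^sup>2) \<in> borel_measurable borel"
        by (rule borel_measurable_diff)
      then show False using False by simp
    qed
    from this[OF assms(1)] this[OF assms(2)] show ?thesis
      unfolding H1_sq_def e by (simp add: not_integrable_integral_eq)
  qed
qed

text \<open>Differences of the approximating test functions approximate the difference; Young's
  inequality with \<delta> = 1 bounds the error.\<close>

lemma H10_diff: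
  assumes u: "u \<in> H10 M" and w: "w \<in> H10 M"
  shows "(\<lambda>x. u x - w x) \<in> H10 M"
proof -
  from u obtain \<psi> where \<psi>: "\<And>n. \<psi> n \<in> test_functions M" "(\<lambda>n. H1_sq M 1 (\<lambda>x. \<psi> n x - u x)) \<longlonglongrightarrow> 0"
    by (auto simp: H10_def)
  from w obtain \<phi> where \<phi>: "\<And>n. \<phi> n \<in> test_functions M" "(\<lambda>n. H1_sq M 1 (\<lambda>x. \<phi> n x - w x)) \<longlonglongrightarrow> 0"
    by (auto simp: H10_def)
  have h1: "(\<lambda>x. \<psi> n x - u x) \<in> H1 M" "(\<lambda>x. \<phi> n x - w x) \<in> H1 M" for n
    using H1_diff test_function_H1 \<psi>(1) \<phi>(1) H10_H1[OF u] H10_H1[OF w] by auto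
  have e: "(\<lambda>x. (\<psi> n x - \<phi> n x) - (u x - w x)) = (\<lambda>x. (\<psi> n x - u x) + (- 1) * (\<phi> n x - w x))" for n
    by (simp add: algebra_simps)
  have lim: "(\<lambda>n. H1_sq M 1 (\<lambda>x. (\<psi> n x - \<phi> n x) - (u x - w x))) \<longlonglongrightarrow> 0"
  proof (rule tendsto_sandwich[OF _ _ tendsto_const])
    show "\<forall>\<^sub>F n in sequentially. 0 \<le> H1_sq M 1 (\<lambda>x. (\<psi> n x - \<phi> n x) - (u x - w x))"
      unfolding e by (intro always_eventually allI H1_sq_nonneg H1_add h1)
    have "H1_sq M 1 (\<lambda>x. (\<psi> n x - \<phi> n x) - (u x - w x)) \<le> 2 * H1_sq M 1 (\<lambda>x. \<psi> n x - u x) + 2 * H1_sq M 1 (\<lambda>x. \<phi> n x - w x)" for n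
      unfolding e using H1_sq_add_le[OF h1(1) h1(2), of 1 n "- 1" n] by simp
    then show "\<forall>\<^sub>F n in sequentially. H1_sq M 1 (\<lambda>x. (\<psi> n x - \<phi> n x) - (u x - w x))
       \<le> 2 * H1_sq M 1 (\<lambda>x. \<psi> n x - u x) + 2 * H1_sq M 1 (\<lambda>x. \<phi> n x - w x)" by simp
    show "(\<lambda>n. 2 * H1_sq M 1 (\<lambda>x. \<psi> n x - u x) + 2 * H1_sq M 1 (\<lambda>x. \<phi> n x - w x)) \<longlonglongrightarrow> 0"
      using tendsto_add[OF tendsto_mult_left[OF \<psi>(2), of 2] tendsto_mult_left[OF \<phi>(2), of 2]]
        by simp
  qed
  show ?thesis unfolding H10_def
    using H1_diff[OF H10_H1[OF u] H10_H1[OF w]] lim test_functions_diff[OF \<psi>(1) \<phi>(1)]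
    by (auto intro!: exI[of _ "\<lambda>n x. \<psi> n x - \<phi> n x"])
qed

section \<open>The Sobolev inequality\<close>

text \<open>The Euclidean inequality on the open box is transported by the bounds on metric and
  volume density. They depend only on the chart and the box, hence so does \<open>S\<close>.\<close>

lemma Sobolev_test_box:
  assumes D: "CARD('n) \<ge> 3" and c: "c \<in> atlas M"
    and ab: "\<And>i. i \<in> Basis \<Longrightarrow> a \<bullet> i < b \<bullet> (i :: real ^ 'n)" "cbox a b \<subseteq> chart_img c"
  shows "\<exists>S\<ge>0. \<forall>\<psi>\<in>test_functions M.
    (\<integral>\<^sup>+p. ennreal (\<bar>\<psi> p\<bar> powr (2 * real CARD('n) / (real CARD('n) - 2))) * indicator (chart_inv c ` cbox a b) p \<partial>vol M)
    \<le> ennreal (S * H1_sq M 1 \<psi> powr (real CARD('n) / (real CARD('n) - 2)))"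
proof -
  define q where "q = 2 * real CARD('n) / (real CARD('n) - 2)"
  define r where "r = real CARD('n) / (real CARD('n) - 2)"
  have r: "0 < r" "0 < q" using D by (auto simp: r_def q_def)
  have D': "DIM(real ^ 'n) \<ge> 3" using D by simp
  have dim: "DIM(real ^ 'n) = CARD('n)" by simp
  show ?thesis
  proof (rule Sobolev_box[OF D' ab(1), unfolded dim, folded q_def r_def])
  fix C :: real
  assume C: "0 < C"
    "\<And>(w :: real ^ 'n \<Rightarrow> real) W K. (\<And>x. x \<in> box a b \<Longrightarrow> (w has_derivative W x) (at x)) \<Longrightarrow>
      (\<And>v. continuous_on (box a b) (\<lambda>x. W x v)) \<Longrightarrow>
      (\<And>x. x \<in> box a b \<Longrightarrow> \<bar>w x\<bar> \<le> K) \<Longrightarrow>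
      (\<And>x i. x \<in> box a b \<Longrightarrow> i \<in> Basis \<Longrightarrow> \<bar>W x i\<bar> \<le> K) \<Longrightarrow>
      (\<integral>x. indicator (box a b) x * \<bar>w x\<bar> powr q \<partial>lborel)
      \<le> C * (\<integral>x. indicator (box a b) x * ((w x)\<^sup>2 + (\<Sum>i\<in>Basis. (W x i)\<^sup>2)) \<partial>lborel) powr r"
  obtain B where B: "0 < B" "\<And>h. h \<in> borel_measurable borel \<Longrightarrow>
    (\<integral>\<^sup>+p. h p * indicator (chart_inv c ` cbox a b) p \<partial>vol M) \<le> ennreal B * (\<integral>\<^sup>+x. indicator (box a b) x * h (chart_inv c x) \<partial>lborel)"
    by (rule nn_integral_inv_box_le[OF c ab(2)]) blast
  obtain k where k: "0 < k" "\<And>h. h \<in> borel_measurable borel \<Longrightarrow>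
    (\<integral>\<^sup>+x. indicator (cbox a b) x * h (chart_inv c x) \<partial>lborel) \<le> ennreal k * (\<integral>\<^sup>+p. h p \<partial>vol M)"
    by (rule nn_integral_pullback_le[OF c compact_cbox ab(2)]) blast
  obtain m where m: "0 < m" "\<And>x \<xi>. x \<in> cbox a b \<Longrightarrow> m * (norm \<xi>)\<^sup>2 \<le> \<xi> \<bullet> (matrix_inv (gram c x) *v \<xi>)"
    by (rule gram_bounds[OF c compact_cbox ab(2)]) metis
  \<comment> \<open>Converts the Euclidean energy on the box into the squared norm on the manifold:
    \<open>k\<close> comes from the volume density, \<open>1 / m\<close> from the inverse Gram
    matrix.\<close>
  define \<kappa> where "\<kappa> = k * (1 + 1 / m)"
  have \<kappa>: "0 < \<kappa>" using k m by (simp add: \<kappa>_def add_pos_pos)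
  have bi: "box a b \<subseteq> interior (chart_img c)"
    by (rule interior_maximal) (use ab(2) box_subset_cbox[of a b] in auto)
  show ?thesis
  proof (intro exI[of _ "B * C * \<kappa> powr r"] conjI ballI)
    show "0 \<le> B * C * \<kappa> powr r" using B C by simp
    fix \<psi> assume \<psi>: "\<psi> \<in> test_functions M"
    note s = test_functions_smooth[OF \<psi> c] and f = classical_differential_field[OF \<psi>]
    let ?h = "covector_inner M (classical_differential \<psi>) (classical_differential \<psi>)"
    define w where "w = \<psi> \<circ> chart_inv c"
    define W where "W x = frechet_derivative w (at x)" for x
    define N where "N = H1_sq M 1 \<psi>"
    have \<psi>m: "\<psi> \<in> borel_measurable borel" by (rule L2_measurable[OF test_function_L2[OF \<psi>]])
    have N: "N = (\<integral>p. ?h p \<partial>vol M) + (\<integral>p. (\<psi> p)\<^sup>2 \<partial>vol M)"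
      unfolding N_def by (simp add: H1_sq_eq[OF test_function_H1[OF \<psi>]]
          dirichlet_form_eq[OF test_function_L2[OF \<psi>] classical_weak_differential[OF \<psi>]])
    have i0: "0 \<le> (\<integral>p. ?h p \<partial>vol M)" "0 \<le> (\<integral>p. (\<psi> p)\<^sup>2 \<partial>vol M)"
      by (auto intro!: Bochner_Integration.integral_nonneg covector_inner_nonneg[OF f])
    have N0: "0 \<le> N" unfolding N using i0 by simp
    obtain K where K: "\<And>x. x \<in> cbox a b \<Longrightarrow> \<bar>\<psi> (chart_inv c x)\<bar> \<le> K"
      "\<And>x v. x \<in> cbox a b \<inter> interior (chart_img c) \<Longrightarrow> v \<in> Basis \<Longrightarrow> \<bar>frechet_derivative (\<psi> \<circ> chart_inv c) (at x) v\<bar> \<le> K"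
      by (rule test_derivative_bounds[OF \<psi> c ab(2)]) blast
    have sub: "x \<in> cbox a b" if "x \<in> box a b" for x using that box_subset_cbox[of a b] by auto
    have wK: "\<bar>w x\<bar> \<le> K" if "x \<in> box a b" for x using K(1)[OF sub[OF that]] by (simp add: w_def)
    have WK: "\<bar>W x i\<bar> \<le> K" if "x \<in> box a b" "i \<in> Basis" for x i
      using K(2)[of x i] sub[OF that(1)] that bi by (auto simp: W_def w_def)
    have dw: "(w has_derivative W x) (at x)" if "x \<in> box a b" for x
      unfolding W_def w_def by (rule smooth_chart_derivative(1)[OF s]) (use bi that in auto)
    have cW: "continuous_on (box a b) (\<lambda>x. W x v)" for v
      unfolding W_def w_def by (rule continuous_on_subset[OF smooth_chart_derivative(2)[OF s] bi])
    have cw: "continuous_on (box a b) w"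
      using dw by (intro continuous_at_imp_continuous_on ballI has_derivative_continuous) auto
    define X where "X = (\<integral>x. indicator (box a b) x * \<bar>w x\<bar> powr q \<partial>lborel)"
    define Y where "Y = (\<integral>x. indicator (box a b) x * ((w x)\<^sup>2 + (\<Sum>i\<in>Basis. (W x i)\<^sup>2)) \<partial>lborel)"
    have XY: "X \<le> C * Y powr r" unfolding X_def Y_def by (rule C(2)[OF dw cW wK WK])
    have Y0: "0 \<le> Y"
      unfolding Y_def by (intro Bochner_Integration.integral_nonneg) (auto intro!: mult_nonneg_nonneg add_nonneg_nonneg sum_nonneg)
    have iX: "integrable lborel (\<lambda>x. indicator (box a b) x * \<bar>w x\<bar> powr q)"
    proof (rule integrable_on_box)
      show "continuous_on (box a b) (\<lambda>x. \<bar>w x\<bar> powr q)"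
        using r by (intro continuous_on_powr' continuous_intros cw) auto
      show "\<bar>\<bar>w x\<bar> powr q\<bar> \<le> K powr q" if "x \<in> box a b" for x
        using wK[OF that] r by (simp add: powr_mono2)
    qed
    have iY: "integrable lborel (\<lambda>x. indicator (box a b) x * ((w x)\<^sup>2 + (\<Sum>i\<in>Basis. (W x i)\<^sup>2)))"
    proof (rule integrable_on_box)
      show "continuous_on (box a b) (\<lambda>x. (w x)\<^sup>2 + (\<Sum>i\<in>Basis. (W x i)\<^sup>2))"
        by (intro continuous_intros cw cW)
      fix x assume x: "x \<in> box a b"
      have sq: "y\<^sup>2 \<le> K\<^sup>2" if "\<bar>y\<bar> \<le> K" for y
        using that by (metis abs_ge_self abs_le_square_iff order_trans)
      have "(\<Sum>i\<in>Basis. (W x i)\<^sup>2) \<le> (\<Sum>i\<in>(Basis::(real ^ 'n) set). K\<^sup>2)"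
        using WK[OF x] by (intro sum_mono sq)
      moreover have "0 \<le> (\<Sum>i\<in>Basis. (W x i)\<^sup>2)" by (intro sum_nonneg) auto
      ultimately show "\<bar>(w x)\<^sup>2 + (\<Sum>i\<in>Basis. (W x i)\<^sup>2)\<bar> \<le> K\<^sup>2 + (\<Sum>i\<in>(Basis::(real ^ 'n) set). K\<^sup>2)"
        using sq[OF wK[OF x]] by simp
    qed
    have "ennreal Y = (\<integral>\<^sup>+x. ennreal (indicator (box a b) x * ((w x)\<^sup>2 + (\<Sum>i\<in>Basis. (W x i)\<^sup>2))) \<partial>lborel)"
      unfolding Y_def by (rule nn_integral_eq_integral[symmetric, OF iY])
        (auto intro!: mult_nonneg_nonneg add_nonneg_nonneg sum_nonneg)
    also have "\<dots> \<le> (\<integral>\<^sup>+x. indicator (cbox a b) x * ennreal ((\<psi> (chart_inv c x))\<^sup>2 + ?h (chart_inv c x) / m) \<partial>lborel)"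
    proof (rule nn_integral_mono)
      fix x
      show "ennreal (indicator (box a b) x * ((w x)\<^sup>2 + (\<Sum>i\<in>Basis. (W x i)\<^sup>2)))
        \<le> indicator (cbox a b) x * ennreal ((\<psi> (chart_inv c x))\<^sup>2 + ?h (chart_inv c x) / m)"
      proof (cases "x \<in> box a b")
        case True
        then have xc: "x \<in> cbox a b" and xi: "x \<in> interior (chart_img c)" and d: "chart_inv c x \<in> chart_dom c"
          using sub bi ab(2) chart_inv_dom[OF c] by auto
        have "(\<Sum>i\<in>Basis. (W x i)\<^sup>2) = (norm (classical_differential \<psi> c (chart_inv c x)))\<^sup>2"
          using norm_classical_differential[OF \<psi> c xi] by (simp add: W_def w_def)
        also have "\<dots> \<le> ?h (chart_inv c x) / m"
          using m(1) m(2)[OF xc]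
            by (simp add: covector_inner_chart[OF f f c d] le_divide_eq mult.commute)
        finally show ?thesis using True xc by (simp add: w_def ennreal_leI)
      qed simp
    qed
    also have "\<dots> \<le> ennreal k * (\<integral>\<^sup>+p. ennreal ((\<psi> p)\<^sup>2 + ?h p / m) \<partial>vol M)"
      by (rule k(2)) (use \<psi>m covector_inner_measurable[OF f f] in simp)
    also have "(\<integral>\<^sup>+p. ennreal ((\<psi> p)\<^sup>2 + ?h p / m) \<partial>vol M) = ennreal ((\<integral>p. (\<psi> p)\<^sup>2 \<partial>vol M) + (\<integral>p. ?h p \<partial>vol M) / m)"
      using L2_integrable[OF test_function_L2[OF \<psi>]] classical_differential_integrable[OF \<psi>] m(1) covector_inner_nonneg[OF f]
      by (subst nn_integral_eq_integral) (auto intro!: AE_I2)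
    also have "ennreal k * \<dots> = ennreal (k * ((\<integral>p. (\<psi> p)\<^sup>2 \<partial>vol M) + (\<integral>p. ?h p \<partial>vol M) / m))"
      using k(1) by (simp add: ennreal_mult')
    also have "\<dots> \<le> ennreal (\<kappa> * N)"
    proof (rule ennreal_leI)
      have "(\<integral>p. (\<psi> p)\<^sup>2 \<partial>vol M) + (\<integral>p. ?h p \<partial>vol M) / m \<le> (1 + 1 / m) * N"
        unfolding N using i0 m(1) by (simp add: algebra_simps add_divide_distrib)
      then show "k * ((\<integral>p. (\<psi> p)\<^sup>2 \<partial>vol M) + (\<integral>p. ?h p \<partial>vol M) / m) \<le> \<kappa> * N"
        unfolding \<kappa>_def using k(1) by (simp only: mult.assoc mult_le_cancel_left_pos)
    qed
    finally have YN: "Y \<le> \<kappa> * N" using N0 \<kappa> by (subst (asm) ennreal_le_iff) auto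
    have "(\<integral>\<^sup>+p. ennreal (\<bar>\<psi> p\<bar> powr q) * indicator (chart_inv c ` cbox a b) p \<partial>vol M)
       \<le> ennreal B * (\<integral>\<^sup>+x. indicator (box a b) x * ennreal (\<bar>\<psi> (chart_inv c x)\<bar> powr q) \<partial>lborel)"
      by (rule B(2)) (use \<psi>m in simp)
    also have "(\<integral>\<^sup>+x. indicator (box a b) x * ennreal (\<bar>\<psi> (chart_inv c x)\<bar> powr q) \<partial>lborel) = (\<integral>\<^sup>+x. ennreal (indicator (box a b) x * \<bar>w x\<bar> powr q) \<partial>lborel)"
      by (rule nn_integral_cong) (simp add: w_def indicator_def)
    also have "\<dots> = ennreal X"
      unfolding X_def by (rule nn_integral_eq_integral[OF iX]) auto
    also have "ennreal B * ennreal X = ennreal (B * X)" using B(1) by (simp add: ennreal_mult')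
    also have "\<dots> \<le> ennreal (B * C * \<kappa> powr r * N powr r)"
    proof (rule ennreal_leI)
      have "Y powr r \<le> (\<kappa> * N) powr r" using YN Y0 r by (intro powr_mono2) auto
      also have "\<dots> = \<kappa> powr r * N powr r" using \<kappa> N0 by (simp add: powr_mult)
      finally have "C * Y powr r \<le> C * (\<kappa> powr r * N powr r)" using C(1) by simp
      with XY have "X \<le> C * (\<kappa> powr r * N powr r)" by linarith
      then have "B * X \<le> B * (C * (\<kappa> powr r * N powr r))" using B(1) by simp
      then show "B * X \<le> B * C * \<kappa> powr r * N powr r" by (simp add: mult.assoc)
    qed
    finally show "(\<integral>\<^sup>+p. ennreal (\<bar>\<psi> p\<bar> powr (2 * real CARD('n) / (real CARD('n) - 2))) * indicator (chart_inv c ` cbox a b) p \<partial>vol M)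
      \<le> ennreal (B * C * \<kappa> powr r * H1_sq M 1 \<psi> powr (real CARD('n) / (real CARD('n) - 2)))"
      unfolding N_def q_def r_def .
  qed
  qed
qed

lemma Sobolev_test:
  assumes D: "CARD('n) \<ge> 3"
  shows "\<exists>S\<ge>0. \<forall>\<psi>\<in>test_functions M.
    (\<integral>\<^sup>+p. ennreal (\<bar>\<psi> p\<bar> powr (2 * real CARD('n) / (real CARD('n) - 2))) \<partial>vol M)
    \<le> ennreal (S * H1_sq M 1 \<psi> powr (real CARD('n) / (real CARD('n) - 2)))"
proof -
  define q where "q = 2 * real CARD('n) / (real CARD('n) - 2)"
  define r where "r = real CARD('n) / (real CARD('n) - 2)"
  obtain \<B> where \<B>: "finite \<B>"
    "\<And>c a b. (c, a, b) \<in> \<B> \<Longrightarrow> c \<in> atlas M \<and> (\<forall>i\<in>Basis. a \<bullet> i < b \<bullet> (i :: real ^ 'n)) \<and> cbox a b \<subseteq> chart_img c"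
    "\<And>p. \<exists>(c, a, b)\<in>\<B>. p \<in> chart_inv c ` cbox a b" by (rule box_cover) blast
  define I where "I t \<psi> = (case t of (c, a, b) \<Rightarrow>
     \<integral>\<^sup>+p. ennreal (\<bar>\<psi> p\<bar> powr q) * indicator (chart_inv c ` cbox a b) p \<partial>vol M)" for t :: "('m, 'n) chart \<times> (real ^ 'n) \<times> (real ^ 'n)" and \<psi>
  have "\<forall>t\<in>\<B>. \<exists>S\<ge>0. \<forall>\<psi>\<in>test_functions M. I t \<psi> \<le> ennreal (S * H1_sq M 1 \<psi> powr r)"
  proof
    fix t assume "t \<in> \<B>"
    moreover obtain c a b where t: "t = (c, a, b)" by (cases t)
    ultimately have "c \<in> atlas M" "\<And>i. i \<in> Basis \<Longrightarrow> a \<bullet> i < b \<bullet> i" "cbox a b \<subseteq> chart_img c"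
      using \<B>(2) by blast+
    from Sobolev_test_box[OF D this] show "\<exists>S\<ge>0. \<forall>\<psi>\<in>test_functions M. I t \<psi> \<le> ennreal (S * H1_sq M 1 \<psi> powr r)"
      unfolding I_def q_def r_def t prod.case .
  qed
  then obtain S where S: "\<And>t. t \<in> \<B> \<Longrightarrow> 0 \<le> S t" "\<And>t \<psi>. t \<in> \<B> \<Longrightarrow> \<psi> \<in> test_functions M \<Longrightarrow> I t \<psi> \<le> ennreal (S t * H1_sq M 1 \<psi> powr r)"
    by metis
  have "(\<integral>\<^sup>+p. ennreal (\<bar>\<psi> p\<bar> powr q) \<partial>vol M) \<le> ennreal ((\<Sum>t\<in>\<B>. S t) * H1_sq M 1 \<psi> powr r)"
    if \<psi>: "\<psi> \<in> test_functions M" for \<psi>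
  proof -
    have "(\<integral>\<^sup>+p. ennreal (\<bar>\<psi> p\<bar> powr q) \<partial>vol M) \<le> (\<Sum>t\<in>\<B>. I t \<psi>)"
    proof -
      have [measurable]: "\<psi> \<in> borel_measurable borel"
        by (rule L2_measurable[OF test_function_L2[OF \<psi>]])
      show ?thesis unfolding I_def by (rule nn_integral_cover_le[OF \<B>]) measurable
    qed
    also have "\<dots> \<le> (\<Sum>t\<in>\<B>. ennreal (S t * H1_sq M 1 \<psi> powr r))" by (intro sum_mono S(2) \<psi>)
    also have "\<dots> = ennreal ((\<Sum>t\<in>\<B>. S t) * H1_sq M 1 \<psi> powr r)"
      using S(1) by (subst sum_ennreal) (auto simp: sum_distrib_right)
    finally show ?thesis .
  qed
  then show ?thesis
    using S(1) unfolding q_def r_def by (intro exI[of _ "\<Sum>t\<in>\<B>. S t"]) (auto intro: sum_nonneg)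
qed

text \<open>A subsequence of the approximating test functions converges almost everywhere, and
  Fatou's lemma bounds the integral for u by the lower limit. The factor \<open>2 powr r\<close>
  comes from Young's inequality for the squared norm.\<close>

lemma Sobolev_H10:
  assumes D: "CARD('n) \<ge> 3"
  shows "\<exists>S\<ge>0. \<forall>u\<in>H10 M.
    integrable (vol M) (\<lambda>x. \<bar>u x\<bar> powr (2 * real CARD('n) / (real CARD('n) - 2))) \<and>
    (\<integral>x. \<bar>u x\<bar> powr (2 * real CARD('n) / (real CARD('n) - 2)) \<partial>vol M)
    \<le> S * H1_sq M 1 u powr (real CARD('n) / (real CARD('n) - 2))"
proof -
  define q where "q = 2 * real CARD('n) / (real CARD('n) - 2)"
  define r where "r = real CARD('n) / (real CARD('n) - 2)"
  have r: "0 < r" "0 < q" using D by (auto simp: r_def q_def)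
  obtain S where S: "0 \<le> S" "\<And>\<psi>. \<psi> \<in> test_functions M \<Longrightarrow>
    (\<integral>\<^sup>+p. ennreal (\<bar>\<psi> p\<bar> powr q) \<partial>vol M) \<le> ennreal (S * H1_sq M 1 \<psi> powr r)"
    using Sobolev_test[OF D] unfolding q_def r_def by blast
  have "integrable (vol M) (\<lambda>x. \<bar>u x\<bar> powr q) \<and> (\<integral>x. \<bar>u x\<bar> powr q \<partial>vol M) \<le> (S * 2 powr r) * H1_sq M 1 u powr r"
    if u: "u \<in> H10 M" for u
  proof -
    from u obtain \<psi> where \<psi>: "\<And>n. \<psi> n \<in> test_functions M" and lim: "(\<lambda>n. H1_sq M 1 (\<lambda>x. \<psi> n x - u x)) \<longlonglongrightarrow> 0"
      by (auto simp: H10_def)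
    note uH = H10_H1[OF u]
    have um: "u \<in> borel_measurable borel" using H1_L2[OF uH] by (rule L2_measurable)
    have \<psi>m: "\<psi> n \<in> borel_measurable borel" for n by (rule L2_measurable[OF test_function_L2[OF \<psi>]])
    have dH: "(\<lambda>x. \<psi> n x - u x) \<in> H1 M" for n by (rule H1_diff[OF test_function_H1[OF \<psi>] uH])
    have "(\<lambda>n. \<integral>x. norm ((\<psi> n x - u x)\<^sup>2) \<partial>vol M) \<longlonglongrightarrow> 0"
    proof (rule tendsto_sandwich[OF _ _ tendsto_const lim])
      show "\<forall>\<^sub>F n in sequentially. (\<integral>x. norm ((\<psi> n x - u x)\<^sup>2) \<partial>vol M) \<le> H1_sq M 1 (\<lambda>x. \<psi> n x - u x)"
        using L2_le_H1_sq[OF dH] by simp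
    qed simp
    from tendsto_L1_AE_subseq[OF L2_integrable[OF H1_L2[OF dH]] this]
    obtain \<rho> where \<rho>: "strict_mono \<rho>" "AE x in vol M. (\<lambda>n. (\<psi> (\<rho> n) x - u x)\<^sup>2) \<longlonglongrightarrow> 0" by blast
    have ae: "AE x in vol M. ennreal (\<bar>u x\<bar> powr q) = liminf (\<lambda>n. ennreal (\<bar>\<psi> (\<rho> n) x\<bar> powr q))"
      using \<rho>(2)
    proof eventually_elim
      case (elim x)
      have "(\<lambda>n. sqrt ((\<psi> (\<rho> n) x - u x)\<^sup>2)) \<longlonglongrightarrow> sqrt 0" by (intro tendsto_real_sqrt elim)
      then have "(\<lambda>n. \<psi> (\<rho> n) x - u x) \<longlonglongrightarrow> 0" by (simp add: tendsto_rabs_zero_iff)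
      then have "(\<lambda>n. \<psi> (\<rho> n) x) \<longlonglongrightarrow> u x" by (simp add: LIM_zero_iff)
      then have "(\<lambda>n. \<bar>\<psi> (\<rho> n) x\<bar> powr q) \<longlonglongrightarrow> \<bar>u x\<bar> powr q"
        using r by (intro tendsto_powr' tendsto_rabs tendsto_const) auto
      then have "(\<lambda>n. ennreal (\<bar>\<psi> (\<rho> n) x\<bar> powr q)) \<longlonglongrightarrow> ennreal (\<bar>u x\<bar> powr q)"
        by (rule tendsto_ennrealI)
      then show ?case by (intro lim_imp_Liminf[symmetric]) auto
    qed
    have "(\<integral>\<^sup>+x. ennreal (\<bar>u x\<bar> powr q) \<partial>vol M) = (\<integral>\<^sup>+x. liminf (\<lambda>n. ennreal (\<bar>\<psi> (\<rho> n) x\<bar> powr q)) \<partial>vol M)"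
      by (rule nn_integral_cong_AE[OF ae])
    also have "\<dots> \<le> liminf (\<lambda>n. \<integral>\<^sup>+x. ennreal (\<bar>\<psi> (\<rho> n) x\<bar> powr q) \<partial>vol M)"
      by (rule nn_integral_liminf) (use \<psi>m in simp)
    also have "\<dots> \<le> liminf (\<lambda>n. ennreal (S * (2 * H1_sq M 1 u + 2 * H1_sq M 1 (\<lambda>x. \<psi> (\<rho> n) x - u x)) powr r))"
    proof (rule Liminf_mono, rule always_eventually, rule allI)
      fix n
      have "H1_sq M 1 (\<psi> (\<rho> n)) \<le> 2 * H1_sq M 1 u + 2 * H1_sq M 1 (\<lambda>x. \<psi> (\<rho> n) x - u x)"
        using H1_sq_add_le[OF uH dH[of "\<rho> n"], of 1 1] by simp
      then have "S * H1_sq M 1 (\<psi> (\<rho> n)) powr r \<le> S * (2 * H1_sq M 1 u + 2 * H1_sq M 1 (\<lambda>x. \<psi> (\<rho> n) x - u x)) powr r"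
        using H1_sq_nonneg[OF test_function_H1[OF \<psi>]] r S(1)
          by (intro mult_left_mono powr_mono2) auto
      then show "(\<integral>\<^sup>+x. ennreal (\<bar>\<psi> (\<rho> n) x\<bar> powr q) \<partial>vol M) \<le> ennreal (S * (2 * H1_sq M 1 u + 2 * H1_sq M 1 (\<lambda>x. \<psi> (\<rho> n) x - u x)) powr r)"
        using S(2)[OF \<psi>[of "\<rho> n"]] ennreal_leI order_trans by blast
    qed
    also have "\<dots> = ennreal (S * (2 * H1_sq M 1 u + 2 * 0) powr r)"
    proof (rule lim_imp_Liminf)
      have l: "(\<lambda>n. H1_sq M 1 (\<lambda>x. \<psi> (\<rho> n) x - u x)) \<longlonglongrightarrow> 0"
        using LIMSEQ_subseq_LIMSEQ[OF lim \<rho>(1)] by (simp add: o_def)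
      show "(\<lambda>n. ennreal (S * (2 * H1_sq M 1 u + 2 * H1_sq M 1 (\<lambda>x. \<psi> (\<rho> n) x - u x)) powr r)) \<longlonglongrightarrow> ennreal (S * (2 * H1_sq M 1 u + 2 * 0) powr r)"
        using r H1_sq_nonneg[OF uH] H1_sq_nonneg[OF dH]
        by (intro tendsto_ennrealI tendsto_mult tendsto_powr' tendsto_add tendsto_const l) (auto intro!: always_eventually add_nonneg_nonneg)
    qed simp
    also have "S * (2 * H1_sq M 1 u + 2 * 0) powr r = (S * 2 powr r) * H1_sq M 1 u powr r"
      using H1_sq_nonneg[OF uH] by (simp add: powr_mult)
    finally have le: "(\<integral>\<^sup>+x. ennreal (\<bar>u x\<bar> powr q) \<partial>vol M) \<le> ennreal ((S * 2 powr r) * H1_sq M 1 u powr r)" .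
    have i: "integrable (vol M) (\<lambda>x. \<bar>u x\<bar> powr q)"
      using um le_less_trans[OF le ennreal_less_top] by (intro integrableI_bounded) auto
    moreover have "(\<integral>x. \<bar>u x\<bar> powr q \<partial>vol M) \<le> (S * 2 powr r) * H1_sq M 1 u powr r"
      using le S(1) by (subst (asm) nn_integral_eq_integral[OF i]) (auto intro!: mult_nonneg_nonneg)
    ultimately show ?thesis ..
  qed
  then show ?thesis
    unfolding q_def r_def using S(1) by (intro exI[of _ "S * 2 powr r"]) (auto simp: r_def)
qed

end

section \<open>Differential inequalities\<close>

text \<open>Solutions give derivatives relative to the half-line, one-sided at 0; at later times
  these are ordinary derivatives, as the mean value theorem requires.\<close>

lemma derivative_interior:
  fixes f :: "real \<Rightarrow> real"
  assumes "(f has_real_derivative D) (at t within {0..})" "0 < t"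
  shows "(f has_real_derivative D) (at t)"
proof -
  have "{0<..} \<subseteq> {0 :: real..}" by auto
  then show ?thesis using assms at_within_open_subset[of t "{0<..}" "{0..}"] by simp
qed

lemma derivative_continuous_on:
  fixes f :: "real \<Rightarrow> real"
  assumes "\<And>t. 0 \<le> t \<Longrightarrow> (f has_real_derivative f' t) (at t within {0..})"
  shows "continuous_on {0..} f"
  using assms by (intro DERIV_continuous_on[of "{0..}" f f']) auto

lemma half_line_mono:
  fixes f :: "real \<Rightarrow> real"
  assumes d: "\<And>t. 0 \<le> t \<Longrightarrow> (f has_real_derivative f' t) (at t within {0..})"
    and st: "0 \<le> s" "s \<le> t" and nn: "\<And>r. s < r \<Longrightarrow> r < t \<Longrightarrow> 0 \<le> f' r"
  shows "f s \<le> f t"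
proof (cases "s = t")
  case False
  show ?thesis
  proof (rule DERIV_nonneg_imp_increasing_open[of s t f])
    show "s \<le> t" using st by simp
    show "\<exists>y. (f has_real_derivative y) (at r) \<and> 0 \<le> y" if "s < r" "r < t" for r
      using derivative_interior[OF d, of r] nn[OF that] that st by (intro exI[of _ "f' r"]) auto
    show "continuous_on {s..t} f"
      by (rule continuous_on_subset[OF derivative_continuous_on[OF d]]) (use st in auto)
  qed
qed simp

lemma half_line_MVT:
  fixes f :: "real \<Rightarrow> real"
  assumes d: "\<And>t. 0 \<le> t \<Longrightarrow> (f has_real_derivative f' t) (at t within {0..})"
    and st: "0 \<le> s" "s < t"
  obtains r where "s < r" "r < t" "f t - f s = (t - s) * f' r"
proof -
  have "\<exists>r>s. r < t \<and> f t - f s = f' r * (t - s)"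
  proof -
    have c: "continuous_on {s..t} f"
      by (rule continuous_on_subset[OF derivative_continuous_on[OF d]]) (use st in auto)
    have "(f has_derivative (\<lambda>h. f' r * h)) (at r)" if "s < r" "r < t" for r
      using derivative_interior[OF d, of r] that st by (simp add: has_field_derivative_def)
    from mvt[OF st(2) c this] show ?thesis by metis
  qed
  then show ?thesis using that by (auto simp: mult.commute)
qed

lemma half_line_growth:
  fixes f :: "real \<Rightarrow> real"
  assumes d: "\<And>t. 0 \<le> t \<Longrightarrow> (f has_real_derivative f' t) (at t within {0..})"
    and st: "0 \<le> s" "s \<le> t" and nn: "\<And>r. s < r \<Longrightarrow> r < t \<Longrightarrow> c \<le> f' r"
  shows "f s + c * (t - s) \<le> f t"
proof -
  have "f s - c * s \<le> f t - c * t"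
    by (rule half_line_mono[where f'="\<lambda>t. f' t - c", OF _ st])
      (use d nn in \<open>auto intro!: derivative_eq_intros\<close>)
  then show ?thesis by (simp add: algebra_simps)
qed

text \<open>Levine's concavity argument: \<open>Y powr (- \<delta> / 4)\<close> would reach zero in finite time.\<close>

lemma concavity_no_growth:
  fixes Y P Q n :: "real \<Rightarrow> real"
  assumes dY: "\<And>t. 0 \<le> t \<Longrightarrow> (Y has_real_derivative 2 * P t) (at t within {0..})"
    and dP: "\<And>t. 0 \<le> t \<Longrightarrow> (P has_real_derivative Q t) (at t within {0..})"
    and cs: "\<And>t. 0 \<le> t \<Longrightarrow> (P t)\<^sup>2 \<le> Y t * n t" and n: "\<And>t. 0 \<le> n t"
    and t0: "0 \<le> t0" and Q: "\<And>t. t0 \<le> t \<Longrightarrow> (4 + \<delta>) * n t + a * Y t - C \<le> 2 * Q t"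
    and pos: "0 < \<delta>" "0 < a"
    and lim: "filterlim Y at_top at_top"
  shows False
proof -
  have "eventually (\<lambda>t. max 1 (C / a) \<le> Y t) at_top" using lim unfolding filterlim_at_top by blast
  then obtain t1' where t1': "\<And>t. t1' \<le> t \<Longrightarrow> max 1 (C / a) \<le> Y t"
    unfolding eventually_at_top_linorder by blast
  \<comment> \<open>From here on Y >= 1 and a Y >= C, so that these terms may be dropped from the
    inequality for Q.\<close>
  define t1 where "t1 = max t0 t1'"
  have t1: "t0 \<le> t1" "0 \<le> t1" using t0 by (auto simp: t1_def)
  have Y1: "1 \<le> Y t" "C \<le> a * Y t" if "t1 \<le> t" for t
    using t1'[of t] that pos(2) by (auto simp: t1_def divide_le_eq mult.commute)
  obtain t2 where t2: "t1 \<le> t2" "0 < P t2"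
  proof (rule ccontr)
    assume "\<not> thesis"
    then have np: "P t \<le> 0" if "t1 \<le> t" for t
      using that that linorder_not_less \<open>(\<And>t2. t1 \<le> t2 \<Longrightarrow> 0 < P t2 \<Longrightarrow> thesis)\<close> by blast
    have "Y t \<le> Y t1" if "t1 \<le> t" for t
    proof -
      have "- Y t1 \<le> - Y t"
        by (rule half_line_mono[where f'="\<lambda>t. - (2 * P t)", OF _ t1(2) that])
          (use dY np in \<open>auto intro!: derivative_eq_intros\<close>)
      then show ?thesis by simp
    qed
    moreover have "eventually (\<lambda>t. Y t1 + 1 \<le> Y t) at_top"
      using lim unfolding filterlim_at_top by blast
    then obtain s where "\<And>t. s \<le> t \<Longrightarrow> Y t1 + 1 \<le> Y t" unfolding eventually_at_top_linorder by blast
    ultimately show False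
      by (metis add_le_same_cancel1 max.cobounded1 max.cobounded2 not_one_le_zero order_trans)
  qed
  \<comment> \<open>With this choice 2 (1 + \<theta>) = 2 + \<delta> / 2 is half the coefficient of
    n, and Q Y - 2 (1 + \<theta>) P^2 is nonnegative by Cauchy-Schwarz.\<close>
  define \<theta> where "\<theta> = \<delta> / 4"
  have \<theta>: "0 < \<theta>" using pos by (simp add: \<theta>_def)
  \<comment> \<open>Up to the factor -2 \<theta> this is the derivative of Y^(-\<theta>); that it
    increases is the concavity of Y^(-\<theta>).\<close>
  define z where "z t = P t * Y t powr (- (1 + \<theta>))" for t
  have zd: "(z has_real_derivative (Y t powr (- (2 + \<theta>)) * (Q t * Y t - 2 * (1 + \<theta>) * (P t)\<^sup>2))) (at t)" if "t1 < t" for t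
  proof -
    have y: "0 < Y t" using Y1(1)[of t] that by simp
    have d: "(Y has_real_derivative 2 * P t) (at t)" "(P has_real_derivative Q t) (at t)"
      using derivative_interior dY dP that t1 by auto
    have p: "((\<lambda>t. Y t powr (- (1 + \<theta>))) has_real_derivative (- (1 + \<theta>)) * Y t powr (- (1 + \<theta>) - 1) * (2 * P t)) (at t)"
      by (rule DERIV_chain2[OF has_real_derivative_powr[OF y] d(1)])
    have e: "- (1 + \<theta>) - 1 = - (2 + \<theta>)" by simp
    have w: "Y t powr (- (1 + \<theta>)) = Y t * Y t powr (- (2 + \<theta>))"
      using y powr_add[of "Y t" 1 "- (2 + \<theta>)"] by simp
    from DERIV_mult[OF d(2) p] show ?thesis
      unfolding z_def[abs_def] e w by (rule DERIV_cong) (simp add: power2_eq_square algebra_simps)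
  qed
  have zpos: "0 \<le> Y t powr (- (2 + \<theta>)) * (Q t * Y t - 2 * (1 + \<theta>) * (P t)\<^sup>2)" if "t1 \<le> t" for t
  proof -
    have "(2 + \<delta> / 2) * n t \<le> Q t" using Q[of t] Y1(2)[OF that] that t1 by (simp add: algebra_simps)
    then have "(2 + \<delta> / 2) * n t * Y t \<le> Q t * Y t"
      using Y1(1)[OF that] by (intro mult_right_mono) auto
    moreover have "(2 + \<delta> / 2) * (P t)\<^sup>2 \<le> (2 + \<delta> / 2) * (Y t * n t)"
      using cs[of t] that t1 pos by (intro mult_left_mono) auto
    ultimately have "2 * (1 + \<theta>) * (P t)\<^sup>2 \<le> Q t * Y t" by (simp add: \<theta>_def algebra_simps)
    then show ?thesis by simp
  qed
  have Yc: "continuous_on {0..} Y" "continuous_on {0..} P"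
    by (rule derivative_continuous_on, erule dY dP)+
  have zc: "continuous_on {t1..} z"
    unfolding z_def[abs_def] using t1 Y1(1)
    by (intro continuous_on_mult continuous_on_powr continuous_on_const continuous_on_subset[OF Yc(1)] continuous_on_subset[OF Yc(2)]) fastforce+
  define z2 where "z2 = z t2"
  have z2: "0 < z2" using t2 Y1(1)[OF t2(1)] by (simp add: z2_def z_def)
  have zge: "z2 \<le> z t" if "t2 \<le> t" for t
  proof (cases "t2 = t")
    case False
    show ?thesis unfolding z2_def
    proof (rule DERIV_nonneg_imp_increasing_open[of t2 t z])
      show "t2 \<le> t" using that by simp
      show "\<exists>y. (z has_real_derivative y) (at r) \<and> 0 \<le> y" if "t2 < r" "r < t" for r
        using zd[of r] zpos[of r] t2(1) that by fastforce
      show "continuous_on {t2..t} z" by (rule continuous_on_subset[OF zc]) (use t2 in auto)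
    qed
  qed (simp add: z2_def)
  define \<phi> where "\<phi> t = Y t powr (- \<theta>)" for t
  have \<phi>d: "(\<phi> has_real_derivative - (2 * \<theta> * z t)) (at t)" if "t1 < t" for t
  proof -
    have y: "0 < Y t" using Y1(1)[of t] that by simp
    have d: "(Y has_real_derivative 2 * P t) (at t)" using derivative_interior dY that t1 by auto
    have "(\<phi> has_real_derivative (- \<theta>) * Y t powr (- \<theta> - 1) * (2 * P t)) (at t)"
      unfolding \<phi>_def[abs_def] by (rule DERIV_chain2[OF has_real_derivative_powr[OF y] d])
    moreover have "- \<theta> - 1 = - (1 + \<theta>)" by simp
    ultimately show ?thesis by (simp add: z_def mult_ac)
  qed
  have \<phi>c: "continuous_on {t1..} \<phi>"
    unfolding \<phi>_def[abs_def] using t1 Y1(1)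
    by (intro continuous_on_powr continuous_on_const continuous_on_subset[OF Yc(1)]) fastforce+
  \<comment> \<open>One unit after the time at which the bound
    \<open>\<phi> t2 - 2 * \<theta> * z2 * (t - t2)\<close> reaches zero.\<close>
  define t3 where "t3 = t2 + \<phi> t2 / (2 * \<theta> * z2) + 1"
  have p0: "0 \<le> \<phi> t2" by (simp add: \<phi>_def)
  have t3: "t2 < t3" unfolding t3_def using p0 \<theta> z2 by (simp add: add_nonneg_pos)
  have "(\<lambda>t. - \<phi> t - 2 * \<theta> * z2 * t) t2 \<le> (\<lambda>t. - \<phi> t - 2 * \<theta> * z2 * t) t3"
  proof (rule DERIV_nonneg_imp_increasing_open[OF less_imp_le[OF t3]])
    fix r assume r: "t2 < r" "r < t3"
    have "((\<lambda>t. - \<phi> t - 2 * \<theta> * z2 * t) has_real_derivative (2 * \<theta> * z r - 2 * \<theta> * z2)) (at r)"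
      using \<phi>d[of r] r t2 by (auto intro!: derivative_eq_intros)
    moreover have "0 \<le> 2 * \<theta> * z r - 2 * \<theta> * z2" using zge[of r] r \<theta> by simp
    ultimately show "\<exists>y. ((\<lambda>t. - \<phi> t - 2 * \<theta> * z2 * t) has_real_derivative y) (at r) \<and> 0 \<le> y"
      by blast
  next
    show "continuous_on {t2..t3} (\<lambda>t. - \<phi> t - 2 * \<theta> * z2 * t)"
      by (intro continuous_intros continuous_on_subset[OF \<phi>c]) (use t2 in auto)
  qed
  then have "\<phi> t3 \<le> \<phi> t2 - 2 * \<theta> * z2 * (t3 - t2)" by (simp add: algebra_simps)
  also have "2 * \<theta> * z2 * (t3 - t2) = \<phi> t2 + 2 * \<theta> * z2"
    using \<theta> z2 by (simp add: t3_def field_simps)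
  finally have "\<phi> t3 < 0" using mult_pos_pos[OF \<theta> z2] by linarith
  then show False by (simp add: \<phi>_def not_less[symmetric])
qed

text \<open>The source keeps Q at least 1/2, so P grows linearly and Y tends to infinity; then
  \<open>concavity_no_growth\<close> applies with C = 0.\<close>

lemma concavity_no_positive_source:
  fixes Y P Q n :: "real \<Rightarrow> real"
  assumes dY: "\<And>t. 0 \<le> t \<Longrightarrow> (Y has_real_derivative 2 * P t) (at t within {0..})"
    and dP: "\<And>t. 0 \<le> t \<Longrightarrow> (P has_real_derivative Q t) (at t within {0..})"
    and cs: "\<And>t. 0 \<le> t \<Longrightarrow> (P t)\<^sup>2 \<le> Y t * n t" and n: "\<And>t. 0 \<le> n t" and Y: "\<And>t. 0 \<le> Y t"
    and t0: "0 \<le> t0" and Q: "\<And>t. t0 \<le> t \<Longrightarrow> (4 + \<delta>) * n t + a * Y t + 1 \<le> 2 * Q t"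
    and pos: "0 < \<delta>" "0 < a"
  shows False
proof (rule concavity_no_growth[OF dY dP cs n t0 _ pos, where C=0])
  show "(4 + \<delta>) * n t + a * Y t - 0 \<le> 2 * Q t" if "t0 \<le> t" for t using Q[OF that] by simp
  have Q2: "1 / 2 \<le> Q t" if "t0 \<le> t" for t
  proof -
    have "0 \<le> (4 + \<delta>) * n t" "0 \<le> a * Y t" using n Y pos by auto
    then show ?thesis using Q[OF that] by linarith
  qed
  define t1 where "t1 = t0 + 2 * (1 + \<bar>P t0\<bar>)"
  have t1: "t0 \<le> t1" by (simp add: t1_def)
  have P1: "1 / 2 \<le> P t" if "t1 \<le> t" for t
  proof -
    have "P t0 + 1 / 2 * (t - t0) \<le> P t"
      by (rule half_line_growth[OF dP t0]) (use that t1 Q2 in auto)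
    moreover have "2 * (1 + \<bar>P t0\<bar>) \<le> t - t0" using that by (simp add: t1_def)
    ultimately show ?thesis using abs_ge_minus_self[of "P t0"] by (simp add: field_simps)
  qed
  have "Y t1 + 1 * (t - t1) \<le> Y t" if "t1 \<le> t" for t
    by (rule half_line_growth[OF dY]) (use that t1 t0 P1 in \<open>auto simp: field_simps\<close>)
  then have "eventually (\<lambda>t. Y t1 + 1 * (t - t1) \<le> Y t) at_top"
    by (auto simp: eventually_at_top_linorder)
  moreover have "filterlim (\<lambda>t. Y t1 + 1 * (t - t1)) at_top at_top"
  proof -
    have "filterlim (\<lambda>t. (Y t1 - t1) + t) at_top at_top"
      by (rule filterlim_tendsto_add_at_top[OF tendsto_const filterlim_ident])
    then show ?thesis by (simp add: algebra_simps)
  qed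
  ultimately show "filterlim Y at_top at_top" by (rule filterlim_at_top_mono[rotated])
qed

text \<open>The function \<open>N = 2 P + l Y - C / l\<close> satisfies \<open>N' \<ge> l N\<close>: once positive it grows
  exponentially and drags \<open>Y\<close> to infinity.\<close>

lemma convexity_decay:
  fixes Y P Q n :: "real \<Rightarrow> real"
  assumes dY: "\<And>t. 0 \<le> t \<Longrightarrow> (Y has_real_derivative 2 * P t) (at t within {0..})"
    and dP: "\<And>t. 0 \<le> t \<Longrightarrow> (P has_real_derivative Q t) (at t within {0..})"
    and cs: "\<And>t. 0 \<le> t \<Longrightarrow> (P t)\<^sup>2 \<le> Y t * n t" and n: "\<And>t. 0 \<le> n t"
    and Q: "\<And>t. 0 \<le> t \<Longrightarrow> (4 + \<delta>) * n t + a * Y t - C \<le> 2 * Q t"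
    and pos: "0 < \<delta>" "0 < a" and l: "0 < l" "l\<^sup>2 = a"
  shows "\<And>t. 0 \<le> t \<Longrightarrow> 2 * P t + l * Y t \<le> C / l"
    and "\<And>t. 0 \<le> t \<Longrightarrow> Y t \<le> Y 0 * exp (- l * t) + C / l\<^sup>2 * (1 - exp (- l * t))"
proof -
  define k where "k = C / l\<^sup>2"
  have Ck: "C / l = l * k" "C = l\<^sup>2 * k" using l(1) by (simp_all add: k_def power2_eq_square)
  define N where "N t = 2 * P t + l * Y t - C / l" for t
  \<comment> \<open>Here \<open>l\<^sup>2 = a\<close> enters: 2 Q + 2 l P >= a Y - C + 2 l P = l
    N.\<close>
  have N': "l * N t \<le> 2 * Q t + l * (2 * P t)" if "0 \<le> t" for t
  proof -
    have "l * N t = 2 * (l * P t) + a * Y t - C"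
      using l by (simp add: N_def algebra_simps power2_eq_square flip: l(2))
    moreover have "0 \<le> (4 + \<delta>) * n t" using n pos by simp
    ultimately show ?thesis using Q[OF that] by simp
  qed
  have Nle: "N t0 \<le> 0" if t0: "0 \<le> t0" for t0
  proof (rule ccontr)
    assume "\<not> N t0 \<le> 0"
    then have N0: "0 < N t0" by simp
    have Ng: "N t0 * exp (l * (t - t0)) \<le> N t" if t: "t0 \<le> t" for t
    proof -
      have "N t0 * exp (- l * t0) \<le> N t * exp (- l * t)"
      proof (rule half_line_mono[where f="\<lambda>t. N t * exp (- l * t)" and f'="\<lambda>t. (2 * Q t + l * (2 * P t) - l * N t) * exp (- l * t)", OF _ t0 t])
        show "((\<lambda>t. N t * exp (- l * t)) has_real_derivative (2 * Q t + l * (2 * P t) - l * N t) * exp (- l * t)) (at t within {0..})"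
          if "0 \<le> t" for t
          unfolding N_def[abs_def]
            using dY[OF that] dP[OF that] by (auto intro!: derivative_eq_intros simp: N_def algebra_simps)
        show "0 \<le> (2 * Q r + l * (2 * P r) - l * N r) * exp (- l * r)" if "t0 < r" for r
          using N'[of r] that t0 by simp
      qed
      then have "N t0 * exp (- l * t0) * exp (l * t) \<le> N t * exp (- l * t) * exp (l * t)"
        by (rule mult_right_mono) simp
      then show ?thesis by (simp add: mult.assoc exp_add[symmetric] algebra_simps)
    qed
    \<comment> \<open>Y' + l Y = N + C / l, and N dominates an exponential. Subtracting from Y the
      solution \<open>N t0 / (2 * l) * exp (l * (t - t0)) + k\<close> of the comparison equation
      leaves g with g' + l g >= 0.\<close>
    define g where "g t = Y t - N t0 / (2 * l) * exp (l * (t - t0)) - k" for t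
    have gg: "g t0 * exp (- l * (t - t0)) \<le> g t" if t: "t0 \<le> t" for t
    proof -
      have "g t0 * exp (l * t0) \<le> g t * exp (l * t)"
      proof (rule half_line_mono[where f="\<lambda>t. g t * exp (l * t)" and f'="\<lambda>t. (2 * P t - N t0 / 2 * exp (l * (t - t0)) + l * g t) * exp (l * t)", OF _ t0 t])
        show "((\<lambda>t. g t * exp (l * t)) has_real_derivative (2 * P t - N t0 / 2 * exp (l * (t - t0)) + l * g t) * exp (l * t)) (at t within {0..})"
          if "0 \<le> t" for t
          unfolding g_def[abs_def]
            using dY[OF that] l by (auto intro!: derivative_eq_intros simp: g_def algebra_simps)
        fix r assume r: "t0 < r"
        have "l * g r = l * Y r - N t0 / 2 * exp (l * (r - t0)) - C / l"
          using l by (simp add: g_def Ck(1) algebra_simps)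
        then have "2 * P r - N t0 / 2 * exp (l * (r - t0)) + l * g r = N r - N t0 * exp (l * (r - t0))"
          by (simp add: N_def)
        also have "0 \<le> \<dots>" using Ng[of r] r by simp
        finally show "0 \<le> (2 * P r - N t0 / 2 * exp (l * (r - t0)) + l * g r) * exp (l * r)" by simp
      qed
      then have "g t0 * exp (l * t0) * exp (- l * t) \<le> g t * exp (l * t) * exp (- l * t)"
        by (rule mult_right_mono) simp
      then show ?thesis by (simp add: mult.assoc exp_add[symmetric] algebra_simps)
    qed
    have "N t0 / 2 * (t - t0) + (k - \<bar>g t0\<bar>) \<le> Y t" if t: "t0 \<le> t" for t
    proof -
      have "exp (- l * (t - t0)) \<le> 1" using t l by simp
      then have "\<bar>g t0\<bar> * exp (- l * (t - t0)) \<le> \<bar>g t0\<bar> * 1" by (intro mult_left_mono) auto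
      moreover have "- \<bar>g t0\<bar> * exp (- l * (t - t0)) \<le> g t0 * exp (- l * (t - t0))"
        by (intro mult_right_mono) auto
      ultimately have "- \<bar>g t0\<bar> \<le> g t" using gg[OF t] by linarith
      moreover have "N t0 / (2 * l) * (l * (t - t0)) \<le> N t0 / (2 * l) * exp (l * (t - t0))"
        using N0 l exp_ge_add_one_self[of "l * (t - t0)"] by (intro mult_left_mono) (linarith, simp)
      moreover have "N t0 / (2 * l) * (l * (t - t0)) = N t0 / 2 * (t - t0)" using l(1) by simp
      ultimately show ?thesis unfolding g_def by linarith
    qed
    then have ev: "eventually (\<lambda>t. (k - \<bar>g t0\<bar> - N t0 / 2 * t0) + N t0 / 2 * t \<le> Y t) at_top"
      unfolding eventually_at_top_linorder
        by (intro exI[of _ t0]) (fastforce simp: right_diff_distrib)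
    have "filterlim (\<lambda>t. (k - \<bar>g t0\<bar> - N t0 / 2 * t0) + N t0 / 2 * t) at_top at_top"
      using N0 by (intro filterlim_tendsto_add_at_top[OF tendsto_const] filterlim_tendsto_pos_mult_at_top[OF tendsto_const _ filterlim_ident]) auto
    from filterlim_at_top_mono[OF this ev] have "filterlim Y at_top at_top" .
    from concavity_no_growth[OF dY dP cs n order_refl Q pos this] show False by simp
  qed
  then show NK: "2 * P t + l * Y t \<le> C / l" if "0 \<le> t" for t using Nle[OF that] by (simp add: N_def)
  show "Y t \<le> Y 0 * exp (- l * t) + C / l\<^sup>2 * (1 - exp (- l * t))" if t: "0 \<le> t" for t
  proof -
    have "- ((Y 0 - k) * exp (l * 0)) \<le> - ((Y t - k) * exp (l * t))"
    proof (rule half_line_mono[where f="\<lambda>t. - ((Y t - k) * exp (l * t))" and f'="\<lambda>t. (C / l - (2 * P t + l * Y t)) * exp (l * t)", OF _ order_refl t])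
      show "((\<lambda>t. - ((Y t - k) * exp (l * t))) has_real_derivative (C / l - (2 * P t + l * Y t)) * exp (l * t)) (at t within {0..})"
        if "0 \<le> t" for t
        using dY[OF that] l by (auto intro!: derivative_eq_intros simp: Ck(1) algebra_simps)
      show "0 \<le> (C / l - (2 * P r + l * Y r)) * exp (l * r)" if "0 < r" for r
        using NK[of r] that by simp
    qed
    then have "(Y t - k) * exp (l * t) * exp (- l * t) \<le> (Y 0 - k) * exp (- l * t)"
      by (intro mult_right_mono) auto
    then show ?thesis
      unfolding k_def[symmetric] by (simp add: mult.assoc exp_add[symmetric] algebra_simps)
  qed
qed

section \<open>Monotonicity from one-sided slopes and Gronwall's inequality\<close>

lemma half_line_integral_derivative:
  fixes e :: "real \<Rightarrow> real"
  assumes "continuous_on {0..} e" "0 \<le> t"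
  shows "((\<lambda>t. integral {0..t} e) has_real_derivative e t) (at t within {0..})"
proof -
  have "((\<lambda>t. integral {0..t} e) has_real_derivative e t) (at t within {0..t + 1})"
    by (rule integral_has_real_derivative) (use assms in \<open>auto intro: continuous_on_subset\<close>)
  moreover have "at t within {0..t + 1} = at t within {0..}"
    by (rule at_within_nhd[of _ "{..<t + 1}"]) auto
  ultimately show ?thesis by simp
qed

text \<open>The supremum of the times up to which \<phi> stays below the line of slope \<eta>
  through its initial value must be b: by continuity the bound holds at the supremum, and the local
  hypothesis carries it beyond. Then \<eta> tends to 0. The lemma serves functions whose difference
  quotients are only bounded from above.\<close>

lemma Dini_nonincreasing:
  fixes \<phi> :: "real \<Rightarrow> real"
  assumes c: "continuous_on {a..b} \<phi>" and ab: "a \<le> b"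
    and D: "\<And>t \<eta>. a \<le> t \<Longrightarrow> t < b \<Longrightarrow> 0 < \<eta> \<Longrightarrow> \<exists>d>0. \<forall>s. t < s \<and> s < t + d \<and> s \<le> b \<longrightarrow> \<phi> s \<le> \<phi> t + \<eta> * (s - t)"
  shows "\<phi> b \<le> \<phi> a"
proof -
  have main: "\<phi> b \<le> \<phi> a + \<eta> * (b - a)" if \<eta>: "0 < \<eta>" for \<eta>
  proof -
    define S where "S = {t \<in> {a..b}. \<forall>r\<in>{a..t}. \<phi> r \<le> \<phi> a + \<eta> * (r - a)}"
    define T where "T = Sup S"
    have aS: "a \<in> S" using ab by (auto simp: S_def)
    have bd: "bdd_above S" by (rule bdd_aboveI[of _ b]) (auto simp: S_def)
    have T: "a \<le> T" "T \<le> b"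
      unfolding T_def by (rule cSup_upper[OF aS bd], rule cSup_least) (use aS in \<open>auto simp: S_def\<close>)
    have below: "\<phi> r \<le> \<phi> a + \<eta> * (r - a)" if r: "a \<le> r" "r < T" for r
    proof -
      obtain t where "t \<in> S" "r < t" using less_cSup_iff[of S r] bd aS r by (auto simp: T_def)
      then show ?thesis using r by (auto simp: S_def)
    qed
    have atT: "\<phi> T \<le> \<phi> a + \<eta> * (T - a)"
    proof (cases "a = T")
      case False
      then have aT: "a < T" using T by simp
      have "(\<phi> \<longlongrightarrow> \<phi> T) (at T within {a..b})" using c T by (simp add: continuous_on_def)
      then have "(\<phi> \<longlongrightarrow> \<phi> T) (at T within {a..<T})" by (rule tendsto_within_subset) (use T in auto)
      moreover have "((\<lambda>r. \<phi> a + \<eta> * (r - a)) \<longlongrightarrow> \<phi> a + \<eta> * (T - a)) (at T within {a..<T})"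
        by (intro tendsto_intros)
      moreover have "\<forall>\<^sub>F r in at T within {a..<T}. \<phi> r \<le> \<phi> a + \<eta> * (r - a)"
        using below by (auto simp: eventually_at_filter)
      moreover have "at T within {a..<T} \<noteq> bot"
        using aT by (simp add: trivial_limit_within islimpt_Ico)
      ultimately show ?thesis by (intro tendsto_le)
    qed simp
    have "T = b"
    proof (rule ccontr)
      assume "T \<noteq> b"
      then have Tb: "T < b" using T by simp
      obtain d where d: "0 < d" "\<And>s. T < s \<Longrightarrow> s < T + d \<Longrightarrow> s \<le> b \<Longrightarrow> \<phi> s \<le> \<phi> T + \<eta> * (s - T)"
        using D[OF T(1) Tb \<eta>] by blast
      define s where "s = min b (T + d / 2)"
      have s: "T < s" "s \<le> b" "s < T + d" using d(1) Tb by (auto simp: s_def)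
      have "s \<in> S" unfolding S_def
      proof (intro CollectI conjI ballI)
        show "s \<in> {a..b}" using s T by auto
        fix r assume r: "r \<in> {a..s}"
        consider "r < T" | "r = T" | "T < r" by linarith
        then show "\<phi> r \<le> \<phi> a + \<eta> * (r - a)"
        proof cases
          case 3
          then have "\<phi> r \<le> \<phi> T + \<eta> * (r - T)" using r s d(2)[of r] by auto
          then show ?thesis using atT by (simp add: algebra_simps)
        qed (use below atT r in auto)
      qed
      then have "s \<le> T" unfolding T_def by (intro cSup_upper bd)
      then show False using s by simp
    qed
    then show ?thesis using atT by simp
  qed
  show ?thesis
  proof (rule field_le_epsilon)
    fix \<epsilon> :: real assume e: "0 < \<epsilon>"
    have "\<phi> b \<le> \<phi> a + \<epsilon> / (b - a + 1) * (b - a)" using main[of "\<epsilon> / (b - a + 1)"] e ab by simp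
    also have "\<epsilon> / (b - a + 1) * (b - a) \<le> \<epsilon>" using e ab by (simp add: field_simps)
    finally show "\<phi> b \<le> \<phi> a + \<epsilon>" by simp
  qed
qed

text \<open>Gronwall's inequality for \<open>y' \<le> 2 L (1 + e) y\<close>, where \<open>y t = e s + 2 (G t - G s)\<close> dominates \<open>e\<close>
  and \<open>G\<close> need not be differentiable.\<close>

lemma Gronwall_unit_windows:
  fixes e G :: "real \<Rightarrow> real"
  assumes ec: "continuous_on {0..} e" and e0: "\<And>t. 0 \<le> t \<Longrightarrow> 0 \<le> e t"
    and L: "0 \<le> L"
    and G: "\<And>s t. 0 \<le> s \<Longrightarrow> s \<le> t \<Longrightarrow> G t - G s \<le> integral {0..t} (\<lambda>r. L * (e r * (1 + e r))) - integral {0..s} (\<lambda>r. L * (e r * (1 + e r)))"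
    and eG: "\<And>s t. 0 \<le> s \<Longrightarrow> s \<le> t \<Longrightarrow> e t \<le> e s + 2 * (G t - G s)"
    and st: "0 \<le> s" "s \<le> t"
  shows "e t \<le> e s * exp (2 * L * ((t - s) + (integral {0..t} e - integral {0..s} e)))"
proof -
  define J where "J t = integral {0..t} (\<lambda>r. L * (e r * (1 + e r)))" for t
  define I where "I t = integral {0..t} e" for t
  have dJ: "(J has_real_derivative L * (e t * (1 + e t))) (at t within {0..})" if "0 \<le> t" for t
    unfolding J_def[abs_def]
      by (rule half_line_integral_derivative[OF _ that]) (intro continuous_intros ec)
  have dI: "(I has_real_derivative e t) (at t within {0..})" if "0 \<le> t" for t
    unfolding I_def[abs_def] by (rule half_line_integral_derivative[OF ec that])
  define y where "y r = e s + 2 * (J r - J s)" for r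
  have ey: "e r \<le> y r" if "s \<le> r" for r
    using eG[OF st(1) that] G[OF st(1) that] by (simp add: y_def J_def)
  \<comment> \<open>Integrating factor: the derivative of
    \<open>y r * exp (- (2 * L) * (r + I r))\<close> is 2 L (1 + e) (e - y) times the exponential,
    and e <= y.\<close>
  have "- (y s * exp (- (2 * L) * (s + I s))) \<le> - (y t * exp (- (2 * L) * (t + I t)))"
  proof (rule half_line_mono[where f="\<lambda>r. - (y r * exp (- (2 * L) * (r + I r)))"
        and f'="\<lambda>r. 2 * L * (1 + e r) * (y r - e r) * exp (- (2 * L) * (r + I r))", OF _ st])
    show "((\<lambda>r. - (y r * exp (- (2 * L) * (r + I r)))) has_real_derivative 2 * L * (1 + e r) * (y r - e r) * exp (- (2 * L) * (r + I r))) (at r within {0..})"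
      if "0 \<le> r" for r
      unfolding y_def[abs_def]
        using dJ[OF that] dI[OF that] by (auto intro!: derivative_eq_intros simp: y_def algebra_simps)
    show "0 \<le> 2 * L * (1 + e r) * (y r - e r) * exp (- (2 * L) * (r + I r))" if "s < r" for r
      using ey[of r] e0[of r] L that st by (intro mult_nonneg_nonneg) auto
  qed
  then have "y t * exp (- (2 * L) * (t + I t)) * exp (2 * L * (t + I t)) \<le> y s * exp (- (2 * L) * (s + I s)) * exp (2 * L * (t + I t))"
    by (intro mult_right_mono) auto
  then have "y t \<le> y s * exp (2 * L * ((t - s) + (I t - I s)))"
    by (simp add: mult.assoc exp_add[symmetric] algebra_simps)
  moreover have "y s = e s" by (simp add: y_def)
  ultimately show ?thesis using ey[OF st(2)] by (simp add: I_def)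
qed

section \<open>The nonlinearity\<close>

text \<open>The power with exponent q dominates where |x| > 1, and the square elsewhere.\<close>

lemma powr_between:
  fixes x :: real
  assumes "2 \<le> e" "e \<le> q"
  shows "\<bar>x\<bar> powr e \<le> x\<^sup>2 + \<bar>x\<bar> powr q"
proof (cases "\<bar>x\<bar> \<le> 1")
  case True
  have "\<bar>x\<bar> powr e \<le> \<bar>x\<bar> powr 2" using True assms by (intro powr_mono') auto
  also have "\<bar>x\<bar> powr 2 = x\<^sup>2" by (cases "x = 0") (simp_all add: powr_numeral)
  finally show ?thesis by (simp add: add_increasing2)
next
  case False
  then have "\<bar>x\<bar> powr e \<le> \<bar>x\<bar> powr q" using assms by (intro powr_mono) auto
  then show ?thesis by (simp add: add_increasing)
qed

text \<open>Beyond the threshold (A / B)^(1 / (r - 1)), where A y = B y^r, the power dominates;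
  below it A y is at most its value at the threshold, which is the constant.\<close>

lemma superlinear_absorbs_linear:
  fixes A B r :: real
  assumes "0 \<le> A" "0 < B" "1 < r"
  shows "\<exists>C\<ge>0. \<forall>y\<ge>0. A * y \<le> B * y powr r + C"
proof (intro exI[of _ "A * (A / B) powr (1 / (r - 1))"] conjI allI impI)
  show "0 \<le> A * (A / B) powr (1 / (r - 1))" using assms by simp
  fix y :: real assume y: "0 \<le> y"
  show "A * y \<le> B * y powr r + A * (A / B) powr (1 / (r - 1))"
  proof (cases "y \<le> (A / B) powr (1 / (r - 1))")
    case True
    then have "A * y \<le> A * (A / B) powr (1 / (r - 1))" using assms by (intro mult_left_mono) auto
    then show ?thesis using assms by (simp add: add_increasing)
  next
    case False
    then have y0: "0 < y" using y powr_ge_zero[of "A / B" "1 / (r - 1)"] by linarith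
    have "A / B = ((A / B) powr (1 / (r - 1))) powr (r - 1)"
      using assms by (cases "A = 0") (simp_all add: powr_powr)
    also have "\<dots> \<le> y powr (r - 1)" using False assms by (intro powr_mono2) auto
    finally have "A \<le> B * y powr (r - 1)" using assms by (simp add: field_simps)
    then have "A * y \<le> B * y powr (r - 1) * y" using y by (rule mult_right_mono)
    also have "\<dots> = B * y powr r" using y0 powr_add[of y "r - 1" 1] by simp
    finally show ?thesis using assms by (simp add: add_increasing2)
  qed
qed

locale nonlin = riem M
  for M :: "('m::{t2_space, second_countable_topology}, 'n::finite) riemannian" +
  fixes p p0 Cf \<epsilon> :: real and f :: "real \<Rightarrow> real"
  assumes dim: "CARD('n) \<ge> 3"
    and p: "1 < p" "p < (real CARD('n) + 2) / (real CARD('n) - 2)" and p0: "1 < p0"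
    and Cf: "0 < Cf" and eps: "0 < \<epsilon>"
    and nl: "nonlinearity M p p0 Cf \<epsilon> f"
begin

definition q :: real where "q = 2 * real CARD('n) / (real CARD('n) - 2)"

text \<open>The upper bound on p says that p + 1 is below the Sobolev exponent, so that F(u) and u
  f(u) are integrable for u in \<open>H10\<close>.\<close>

lemma p_le_q: "2 \<le> p + 1" "p + 1 \<le> q" "2 < q"
proof -
  have "real CARD('n) - 2 > 0" using dim by simp
  then show "2 \<le> p + 1" "p + 1 \<le> q" "2 < q" using p by (auto simp: q_def field_simps)
qed

definition F :: "real \<Rightarrow> real" where "F = primitive f"

lemma f_continuous: "continuous_on UNIV f"
proof -
  from nl obtain D where "\<And>x. (f has_vector_derivative D x) (at x)"
    by (auto simp: nonlinearity_def C1_differentiable_on_def)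
  then show ?thesis
    by (auto intro!: continuous_at_imp_continuous_on has_vector_derivative_continuous)
qed

lemma f_growth: "\<bar>f s\<bar> \<le> Cf * (\<bar>s\<bar> + \<bar>s\<bar> powr p)"
proof -
  have "\<bar>f s - f 0\<bar> \<le> Cf * \<bar>s - 0\<bar> * (1 + \<bar>s\<bar> powr (p - 1) + \<bar>0\<bar> powr (p - 1))"
    using nl unfolding nonlinearity_def by blast
  moreover have "f 0 = 0" using nl by (simp add: nonlinearity_def)
  moreover have "\<bar>s\<bar> * \<bar>s\<bar> powr (p - 1) = \<bar>s\<bar> powr p"
    using powr_add[of "\<bar>s\<bar>" 1 "p - 1"] by (cases "s = 0") simp_all
  ultimately show ?thesis by (simp add: algebra_simps)
qed

lemma F_derivative: "(F has_real_derivative f s) (at s)"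
proof -
  \<comment> \<open>The interval from -b to b is a neighbourhood of s that also contains 0, the
    lower limit of the primitive.\<close>
  define b where "b = \<bar>s\<bar> + 1"
  have "((\<lambda>x. LBINT y=ereal 0..ereal x. f y) has_vector_derivative f s) (at s within {- b..b})"
    by (rule interval_integral_FTC2) (use continuous_on_subset[OF f_continuous] in \<open>auto simp: b_def\<close>)
  moreover have "at s within {- b..b} = at s"
    by (rule at_within_interior) (auto simp: b_def)
  moreover have "F = (\<lambda>x. LBINT y=ereal 0..ereal x. f y)"
    by (simp add: F_def primitive_def fun_eq_iff)
  ultimately show ?thesis by (simp add: has_real_derivative_iff_has_vector_derivative)
qed

lemma F_0: "F 0 = 0"
  by (simp add: F_def primitive_def)

text \<open>By the mean value theorem; the intermediate point is bounded in modulus by one of the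
  endpoints. The bound is linear in a - b, so that it can be divided by a time increment
  later.\<close>

lemma F_increment: "\<bar>F a - F b\<bar> \<le> \<bar>a - b\<bar> * (Cf * (\<bar>a\<bar> + \<bar>a\<bar> powr p) + Cf * (\<bar>b\<bar> + \<bar>b\<bar> powr p))"
proof -
  have main: "\<bar>F a - F b\<bar> \<le> \<bar>a - b\<bar> * (Cf * (\<bar>a\<bar> + \<bar>a\<bar> powr p) + Cf * (\<bar>b\<bar> + \<bar>b\<bar> powr p))" if ab: "a < b" for a b
  proof -
    obtain c where c: "a < c" "c < b" "F b - F a = (b - a) * f c"
      using MVT2[OF ab, of F f] F_derivative by blast
    have "\<bar>c\<bar> \<le> \<bar>a\<bar> \<or> \<bar>c\<bar> \<le> \<bar>b\<bar>" using c by linarith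
    then have "Cf * (\<bar>c\<bar> + \<bar>c\<bar> powr p) \<le> Cf * (\<bar>a\<bar> + \<bar>a\<bar> powr p) + Cf * (\<bar>b\<bar> + \<bar>b\<bar> powr p)"
    proof
      assume "\<bar>c\<bar> \<le> \<bar>a\<bar>"
      then have "Cf * (\<bar>c\<bar> + \<bar>c\<bar> powr p) \<le> Cf * (\<bar>a\<bar> + \<bar>a\<bar> powr p)"
        using p Cf by (intro mult_left_mono add_mono powr_mono2) auto
      moreover have "0 \<le> Cf * (\<bar>b\<bar> + \<bar>b\<bar> powr p)" using Cf by simp
      ultimately show ?thesis by linarith
    next
      assume "\<bar>c\<bar> \<le> \<bar>b\<bar>"
      then have "Cf * (\<bar>c\<bar> + \<bar>c\<bar> powr p) \<le> Cf * (\<bar>b\<bar> + \<bar>b\<bar> powr p)"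
        using p Cf by (intro mult_left_mono add_mono powr_mono2) auto
      moreover have "0 \<le> Cf * (\<bar>a\<bar> + \<bar>a\<bar> powr p)" using Cf by simp
      ultimately show ?thesis by linarith
    qed
    then have fc: "\<bar>f c\<bar> \<le> Cf * (\<bar>a\<bar> + \<bar>a\<bar> powr p) + Cf * (\<bar>b\<bar> + \<bar>b\<bar> powr p)"
      using f_growth[of c] by linarith
    have "\<bar>F a - F b\<bar> = \<bar>a - b\<bar> * \<bar>f c\<bar>" using c(3) by (metis abs_minus_commute abs_mult)
    also have "\<dots> \<le> \<bar>a - b\<bar> * (Cf * (\<bar>a\<bar> + \<bar>a\<bar> powr p) + Cf * (\<bar>b\<bar> + \<bar>b\<bar> powr p))"
      using fc by (intro mult_left_mono) auto
    finally show ?thesis .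
  qed
  consider "a < b" | "b < a" | "a = b" by linarith
  then show ?thesis
  proof cases
    case 2
    then show ?thesis using main[of b a] by (simp add: abs_minus_commute add.commute)
  qed (use main in auto)
qed

lemma square_powr: "\<bar>s\<bar> * (Cf * (\<bar>s\<bar> + \<bar>s\<bar> powr p)) \<le> Cf * (2 * s\<^sup>2 + \<bar>s\<bar> powr q)"
proof -
  have "\<bar>s\<bar> * \<bar>s\<bar> powr p = \<bar>s\<bar> powr (p + 1)"
    using powr_add[of "\<bar>s\<bar>" p 1] by (cases "s = 0") simp_all
  then have "\<bar>s\<bar> * \<bar>s\<bar> powr p \<le> s\<^sup>2 + \<bar>s\<bar> powr q" using powr_between[OF p_le_q(1,2), of s] by simp
  then have "s\<^sup>2 + \<bar>s\<bar> * \<bar>s\<bar> powr p \<le> 2 * s\<^sup>2 + \<bar>s\<bar> powr q" by simp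
  then have "Cf * (s\<^sup>2 + \<bar>s\<bar> * \<bar>s\<bar> powr p) \<le> Cf * (2 * s\<^sup>2 + \<bar>s\<bar> powr q)" using Cf by simp
  then show ?thesis by (simp add: algebra_simps power2_eq_square)
qed

lemma F_bound: "\<bar>F s\<bar> \<le> Cf * (2 * s\<^sup>2 + \<bar>s\<bar> powr q)"
  using F_increment[of s 0] square_powr[of s] by (simp add: F_0)

lemma f_bound: "\<bar>f s * s\<bar> \<le> Cf * (2 * s\<^sup>2 + \<bar>s\<bar> powr q)"
  using mult_left_mono[OF f_growth[of s], of "\<bar>s\<bar>"] square_powr[of s]
    by (simp add: abs_mult mult.commute)

lemma f_measurable[measurable]: "f \<in> borel_measurable borel"
  using f_continuous by (rule borel_measurable_continuous_onI)

lemma F_measurable[measurable]: "F \<in> borel_measurable borel"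
  by (rule borel_measurable_continuous_onI) (auto intro!: continuous_at_imp_continuous_on DERIV_isCont[OF F_derivative])

lemma q_integrable:
  assumes w: "w \<in> H10 M" shows "integrable (vol M) (\<lambda>x. \<bar>w x\<bar> powr q)"
  using Sobolev_H10[OF dim] w unfolding q_def by blast

lemma growth_integrable:
  assumes w: "w \<in> H10 M" shows "integrable (vol M) (\<lambda>x. Cf * (2 * (w x)\<^sup>2 + \<bar>w x\<bar> powr q))"
  using q_integrable[OF w] L2_integrable[OF H1_L2[OF H10_H1[OF w]]] by simp

lemma F_integrable:
  assumes w: "w \<in> H10 M" shows "integrable (vol M) (\<lambda>x. F (w x))"
proof (rule Bochner_Integration.integrable_bound[OF growth_integrable[OF w]])
  have [measurable]: "w \<in> borel_measurable borel" by (rule L2_measurable[OF H1_L2[OF H10_H1[OF w]]])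
  show "(\<lambda>x. F (w x)) \<in> borel_measurable (vol M)" by (simp, measurable)
  show "AE x in vol M. norm (F (w x)) \<le> norm (Cf * (2 * (w x)\<^sup>2 + \<bar>w x\<bar> powr q))"
    using F_bound by (intro AE_I2) (smt (verit) real_norm_def)
qed

lemma f_integrable:
  assumes w: "w \<in> H10 M" shows "integrable (vol M) (\<lambda>x. f (w x) * w x)"
proof (rule Bochner_Integration.integrable_bound[OF growth_integrable[OF w]])
  have [measurable]: "w \<in> borel_measurable borel" by (rule L2_measurable[OF H1_L2[OF H10_H1[OF w]]])
  show "(\<lambda>x. f (w x) * w x) \<in> borel_measurable (vol M)" by (simp, measurable)
  show "AE x in vol M. norm (f (w x) * w x) \<le> norm (Cf * (2 * (w x)\<^sup>2 + \<bar>w x\<bar> powr q))"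
    using f_bound by (intro AE_I2) (smt (verit) real_norm_def)
qed

lemma f_F_integral:
  assumes w: "w \<in> H10 M"
  shows "(2 + \<epsilon>) * (\<integral>x. F (w x) \<partial>vol M) \<le> (\<integral>x. f (w x) * w x \<partial>vol M)"
proof -
  have "(\<integral>x. (2 + \<epsilon>) * F (w x) \<partial>vol M) \<le> (\<integral>x. f (w x) * w x \<partial>vol M)"
    using F_integrable[OF w] f_integrable[OF w] nl
    by (intro integral_mono) (auto simp: F_def nonlinearity_def mult.commute)
  then show ?thesis by simp
qed

lemma L2_norm_sq: "(L2_norm M w)\<^sup>2 = (\<integral>x. (w x)\<^sup>2 \<partial>vol M)"
  by (simp add: L2_norm_def)

text \<open>The square root in \<open>L2_norm\<close> halves the exponent, and (p0 + 1) / 2 > 1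
  because p0 > 1. This is the form in which \<open>superlinear_absorbs_linear\<close> uses
  it.\<close>

lemma F_integral_lower:
  assumes w: "w \<in> H10 M"
  shows "(\<integral>x. (w x)\<^sup>2 \<partial>vol M) powr ((p0 + 1) / 2) / Cf \<le> (\<integral>x. F (w x) \<partial>vol M)"
proof -
  have "L2_norm M w powr (p0 + 1) \<le> Cf * (\<integral>x. F (w x) \<partial>vol M)"
    using nl w by (simp add: nonlinearity_def F_def)
  moreover have "L2_norm M w powr (p0 + 1) = (\<integral>x. (w x)\<^sup>2 \<partial>vol M) powr ((p0 + 1) / 2)"
    by (simp add: L2_norm_def powr_half_sqrt[symmetric] powr_powr)
  ultimately show ?thesis using Cf by (simp add: divide_le_eq mult.commute)
qed

lemma F_integral_nonneg: "w \<in> H10 M \<Longrightarrow> 0 \<le> (\<integral>x. F (w x) \<partial>vol M)"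
  using F_integral_lower[of w] Cf by (meson divide_nonneg_pos order_trans powr_ge_zero)

end

section \<open>Limits in \<open>L2\<close>\<close>

context riem
begin

lemma L2_norm_nonneg: "0 \<le> L2_norm M w"
  by (simp add: L2_norm_def)

lemma L2_scale: "w \<in> L2 M \<Longrightarrow> (\<lambda>x. w x / c) \<in> L2 M"
  by (auto simp: L2_def power_divide intro!: borel_measurable_divide)

lemma L2_inner_integrable: "a \<in> L2 M \<Longrightarrow> b \<in> L2 M \<Longrightarrow> integrable (vol M) (\<lambda>x. a x * b x)"
  by (rule square_integrable_mult) (auto simp: L2_def)

lemma L2_Cauchy_Schwarz: "a \<in> L2 M \<Longrightarrow> b \<in> L2 M \<Longrightarrow> \<bar>\<integral>x. a x * b x \<partial>vol M\<bar> \<le> L2_norm M a * L2_norm M b"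
  unfolding L2_norm_def by (rule integral_Cauchy_Schwarz) (auto simp: L2_def)

text \<open>Both factors may vary with s: this covers a difference quotient of u paired with u(s) or
  v(s), whose limits enter the derivatives of Y and P.\<close>

lemma L2_inner_tendsto:
  assumes S: "\<And>s. s \<in> S \<Longrightarrow> a s \<in> L2 M" "\<And>s. s \<in> S \<Longrightarrow> b s \<in> L2 M" and 0: "a0 \<in> L2 M" "b0 \<in> L2 M"
    and la: "((\<lambda>s. L2_norm M (\<lambda>x. a s x - a0 x)) \<longlongrightarrow> 0) (at t within S)"
    and lb: "((\<lambda>s. L2_norm M (\<lambda>x. b s x - b0 x)) \<longlongrightarrow> 0) (at t within S)"
  shows "((\<lambda>s. \<integral>x. a s x * b s x \<partial>vol M) \<longlongrightarrow> (\<integral>x. a0 x * b0 x \<partial>vol M)) (at t within S)"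
proof (rule LIM_zero_cancel, rule Lim_null_comparison)
  let ?A = "\<lambda>s. L2_norm M (\<lambda>x. a s x - a0 x)" and ?B = "\<lambda>s. L2_norm M (\<lambda>x. b s x - b0 x)"
  show "((\<lambda>s. ?A s * ?B s + ?A s * L2_norm M b0 + L2_norm M a0 * ?B s) \<longlongrightarrow> 0) (at t within S)"
    using tendsto_add[OF tendsto_add[OF tendsto_mult[OF la lb] tendsto_mult_left_zero[OF la, of "L2_norm M b0"]] tendsto_mult_right_zero[OF lb, of "L2_norm M a0"]]
    by simp
  show "\<forall>\<^sub>F s in at t within S. norm ((\<integral>x. a s x * b s x \<partial>vol M) - (\<integral>x. a0 x * b0 x \<partial>vol M))
     \<le> ?A s * ?B s + ?A s * L2_norm M b0 + L2_norm M a0 * ?B s"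
    unfolding eventually_at_filter
  proof (rule always_eventually, intro allI impI)
    fix s assume s: "s \<in> S"
    have da: "(\<lambda>x. a s x - a0 x) \<in> L2 M" and db: "(\<lambda>x. b s x - b0 x) \<in> L2 M"
      using L2_diff S[OF s] 0 by auto
    have "(\<integral>x. a s x * b s x \<partial>vol M) - (\<integral>x. a0 x * b0 x \<partial>vol M)
      = (\<integral>x. (a s x - a0 x) * (b s x - b0 x) \<partial>vol M) + (\<integral>x. (a s x - a0 x) * b0 x \<partial>vol M) + (\<integral>x. a0 x * (b s x - b0 x) \<partial>vol M)"
      using L2_inner_integrable[OF S(1)[OF s] S(2)[OF s]] L2_inner_integrable[OF 0] L2_inner_integrable[OF S(1)[OF s] 0(2)]
        L2_inner_integrable[OF 0(1) S(2)[OF s]]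
      by (simp add: left_diff_distrib right_diff_distrib)
    then show "norm ((\<integral>x. a s x * b s x \<partial>vol M) - (\<integral>x. a0 x * b0 x \<partial>vol M))
     \<le> ?A s * ?B s + ?A s * L2_norm M b0 + L2_norm M a0 * ?B s"
      using L2_Cauchy_Schwarz[OF da db] L2_Cauchy_Schwarz[OF da 0(2)] L2_Cauchy_Schwarz[OF 0(1) db]
        by simp
  qed
qed

end

section \<open>Global solutions\<close>

text \<open>\<open>C1\<close> is what remains of the damping term: \<open>4 K\<^sup>2 / \<epsilon> Y\<close> comes from Young's inequality, and
  \<open>Y powr ((p0 + 1) / 2)\<close> is controlled by the integral of \<open>F u\<close>.\<close>

locale wave = nonlin M p p0 Cf \<epsilon> f
  for M :: "('m::{t2_space, second_countable_topology}, 'n::finite) riemannian" and p p0 Cf \<epsilon> f +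
  fixes \<beta> \<kappa> K C1 :: real and \<gamma> u0 u1 :: "'m \<Rightarrow> real" and u v :: "real \<Rightarrow> 'm \<Rightarrow> real"
  assumes kappa: "0 < \<kappa>" and coer: "\<And>w. w \<in> H10 M \<Longrightarrow> \<kappa> * (\<integral>x. (w x)\<^sup>2 \<partial>vol M) \<le> H1_sq M \<beta> w"
    and gam: "\<gamma> \<in> borel_measurable (vol M)" "0 \<le> K" "AE x in vol M. 0 \<le> \<gamma> x \<and> \<gamma> x \<le> K"
    and C1: "0 \<le> C1" "\<And>y. 0 \<le> y \<Longrightarrow> 4 * K\<^sup>2 / \<epsilon> * y \<le> \<epsilon> / Cf * y powr ((p0 + 1) / 2) + C1"
    and lwp: "locally_well_posed M \<beta> \<gamma> f" and data: "u0 \<in> H10 M" "u1 \<in> L2 M"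
    and sol: "wave_solution M \<beta> \<gamma> f \<infinity> u0 u1 u v"
begin

lemma time_interval_infinity: "time_interval \<infinity> = {0..}"
  by (auto simp: time_interval_def)

lemma H1_sq_nonneg': "w \<in> H10 M \<Longrightarrow> 0 \<le> H1_sq M \<beta> w"
  using coer[of w] kappa
    by (meson Bochner_Integration.integral_nonneg mult_nonneg_nonneg less_imp_le order_trans zero_le_power2)

lemma H10_norm_sq: "w \<in> H10 M \<Longrightarrow> (H10_norm M \<beta> w)\<^sup>2 = H1_sq M \<beta> w"
  by (simp add: H10_norm_def H1_sq_nonneg')

lemma H10_L2: "w \<in> H10 M \<Longrightarrow> w \<in> L2 M"
  by (intro H1_L2 H10_H1)

lemma
  assumes "0 \<le> t"
  shows uH: "u t \<in> H10 M" and vL: "v t \<in> L2 M"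
    and lim_u: "((\<lambda>s. H10_norm M \<beta> (\<lambda>x. u s x - u t x)) \<longlongrightarrow> 0) (at t within {0..})"
    and lim_du: "((\<lambda>s. L2_norm M (\<lambda>x. (u s x - u t x) / (s - t) - v t x)) \<longlongrightarrow> 0) (at t within {0..})"
    and lim_v: "((\<lambda>s. L2_norm M (\<lambda>x. v s x - v t x)) \<longlongrightarrow> 0) (at t within {0..})"
    and weak: "\<And>\<phi>. \<phi> \<in> H10 M \<Longrightarrow> ((\<lambda>s. \<integral>x. v s x * \<phi> x \<partial>vol M) has_real_derivative
              (- dirichlet_form M (u t) \<phi> - (\<integral>x. \<gamma> x * v t x * \<phi> x \<partial>vol M)
               - \<beta> * (\<integral>x. u t x * \<phi> x \<partial>vol M) + (\<integral>x. f (u t x) * \<phi> x \<partial>vol M))) (at t within {0..})"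
  using sol assms unfolding wave_solution_def time_interval_infinity by auto

lemma init: "AE x in vol M. u 0 x = u0 x" "AE x in vol M. v 0 x = u1 x"
  using sol unfolding wave_solution_def by auto

lemma uL: "0 \<le> t \<Longrightarrow> u t \<in> L2 M"
  using uH H10_L2 by blast

definition Y where "Y t = (\<integral>x. (u t x)\<^sup>2 \<partial>vol M)"
definition P where "P t = (\<integral>x. u t x * v t x \<partial>vol M)"
definition n where "n t = (\<integral>x. (v t x)\<^sup>2 \<partial>vol M)"
definition h where "h t = H1_sq M \<beta> (u t)"
definition G where "G t = (\<integral>x. F (u t x) \<partial>vol M)"
definition E where "E t = energy M \<beta> f (u t) (v t)"
definition Q where "Q t = n t - h t - (\<integral>x. \<gamma> x * v t x * u t x \<partial>vol M) + (\<integral>x. f (u t x) * u t x \<partial>vol M)"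

lemma Y_nonneg: "0 \<le> Y t" and n_nonneg: "0 \<le> n t"
  by (simp_all add: Y_def n_def)

lemma h_ge: "0 \<le> t \<Longrightarrow> \<kappa> * Y t \<le> h t"
  unfolding h_def Y_def by (rule coer[OF uH])

lemma h_nonneg: "0 \<le> t \<Longrightarrow> 0 \<le> h t"
  unfolding h_def by (rule H1_sq_nonneg'[OF uH])

lemma G_nonneg: "0 \<le> t \<Longrightarrow> 0 \<le> G t"
  unfolding G_def by (rule F_integral_nonneg[OF uH])

lemma E_eq: "0 \<le> t \<Longrightarrow> E t = h t / 2 + n t / 2 - G t"
  unfolding E_def energy_def by (simp add: H10_norm_sq[OF uH] L2_norm_sq h_def n_def G_def F_def)

lemma lim_u_L2: assumes t: "0 \<le> t" shows "((\<lambda>s. L2_norm M (\<lambda>x. u s x - u t x)) \<longlongrightarrow> 0) (at t within {0..})"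
proof (rule Lim_null_comparison)
  show "((\<lambda>s. H10_norm M \<beta> (\<lambda>x. u s x - u t x) / sqrt \<kappa>) \<longlongrightarrow> 0) (at t within {0..})"
    using tendsto_divide[OF lim_u[OF t] tendsto_const[of "sqrt \<kappa>"]] kappa by simp
  show "\<forall>\<^sub>F s in at t within {0..}. norm (L2_norm M (\<lambda>x. u s x - u t x)) \<le> H10_norm M \<beta> (\<lambda>x. u s x - u t x) / sqrt \<kappa>"
    unfolding eventually_at_filter
  proof (rule always_eventually, intro allI impI)
    fix s :: real assume "s \<in> {0..}"
    then have d: "(\<lambda>x. u s x - u t x) \<in> H10 M" using H10_diff uH t by auto
    have "sqrt (\<kappa> * (\<integral>x. (u s x - u t x)\<^sup>2 \<partial>vol M)) \<le> sqrt (H1_sq M \<beta> (\<lambda>x. u s x - u t x))"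
      using coer[OF d] by simp
    then show "norm (L2_norm M (\<lambda>x. u s x - u t x)) \<le> H10_norm M \<beta> (\<lambda>x. u s x - u t x) / sqrt \<kappa>"
      using kappa by (simp add: H10_norm_def L2_norm_def real_sqrt_mult le_divide_eq mult.commute)
  qed
qed

lemma dquot_L2: "0 \<le> s \<Longrightarrow> 0 \<le> t \<Longrightarrow> (\<lambda>x. (u s x - u t x) / (s - t)) \<in> L2 M"
  by (intro L2_scale L2_diff uL)

text \<open>The difference quotient of Y is that of u paired with u(s) + u(t).\<close>

lemma Y_derivative:
  assumes t: "0 \<le> t" shows "(Y has_real_derivative 2 * P t) (at t within {0..})"
  unfolding has_field_derivative_iff
proof (rule Lim_transform_eventually)
  have 1: "((\<lambda>s. \<integral>x. (u s x - u t x) / (s - t) * u s x \<partial>vol M) \<longlongrightarrow> (\<integral>x. v t x * u t x \<partial>vol M)) (at t within {0..})"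
    by (rule L2_inner_tendsto) (use t dquot_L2 uL vL lim_du lim_u_L2 in auto)
  have 2: "((\<lambda>s. \<integral>x. (u s x - u t x) / (s - t) * u t x \<partial>vol M) \<longlongrightarrow> (\<integral>x. v t x * u t x \<partial>vol M)) (at t within {0..})"
    by (rule L2_inner_tendsto) (use t dquot_L2 uL vL lim_du in \<open>auto simp: L2_norm_def\<close>)
  show "((\<lambda>s. (\<integral>x. (u s x - u t x) / (s - t) * u s x \<partial>vol M) + (\<integral>x. (u s x - u t x) / (s - t) * u t x \<partial>vol M)) \<longlongrightarrow> 2 * P t) (at t within {0..})"
    using tendsto_add[OF 1 2] by (simp add: P_def mult.commute)
  show "\<forall>\<^sub>F s in at t within {0..}. (\<integral>x. (u s x - u t x) / (s - t) * u s x \<partial>vol M) + (\<integral>x. (u s x - u t x) / (s - t) * u t x \<partial>vol M) = (Y s - Y t) / (s - t)"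
    unfolding eventually_at_filter
  proof (rule always_eventually, intro allI impI)
    fix s :: real assume "s \<noteq> t" and s: "s \<in> {0..}"
    then have s0: "0 \<le> s" by simp
    have "(\<integral>x. (u s x - u t x) / (s - t) * u s x \<partial>vol M) + (\<integral>x. (u s x - u t x) / (s - t) * u t x \<partial>vol M)
      = (\<integral>x. (u s x - u t x) / (s - t) * u s x + (u s x - u t x) / (s - t) * u t x \<partial>vol M)"
      by (rule Bochner_Integration.integral_add[symmetric]; rule L2_inner_integrable[OF dquot_L2[OF s0 t] uL]) (use s0 t in auto)
    also have "\<dots> = (\<integral>x. ((u s x)\<^sup>2 - (u t x)\<^sup>2) / (s - t) \<partial>vol M)"
      by (rule Bochner_Integration.integral_cong[OF refl]) (simp add: add_divide_distrib[symmetric] power2_eq_square algebra_simps)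
    also have "\<dots> = (Y s - Y t) / (s - t)"
      unfolding Y_def using L2_integrable[OF uL[OF s0]] L2_integrable[OF uL[OF t]] by simp
    finally show "(\<integral>x. (u s x - u t x) / (s - t) * u s x \<partial>vol M) + (\<integral>x. (u s x - u t x) / (s - t) * u t x \<partial>vol M) = (Y s - Y t) / (s - t)" .
  qed
qed

text \<open>The difference quotient of P splits into v(s) paired with the quotient of u, and the
  quotient of v paired with the fixed u(t). The first converges in L2; for the second, v being
  differentiable only weakly, the equation is tested with u(t), a member of
  \<open>H10\<close>.\<close>

lemma P_derivative:
  assumes t: "0 \<le> t" shows "(P has_real_derivative Q t) (at t within {0..})"
  unfolding has_field_derivative_iff
proof (rule Lim_transform_eventually)
  have 1: "((\<lambda>s. \<integral>x. v s x * ((u s x - u t x) / (s - t)) \<partial>vol M) \<longlongrightarrow> (\<integral>x. v t x * v t x \<partial>vol M)) (at t within {0..})"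
    by (rule L2_inner_tendsto) (use t dquot_L2 vL lim_du lim_v in auto)
  let ?W = "- dirichlet_form M (u t) (u t) - (\<integral>x. \<gamma> x * v t x * u t x \<partial>vol M)
               - \<beta> * (\<integral>x. u t x * u t x \<partial>vol M) + (\<integral>x. f (u t x) * u t x \<partial>vol M)"
  have 2: "((\<lambda>s. ((\<integral>x. v s x * u t x \<partial>vol M) - (\<integral>x. v t x * u t x \<partial>vol M)) / (s - t)) \<longlongrightarrow> ?W) (at t within {0..})"
    using weak[OF t uH[OF t]] unfolding has_field_derivative_iff .
  have "(\<integral>x. v t x * v t x \<partial>vol M) + ?W = Q t"
    unfolding Q_def n_def h_def H1_sq_eq[OF H10_H1[OF uH[OF t]]] by (simp add: power2_eq_square)
  with tendsto_add[OF 1 2]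
  show "((\<lambda>s. (\<integral>x. v s x * ((u s x - u t x) / (s - t)) \<partial>vol M) + ((\<integral>x. v s x * u t x \<partial>vol M) - (\<integral>x. v t x * u t x \<partial>vol M)) / (s - t)) \<longlongrightarrow> Q t) (at t within {0..})"
    by simp
  show "\<forall>\<^sub>F s in at t within {0..}. (\<integral>x. v s x * ((u s x - u t x) / (s - t)) \<partial>vol M) + ((\<integral>x. v s x * u t x \<partial>vol M) - (\<integral>x. v t x * u t x \<partial>vol M)) / (s - t) = (P s - P t) / (s - t)"
    unfolding eventually_at_filter
  proof (rule always_eventually, intro allI impI)
    fix s :: real assume st: "s \<noteq> t" and s: "s \<in> {0..}"
    then have s0: "0 \<le> s" by simp
    have "(\<integral>x. v s x * ((u s x - u t x) / (s - t)) \<partial>vol M) = (\<integral>x. (v s x * u s x - v s x * u t x) / (s - t) \<partial>vol M)"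
      by (simp add: right_diff_distrib)
    also have "\<dots> = ((\<integral>x. v s x * u s x \<partial>vol M) - (\<integral>x. v s x * u t x \<partial>vol M)) / (s - t)"
      using L2_inner_integrable[OF vL[OF s0] uL[OF s0]] L2_inner_integrable[OF vL[OF s0] uL[OF t]]
        by simp
    finally have a: "(\<integral>x. v s x * ((u s x - u t x) / (s - t)) \<partial>vol M) = (P s - (\<integral>x. v s x * u t x \<partial>vol M)) / (s - t)"
      by (simp add: P_def mult.commute)
    have b: "(\<integral>x. v t x * u t x \<partial>vol M) = P t" by (simp add: P_def mult.commute)
    show "(\<integral>x. v s x * ((u s x - u t x) / (s - t)) \<partial>vol M) + ((\<integral>x. v s x * u t x \<partial>vol M) - (\<integral>x. v t x * u t x \<partial>vol M)) / (s - t) = (P s - P t) / (s - t)"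
      unfolding a b by (simp add: add_divide_distrib[symmetric])
  qed
qed

section \<open>Virial inequality and energy estimates\<close>

lemma P_Cauchy_Schwarz: "0 \<le> t \<Longrightarrow> (P t)\<^sup>2 \<le> Y t * n t"
proof -
  assume t: "0 \<le> t"
  have "\<bar>P t\<bar> \<le> sqrt (Y t) * sqrt (n t)"
    using L2_Cauchy_Schwarz[OF uL[OF t] vL[OF t]] by (simp add: P_def Y_def n_def L2_norm_def)
  then have "\<bar>P t\<bar>\<^sup>2 \<le> (sqrt (Y t) * sqrt (n t))\<^sup>2" by (rule power_mono) simp
  then show ?thesis by (simp add: power_mult_distrib Y_nonneg n_nonneg)
qed

text \<open>Young's inequality with the weights sqrt \<epsilon> / 2 and 2 K / sqrt \<epsilon>,
  chosen so that only half of the surplus \<epsilon> / 2 in the coefficient of n is spent.\<close>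

lemma damping_integral:
  assumes t: "0 \<le> t" shows "2 * \<bar>\<integral>x. \<gamma> x * v t x * u t x \<partial>vol M\<bar> \<le> \<epsilon> / 4 * n t + 4 * K\<^sup>2 / \<epsilon> * Y t"
proof -
  have i: "integrable (vol M) (\<lambda>x. \<bar>v t x * u t x\<bar>)"
    using L2_inner_integrable[OF vL[OF t] uL[OF t]] by simp
  have "\<bar>\<integral>x. \<gamma> x * v t x * u t x \<partial>vol M\<bar> \<le> (\<integral>x. \<bar>\<gamma> x * v t x * u t x\<bar> \<partial>vol M)"
    by (rule integral_abs_bound)
  also have "\<dots> \<le> (\<integral>x. K * \<bar>v t x * u t x\<bar> \<partial>vol M)"
  proof (rule integral_mono_AE')
    show "integrable (vol M) (\<lambda>x. K * \<bar>v t x * u t x\<bar>)" using i by simp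
    show "AE x in vol M. \<bar>\<gamma> x * v t x * u t x\<bar> \<le> K * \<bar>v t x * u t x\<bar>"
      using gam(3) by eventually_elim (simp add: abs_mult mult.assoc mult_right_mono)
    show "AE x in vol M. 0 \<le> K * \<bar>v t x * u t x\<bar>" using gam(2) by simp
  qed
  also have "\<dots> \<le> K * (L2_norm M (v t) * L2_norm M (u t))"
    using integral_Cauchy_Schwarz_abs[of "v t" "vol M" "u t"] vL[OF t] uL[OF t] gam(2)
    by (simp add: L2_def L2_norm_def mult_left_mono)
  also have "\<dots> = K * (sqrt (n t) * sqrt (Y t))" by (simp add: L2_norm_def n_def Y_def)
  finally have "2 * \<bar>\<integral>x. \<gamma> x * v t x * u t x \<partial>vol M\<bar> \<le> 2 * (sqrt \<epsilon> / 2 * sqrt (n t)) * (2 * K / sqrt \<epsilon> * sqrt (Y t))"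
    using eps by (simp add: field_simps)
  also have "\<dots> \<le> (sqrt \<epsilon> / 2 * sqrt (n t))\<^sup>2 + (2 * K / sqrt \<epsilon> * sqrt (Y t))\<^sup>2"
    by (rule sum_squares_bound)
  also have "\<dots> = \<epsilon> / 4 * n t + 4 * K\<^sup>2 / \<epsilon> * Y t"
    using eps by (simp add: power_mult_distrib power_divide Y_nonneg n_nonneg)
  finally show ?thesis .
qed

text \<open>Twice the lower bound (2 + \<epsilon>) G of the nonlinear term is split as (4 +
  \<epsilon>) G + \<epsilon> G. The first part is expressed by h, n and E; the second pays for the
  damping, up to \<open>C1\<close>.\<close>

lemma virial_inequality:
  assumes t: "0 \<le> t" shows "(4 + \<epsilon> / 4) * n t + \<epsilon> / 2 * h t - (4 + \<epsilon>) * E t - C1 \<le> 2 * Q t"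
proof -
  have a: "(2 + \<epsilon>) * G t \<le> (\<integral>x. f (u t x) * u t x \<partial>vol M)"
    unfolding G_def by (rule f_F_integral[OF uH[OF t]])
  have "\<epsilon> * (Y t powr ((p0 + 1) / 2) / Cf) \<le> \<epsilon> * G t"
    unfolding G_def Y_def using F_integral_lower[OF uH[OF t]] eps by (intro mult_left_mono) auto
  moreover have "4 * K\<^sup>2 / \<epsilon> * Y t \<le> \<epsilon> / Cf * Y t powr ((p0 + 1) / 2) + C1"
    by (rule C1(2)[OF Y_nonneg])
  ultimately have b: "4 * K\<^sup>2 / \<epsilon> * Y t \<le> \<epsilon> * G t + C1" by simp
  note d = damping_integral[OF t]
  have g: "G t = h t / 2 + n t / 2 - E t" using E_eq[OF t] by simp
  have "(4 + \<epsilon>) * G t + \<epsilon> * G t = 2 * ((2 + \<epsilon>) * G t)" by (simp add: algebra_simps)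
  moreover have "(4 + \<epsilon>) * G t = (2 + \<epsilon> / 2) * h t + (2 + \<epsilon> / 2) * n t - (4 + \<epsilon>) * E t"
    unfolding g by (simp add: field_simps)
  ultimately have "(2 + \<epsilon> / 2) * h t + (2 + \<epsilon> / 2) * n t - (4 + \<epsilon>) * E t + (4 * K\<^sup>2 / \<epsilon> * Y t - C1) \<le> 2 * (\<integral>x. f (u t x) * u t x \<partial>vol M)"
    using a b by linarith
  moreover have "2 * Q t = 2 * n t - 2 * h t - 2 * (\<integral>x. \<gamma> x * v t x * u t x \<partial>vol M) + 2 * (\<integral>x. f (u t x) * u t x \<partial>vol M)"
    by (simp add: Q_def)
  ultimately have "2 * n t - 2 * h t + (2 + \<epsilon> / 2) * h t + (2 + \<epsilon> / 2) * n t - (4 + \<epsilon>) * E t - C1 - \<epsilon> / 4 * n t \<le> 2 * Q t"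
    using d by linarith
  then show ?thesis by (simp add: algebra_simps)
qed

lemma energy_cong:
  assumes "a \<in> H10 M" "a' \<in> H10 M" "b \<in> L2 M" "b' \<in> L2 M"
    and ae: "AE x in vol M. a x = a' x" "AE x in vol M. b x = b' x"
  shows "energy M \<beta> f a b = energy M \<beta> f a' b'"
proof -
  have [measurable]: "a \<in> borel_measurable borel" "a' \<in> borel_measurable borel" "b \<in> borel_measurable borel" "b' \<in> borel_measurable borel"
    using assms H10_L2 L2_measurable by auto
  have "H1_sq M \<beta> a = H1_sq M \<beta> a'" by (rule H1_sq_cong) (use assms H10_L2 in auto)
  moreover have "(\<integral>x. (b x)\<^sup>2 \<partial>vol M) = (\<integral>x. (b' x)\<^sup>2 \<partial>vol M)"
    by (rule integral_cong_AE) (use ae(2) in \<open>auto elim: eventually_mono\<close>)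
  moreover have "(\<integral>x. F (a x) \<partial>vol M) = (\<integral>x. F (a' x) \<partial>vol M)"
  proof (rule integral_cong_AE)
    show "AE x in vol M. F (a x) = F (a' x)" using ae(1) by eventually_elim simp
  qed (simp, measurable)+
  ultimately show ?thesis unfolding energy_def H10_norm_def L2_norm_def F_def by simp
qed

lemma E_initial: "E 0 = energy M \<beta> f u0 u1"
  unfolding E_def using init data uH[of 0] vL[of 0] by (intro energy_cong) auto

text \<open>Well-posedness asserts the energy equality for its own solution u', v'. Uniqueness
  identifies u with u' almost everywhere at each time, and then v with v', because both are L2
  limits of the same difference quotients; thus the energies coincide.\<close>

lemma E_decreasing:
  assumes st: "0 \<le> s" "s \<le> t" shows "E t \<le> E s"
proof -
  from bspec[OF bspec[OF lwp[unfolded locally_well_posed_def] data(1)] data(2)] show ?thesis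
  proof (elim exE conjE)
  fix Tmax u' v'
  assume s': "wave_solution M \<beta> \<gamma> f Tmax u0 u1 u' v'"
    and uniq: "\<forall>T u2 v2. wave_solution M \<beta> \<gamma> f T u0 u1 u2 v2 \<longrightarrow> T \<le> Tmax \<and> (\<forall>t\<in>time_interval T. AE x in vol M. u2 t x = u' t x)"
    and en: "\<forall>t0 t1. 0 \<le> t0 \<longrightarrow> t0 \<le> t1 \<longrightarrow> ereal t1 < Tmax \<longrightarrow> energy M \<beta> f (u' t1) (v' t1) = energy M \<beta> f (u' t0) (v' t0)
             - integral {t0..t1} (\<lambda>t. \<integral>x. \<gamma> x * (v' t x)\<^sup>2 \<partial>vol M)"
  from uniq[rule_format, OF sol] have T: "Tmax = \<infinity>" and ae: "\<And>t. 0 \<le> t \<Longrightarrow> AE x in vol M. u t x = u' t x"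
    by (auto simp: time_interval_infinity)
  have u': "u' t \<in> H10 M" "v' t \<in> L2 M"
    "((\<lambda>s. L2_norm M (\<lambda>x. (u' s x - u' t x) / (s - t) - v' t x)) \<longlongrightarrow> 0) (at t within {0..})" if "0 \<le> t" for t
    using s' that unfolding T wave_solution_def time_interval_infinity by auto
  have aev: "AE x in vol M. v t x = v' t x" if t: "0 \<le> t" for t
  proof -
    let ?d = "\<lambda>s x. (u s x - u t x) / (s - t)" and ?d' = "\<lambda>s x. (u' s x - u' t x) / (s - t)"
    have L: "(\<lambda>x. v t x - v' t x) \<in> L2 M" by (rule L2_diff[OF vL[OF t] u'(2)[OF t]])
    have le: "(\<integral>x. (v t x - v' t x)\<^sup>2 \<partial>vol M)
        \<le> 2 * (L2_norm M (\<lambda>x. ?d' s x - v' t x))\<^sup>2 + 2 * (L2_norm M (\<lambda>x. ?d s x - v t x))\<^sup>2" if s: "0 \<le> s" for s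
    proof -
      have d1: "(\<lambda>x. ?d' s x - v' t x) \<in> L2 M" by (intro L2_diff L2_scale H10_L2 u' s t)
      have d2: "(\<lambda>x. ?d s x - v t x) \<in> L2 M" by (intro L2_diff dquot_L2 vL s t)
      have "(\<integral>x. (v t x - v' t x)\<^sup>2 \<partial>vol M) = (\<integral>x. ((?d' s x - v' t x) + (- 1) * (?d s x - v t x))\<^sup>2 \<partial>vol M)"
      proof (rule integral_cong_AE)
        show "AE x in vol M. (v t x - v' t x)\<^sup>2 = ((?d' s x - v' t x) + (- 1) * (?d s x - v t x))\<^sup>2"
          using ae[OF s] ae[OF t] by eventually_elim simp
      qed (use L2_integrable[OF L] L2_integrable[OF L2_add[OF d1 d2, of "- 1"]] in \<open>auto dest: borel_measurable_integrable\<close>)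
      also have "\<dots> \<le> 2 * (\<integral>x. (?d' s x - v' t x)\<^sup>2 \<partial>vol M) + 2 * (\<integral>x. (?d s x - v t x)\<^sup>2 \<partial>vol M)"
        using L2_sq_add_le[OF d1 d2, of 1 "- 1"] by simp
      finally show ?thesis by (simp add: L2_norm_sq)
    qed
    have "((\<lambda>s. 2 * (L2_norm M (\<lambda>x. ?d' s x - v' t x))\<^sup>2 + 2 * (L2_norm M (\<lambda>x. ?d s x - v t x))\<^sup>2) \<longlongrightarrow> 2 * 0\<^sup>2 + 2 * 0\<^sup>2) (at t within {0..})"
      by (intro tendsto_intros u'(3) lim_du t)
    then have "(\<integral>x. (v t x - v' t x)\<^sup>2 \<partial>vol M) \<le> 2 * 0\<^sup>2 + 2 * 0\<^sup>2"
    proof (rule tendsto_lowerbound)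
      show "\<forall>\<^sub>F s in at t within {0..}. (\<integral>x. (v t x - v' t x)\<^sup>2 \<partial>vol M)
        \<le> 2 * (L2_norm M (\<lambda>x. ?d' s x - v' t x))\<^sup>2 + 2 * (L2_norm M (\<lambda>x. ?d s x - v t x))\<^sup>2"
        using le by (simp add: eventually_at_filter)
      show "at t within {0..} \<noteq> bot" 
      proof
        assume "at t within {0..} = bot"
        moreover have "at_right t \<le> at t within {0..}" by (rule at_le) (use t in auto)
        ultimately have "at_right t = bot" by (simp add: bot.extremum_unique)
        then show False by (simp add: trivial_limit_at_right_real)
      qed
    qed
    then have "(\<integral>x. (v t x - v' t x)\<^sup>2 \<partial>vol M) = 0" by (simp add: antisym)
    then have "AE x in vol M. (v t x - v' t x)\<^sup>2 = 0"
      using integral_nonneg_eq_0_iff_AE[OF L2_integrable[OF L]] by simp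
    then show ?thesis by eventually_elim simp
  qed
  have EE: "E t = energy M \<beta> f (u' t) (v' t)" if t: "0 \<le> t" for t
    unfolding E_def by (intro energy_cong uH vL u' ae aev t)
  \<comment> \<open>If the integral over time does not exist, it is 0 by default, and the sign is
    right in this case too.\<close>
  have I: "0 \<le> integral {s..t} (\<lambda>t. \<integral>x. \<gamma> x * (v' t x)\<^sup>2 \<partial>vol M)"
  proof (cases "(\<lambda>t. \<integral>x. \<gamma> x * (v' t x)\<^sup>2 \<partial>vol M) integrable_on {s..t}")
    case True
    then show ?thesis
    proof (rule Henstock_Kurzweil_Integration.integral_nonneg)
      fix r
      show "0 \<le> (\<integral>x. \<gamma> x * (v' r x)\<^sup>2 \<partial>vol M)"
        by (rule integral_nonneg_AE) (use gam(3) in \<open>auto elim: eventually_mono\<close>)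
    qed
  next
    case False
    then show ?thesis by (simp add: not_integrable_integral)
  qed
  show "E t \<le> E s" using en[rule_format, OF st] I EE st by (simp add: T)
  qed
qed

text \<open>An energy below the bound stays below it, and the virial inequality then has a positive
  source at all later times. The 1 in \<open>C1 + 1\<close> is that source.\<close>

lemma energy_lower_bound:
  assumes t0: "0 \<le> t0" shows "- ((C1 + 1) / (4 + \<epsilon>)) \<le> E t0"
proof (rule ccontr)
  assume "\<not> ?thesis"
  then have "(4 + \<epsilon>) * E t0 < - (C1 + 1)" using eps by (simp add: field_simps)
  have "(4 + \<epsilon> / 4) * n t + \<epsilon> / 2 * \<kappa> * Y t + 1 \<le> 2 * Q t" if t: "t0 \<le> t" for t
  proof -
    have "(4 + \<epsilon>) * E t \<le> (4 + \<epsilon>) * E t0" using E_decreasing[OF t0 t] eps by simp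
    moreover have "\<epsilon> / 2 * (\<kappa> * Y t) \<le> \<epsilon> / 2 * h t"
      using h_ge[of t] t t0 eps by (intro mult_left_mono) auto
    ultimately show ?thesis using virial_inequality[of t] t t0 \<open>(4 + \<epsilon>) * E t0 < - (C1 + 1)\<close> by simp
  qed
  then show False
    using concavity_no_positive_source[OF Y_derivative P_derivative P_Cauchy_Schwarz n_nonneg Y_nonneg t0, of "\<epsilon> / 4" "\<epsilon> / 2 * \<kappa>"] eps kappa
    by simp
qed

text \<open>The square root of the coefficient of Y that coercivity extracts from \<epsilon> / 2 h;
  it becomes the decay rate.\<close>

definition l where "l = sqrt (\<epsilon> / 2 * \<kappa>)"

lemma l: "0 < l" "l\<^sup>2 = \<epsilon> / 2 * \<kappa>"
  using eps kappa by (simp_all add: l_def)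

text \<open>\<open>B\<close> is any nonnegative majorant of the initial energy. It will be |E 0| for
  bounds by the energy and half the squared initial norm for bounds by the data.\<close>

lemma Y_bounds:
  assumes B: "0 \<le> B" "E 0 \<le> B" and t: "0 \<le> t"
  shows "2 * P t + l * Y t \<le> (C1 + (4 + \<epsilon>) * B) / l"
    and "Y t \<le> Y 0 * exp (- l * t) + (C1 + (4 + \<epsilon>) * B) / l\<^sup>2 * (1 - exp (- l * t))"
    and "\<epsilon> / 2 * h t + 4 * n t - (C1 + (4 + \<epsilon>) * B) \<le> 2 * Q t"
proof -
  have v: "(4 + \<epsilon> / 4) * n t + \<epsilon> / 2 * h t - (C1 + (4 + \<epsilon>) * B) \<le> 2 * Q t" if t: "0 \<le> t" for t
  proof -
    have "(4 + \<epsilon>) * E t \<le> (4 + \<epsilon>) * B"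
      using E_decreasing[OF order_refl t] B eps by (intro mult_left_mono) auto
    then show ?thesis using virial_inequality[OF t] by simp
  qed
  have "(4 + \<epsilon> / 4) * n t + \<epsilon> / 2 * \<kappa> * Y t - (C1 + (4 + \<epsilon>) * B) \<le> 2 * Q t" if t: "0 \<le> t" for t
  proof -
    have "\<epsilon> / 2 * (\<kappa> * Y t) \<le> \<epsilon> / 2 * h t" using h_ge[OF t] eps by (intro mult_left_mono) auto
    then show ?thesis using v[OF t] by simp
  qed
  note * = convexity_decay[OF Y_derivative P_derivative P_Cauchy_Schwarz n_nonneg this _ _ l]
  show "2 * P t + l * Y t \<le> (C1 + (4 + \<epsilon>) * B) / l" by (rule *(1)) (use eps kappa t in auto)
  show "Y t \<le> Y 0 * exp (- l * t) + (C1 + (4 + \<epsilon>) * B) / l\<^sup>2 * (1 - exp (- l * t))"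
    by (rule *(2)) (use eps kappa t in auto)
  have "0 \<le> \<epsilon> / 4 * n t" using eps n_nonneg by simp
  then show "\<epsilon> / 2 * h t + 4 * n t - (C1 + (4 + \<epsilon>) * B) \<le> 2 * Q t"
    using v[OF t] by (simp add: algebra_simps)
qed

lemma Y_initial: "Y 0 = (L2_norm M u0)\<^sup>2"
proof -
  have [measurable]: "u 0 \<in> borel_measurable borel" "u0 \<in> borel_measurable borel"
    using uL[of 0] data(1) H10_L2 L2_measurable by auto
  show ?thesis
    unfolding Y_def L2_norm_sq by (rule integral_cong_AE) (use init(1) in \<open>auto elim: eventually_mono\<close>)
qed

end

section \<open>Subcritical nonlinearities\<close>

text \<open>The Young bounds for all \<delta> amount to the triangle inequality: the optimal choice
  is \<delta> = sqrt (b / a). If a or b vanishes, a large or a small \<delta> is used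
  instead.\<close>

lemma sqrt_triangle:
  fixes x a b :: real
  assumes "0 \<le> a" "0 \<le> b" and le: "\<And>\<delta>. 0 < \<delta> \<Longrightarrow> x \<le> (1 + \<delta>) * a + (1 + 1 / \<delta>) * b"
  shows "sqrt x \<le> sqrt a + sqrt b"
proof -
  consider "a = 0" | "b = 0" | "0 < a" "0 < b" using assms by linarith
  then have "x \<le> (sqrt a + sqrt b)\<^sup>2"
  proof cases
    case 1
    have "x \<le> b"
    proof (rule ccontr)
      assume n: "\<not> x \<le> b"
      show False
      proof (cases "b = 0")
        case True
        then show ?thesis using le[of 1] n 1 by simp
      next
        case False
        then have b: "0 < b" using assms by simp
        then have "x \<le> b + (x - b) / 2"
          using le[of "2 * b / (x - b)"] n 1 by (simp add: field_simps)
        then show False using n by (simp add: field_simps)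
      qed
    qed
    then show ?thesis using 1 assms by simp
  next
    case 2
    have "x \<le> a"
    proof (rule ccontr)
      assume n: "\<not> x \<le> a"
      show False
      proof (cases "a = 0")
        case True
        then show ?thesis using le[of 1] n 2 by simp
      next
        case False
        then have a: "0 < a" using assms by simp
        then have "x \<le> a + (x - a) / 2"
          using le[of "(x - a) / (2 * a)"] n 2 by (simp add: field_simps)
        then show False using n by (simp add: field_simps)
      qed
    qed
    then show ?thesis using 2 assms by simp
  next
    case 3
    define \<alpha> where "\<alpha> = sqrt a"
    define \<tau> where "\<tau> = sqrt b"
    have pos: "0 < \<alpha>" "0 < \<tau>" and sq: "a = \<alpha>\<^sup>2" "b = \<tau>\<^sup>2" using 3 by (simp_all add: \<alpha>_def \<tau>_def)
    have "x \<le> (1 + \<tau> / \<alpha>) * \<alpha>\<^sup>2 + (1 + 1 / (\<tau> / \<alpha>)) * \<tau>\<^sup>2"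
      using le[of "\<tau> / \<alpha>"] pos by (simp add: sq)
    also have "\<dots> = (\<alpha> + \<tau>)\<^sup>2" using pos by (simp add: field_simps power2_eq_square)
    finally show ?thesis by (simp add: \<alpha>_def \<tau>_def)
  qed
  then show ?thesis by (rule real_le_lsqrt[rotated]) (use assms in auto)
qed

text \<open>The square roots of \<open>X s\<close> and \<open>X0\<close> differ by at most that of
  \<open>z s\<close>. This gives continuity of the Dirichlet form along a solution from Young's
  inequality alone, with no expansion of the form.\<close>

lemma tendsto_quasi_triangle:
  fixes X z :: "'a \<Rightarrow> real"
  assumes z: "(z \<longlongrightarrow> 0) F" and nn: "0 \<le> X0" "eventually (\<lambda>s. 0 \<le> X s \<and> 0 \<le> z s \<and>
      (\<forall>\<delta>>0. X s \<le> (1 + \<delta>) * X0 + (1 + 1 / \<delta>) * z s) \<and> (\<forall>\<delta>>0. X0 \<le> (1 + \<delta>) * X s + (1 + 1 / \<delta>) * z s)) F"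
  shows "(X \<longlongrightarrow> X0) F"
proof -
  have "((\<lambda>s. sqrt (X s)) \<longlongrightarrow> sqrt X0) F"
  proof (rule LIM_zero_cancel, rule Lim_null_comparison)
    show "((\<lambda>s. sqrt (z s)) \<longlongrightarrow> 0) F" using tendsto_real_sqrt[OF z] by simp
    show "\<forall>\<^sub>F s in F. norm (sqrt (X s) - sqrt X0) \<le> sqrt (z s)"
      using nn(2)
    proof eventually_elim
      case (elim s)
      then have "sqrt (X s) \<le> sqrt X0 + sqrt (z s)" "sqrt X0 \<le> sqrt (X s) + sqrt (z s)"
        using nn(1) by (auto intro!: sqrt_triangle)
      then show ?case by simp
    qed
  qed
  then have "((\<lambda>s. (sqrt (X s))\<^sup>2) \<longlongrightarrow> (sqrt X0)\<^sup>2) F" by (intro tendsto_power)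
  then have "((\<lambda>s. (sqrt (X s))\<^sup>2) \<longlongrightarrow> X0) F" using nn(1) by simp
  then show ?thesis
    by (rule Lim_transform_eventually) (use nn(2) in \<open>auto elim!: eventually_mono\<close>)
qed

text \<open>Packs the bound obtained from a unit window, with A at most affine in R, into the single
  shape d exp(d R). The constant is a crude sum: 1 + 2 L c for the exponent and 1 + (1 + c) exp(2 L
  (1 + c)) for the prefactor.\<close>

lemma exponential_bound:
  fixes A R L c :: real
  assumes "0 \<le> A" "0 \<le> R" "0 \<le> L" "0 \<le> c" "A \<le> c * (1 + R)"
  shows "sqrt ((R + A) * exp (2 * L * (1 + A)))
    \<le> (2 + 2 * L * c + (1 + c) * exp (2 * L * (1 + c))) * exp ((2 + 2 * L * c + (1 + c) * exp (2 * L * (1 + c))) * R)"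
    (is "_ \<le> ?d * exp (?d * R)")
proof -
  have sq: "sqrt x \<le> 1 + x" if "0 \<le> x" for x :: real
    using that by (intro real_le_lsqrt) (auto simp: power2_eq_square algebra_simps)
  have "R + A \<le> (1 + c) * (1 + R)" using assms by (simp add: algebra_simps)
  also have "\<dots> \<le> (1 + c) * exp R"
    using assms exp_ge_add_one_self[of R] by (intro mult_left_mono) auto
  finally have 1: "R + A \<le> (1 + c) * exp R" .
  have "2 * L * (1 + A) \<le> 2 * L * (1 + c * (1 + R))" using assms by (intro mult_left_mono) auto
  also have "\<dots> = 2 * L * (1 + c) + 2 * L * c * R" by (simp add: algebra_simps)
  finally have 2: "exp (2 * L * (1 + A)) \<le> exp (2 * L * (1 + c)) * exp (2 * L * c * R)"
    by (simp add: exp_add[symmetric])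
  have "(R + A) * exp (2 * L * (1 + A)) \<le> ((1 + c) * exp R) * (exp (2 * L * (1 + c)) * exp (2 * L * c * R))"
    using assms by (intro mult_mono 1 2) auto
  also have "\<dots> = (1 + c) * exp (2 * L * (1 + c)) * exp ((1 + 2 * L * c) * R)"
    by (simp add: exp_add algebra_simps)
  finally have 3: "(R + A) * exp (2 * L * (1 + A)) \<le> (1 + c) * exp (2 * L * (1 + c)) * exp ((1 + 2 * L * c) * R)" .
  have d: "1 + 2 * L * c \<le> ?d" "0 \<le> ?d" "1 + (1 + c) * exp (2 * L * (1 + c)) \<le> ?d"
    using assms by (auto intro!: add_nonneg_nonneg mult_nonneg_nonneg)
  have "(1 + 2 * L * c) * R \<le> ?d * R" using d(1) assms by (intro mult_right_mono) auto
  then have 4: "exp ((1 + 2 * L * c) * R) \<le> exp (?d * R)" by simp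
  have "1 \<le> exp (?d * R)" using d(2) assms by simp
  have "sqrt ((R + A) * exp (2 * L * (1 + A))) \<le> 1 + (R + A) * exp (2 * L * (1 + A))"
    using assms by (intro sq) auto
  also have "\<dots> \<le> 1 * exp (?d * R) + (1 + c) * exp (2 * L * (1 + c)) * exp (?d * R)"
  proof (rule add_mono)
    show "1 \<le> 1 * exp (?d * R)" using \<open>1 \<le> exp (?d * R)\<close> by simp
    have "(1 + c) * exp (2 * L * (1 + c)) * exp ((1 + 2 * L * c) * R) \<le> (1 + c) * exp (2 * L * (1 + c)) * exp (?d * R)"
      using 4 assms by (intro mult_left_mono) auto
    with 3 show "(R + A) * exp (2 * L * (1 + A)) \<le> (1 + c) * exp (2 * L * (1 + c)) * exp (?d * R)"
      by linarith
  qed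
  also have "\<dots> = (1 + (1 + c) * exp (2 * L * (1 + c))) * exp (?d * R)" by (simp only: distrib_right)
  also have "\<dots> \<le> ?d * exp (?d * R)" using d(3) by (intro mult_right_mono) auto
  finally show ?thesis .
qed

locale wave_subcritical = wave M p p0 Cf \<epsilon> f \<beta> \<kappa> K C1 \<gamma> u0 u1 u v
  for M :: "('m::{t2_space, second_countable_topology}, 'n::finite) riemannian" and p p0 Cf \<epsilon> f
    and \<beta> \<kappa> K C1 :: real and \<gamma> u0 u1 :: "'m \<Rightarrow> real" and u v :: "real \<Rightarrow> 'm \<Rightarrow> real" +
  fixes S :: real
  assumes pd: "p \<le> real CARD('n) / (real CARD('n) - 2)"
    and S: "0 \<le> S" "\<And>w. w \<in> H10 M \<Longrightarrow> (\<integral>x. \<bar>w x\<bar> powr (2 * real CARD('n) / (real CARD('n) - 2)) \<partial>vol M)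
      \<le> S * H1_sq M 1 w powr (real CARD('n) / (real CARD('n) - 2))"
begin

text \<open>The Sobolev inequality uses the norm with \<beta> = 1; by coercivity this factor is the
  price of passing to the norm with the given \<beta>.\<close>

definition \<Theta> where "\<Theta> = 1 + \<bar>1 - \<beta>\<bar> / \<kappa>"

lemma Theta: "1 \<le> \<Theta>"
  using kappa by (simp add: \<Theta>_def)

lemma H1_sq_le: assumes w: "w \<in> H10 M" shows "H1_sq M 1 w \<le> \<Theta> * H1_sq M \<beta> w"
proof -
  let ?I = "\<integral>x. (w x)\<^sup>2 \<partial>vol M"
  have "H1_sq M 1 w = H1_sq M \<beta> w + (1 - \<beta>) * ?I"
    by (simp add: H1_sq_eq[OF H10_H1[OF w]] algebra_simps)
  also have "(1 - \<beta>) * ?I \<le> \<bar>1 - \<beta>\<bar> * ?I" by (intro mult_right_mono) auto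
  also have "?I \<le> H1_sq M \<beta> w / \<kappa>" using coer[OF w] kappa by (simp add: le_divide_eq mult.commute)
  then have "\<bar>1 - \<beta>\<bar> * ?I \<le> \<bar>1 - \<beta>\<bar> * (H1_sq M \<beta> w / \<kappa>)" by (intro mult_left_mono) auto
  finally show ?thesis by (simp add: \<Theta>_def algebra_simps)
qed

definition r where "r = real CARD('n) / (real CARD('n) - 2)"

text \<open>Since d >= 3, r lies between 1 and 3. The additional assumption on p reads p <= r, that
  is, 2 p <= q.\<close>

lemma r: "1 \<le> r" "r \<le> 3" "q = 2 * r" "p \<le> r"
  using dim pd by (auto simp: r_def q_def field_simps)

definition L0 where "L0 = 2 * Cf\<^sup>2 * (2 / \<kappa> + S * \<Theta> powr r)"

lemma L0_nonneg: "0 \<le> L0"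
  using kappa S Cf by (simp add: L0_def)

definition g where "g s = Cf * (\<bar>s\<bar> + \<bar>s\<bar> powr p)" for s :: real

lemma g_measurable[measurable]: "g \<in> borel_measurable borel"
  unfolding g_def[abs_def] by measurable

lemma g_sq: "(g s)\<^sup>2 \<le> 2 * Cf\<^sup>2 * (2 * s\<^sup>2 + \<bar>s\<bar> powr q)"
proof -
  have "(\<bar>s\<bar> powr p)\<^sup>2 = \<bar>s\<bar> powr (2 * p)"
    by (cases "s = 0") (simp_all add: powr_realpow[symmetric] powr_powr mult.commute)
  also have "\<dots> \<le> s\<^sup>2 + \<bar>s\<bar> powr q" by (rule powr_between) (use p r in auto)
  finally have "(\<bar>s\<bar> + \<bar>s\<bar> powr p)\<^sup>2 \<le> 2 * (2 * s\<^sup>2 + \<bar>s\<bar> powr q)"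
    using square_add_le[of 1 "\<bar>s\<bar>" "\<bar>s\<bar> powr p"] by simp
  then have "Cf\<^sup>2 * (\<bar>s\<bar> + \<bar>s\<bar> powr p)\<^sup>2 \<le> Cf\<^sup>2 * (2 * (2 * s\<^sup>2 + \<bar>s\<bar> powr q))"
    by (rule mult_left_mono) simp
  then show ?thesis unfolding g_def power_mult_distrib by (simp only: mult_ac)
qed

text \<open>g bounds |f|, and 2 p <= q lets the Sobolev inequality control its square. As 1 <= r <=
  3, the power X^r is replaced by X + X^3, a bound in which the dimension no longer appears as an
  exponent.\<close>

lemma g_L2: assumes w: "w \<in> H10 M"
  shows "(\<lambda>x. g (w x)) \<in> L2 M" "L2_norm M (\<lambda>x. g (w x)) \<le> sqrt (L0 * (H1_sq M \<beta> w + H1_sq M \<beta> w ^ 3))"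
proof -
  have [measurable]: "w \<in> borel_measurable borel" by (rule L2_measurable[OF H10_L2[OF w]])
  let ?X = "H1_sq M \<beta> w"
  have X0: "0 \<le> ?X" by (rule H1_sq_nonneg'[OF w])
  have i: "integrable (vol M) (\<lambda>x. 2 * Cf\<^sup>2 * (2 * (w x)\<^sup>2 + \<bar>w x\<bar> powr q))"
    using q_integrable[OF w] L2_integrable[OF H10_L2[OF w]] by simp
  have gi: "integrable (vol M) (\<lambda>x. (g (w x))\<^sup>2)"
  proof (rule Bochner_Integration.integrable_bound[OF i])
    show "(\<lambda>x. (g (w x))\<^sup>2) \<in> borel_measurable (vol M)" by (simp, measurable)
    show "AE x in vol M. norm ((g (w x))\<^sup>2) \<le> norm (2 * Cf\<^sup>2 * (2 * (w x)\<^sup>2 + \<bar>w x\<bar> powr q))"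
    proof (rule AE_I2)
      fix x
      have "0 \<le> 2 * Cf\<^sup>2 * (2 * (w x)\<^sup>2 + \<bar>w x\<bar> powr q)" by simp
      then show "norm ((g (w x))\<^sup>2) \<le> norm (2 * Cf\<^sup>2 * (2 * (w x)\<^sup>2 + \<bar>w x\<bar> powr q))"
        using g_sq[of "w x"] by (simp only: real_norm_def abs_of_nonneg zero_le_power2)
    qed
  qed
  then show "(\<lambda>x. g (w x)) \<in> L2 M" by (simp add: L2_def)
  have "(\<integral>x. (g (w x))\<^sup>2 \<partial>vol M) \<le> (\<integral>x. 2 * Cf\<^sup>2 * (2 * (w x)\<^sup>2 + \<bar>w x\<bar> powr q) \<partial>vol M)"
    by (rule integral_mono[OF gi i g_sq])
  also have "\<dots> = 2 * Cf\<^sup>2 * (2 * (\<integral>x. (w x)\<^sup>2 \<partial>vol M) + (\<integral>x. \<bar>w x\<bar> powr q \<partial>vol M))"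
    using q_integrable[OF w] L2_integrable[OF H10_L2[OF w]] by simp
  also have "\<dots> \<le> 2 * Cf\<^sup>2 * (2 * ((?X + ?X ^ 3) / \<kappa>) + S * \<Theta> powr r * (?X + ?X ^ 3))"
  proof (intro mult_left_mono add_mono)
    have "\<kappa> * (\<integral>x. (w x)\<^sup>2 \<partial>vol M) \<le> ?X + ?X ^ 3" using coer[OF w] X0 by (simp add: add_increasing2)
    then show "(\<integral>x. (w x)\<^sup>2 \<partial>vol M) \<le> (?X + ?X ^ 3) / \<kappa>"
      using kappa by (simp add: le_divide_eq mult.commute)
    have "(\<integral>x. \<bar>w x\<bar> powr q \<partial>vol M) \<le> S * H1_sq M 1 w powr r"
      using S(2)[OF w] by (simp add: q_def r_def)
    also have "\<dots> \<le> S * (\<Theta> * ?X) powr r"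
      using H1_sq_le[OF w] H1_sq_nonneg[OF H10_H1[OF w]] r S(1)
        by (intro mult_left_mono powr_mono2) auto
    also have "\<dots> = S * \<Theta> powr r * ?X powr r" using Theta X0 by (simp add: powr_mult)
    also have "\<dots> \<le> S * \<Theta> powr r * (?X + ?X ^ 3)"
    proof (rule mult_left_mono)
      show "?X powr r \<le> ?X + ?X ^ 3"
      proof (cases "?X \<le> 1")
        case True
        then have "?X powr r \<le> ?X powr 1" using X0 r by (intro powr_mono') auto
        then show ?thesis using X0 by (simp add: add_increasing2)
      next
        case False
        then have "?X powr r \<le> ?X powr 3" using r by (intro powr_mono) auto
        then show ?thesis using X0 False by (simp add: powr_numeral)
      qed
    qed (use S in auto)
    finally show "(\<integral>x. \<bar>w x\<bar> powr q \<partial>vol M) \<le> S * \<Theta> powr r * (?X + ?X ^ 3)" .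
  qed auto
  also have "\<dots> = L0 * (?X + ?X ^ 3)" using kappa by (simp add: L0_def field_simps)
  finally show "L2_norm M (\<lambda>x. g (w x)) \<le> sqrt (L0 * (?X + ?X ^ 3))"
    unfolding L2_norm_def by (rule real_sqrt_le_mono)
qed

section \<open>Continuity and growth of the energy norm\<close>

definition H where "H t = sqrt (L0 * (h t + h t ^ 3))"

text \<open>\<open>F_increment\<close> followed by Cauchy-Schwarz in space. The small factor is an
  L2 norm, whose quotient by the time increment tends to the norm of v.\<close>

lemma G_increment:
  assumes "0 \<le> s" "0 \<le> t"
  shows "\<bar>G s - G t\<bar> \<le> L2_norm M (\<lambda>x. u s x - u t x) * (H s + H t)"
proof -
  have us: "u s \<in> H10 M" "u t \<in> H10 M" using uH assms by auto
  have d: "(\<lambda>x. u s x - u t x) \<in> L2 M" by (intro L2_diff uL assms)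
  have ad: "(\<lambda>x. \<bar>u s x - u t x\<bar>) \<in> L2 M"
    using d by (auto simp: L2_def intro!: borel_measurable_abs)
  have nd: "L2_norm M (\<lambda>x. \<bar>u s x - u t x\<bar>) = L2_norm M (\<lambda>x. u s x - u t x)"
    by (simp add: L2_norm_def)
  note gs = g_L2[OF us(1)] and gt = g_L2[OF us(2)]
  have ii: "integrable (vol M) (\<lambda>x. \<bar>u s x - u t x\<bar> * g (u s x))" "integrable (vol M) (\<lambda>x. \<bar>u s x - u t x\<bar> * g (u t x))"
    using L2_inner_integrable[OF ad gs(1)] L2_inner_integrable[OF ad gt(1)] by auto
  have "\<bar>G s - G t\<bar> = \<bar>\<integral>x. F (u s x) - F (u t x) \<partial>vol M\<bar>"
    unfolding G_def using F_integrable[OF us(1)] F_integrable[OF us(2)] by simp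
  also have "\<dots> \<le> (\<integral>x. \<bar>F (u s x) - F (u t x)\<bar> \<partial>vol M)" by (rule integral_abs_bound)
  also have "\<dots> \<le> (\<integral>x. \<bar>u s x - u t x\<bar> * g (u s x) + \<bar>u s x - u t x\<bar> * g (u t x) \<partial>vol M)"
  proof (rule integral_mono)
    show "integrable (vol M) (\<lambda>x. \<bar>F (u s x) - F (u t x)\<bar>)"
      using F_integrable[OF us(1)] F_integrable[OF us(2)] by simp
    show "integrable (vol M) (\<lambda>x. \<bar>u s x - u t x\<bar> * g (u s x) + \<bar>u s x - u t x\<bar> * g (u t x))"
      using ii by simp
    show "\<bar>F (u s x) - F (u t x)\<bar> \<le> \<bar>u s x - u t x\<bar> * g (u s x) + \<bar>u s x - u t x\<bar> * g (u t x)" for x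
      using F_increment[of "u s x" "u t x"] by (simp add: g_def distrib_left)
  qed
  also have "\<dots> = (\<integral>x. \<bar>u s x - u t x\<bar> * g (u s x) \<partial>vol M) + (\<integral>x. \<bar>u s x - u t x\<bar> * g (u t x) \<partial>vol M)"
    using ii by simp
  also have "\<dots> \<le> L2_norm M (\<lambda>x. u s x - u t x) * H s + L2_norm M (\<lambda>x. u s x - u t x) * H t"
  proof (rule add_mono)
    have "(\<integral>x. \<bar>u s x - u t x\<bar> * g (u s x) \<partial>vol M) \<le> L2_norm M (\<lambda>x. u s x - u t x) * L2_norm M (\<lambda>x. g (u s x))"
      using L2_Cauchy_Schwarz[OF ad gs(1)] by (simp add: nd)
    also have "\<dots> \<le> L2_norm M (\<lambda>x. u s x - u t x) * H s"
      using gs(2) by (intro mult_left_mono) (auto simp: H_def h_def L2_norm_nonneg)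
    finally show "(\<integral>x. \<bar>u s x - u t x\<bar> * g (u s x) \<partial>vol M) \<le> L2_norm M (\<lambda>x. u s x - u t x) * H s" .
    have "(\<integral>x. \<bar>u s x - u t x\<bar> * g (u t x) \<partial>vol M) \<le> L2_norm M (\<lambda>x. u s x - u t x) * L2_norm M (\<lambda>x. g (u t x))"
      using L2_Cauchy_Schwarz[OF ad gt(1)] by (simp add: nd)
    also have "\<dots> \<le> L2_norm M (\<lambda>x. u s x - u t x) * H t"
      using gt(2) by (intro mult_left_mono) (auto simp: H_def h_def L2_norm_nonneg)
    finally show "(\<integral>x. \<bar>u s x - u t x\<bar> * g (u t x) \<partial>vol M) \<le> L2_norm M (\<lambda>x. u s x - u t x) * H t" .
  qed
  finally show ?thesis by (simp add: distrib_left)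
qed

lemma n_tendsto: assumes t: "0 \<le> t" shows "(n \<longlongrightarrow> n t) (at t within {0..})"
  unfolding n_def[abs_def] power2_eq_square
  by (rule L2_inner_tendsto) (use t vL lim_v in auto)

lemma dirichlet_tendsto:
  assumes t: "0 \<le> t"
  shows "((\<lambda>s. dirichlet_form M (u s) (u s)) \<longlongrightarrow> dirichlet_form M (u t) (u t)) (at t within {0..})"
proof (rule tendsto_quasi_triangle)
  have "((\<lambda>s. \<Theta> * (H10_norm M \<beta> (\<lambda>x. u s x - u t x))\<^sup>2) \<longlongrightarrow> \<Theta> * 0\<^sup>2) (at t within {0..})"
    by (intro tendsto_intros lim_u t)
  then show "((\<lambda>s. \<Theta> * (H10_norm M \<beta> (\<lambda>x. u s x - u t x))\<^sup>2) \<longlongrightarrow> 0) (at t within {0..})" by simp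
  have ut: "u t \<in> H1 M" by (rule H10_H1[OF uH[OF t]])
  show "0 \<le> dirichlet_form M (u t) (u t)" by (rule dirichlet_form_nonneg[OF ut])
  show "\<forall>\<^sub>F s in at t within {0..}. 0 \<le> dirichlet_form M (u s) (u s) \<and> 0 \<le> \<Theta> * (H10_norm M \<beta> (\<lambda>x. u s x - u t x))\<^sup>2 \<and>
    (\<forall>\<delta>>0. dirichlet_form M (u s) (u s) \<le> (1 + \<delta>) * dirichlet_form M (u t) (u t) + (1 + 1 / \<delta>) * (\<Theta> * (H10_norm M \<beta> (\<lambda>x. u s x - u t x))\<^sup>2)) \<and>
    (\<forall>\<delta>>0. dirichlet_form M (u t) (u t) \<le> (1 + \<delta>) * dirichlet_form M (u s) (u s) + (1 + 1 / \<delta>) * (\<Theta> * (H10_norm M \<beta> (\<lambda>x. u s x - u t x))\<^sup>2))"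
    unfolding eventually_at_filter
  proof (rule always_eventually, intro allI impI)
    fix s :: real assume "s \<in> {0..}"
    then have s: "0 \<le> s" by simp
    have us: "u s \<in> H1 M" by (rule H10_H1[OF uH[OF s]])
    have d: "(\<lambda>x. u s x - u t x) \<in> H10 M" by (rule H10_diff[OF uH[OF s] uH[OF t]])
    have dH: "(\<lambda>x. u s x - u t x) \<in> H1 M" by (rule H10_H1[OF d])
    let ?D = "dirichlet_form M (\<lambda>x. u s x - u t x) (\<lambda>x. u s x - u t x)"
    let ?z = "\<Theta> * (H10_norm M \<beta> (\<lambda>x. u s x - u t x))\<^sup>2"
    have "0 \<le> (\<integral>x. (u s x - u t x)\<^sup>2 \<partial>vol M)" by simp
    then have Dz: "?D \<le> ?z"
      using H1_sq_le[OF d] unfolding H10_norm_sq[OF d] H1_sq_eq[OF dH, of 1] by linarith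
    have e1: "(\<lambda>x. u t x + 1 * (u s x - u t x)) = u s" and e2: "(\<lambda>x. u s x + (- 1) * (u s x - u t x)) = u t"
      by (simp_all add: fun_eq_iff)
    have 1: "dirichlet_form M (u s) (u s) \<le> (1 + \<delta>) * dirichlet_form M (u t) (u t) + (1 + 1 / \<delta>) * ?z" if "0 < \<delta>" for \<delta>
    proof -
      have "(1 + 1 / \<delta>) * ?D \<le> (1 + 1 / \<delta>) * ?z" using Dz that by (intro mult_left_mono) auto
      then show ?thesis using dirichlet_form_add_le[OF ut dH that, of 1] unfolding e1 by simp
    qed
    have 2: "dirichlet_form M (u t) (u t) \<le> (1 + \<delta>) * dirichlet_form M (u s) (u s) + (1 + 1 / \<delta>) * ?z" if "0 < \<delta>" for \<delta>
    proof -
      have "(1 + 1 / \<delta>) * ?D \<le> (1 + 1 / \<delta>) * ?z" using Dz that by (intro mult_left_mono) auto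
      then show ?thesis using dirichlet_form_add_le[OF us dH that, of "- 1"] unfolding e2 by simp
    qed
    show "0 \<le> dirichlet_form M (u s) (u s) \<and> 0 \<le> ?z \<and>
      (\<forall>\<delta>>0. dirichlet_form M (u s) (u s) \<le> (1 + \<delta>) * dirichlet_form M (u t) (u t) + (1 + 1 / \<delta>) * ?z) \<and>
      (\<forall>\<delta>>0. dirichlet_form M (u t) (u t) \<le> (1 + \<delta>) * dirichlet_form M (u s) (u s) + (1 + 1 / \<delta>) * ?z)"
      using 1 2 dirichlet_form_nonneg[OF us] Theta by simp
  qed
qed

lemma h_tendsto: assumes t: "0 \<le> t" shows "(h \<longlongrightarrow> h t) (at t within {0..})"
proof -
  have hs: "h s = dirichlet_form M (u s) (u s) + \<beta> * Y s" if "0 \<le> s" for s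
    unfolding h_def Y_def by (rule H1_sq_eq[OF H10_H1[OF uH[OF that]]])
  have "(Y \<longlongrightarrow> Y t) (at t within {0..})"
    using Y_derivative[OF t] by (meson DERIV_continuous continuous_within)
  then have "((\<lambda>s. dirichlet_form M (u s) (u s) + \<beta> * Y s) \<longlongrightarrow> dirichlet_form M (u t) (u t) + \<beta> * Y t) (at t within {0..})"
    by (intro tendsto_intros dirichlet_tendsto[OF t])
  then show ?thesis unfolding hs[OF t]
    by (rule Lim_transform_eventually) (auto simp: eventually_at_filter hs)
qed

definition e where "e t = h t + n t"

lemma e_nonneg: "0 \<le> t \<Longrightarrow> 0 \<le> e t"
  by (simp add: e_def h_nonneg n_nonneg)

lemma e_continuous: "continuous_on {0..} e"
  unfolding continuous_on_def e_def[abs_def] by (auto intro!: tendsto_add h_tendsto n_tendsto)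

lemma H_tendsto: assumes t: "0 \<le> t" shows "(H \<longlongrightarrow> H t) (at t within {0..})"
  unfolding H_def[abs_def] by (intro tendsto_intros h_tendsto t)

lemma G_continuous: "continuous_on {0..} G"
  unfolding continuous_on_def
proof
  fix t :: real assume "t \<in> {0..}"
  then have t: "0 \<le> t" by simp
  show "(G \<longlongrightarrow> G t) (at t within {0..})"
  proof (rule LIM_zero_cancel, rule Lim_null_comparison)
    have "((\<lambda>s. L2_norm M (\<lambda>x. u s x - u t x) * (H s + H t)) \<longlongrightarrow> 0 * (H t + H t)) (at t within {0..})"
      by (intro tendsto_intros lim_u_L2 H_tendsto t)
    then show "((\<lambda>s. L2_norm M (\<lambda>x. u s x - u t x) * (H s + H t)) \<longlongrightarrow> 0) (at t within {0..})" by simp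
    show "\<forall>\<^sub>F s in at t within {0..}. norm (G s - G t) \<le> L2_norm M (\<lambda>x. u s x - u t x) * (H s + H t)"
      using G_increment t by (simp add: eventually_at_filter)
  qed
qed

definition L where "L = 2 * sqrt L0"

lemma L_nonneg: "0 \<le> L"
  by (simp add: L_def L0_nonneg)

text \<open>H is at most sqrt (L0 (e + e^3)), and e^2 + e^4 <= (e (1 + e))^2. The shape e (1 + e)
  suits Gronwall's inequality: one factor is the unknown, the other has a bounded integral over a
  unit window.\<close>

lemma growth_rate: assumes t: "0 \<le> t" shows "sqrt (n t) * (H t + H t) \<le> L * (e t * (1 + e t))"
proof -
  have e0: "0 \<le> e t" by (rule e_nonneg[OF t])
  have "sqrt (n t) \<le> sqrt (e t)" using h_nonneg[OF t] by (simp add: e_def)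
  moreover have "H t \<le> sqrt (L0 * (e t + e t ^ 3))"
    unfolding H_def using h_nonneg[OF t] n_nonneg[of t] L0_nonneg
    by (intro real_sqrt_le_mono mult_left_mono add_mono power_mono) (auto simp: e_def)
  moreover have "0 \<le> H t" using h_nonneg[OF t] L0_nonneg by (simp add: H_def)
  ultimately have "sqrt (n t) * (H t + H t) \<le> sqrt (e t) * (2 * sqrt (L0 * (e t + e t ^ 3)))"
    using n_nonneg[of t] e0 by (intro mult_mono) auto
  also have "\<dots> = L * sqrt ((e t)\<^sup>2 + (e t) ^ 4)"
    by (simp add: L_def real_sqrt_mult[symmetric] algebra_simps power2_eq_square power3_eq_cube power4_eq_xxxx)
  also have "\<dots> \<le> L * (e t * (1 + e t))"
  proof (rule mult_left_mono[OF _ L_nonneg], rule real_le_lsqrt)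
    show "(e t)\<^sup>2 + (e t) ^ 4 \<le> (e t * (1 + e t))\<^sup>2"
      using e0 by (simp add: power2_eq_square power4_eq_xxxx algebra_simps)
  qed (use e0 in auto)
  finally show ?thesis .
qed

text \<open>At each time the right upper slope of G is at most the norm of v times 2 H, hence at
  most L e (1 + e), which is the derivative of J. So G - J satisfies the hypothesis of
  \<open>Dini_nonincreasing\<close>, the slack \<eta> being shared equally by G and J.\<close>

lemma G_integrated:
  assumes st: "0 \<le> s" "s \<le> t"
  shows "G t - G s \<le> integral {0..t} (\<lambda>r. L * (e r * (1 + e r))) - integral {0..s} (\<lambda>r. L * (e r * (1 + e r)))"
proof -
  define b where "b r = L * (e r * (1 + e r))" for r
  define J where "J t = integral {0..t} b" for t
  have bc: "continuous_on {0..} b"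
    unfolding b_def[abs_def] by (intro continuous_intros e_continuous)
  have dJ: "(J has_real_derivative b t) (at t within {0..})" if "0 \<le> t" for t
    unfolding J_def[abs_def] by (rule half_line_integral_derivative[OF bc that])
  have Jc: "continuous_on {0..} J" by (rule derivative_continuous_on[OF dJ])
  have "G t - J t \<le> G s - J s"
  proof (rule Dini_nonincreasing[OF _ st(2)])
    show "continuous_on {s..t} (\<lambda>t. G t - J t)"
      by (intro continuous_on_diff continuous_on_subset[OF G_continuous] continuous_on_subset[OF Jc]) (use st in auto)
    fix r \<eta> :: real assume r: "s \<le> r" "r < t" and \<eta>: "0 < \<eta>"
    have r0: "0 \<le> r" using r st by simp
    let ?d = "\<lambda>s x. (u s x - u r x) / (s - r)"
    have "((\<lambda>s. \<integral>x. ?d s x * ?d s x \<partial>vol M) \<longlongrightarrow> (\<integral>x. v r x * v r x \<partial>vol M)) (at r within {0..})"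
      by (rule L2_inner_tendsto) (use r0 dquot_L2 vL lim_du in auto)
    then have "((\<lambda>s. sqrt (\<integral>x. ?d s x * ?d s x \<partial>vol M)) \<longlongrightarrow> sqrt (n r)) (at r within {0..})"
      unfolding n_def power2_eq_square by (rule tendsto_real_sqrt)
    then have "((\<lambda>s. L2_norm M (?d s)) \<longlongrightarrow> sqrt (n r)) (at r within {0..})"
      by (simp add: L2_norm_def power2_eq_square)
    then have "((\<lambda>s. L2_norm M (?d s) * (H s + H r)) \<longlongrightarrow> sqrt (n r) * (H r + H r)) (at r within {0..})"
      by (intro tendsto_intros H_tendsto r0)
    moreover have "sqrt (n r) * (H r + H r) < b r + \<eta> / 2"
      using growth_rate[OF r0] \<eta> by (simp add: b_def)
    ultimately have ev1: "\<forall>\<^sub>F s in at r within {0..}. L2_norm M (?d s) * (H s + H r) < b r + \<eta> / 2"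
      by (rule order_tendstoD(2))
    have "((\<lambda>s. (J s - J r) / (s - r)) \<longlongrightarrow> b r) (at r within {0..})"
      using dJ[OF r0] unfolding has_field_derivative_iff .
    then have ev2: "\<forall>\<^sub>F s in at r within {0..}. b r - \<eta> / 2 < (J s - J r) / (s - r)"
      by (rule order_tendstoD(1)) (use \<eta> in simp)
    obtain d where d: "0 < d" "\<And>s. 0 \<le> s \<Longrightarrow> s \<noteq> r \<Longrightarrow> dist s r < d \<Longrightarrow>
        L2_norm M (?d s) * (H s + H r) < b r + \<eta> / 2 \<and> b r - \<eta> / 2 < (J s - J r) / (s - r)"
      using eventually_conj[OF ev1 ev2] unfolding eventually_at by auto
    show "\<exists>d>0. \<forall>s. r < s \<and> s < r + d \<and> s \<le> t \<longrightarrow> G s - J s \<le> G r - J r + \<eta> * (s - r)"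
    proof (intro exI[of _ d] conjI d(1) allI impI)
      fix s assume s: "r < s \<and> s < r + d \<and> s \<le> t"
      then have s': "0 \<le> s" "s \<noteq> r" "dist s r < d" "0 < s - r"
        using r0 by (auto simp: dist_real_def)
      have "L2_norm M (\<lambda>x. u s x - u r x) = (s - r) * L2_norm M (?d s)"
        using s'(4) by (simp add: L2_norm_def power_divide real_sqrt_divide)
      then have "G s - G r \<le> (s - r) * (L2_norm M (?d s) * (H s + H r))"
        using G_increment[OF s'(1) r0] by (simp add: mult.assoc)
      also have "\<dots> \<le> (s - r) * (b r + \<eta> / 2)"
        using d(2)[OF s'(1-3)] s'(4) by (intro mult_left_mono) auto
      finally have 1: "G s - G r \<le> (s - r) * (b r + \<eta> / 2)" .
      have 2: "(s - r) * (b r - \<eta> / 2) \<le> J s - J r"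
        using d(2)[OF s'(1-3)] s'(4) by (simp add: less_divide_eq mult.commute)
      show "G s - J s \<le> G r - J r + \<eta> * (s - r)" using 1 2 by (simp add: field_simps)
    qed
  qed
  then have "G t - G s \<le> J t - J s" by simp
  then show ?thesis unfolding J_def b_def[abs_def] .
qed

section \<open>Bounds over unit windows\<close>

definition I where "I t = integral {0..t} e"

lemma I_derivative: "0 \<le> t \<Longrightarrow> (I has_real_derivative e t) (at t within {0..})"
  unfolding I_def[abs_def] by (rule half_line_integral_derivative[OF e_continuous])

lemma I_mono: "0 \<le> s \<Longrightarrow> s \<le> t \<Longrightarrow> I s \<le> I t"
  by (rule half_line_mono[OF I_derivative]) (auto intro: e_nonneg)

lemma e_growth:
  assumes "0 \<le> s" "s \<le> t" shows "e t \<le> e s * exp (2 * L * ((t - s) + (I t - I s)))"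
  unfolding I_def
proof (rule Gronwall_unit_windows[OF e_continuous e_nonneg L_nonneg G_integrated _ assms])
  \<comment> \<open>By definition e = 2 E + 2 G, and E does not increase.\<close>
  show "e t \<le> e s + 2 * (G t - G s)" if "0 \<le> s" "s \<le> t" for s t
    using E_decreasing[OF that] E_eq[of s] E_eq[of t] that by (simp add: e_def)
qed

text \<open>The smaller of the coefficients of h and n in the third bound of
  \<open>Y_bounds\<close>, so that \<open>a0\<close> times e is at most 2 Q plus a constant.\<close>

definition a0 where "a0 = min (\<epsilon> / 2) 4"

lemma a0_pos: "0 < a0"
  using eps by (simp add: a0_def)

text \<open>Both estimates come from windows of unit length: \<open>I (t + 1) - I t\<close> is controlled by \<open>P\<close> and hence
  by \<open>Y\<close>, and Gronwall's inequality propagates the bound at a good time inside the window.\<close>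

lemma window_bound:
  assumes B: "0 \<le> B" "E 0 \<le> B" and t: "0 \<le> t" and m: "- (2 * P t) \<le> m"
  shows "I (t + 1) - I t \<le> ((C1 + (4 + \<epsilon>) * B) / l + m + (C1 + (4 + \<epsilon>) * B)) / a0"
proof -
  define C2 where "C2 = C1 + (4 + \<epsilon>) * B"
  have "2 * P t + C2 * t - a0 * I t \<le> 2 * P (t + 1) + C2 * (t + 1) - a0 * I (t + 1)"
  proof (rule half_line_mono[where f="\<lambda>t. 2 * P t + C2 * t - a0 * I t" and f'="\<lambda>t. 2 * Q t + C2 - a0 * e t"])
    show "((\<lambda>t. 2 * P t + C2 * t - a0 * I t) has_real_derivative 2 * Q t + C2 - a0 * e t) (at t within {0..})" if "0 \<le> t" for t
      using P_derivative[OF that] I_derivative[OF that] by (auto intro!: derivative_eq_intros)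
    fix r assume "t < r"
    then have r: "0 \<le> r" using t by simp
    have "a0 * h r \<le> \<epsilon> / 2 * h r" "a0 * n r \<le> 4 * n r"
      using h_nonneg[OF r] n_nonneg[of r] by (intro mult_right_mono; simp add: a0_def)+
    then show "0 \<le> 2 * Q r + C2 - a0 * e r"
      using Y_bounds(3)[OF B r] by (simp add: e_def C2_def distrib_left)
  qed (use t in auto)
  \<comment> \<open>At the end of the window P is bounded above because 2 P + l Y is and Y is
    nonnegative.\<close>
  moreover have "2 * P (t + 1) \<le> C2 / l"
  proof -
    have "0 \<le> l * Y (t + 1)" using l(1) Y_nonneg by simp
    then show ?thesis using Y_bounds(1)[OF B, of "t + 1"] t unfolding C2_def by linarith
  qed
  moreover have "C2 * (t + 1) = C2 * t + C2" by (simp add: distrib_left)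
  ultimately have "a0 * I (t + 1) - a0 * I t \<le> C2 / l + m + C2" using m by linarith
  then have "a0 * (I (t + 1) - I t) \<le> C2 / l + m + C2" by (simp only: right_diff_distrib)
  then show ?thesis using a0_pos unfolding C2_def by (simp add: le_divide_eq mult.commute)
qed

text \<open>2 Q is bounded below, so P can lose only a fixed amount in a unit of time.\<close>

lemma P_lower:
  assumes B: "0 \<le> B" "E 0 \<le> B" and st: "0 \<le> s" "s \<le> t" "t \<le> s + 1"
  shows "2 * P s - (C1 + (4 + \<epsilon>) * B) \<le> 2 * P t"
proof -
  have C2: "0 \<le> C1 + (4 + \<epsilon>) * B" using C1 B eps by simp
  have "2 * P s + (- (C1 + (4 + \<epsilon>) * B)) * (t - s) \<le> 2 * P t"
  proof (rule half_line_growth[where f="\<lambda>t. 2 * P t" and f'="\<lambda>t. 2 * Q t", OF _ st(1,2)])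
    show "((\<lambda>t. 2 * P t) has_real_derivative 2 * Q t) (at t within {0..})" if "0 \<le> t" for t
      using P_derivative[OF that] by (auto intro!: derivative_eq_intros)
    fix r assume "s < r"
    then have r: "0 \<le> r" using st by simp
    have "0 \<le> \<epsilon> / 2 * h r" "0 \<le> 4 * n r" using h_nonneg[OF r] n_nonneg[of r] eps by auto
    then show "- (C1 + (4 + \<epsilon>) * B) \<le> 2 * Q r" using Y_bounds(3)[OF B r] by linarith
  qed
  moreover have "(C1 + (4 + \<epsilon>) * B) * (t - s) \<le> (C1 + (4 + \<epsilon>) * B) * 1"
    using C2 st by (intro mult_left_mono) auto
  ultimately show ?thesis by (simp only: mult_minus_left mult_1_right)
qed

text \<open>At some time of the preceding unit interval 2 P equals Y(t) - Y(t - 1) >= - Y(t - 1), by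
  the mean value theorem; \<open>P_lower\<close> limits how far P falls from there until t.\<close>

lemma P_lower_Y:
  assumes B: "0 \<le> B" "E 0 \<le> B" and t: "1 \<le> t"
  shows "- (2 * P t) \<le> Y (t - 1) + (C1 + (4 + \<epsilon>) * B)"
proof -
  obtain s where s: "t - 1 < s" "s < t" "Y t - Y (t - 1) = (t - (t - 1)) * (2 * P s)"
    by (rule half_line_MVT[OF Y_derivative, of "t - 1" t]) (use t in auto)
  then have "- (2 * P s) \<le> Y (t - 1)" using Y_nonneg[of t] by simp
  then show ?thesis using P_lower[OF B, of s t] s t by simp
qed

lemma e_bound_after_window:
  assumes t: "0 \<le> t" and A: "I (t + 1) - I t \<le> A"
  shows "e (t + 1) \<le> A * exp (2 * L * (1 + A))"
proof -
  obtain s where s: "t < s" "s < t + 1" "I (t + 1) - I t = (t + 1 - t) * e s"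
    by (rule half_line_MVT[OF I_derivative, of t "t + 1"]) (use t in auto)
  then have es: "e s \<le> A" using A by simp
  have "I (t + 1) - I s \<le> A" using I_mono[of t s] s t A by simp
  then have "2 * L * ((t + 1 - s) + (I (t + 1) - I s)) \<le> 2 * L * (1 + A)"
    using L_nonneg s by (intro mult_left_mono) auto
  then have "e s * exp (2 * L * ((t + 1 - s) + (I (t + 1) - I s))) \<le> A * exp (2 * L * (1 + A))"
    using es e_nonneg[of s] s t by (intro mult_mono) auto
  then show ?thesis using e_growth[of s "t + 1"] s t by linarith
qed

text \<open>The sum of the coefficients that occur in \<open>A\<close> in
  \<open>global_bound\<close>, once each C1 + (4 + \<epsilon>) B is bounded by (C1 + 4 + \<epsilon>)
  (1 + R). The term 1 / \<kappa> comes from Y 0 <= R / \<kappa>. The same constant covers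
  \<open>eventual_bound\<close>.\<close>

definition C3 where "C3 = ((C1 + 4 + \<epsilon>) / l + 1 / \<kappa> + 2 + (C1 + 4 + \<epsilon>) / l\<^sup>2 + 2 * (C1 + 4 + \<epsilon>)) / a0"

lemma C3_nonneg: "0 \<le> C3"
  using C1 eps kappa l a0_pos unfolding C3_def by (intro divide_nonneg_pos add_nonneg_nonneg) auto

lemma C2_le: assumes "0 \<le> x" shows "C1 + (4 + \<epsilon>) * x \<le> (C1 + 4 + \<epsilon>) * (1 + x)"
proof -
  have "0 \<le> C1 * x" using C1 assms by simp
  then show ?thesis using eps by (simp add: algebra_simps)
qed

definition D where "D = 2 + 2 * L * C3 + (1 + C3) * exp (2 * L * (1 + C3))"

lemma state_norm_e: "0 \<le> t \<Longrightarrow> state_norm M \<beta> (u t) (v t) = sqrt (e t)"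
  unfolding state_norm_def by (simp add: H10_norm_sq[OF uH] L2_norm_sq e_def h_def n_def)

lemma e_initial: "e 0 = (H10_norm M \<beta> u0)\<^sup>2 + (L2_norm M u1)\<^sup>2"
proof -
  have [measurable]: "v 0 \<in> borel_measurable borel" "u1 \<in> borel_measurable borel"
    using vL[of 0] data(2) L2_measurable by auto
  have "H1_sq M \<beta> (u 0) = H1_sq M \<beta> u0" by (rule H1_sq_cong) (use uL[of 0] data H10_L2 init in auto)
  moreover have "(\<integral>x. (v 0 x)\<^sup>2 \<partial>vol M) = (\<integral>x. (u1 x)\<^sup>2 \<partial>vol M)"
    by (rule integral_cong_AE) (use init(2) in \<open>auto elim: eventually_mono\<close>)
  ultimately show ?thesis by (simp add: e_def h_def n_def H10_norm_sq[OF data(1)] L2_norm_sq)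
qed

text \<open>A time t >= 1 is the end of a unit window; before time 1 Gronwall's inequality starts at
  time 0 with the value R. The sum R + A covers both cases.\<close>

lemma global_bound:
  assumes t: "0 \<le> t"
  shows "state_norm M \<beta> (u t) (v t) \<le> D * exp (D * e 0)"
proof -
  define R where "R = e 0"
  have R: "0 \<le> R" unfolding R_def by (rule e_nonneg) simp
  define C2 where "C2 = C1 + (4 + \<epsilon>) * (R / 2)"
  \<comment> \<open>G 0 >= 0 bounds the initial energy by half the squared norm of the data, which
    thus controls all constants.\<close>
  have B: "0 \<le> R / 2" "E 0 \<le> R / 2" using R E_eq[of 0] G_nonneg[of 0] by (auto simp: R_def e_def)
  have C2: "0 \<le> C2" "C2 \<le> (C1 + 4 + \<epsilon>) * (1 + R)"
  proof -
    show "0 \<le> C2" using C1 eps R by (simp add: C2_def)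
    have "(4 + \<epsilon>) * (R / 2) \<le> (4 + \<epsilon>) * R" using eps R by (intro mult_left_mono) auto
    then show "C2 \<le> (C1 + 4 + \<epsilon>) * (1 + R)" using C2_le[OF R] unfolding C2_def by linarith
  qed
  have Y0: "Y 0 \<le> R / \<kappa>"
    using h_ge[of 0] n_nonneg[of 0] kappa by (simp add: R_def e_def le_divide_eq mult.commute)
  have n0: "n 0 \<le> R" using h_nonneg[of 0] by (simp add: R_def e_def)
  have Yt: "Y s \<le> R / \<kappa> + C2 / l\<^sup>2" if s: "0 \<le> s" for s
  proof -
    have x: "exp (- l * s) \<le> 1" using l s by simp
    have "Y 0 * exp (- l * s) \<le> Y 0" using x Y_nonneg[of 0] by (intro mult_left_le) auto
    moreover have "C2 / l\<^sup>2 * (1 - exp (- l * s)) \<le> C2 / l\<^sup>2"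
      using x C2 by (intro mult_left_le) auto
    ultimately show ?thesis using Y_bounds(2)[OF B s] Y0 unfolding C2_def by linarith
  qed
  define m where "m = R / \<kappa> + R + C2 / l\<^sup>2 + C2"
  have m: "- (2 * P s) \<le> m" if s: "0 \<le> s" for s
  proof (cases "1 \<le> s")
    case True
    then show ?thesis using P_lower_Y[OF B True] Yt[of "s - 1"] R by (simp add: m_def C2_def)
  next
    \<comment> \<open>There is no preceding unit interval; P is followed from time 0, where
      Cauchy-Schwarz bounds it by the data.\<close>
    case False
    have "- (2 * P 0) \<le> Y 0 + n 0"
    proof -
      have "\<bar>P 0\<bar> \<le> sqrt (Y 0) * sqrt (n 0)"
        using P_Cauchy_Schwarz[of 0] by (simp add: real_sqrt_mult[symmetric] real_le_rsqrt)
      then show ?thesis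
        using sum_squares_bound[of "sqrt (Y 0)" "sqrt (n 0)"] Y_nonneg[of 0] n_nonneg[of 0] by simp
    qed
    moreover have "0 \<le> C2 / l\<^sup>2" using C2 by simp
    ultimately show ?thesis using P_lower[OF B, of 0 s] False s Y0 n0 by (simp add: m_def C2_def)
  qed
  define A where "A = (C2 / l + m + C2) / a0"
  have A0: "0 \<le> A"
    using C2 R kappa l a0_pos unfolding A_def m_def by (intro divide_nonneg_pos add_nonneg_nonneg) auto
  have win: "I (s + 1) - I s \<le> A" if "0 \<le> s" for s
    using window_bound[OF B that m[OF that]] by (simp add: A_def C2_def)
  have AC: "A \<le> C3 * (1 + R)"
  proof -
    define Z where "Z = (C1 + 4 + \<epsilon>) * (1 + R)"
    have CZ: "C2 \<le> Z" using C2 by (simp add: Z_def)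
    have sums: "a + (b + R + d + C2) + C2 \<le> a' + b' + 2 * (1 + R) + d' + 2 * Z"
      if "a \<le> a'" "d \<le> d'" "b \<le> b'" for a a' b b' d d'
      using that CZ R by simp
    have "C2 / l \<le> Z / l" "C2 / l\<^sup>2 \<le> Z / l\<^sup>2"
      using CZ l by (auto intro!: divide_right_mono)
    moreover have "R / \<kappa> \<le> (1 + R) / \<kappa>" using kappa by (simp add: divide_right_mono)
    ultimately have "C2 / l + m + C2 \<le> Z / l + (1 + R) / \<kappa> + 2 * (1 + R) + Z / l\<^sup>2 + 2 * Z"
      unfolding m_def by (rule sums)
    also have "\<dots> = ((C1 + 4 + \<epsilon>) / l + 1 / \<kappa> + 2 + (C1 + 4 + \<epsilon>) / l\<^sup>2 + 2 * (C1 + 4 + \<epsilon>)) * (1 + R)"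
      by (simp add: distrib_right Z_def)
    finally show ?thesis unfolding A_def C3_def using a0_pos by (simp add: divide_right_mono)
  qed
  have "e t \<le> (R + A) * exp (2 * L * (1 + A))"
  proof (cases "1 \<le> t")
    case True
    have "e (t - 1 + 1) \<le> A * exp (2 * L * (1 + A))"
      by (rule e_bound_after_window[OF _ win]) (use True in auto)
    also have "\<dots> \<le> (R + A) * exp (2 * L * (1 + A))" using R by (intro mult_right_mono) auto
    finally show ?thesis by simp
  next
    case False
    have "I t - I 0 \<le> A" using win[of 0] I_mono[of t 1] t False by simp
    then have "2 * L * ((t - 0) + (I t - I 0)) \<le> 2 * L * (1 + A)"
      using L_nonneg False by (intro mult_left_mono) auto
    then have "e 0 * exp (2 * L * ((t - 0) + (I t - I 0))) \<le> (R + A) * exp (2 * L * (1 + A))"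
      using R A0 by (intro mult_mono) (auto simp: R_def)
    then show ?thesis using e_growth[of 0 t] t by simp
  qed
  then have "sqrt (e t) \<le> sqrt ((R + A) * exp (2 * L * (1 + A)))" by (rule real_sqrt_le_mono)
  also have "\<dots> \<le> D * exp (D * R)"
    unfolding D_def by (rule exponential_bound[OF A0 R L_nonneg C3_nonneg AC])
  finally show ?thesis by (simp add: state_norm_e[OF t] R_def)
qed

text \<open>After \<tau> the contribution of Y 0 has decayed below 1, and what remains depends on |E
  0| only. Of the 2 extra units of time, one is the window that ends at t and one is the interval on
  which \<open>P_lower_Y\<close> looks back from the start of that window.\<close>

lemma eventual_bound:
  assumes \<tau>: "0 \<le> \<tau>" "e 0 / \<kappa> * exp (- l * \<tau>) \<le> 1" and t: "\<tau> + 2 \<le> t"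
  shows "state_norm M \<beta> (u t) (v t) \<le> D * exp (D * \<bar>E 0\<bar>)"
proof -
  define R where "R = \<bar>E 0\<bar>"
  have R: "0 \<le> R" and B: "0 \<le> R" "E 0 \<le> R" by (auto simp: R_def)
  define C2 where "C2 = C1 + (4 + \<epsilon>) * R"
  have C2: "0 \<le> C2" "C2 \<le> (C1 + 4 + \<epsilon>) * (1 + R)"
    using C1 eps R C2_le[OF R] by (auto simp: C2_def)
  have Yt: "Y s \<le> 1 + C2 / l\<^sup>2" if s: "\<tau> \<le> s" for s
  proof -
    have s0: "0 \<le> s" using s \<tau> by simp
    have "Y 0 \<le> e 0 / \<kappa>"
      using h_ge[of 0] n_nonneg[of 0] kappa by (simp add: e_def le_divide_eq mult.commute)
    moreover have "exp (- l * s) \<le> exp (- l * \<tau>)" using l s by simp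
    ultimately have "Y 0 * exp (- l * s) \<le> e 0 / \<kappa> * exp (- l * \<tau>)"
      using Y_nonneg[of 0] by (intro mult_mono) auto
    moreover have "C2 / l\<^sup>2 * (1 - exp (- l * s)) \<le> C2 / l\<^sup>2"
      using C2 l s0 by (intro mult_left_le) auto
    ultimately show ?thesis using Y_bounds(2)[OF B s0] \<tau> unfolding C2_def by linarith
  qed
  define A where "A = (C2 / l + (1 + C2 / l\<^sup>2 + C2) + C2) / a0"
  have A0: "0 \<le> A"
    using C2 l a0_pos unfolding A_def by (intro divide_nonneg_pos add_nonneg_nonneg) auto
  have win: "I (t - 1 + 1) - I (t - 1) \<le> A"
    unfolding A_def C2_def
  proof (rule window_bound[OF B])
    show "- (2 * P (t - 1)) \<le> 1 + (C1 + (4 + \<epsilon>) * R) / l\<^sup>2 + (C1 + (4 + \<epsilon>) * R)"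
      using P_lower_Y[OF B, of "t - 1"] Yt[of "t - 1 - 1"] t \<tau> by (simp add: C2_def)
  qed (use t \<tau> in simp)
  have AC: "A \<le> C3 * (1 + R)"
  proof -
    define Z where "Z = (C1 + 4 + \<epsilon>) * (1 + R)"
    have CZ: "C2 \<le> Z" using C2 by (simp add: Z_def)
    have sums: "a + (1 + d + C2) + C2 \<le> a' + b' + 2 * (1 + R) + d' + 2 * Z"
      if "a \<le> a'" "d \<le> d'" "0 \<le> b'" for a a' b' d d'
      using that CZ R by simp
    have "C2 / l \<le> Z / l" "C2 / l\<^sup>2 \<le> Z / l\<^sup>2"
      using CZ l by (auto intro!: divide_right_mono)
    moreover have "0 \<le> (1 + R) / \<kappa>" using kappa R by simp
    ultimately have "C2 / l + (1 + C2 / l\<^sup>2 + C2) + C2 \<le> Z / l + (1 + R) / \<kappa> + 2 * (1 + R) + Z / l\<^sup>2 + 2 * Z"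
      by (rule sums)
    also have "\<dots> = ((C1 + 4 + \<epsilon>) / l + 1 / \<kappa> + 2 + (C1 + 4 + \<epsilon>) / l\<^sup>2 + 2 * (C1 + 4 + \<epsilon>)) * (1 + R)"
      by (simp add: distrib_right Z_def)
    finally show ?thesis unfolding A_def C3_def using a0_pos by (simp add: divide_right_mono)
  qed
  have "e (t - 1 + 1) \<le> A * exp (2 * L * (1 + A))"
    by (rule e_bound_after_window[OF _ win]) (use t \<tau> in auto)
  also have "\<dots> \<le> (R + A) * exp (2 * L * (1 + A))" using R by (intro mult_right_mono) auto
  finally have "sqrt (e t) \<le> sqrt ((R + A) * exp (2 * L * (1 + A)))" by simp
  also have "\<dots> \<le> D * exp (D * R)"
    unfolding D_def by (rule exponential_bound[OF A0 R L_nonneg C3_nonneg AC])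
  finally show ?thesis using t \<tau> by (simp add: state_norm_e R_def)
qed

end

section \<open>Energy and decay bounds in terms of the initial data\<close>

context wave
begin

lemma energy_bounds:
  assumes t: "0 \<le> t"
  shows "energy M \<beta> f (u t) (v t) \<le> energy M \<beta> f u0 u1" "- ((C1 + 1) / (4 + \<epsilon>)) \<le> energy M \<beta> f (u t) (v t)"
  using E_decreasing[OF order_refl t] energy_lower_bound[OF t]
    unfolding E_initial by (simp_all add: E_def)

lemma L2_bound:
  assumes t: "0 \<le> t" and r: "r = sqrt (\<epsilon> / 2 * \<kappa>)"
  shows "(L2_norm M (u t))\<^sup>2 \<le> (L2_norm M u0)\<^sup>2 * exp (- r * t)
    + ((C1 + 1) / r\<^sup>2 + (4 + \<epsilon>) / r\<^sup>2 * \<bar>energy M \<beta> f u0 u1\<bar>) * (1 - exp (- r * t))"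
proof -
  have rl: "r = l" by (simp add: r l_def)
  \<comment> \<open>\<open>C1\<close> may be 0, whereas the additive constant of the decay estimate
    has to be positive; hence C1 + 1.\<close>
  have "C1 / l\<^sup>2 \<le> (C1 + 1) / l\<^sup>2" using l by (simp add: divide_right_mono)
  then have "(C1 + (4 + \<epsilon>) * \<bar>E 0\<bar>) / l\<^sup>2 * (1 - exp (- l * t))
      \<le> ((C1 + 1) / l\<^sup>2 + (4 + \<epsilon>) / l\<^sup>2 * \<bar>E 0\<bar>) * (1 - exp (- l * t))"
    using l t by (intro mult_right_mono) (auto simp: add_divide_distrib distrib_right)
  then show ?thesis
    using Y_bounds(2)[of "\<bar>E 0\<bar>", OF abs_ge_zero abs_ge_self t]
      unfolding rl E_initial[symmetric] Y_initial[symmetric]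
    by (simp add: Y_def L2_norm_sq)
qed

end

lemma exponential_mono:
  fixes a b s :: real
  assumes "a \<le> b" "0 \<le> b" "0 \<le> s" shows "a * exp (a * s) \<le> b * exp (b * s)"
proof -
  have "a * exp (a * s) \<le> b * exp (a * s)" using assms by (intro mult_right_mono) auto
  also have "\<dots> \<le> b * exp (b * s)"
    using assms by (intro mult_left_mono) (auto intro: mult_right_mono)
  finally show ?thesis .
qed

text \<open>The order of the quantifiers renders the convention on constants: each of them is chosen
  before f ranges over the nonlinearities with the given parameters, \<open>c2\<close> also before
  \<gamma>, and \<open>T\<close> after the size \<open>R\<close> of the data but before the data
  themselves.\<close>

theorem theorem1:
  fixes \<Omega> :: "('m::{t2_space, second_countable_topology}, 'n::finite) riemannian"
    and \<beta> p p\<^sub>0 C\<^sub>f \<epsilon> :: real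
  assumes "compact_riemannian_manifold \<Omega>"
    and "CARD('n) \<ge> 3"
    and "coercive \<Omega> \<beta>"
    and "1 < p" and "p < (real CARD('n) + 2) / (real CARD('n) - 2)"
    and "1 < p\<^sub>0" and "0 < C\<^sub>f" and "0 < \<epsilon>"
  shows
    "(\<forall>\<gamma>. damping \<Omega> \<gamma> \<longrightarrow>
       (\<exists>C>0. \<forall>f. nonlinearity \<Omega> p p\<^sub>0 C\<^sub>f \<epsilon> f \<longrightarrow> locally_well_posed \<Omega> \<beta> \<gamma> f \<longrightarrow>
         (\<forall>u0\<in>H10 \<Omega>. \<forall>u1\<in>L2 \<Omega>. \<forall>u v. wave_solution \<Omega> \<beta> \<gamma> f \<infinity> u0 u1 u v \<longrightarrow>
           (\<forall>t\<ge>0. energy \<Omega> \<beta> f u0 u1 \<ge> energy \<Omega> \<beta> f (u t) (v t) \<and>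
                  energy \<Omega> \<beta> f (u t) (v t) \<ge> - C))))
     \<and>
     (\<exists>c2>0. \<forall>\<gamma>. damping \<Omega> \<gamma> \<longrightarrow>
       (\<exists>c0>0. \<exists>c1>0. \<forall>f. nonlinearity \<Omega> p p\<^sub>0 C\<^sub>f \<epsilon> f \<longrightarrow> locally_well_posed \<Omega> \<beta> \<gamma> f \<longrightarrow>
         (\<forall>u0\<in>H10 \<Omega>. \<forall>u1\<in>L2 \<Omega>. \<forall>u v. wave_solution \<Omega> \<beta> \<gamma> f \<infinity> u0 u1 u v \<longrightarrow>
           (\<forall>t\<ge>0. (L2_norm \<Omega> (u t))\<^sup>2 \<le> (L2_norm \<Omega> u0)\<^sup>2 * exp (- c2 * t)
                    + (c0 + c1 * \<bar>energy \<Omega> \<beta> f u0 u1\<bar>) * (1 - exp (- c2 * t))))))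
     \<and>
     (p \<le> real CARD('n) / (real CARD('n) - 2) \<longrightarrow>
       (\<forall>\<gamma>. damping \<Omega> \<gamma> \<longrightarrow>
         (\<exists>c>0. let \<alpha> = (\<lambda>s. c * exp (c * s)) in
           (\<forall>f. nonlinearity \<Omega> p p\<^sub>0 C\<^sub>f \<epsilon> f \<longrightarrow> locally_well_posed \<Omega> \<beta> \<gamma> f \<longrightarrow>
             (\<forall>u0\<in>H10 \<Omega>. \<forall>u1\<in>L2 \<Omega>. \<forall>u v. wave_solution \<Omega> \<beta> \<gamma> f \<infinity> u0 u1 u v \<longrightarrow>
               (\<forall>t\<ge>0. state_norm \<Omega> \<beta> (u t) (v t) \<le>
                  \<alpha> ((H10_norm \<Omega> \<beta> u0)\<^sup>2 + (L2_norm \<Omega> u1)\<^sup>2)))) \<and>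
           (\<forall>R\<ge>0. \<exists>T\<ge>0.
             \<forall>f. nonlinearity \<Omega> p p\<^sub>0 C\<^sub>f \<epsilon> f \<longrightarrow> locally_well_posed \<Omega> \<beta> \<gamma> f \<longrightarrow>
             (\<forall>u0\<in>H10 \<Omega>. \<forall>u1\<in>L2 \<Omega>. \<forall>u v.
               (H10_norm \<Omega> \<beta> u0)\<^sup>2 + (L2_norm \<Omega> u1)\<^sup>2 = R \<longrightarrow>
               wave_solution \<Omega> \<beta> \<gamma> f \<infinity> u0 u1 u v \<longrightarrow>
               (\<forall>t\<ge>T. state_norm \<Omega> \<beta> (u t) (v t) \<le> \<alpha> \<bar>energy \<Omega> \<beta> f u0 u1\<bar>))))))"
proof -
  interpret riem \<Omega> by unfold_locales (fact assms(1))
  obtain \<kappa> where \<kappa>: "0 < \<kappa>" "\<And>w. w \<in> H10 \<Omega> \<Longrightarrow> \<kappa> * (\<integral>x. (w x)\<^sup>2 \<partial>vol \<Omega>) \<le> H1_sq \<Omega> \<beta> w"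
    using assms(3) unfolding coercive_def by blast
  obtain S where S: "0 \<le> S" "\<And>w. w \<in> H10 \<Omega> \<Longrightarrow> (\<integral>x. \<bar>w x\<bar> powr (2 * real CARD('n) / (real CARD('n) - 2)) \<partial>vol \<Omega>)
      \<le> S * H1_sq \<Omega> 1 w powr (real CARD('n) / (real CARD('n) - 2))"
    using Sobolev_H10[OF assms(2)] by blast
  define rate where "rate = sqrt (\<epsilon> / 2 * \<kappa>)"
  have rate: "0 < rate" using \<kappa>(1) assms(8) by (simp add: rate_def)
  \<comment> \<open>\<open>K\<close> and \<open>C1\<close> are found from \<gamma> and the numerical
    parameters alone, uniformly in f and in the solution.\<close>
  have damped: "\<exists>C1\<ge>0. \<exists>K. \<forall>f u0 u1 u v. nonlinearity \<Omega> p p\<^sub>0 C\<^sub>f \<epsilon> f \<longrightarrow> locally_well_posed \<Omega> \<beta> \<gamma> f \<longrightarrow>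
      u0 \<in> H10 \<Omega> \<longrightarrow> u1 \<in> L2 \<Omega> \<longrightarrow> wave_solution \<Omega> \<beta> \<gamma> f \<infinity> u0 u1 u v \<longrightarrow>
      wave \<Omega> p p\<^sub>0 C\<^sub>f \<epsilon> f \<beta> \<kappa> K C1 \<gamma> u0 u1 u v"
    if \<gamma>: "damping \<Omega> \<gamma>" for \<gamma>
  proof -
    from \<gamma> obtain K where K: "\<gamma> \<in> borel_measurable (vol \<Omega>)" "AE x in vol \<Omega>. 0 \<le> \<gamma> x \<and> \<gamma> x \<le> K"
      unfolding damping_def by blast
    have K': "AE x in vol \<Omega>. 0 \<le> \<gamma> x \<and> \<gamma> x \<le> \<bar>K\<bar>" using K(2) by (rule eventually_mono) linarith
    obtain C1 where C1: "0 \<le> C1" "\<And>y. 0 \<le> y \<Longrightarrow> 4 * \<bar>K\<bar>\<^sup>2 / \<epsilon> * y \<le> \<epsilon> / C\<^sub>f * y powr ((p\<^sub>0 + 1) / 2) + C1"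
      using superlinear_absorbs_linear[of "4 * \<bar>K\<bar>\<^sup>2 / \<epsilon>" "\<epsilon> / C\<^sub>f" "(p\<^sub>0 + 1) / 2"] assms(6-8)
        by auto
    show ?thesis
      by (intro exI[of _ C1] exI[of _ "\<bar>K\<bar>"] conjI C1(1) allI impI, unfold_locales)
        (use assms \<kappa> K K' C1 in auto)
  qed
  show ?thesis
  proof (intro conjI)
    show "\<forall>\<gamma>. damping \<Omega> \<gamma> \<longrightarrow>
       (\<exists>C>0. \<forall>f. nonlinearity \<Omega> p p\<^sub>0 C\<^sub>f \<epsilon> f \<longrightarrow> locally_well_posed \<Omega> \<beta> \<gamma> f \<longrightarrow>
         (\<forall>u0\<in>H10 \<Omega>. \<forall>u1\<in>L2 \<Omega>. \<forall>u v. wave_solution \<Omega> \<beta> \<gamma> f \<infinity> u0 u1 u v \<longrightarrow>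
           (\<forall>t\<ge>0. energy \<Omega> \<beta> f u0 u1 \<ge> energy \<Omega> \<beta> f (u t) (v t) \<and>
                  energy \<Omega> \<beta> f (u t) (v t) \<ge> - C)))"
    proof (intro allI impI)
      fix \<gamma> assume "damping \<Omega> \<gamma>"
      from damped[OF this] obtain C1 K where C1: "0 \<le> C1" and w: "\<And>f u0 u1 u v. nonlinearity \<Omega> p p\<^sub>0 C\<^sub>f \<epsilon> f \<Longrightarrow>
          locally_well_posed \<Omega> \<beta> \<gamma> f \<Longrightarrow> u0 \<in> H10 \<Omega> \<Longrightarrow> u1 \<in> L2 \<Omega> \<Longrightarrow> wave_solution \<Omega> \<beta> \<gamma> f \<infinity> u0 u1 u v \<Longrightarrow>
          wave \<Omega> p p\<^sub>0 C\<^sub>f \<epsilon> f \<beta> \<kappa> K C1 \<gamma> u0 u1 u v" by blast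
      show "\<exists>C>0. \<forall>f. nonlinearity \<Omega> p p\<^sub>0 C\<^sub>f \<epsilon> f \<longrightarrow> locally_well_posed \<Omega> \<beta> \<gamma> f \<longrightarrow>
         (\<forall>u0\<in>H10 \<Omega>. \<forall>u1\<in>L2 \<Omega>. \<forall>u v. wave_solution \<Omega> \<beta> \<gamma> f \<infinity> u0 u1 u v \<longrightarrow>
           (\<forall>t\<ge>0. energy \<Omega> \<beta> f u0 u1 \<ge> energy \<Omega> \<beta> f (u t) (v t) \<and>
                  energy \<Omega> \<beta> f (u t) (v t) \<ge> - C))"
        using C1 assms(8) by (intro exI[of _ "(C1 + 1) / (4 + \<epsilon>)"] conjI allI impI ballI)
          (auto intro: wave.energy_bounds[OF w])
    qed
    show "\<exists>c2>0. \<forall>\<gamma>. damping \<Omega> \<gamma> \<longrightarrow>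
       (\<exists>c0>0. \<exists>c1>0. \<forall>f. nonlinearity \<Omega> p p\<^sub>0 C\<^sub>f \<epsilon> f \<longrightarrow> locally_well_posed \<Omega> \<beta> \<gamma> f \<longrightarrow>
         (\<forall>u0\<in>H10 \<Omega>. \<forall>u1\<in>L2 \<Omega>. \<forall>u v. wave_solution \<Omega> \<beta> \<gamma> f \<infinity> u0 u1 u v \<longrightarrow>
           (\<forall>t\<ge>0. (L2_norm \<Omega> (u t))\<^sup>2 \<le> (L2_norm \<Omega> u0)\<^sup>2 * exp (- c2 * t)
                    + (c0 + c1 * \<bar>energy \<Omega> \<beta> f u0 u1\<bar>) * (1 - exp (- c2 * t)))))"
    proof (rule exI[of _ rate], intro conjI rate allI impI)
      fix \<gamma> assume "damping \<Omega> \<gamma>"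
      from damped[OF this] obtain C1 K where C1: "0 \<le> C1" and w: "\<And>f u0 u1 u v. nonlinearity \<Omega> p p\<^sub>0 C\<^sub>f \<epsilon> f \<Longrightarrow>
          locally_well_posed \<Omega> \<beta> \<gamma> f \<Longrightarrow> u0 \<in> H10 \<Omega> \<Longrightarrow> u1 \<in> L2 \<Omega> \<Longrightarrow> wave_solution \<Omega> \<beta> \<gamma> f \<infinity> u0 u1 u v \<Longrightarrow>
          wave \<Omega> p p\<^sub>0 C\<^sub>f \<epsilon> f \<beta> \<kappa> K C1 \<gamma> u0 u1 u v" by blast
      show "\<exists>c0>0. \<exists>c1>0. \<forall>f. nonlinearity \<Omega> p p\<^sub>0 C\<^sub>f \<epsilon> f \<longrightarrow> locally_well_posed \<Omega> \<beta> \<gamma> f \<longrightarrow>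
         (\<forall>u0\<in>H10 \<Omega>. \<forall>u1\<in>L2 \<Omega>. \<forall>u v. wave_solution \<Omega> \<beta> \<gamma> f \<infinity> u0 u1 u v \<longrightarrow>
           (\<forall>t\<ge>0. (L2_norm \<Omega> (u t))\<^sup>2 \<le> (L2_norm \<Omega> u0)\<^sup>2 * exp (- rate * t)
                    + (c0 + c1 * \<bar>energy \<Omega> \<beta> f u0 u1\<bar>) * (1 - exp (- rate * t))))"
      proof (rule exI[of _ "(C1 + 1) / rate\<^sup>2"], rule conjI[rotated], rule exI[of _ "(4 + \<epsilon>) / rate\<^sup>2"], intro conjI allI impI ballI)
        show "0 < (C1 + 1) / rate\<^sup>2" "0 < (4 + \<epsilon>) / rate\<^sup>2" using C1 rate assms(8) by auto
        fix f u0 u1 u v and t :: real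
        assume asm: "nonlinearity \<Omega> p p\<^sub>0 C\<^sub>f \<epsilon> f" "locally_well_posed \<Omega> \<beta> \<gamma> f" "u0 \<in> H10 \<Omega>" "u1 \<in> L2 \<Omega>"
          "wave_solution \<Omega> \<beta> \<gamma> f \<infinity> u0 u1 u v" and t: "0 \<le> t"
        show "(L2_norm \<Omega> (u t))\<^sup>2 \<le> (L2_norm \<Omega> u0)\<^sup>2 * exp (- rate * t)
            + ((C1 + 1) / rate\<^sup>2 + (4 + \<epsilon>) / rate\<^sup>2 * \<bar>energy \<Omega> \<beta> f u0 u1\<bar>) * (1 - exp (- rate * t))"
          by (rule wave.L2_bound[OF w[OF asm] t rate_def])
      qed
    qed
    show "p \<le> real CARD('n) / (real CARD('n) - 2) \<longrightarrow>
       (\<forall>\<gamma>. damping \<Omega> \<gamma> \<longrightarrow>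
         (\<exists>c>0. let \<alpha> = (\<lambda>s. c * exp (c * s)) in
           (\<forall>f. nonlinearity \<Omega> p p\<^sub>0 C\<^sub>f \<epsilon> f \<longrightarrow> locally_well_posed \<Omega> \<beta> \<gamma> f \<longrightarrow>
             (\<forall>u0\<in>H10 \<Omega>. \<forall>u1\<in>L2 \<Omega>. \<forall>u v. wave_solution \<Omega> \<beta> \<gamma> f \<infinity> u0 u1 u v \<longrightarrow>
               (\<forall>t\<ge>0. state_norm \<Omega> \<beta> (u t) (v t) \<le>
                  \<alpha> ((H10_norm \<Omega> \<beta> u0)\<^sup>2 + (L2_norm \<Omega> u1)\<^sup>2)))) \<and>
           (\<forall>R\<ge>0. \<exists>T\<ge>0.
             \<forall>f. nonlinearity \<Omega> p p\<^sub>0 C\<^sub>f \<epsilon> f \<longrightarrow> locally_well_posed \<Omega> \<beta> \<gamma> f \<longrightarrow>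
             (\<forall>u0\<in>H10 \<Omega>. \<forall>u1\<in>L2 \<Omega>. \<forall>u v.
               (H10_norm \<Omega> \<beta> u0)\<^sup>2 + (L2_norm \<Omega> u1)\<^sup>2 = R \<longrightarrow>
               wave_solution \<Omega> \<beta> \<gamma> f \<infinity> u0 u1 u v \<longrightarrow>
               (\<forall>t\<ge>T. state_norm \<Omega> \<beta> (u t) (v t) \<le> \<alpha> \<bar>energy \<Omega> \<beta> f u0 u1\<bar>)))))"
    proof (intro allI impI)
      fix \<gamma> assume pd: "p \<le> real CARD('n) / (real CARD('n) - 2)" and "damping \<Omega> \<gamma>"
      from damped[OF this(2)] obtain C1 K where w: "\<And>f u0 u1 u v. nonlinearity \<Omega> p p\<^sub>0 C\<^sub>f \<epsilon> f \<Longrightarrow>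
          locally_well_posed \<Omega> \<beta> \<gamma> f \<Longrightarrow> u0 \<in> H10 \<Omega> \<Longrightarrow> u1 \<in> L2 \<Omega> \<Longrightarrow> wave_solution \<Omega> \<beta> \<gamma> f \<infinity> u0 u1 u v \<Longrightarrow>
          wave \<Omega> p p\<^sub>0 C\<^sub>f \<epsilon> f \<beta> \<kappa> K C1 \<gamma> u0 u1 u v" by blast
      \<comment> \<open>The constant underlying \<open>D\<close> outside the locale, applied to just
        those parameters on which it depends. Neither f nor the solution is among them, so one value
        serves all interpretations below.\<close>
      define d where "d = wave_subcritical.D TYPE('n) C\<^sub>f \<epsilon> \<beta> \<kappa> C1 S"
      \<comment> \<open>The maximum with 1 gives positivity before any interpretation of the locale
        is available.\<close>
      define c where "c = max 1 d"
      have c: "0 < c" "d \<le> c" by (auto simp: c_def)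
      show "\<exists>c>0. let \<alpha> = (\<lambda>s. c * exp (c * s)) in
           (\<forall>f. nonlinearity \<Omega> p p\<^sub>0 C\<^sub>f \<epsilon> f \<longrightarrow> locally_well_posed \<Omega> \<beta> \<gamma> f \<longrightarrow>
             (\<forall>u0\<in>H10 \<Omega>. \<forall>u1\<in>L2 \<Omega>. \<forall>u v. wave_solution \<Omega> \<beta> \<gamma> f \<infinity> u0 u1 u v \<longrightarrow>
               (\<forall>t\<ge>0. state_norm \<Omega> \<beta> (u t) (v t) \<le>
                  \<alpha> ((H10_norm \<Omega> \<beta> u0)\<^sup>2 + (L2_norm \<Omega> u1)\<^sup>2)))) \<and>
           (\<forall>R\<ge>0. \<exists>T\<ge>0.
             \<forall>f. nonlinearity \<Omega> p p\<^sub>0 C\<^sub>f \<epsilon> f \<longrightarrow> locally_well_posed \<Omega> \<beta> \<gamma> f \<longrightarrow>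
             (\<forall>u0\<in>H10 \<Omega>. \<forall>u1\<in>L2 \<Omega>. \<forall>u v.
               (H10_norm \<Omega> \<beta> u0)\<^sup>2 + (L2_norm \<Omega> u1)\<^sup>2 = R \<longrightarrow>
               wave_solution \<Omega> \<beta> \<gamma> f \<infinity> u0 u1 u v \<longrightarrow>
               (\<forall>t\<ge>T. state_norm \<Omega> \<beta> (u t) (v t) \<le> \<alpha> \<bar>energy \<Omega> \<beta> f u0 u1\<bar>)))"
        unfolding Let_def
      proof (rule exI[of _ c], intro conjI c(1) allI impI ballI)
        fix f u0 u1 u v and t :: real
        assume asm: "nonlinearity \<Omega> p p\<^sub>0 C\<^sub>f \<epsilon> f" "locally_well_posed \<Omega> \<beta> \<gamma> f" "u0 \<in> H10 \<Omega>" "u1 \<in> L2 \<Omega>"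
          "wave_solution \<Omega> \<beta> \<gamma> f \<infinity> u0 u1 u v" and t: "0 \<le> t"
        interpret wave \<Omega> p p\<^sub>0 C\<^sub>f \<epsilon> f \<beta> \<kappa> K C1 \<gamma> u0 u1 u v by (rule w[OF asm])
        interpret wave_subcritical \<Omega> p p\<^sub>0 C\<^sub>f \<epsilon> f \<beta> \<kappa> K C1 \<gamma> u0 u1 u v S
          by unfold_locales (use pd S in auto)
        let ?R = "(H10_norm \<Omega> \<beta> u0)\<^sup>2 + (L2_norm \<Omega> u1)\<^sup>2"
        have "state_norm \<Omega> \<beta> (u t) (v t) \<le> d * exp (d * ?R)"
          using global_bound[OF t] unfolding e_initial d_def .
        also have "\<dots> \<le> c * exp (c * ?R)" using c by (intro exponential_mono) auto
        finally show "state_norm \<Omega> \<beta> (u t) (v t) \<le> c * exp (c * ?R)" .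
      next
        fix R :: real assume R: "0 \<le> R"
        \<comment> \<open>Chosen so that \<open>exp (- rate * \<tau>)\<close> equals 1 / (1 + R /
          \<kappa>), which brings R / \<kappa> below 1.\<close>
        define \<tau> where "\<tau> = ln (1 + R / \<kappa>) / rate"
        have pos: "0 < 1 + R / \<kappa>" using R \<kappa>(1) by (simp add: add_pos_nonneg)
        have \<tau>0: "0 \<le> \<tau>" using R \<kappa>(1) rate by (simp add: \<tau>_def)
        have "exp (- rate * \<tau>) = 1 / (1 + R / \<kappa>)"
          using rate pos by (simp add: \<tau>_def exp_minus inverse_eq_divide)
        then have \<tau>: "R / \<kappa> * exp (- rate * \<tau>) \<le> 1"
          using pos by (simp only: mult_1_right times_divide_eq_right divide_le_eq_1_pos)
        show "\<exists>T\<ge>0. \<forall>f. nonlinearity \<Omega> p p\<^sub>0 C\<^sub>f \<epsilon> f \<longrightarrow> locally_well_posed \<Omega> \<beta> \<gamma> f \<longrightarrow>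
             (\<forall>u0\<in>H10 \<Omega>. \<forall>u1\<in>L2 \<Omega>. \<forall>u v.
               (H10_norm \<Omega> \<beta> u0)\<^sup>2 + (L2_norm \<Omega> u1)\<^sup>2 = R \<longrightarrow>
               wave_solution \<Omega> \<beta> \<gamma> f \<infinity> u0 u1 u v \<longrightarrow>
               (\<forall>t\<ge>T. state_norm \<Omega> \<beta> (u t) (v t) \<le> c * exp (c * \<bar>energy \<Omega> \<beta> f u0 u1\<bar>)))"
        proof (intro exI[of _ "\<tau> + 2"] conjI allI impI ballI)
          show "0 \<le> \<tau> + 2" using \<tau>0 by simp
          fix f u0 u1 u v and t :: real
          assume asm: "nonlinearity \<Omega> p p\<^sub>0 C\<^sub>f \<epsilon> f" "locally_well_posed \<Omega> \<beta> \<gamma> f" "u0 \<in> H10 \<Omega>" "u1 \<in> L2 \<Omega>"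
            "wave_solution \<Omega> \<beta> \<gamma> f \<infinity> u0 u1 u v"
            and eR: "(H10_norm \<Omega> \<beta> u0)\<^sup>2 + (L2_norm \<Omega> u1)\<^sup>2 = R" and t: "\<tau> + 2 \<le> t"
          interpret wave \<Omega> p p\<^sub>0 C\<^sub>f \<epsilon> f \<beta> \<kappa> K C1 \<gamma> u0 u1 u v by (rule w[OF asm])
          interpret wave_subcritical \<Omega> p p\<^sub>0 C\<^sub>f \<epsilon> f \<beta> \<kappa> K C1 \<gamma> u0 u1 u v S
            by unfold_locales (use pd S in auto)
          have "e 0 / \<kappa> * exp (- l * \<tau>) \<le> 1" using \<tau> unfolding e_initial eR rate_def l_def .
          from eventual_bound[OF \<tau>0 this t]
          have "state_norm \<Omega> \<beta> (u t) (v t) \<le> d * exp (d * \<bar>energy \<Omega> \<beta> f u0 u1\<bar>)"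
            unfolding E_initial d_def .
          also have "\<dots> \<le> c * exp (c * \<bar>energy \<Omega> \<beta> f u0 u1\<bar>)"
            using c by (intro exponential_mono) auto
          finally show "state_norm \<Omega> \<beta> (u t) (v t) \<le> c * exp (c * \<bar>energy \<Omega> \<beta> f u0 u1\<bar>)" .
        qed
      qed
    qed
  qed
qed

end
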